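(* Let $\alpha\in\mathbb{R}$, $c>0$, and suppose that one of the following conditions is satisfied: (1) $\beta\le 0$ and $p>2$; (2) $\beta>0$ and $2<p<4$; (3) $\beta>0$, $p=4$ and $c<2/\bigl(\beta\,\widetilde K_{\mathrm{GN}}(p)\bigr)$. Consider the minimization problem of finding $u$ such that $$u\in\mathscr{S}_\alpha(c)\quad\text{and}\quad \mathcal{E}_\alpha(u)=m_\alpha(c):=\inf_{v\in\mathscr{S}_\alpha(c)}\mathcal{E}_\alpha(v).\qquad (\star)$$ Then the following implications hold. (i) If $(u_n)_{n\in\mathbb{N}}$ is a minimizing sequence of $\mathcal{E}_\alpha|_{\mathscr{S}_\alpha(c)}$ (i.e. $u_n\in\mathscr{S}_\alpha(c)$ and $\mathcal{E}_\alpha(u_n)\to m_\alpha(c)$), then it admits a subsequence that converges in $X_\alpha$ to a solution of $(\star)$. (ii) If $u$ solves $(\star)$, then $\mathcal{Q}(u)\neq 0$.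
   Context: All function spaces consist of complex-valued functions defined a.e. on $\mathbb{R}^2$; sesquilinear forms are linear in the second entry. $\|\cdot\|_{\dot W^{1,2}}$ denotes the $L^2$ norm of the gradient. For $\lambda>0$ let $G_\lambda(x)=\frac{1}{2\pi}K_0(\sqrt\lambda|x|)$, $x\in\mathbb{R}^2\setminus\{0\}$, where $K_0$ is the modified Bessel function of the second kind (so $-\Delta G_\lambda+\lambda G_\lambda=\delta_0$ in the sense of distributions). Let $\gamma$ be the Euler--Mascheroni constant, $\theta_\lambda=\frac{\gamma}{2\pi}+\frac1{2\pi}\log\frac{\sqrt\lambda}{2}$ and $\omega_\alpha=4e^{-4\pi\alpha-2\gamma}$. Energy space: $W^{1,2}_\alpha$ is the vector space $\{\phi+qG_\lambda:\phi\in W^{1,2}(\mathbb{R}^2),\ q\in\mathbb{C},\ \lambda>0\}$. For $u\in W^{1,2}_\alpha$ the coefficient $q$ is the same in every such decomposition; it is called the charge of $u$ and denoted $\mathcal{Q}(u)$. For every $\lambda>0$ there is a unique $\phi_\lambda\in W^{1,2}$ with $u=\phi_\lambda+\mathcal{Q}(u)G_\lambda$. For $u=\phi_u+q_uG_\lambda$ and $v=\phi_v+q_vG_\lambda$ (same $\lambda$) define $$H_\alpha[u,v]=\langle\phi_u,\phi_v\rangle_{\dot W^{1,2}}+\lambda\bigl(\langle\phi_u,\phi_v\rangle_{L^2}-\langle u,v\rangle_{L^2}\bigr)+(\alpha+\theta_\lambda)\overline{q_u}q_v,$$ which does not depend on $\lambda$, and $\mathcal{H}_\alpha(u)=H_\alpha[u,u]$.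 $W^{1,2}_\alpha$ is a Hilbert space with inner product $\langle u,v\rangle_{W^{1,2}_\alpha}=H_\alpha[u,v]+(1+\omega_\alpha)\langle u,v\rangle_{L^2}$; it embeds in $L^r$ for every $r\in[2,\infty)$. $X_\alpha$ is the Hilbert space of all $u\in W^{1,2}_\alpha$ with $\int\log(1+|x|)|u(x)|^2dx<\infty$, with inner product $\langle u,v\rangle_{X_\alpha}=\langle u,v\rangle_{W^{1,2}_\alpha}+\int\log(1+|x|)\overline{u(x)}v(x)dx$. The energy functional $\mathcal{E}_\alpha:X_\alpha\to\mathbb{R}$ is $$\mathcal{E}_\alpha(u)=\frac12\mathcal{H}_\alpha(u)+\frac14\iint\log(|x-y|)|u(x)|^2|u(y)|^2dx\,dy-\frac{\beta}{p}\|u\|_{L^p}^p,$$ and $\mathscr{S}_\alpha(c)=\{u\in X_\alpha:\|u\|_{L^2}^2=c\}$. For $p\in(2,\infty)$, $\widetilde K_{\mathrm{GN}}(p)$ denotes a positive constant (known to exist) for which the following Gagliardo--Nirenberg inequality holds: for every $u\in W^{1,2}_\alpha\setminus W^{1,2}$, writing $q=\mathcal{Q}(u)\ne0$ and $\phi=u-qG_{|q|^2/\|u\|_{L^2}^2}\in W^{1,2}$, $$\|u\|_{L^p}^p\le\widetilde K_{\mathrm{GN}}(p)\bigl(\|\phi\|_{\dot W^{1,2}}^{p-2}+|q|^{p-2}\bigr)\|u\|_{L^2}^2.$$ *)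

theory Defs
  imports "HOL-Analysis.Analysis"
begin

text \<open>
  Functions "defined a.e." are represented by Borel functions \<^typ>\<open>real^2 \<Rightarrow> complex\<close>; every a.e.
  class has such a representative, and everything below is invariant under modification on a
  null set. Forms are antilinear in the first and linear in the second argument.
\<close>

type_synonym wfun = "real^2 \<Rightarrow> complex"

definition L2 :: "wfun set" where
  "L2 = {u \<in> borel_measurable lborel. integrable lborel (\<lambda>x. (norm (u x))\<^sup>2)}"

definition L2_ip :: "wfun \<Rightarrow> wfun \<Rightarrow> complex" where
  "L2_ip u v = (LINT x|lborel. cnj (u x) * v x)"

text \<open>The $p$-th power of the $L^p$ norm.\<close>

definition Lp_norm_pow :: "real \<Rightarrow> wfun \<Rightarrow> real" where
  "Lp_norm_pow p u = (LINT x|lborel. norm (u x) powr p)"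

definition mass :: "wfun \<Rightarrow> real" where
  "mass u = (LINT x|lborel. (norm (u x))\<^sup>2)"


definition pderiv_fun :: "2 \<Rightarrow> (real^2 \<Rightarrow> real) \<Rightarrow> real^2 \<Rightarrow> real" where
  "pderiv_fun i f x = frechet_derivative f (at x) (axis i 1)"

primrec C_k :: "nat \<Rightarrow> (real^2 \<Rightarrow> real) \<Rightarrow> bool" where
  "C_k 0 f \<longleftrightarrow> continuous_on UNIV f"
| "C_k (Suc k) f \<longleftrightarrow> (\<forall>x. f differentiable (at x)) \<and> (\<forall>i. C_k k (pderiv_fun i f))"

definition test_functions :: "(real^2 \<Rightarrow> real) set" where
  "test_functions = {\<eta>. (\<forall>k. C_k k \<eta>) \<and> compact (closure {x. \<eta> x \<noteq> 0})}"

definition has_weak_pderiv :: "2 \<Rightarrow> wfun \<Rightarrow> wfun \<Rightarrow> bool" where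
  "has_weak_pderiv i u g \<longleftrightarrow>
     (\<forall>\<eta>\<in>test_functions.
        (LINT x|lborel. u x * of_real (pderiv_fun i \<eta> x)) = - (LINT x|lborel. g x * of_real (\<eta> x)))"

definition W12 :: "wfun set" where
  "W12 = {u \<in> L2. \<forall>i. \<exists>g\<in>L2. has_weak_pderiv i u g}"

text \<open>Weak partial derivatives are unique only up to null sets, hence the choice operator.\<close>

definition weak_pderiv :: "2 \<Rightarrow> wfun \<Rightarrow> wfun" where
  "weak_pderiv i u = (SOME g. g \<in> L2 \<and> has_weak_pderiv i u g)"

definition grad_ip :: "wfun \<Rightarrow> wfun \<Rightarrow> complex" where
  "grad_ip u v = (\<Sum>i\<in>UNIV. L2_ip (weak_pderiv i u) (weak_pderiv i v))"

definition grad_norm :: "wfun \<Rightarrow> real" where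
  "grad_norm u = sqrt (Re (grad_ip u u))"


text \<open>
  Modified Bessel function of the second kind of order $0$, via
  $K_0(r) = \int_0^\infty e^{-r \cosh t}\,dt$ for $r > 0$.
\<close>

definition bessel_K0 :: "real \<Rightarrow> real" where
  "bessel_K0 r = (LBINT t:{0..}. exp (- r * cosh t))"

text \<open>The value at the origin is a dummy value.\<close>

definition Green :: "real \<Rightarrow> wfun" where
  "Green l x = of_real (bessel_K0 (sqrt l * norm x) / (2 * pi))"

definition theta :: "real \<Rightarrow> real" where
  "theta l = euler_mascheroni / (2 * pi) + ln (sqrt l / 2) / (2 * pi)"

definition omega :: "real \<Rightarrow> real" where
  "omega \<alpha> = 4 * exp (- 4 * pi * \<alpha> - 2 * euler_mascheroni)"


text \<open>
  The energy space $W^{1,2}_\alpha$. As a set it does not depend on $\alpha$; only its inner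
  product does.
\<close>

definition W12_point :: "wfun set" where
  "W12_point = {\<lambda>x. \<phi> x + q * Green l x | \<phi> q l. \<phi> \<in> W12 \<and> l > 0}"

definition charge :: "wfun \<Rightarrow> complex" where
  "charge u = (THE q. \<exists>\<phi>\<in>W12. \<exists>l>0. u = (\<lambda>x. \<phi> x + q * Green l x))"

definition regular_part :: "real \<Rightarrow> wfun \<Rightarrow> wfun" where
  "regular_part l u = (\<lambda>x. u x - charge u * Green l x)"

definition H_form_at :: "real \<Rightarrow> real \<Rightarrow> wfun \<Rightarrow> wfun \<Rightarrow> complex" where
  "H_form_at l \<alpha> u v =
     grad_ip (regular_part l u) (regular_part l v)
     + of_real l * (L2_ip (regular_part l u) (regular_part l v) - L2_ip u v)
     + of_real (\<alpha> + theta l) * cnj (charge u) * charge v"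

text \<open>$H_\alpha[u,v]$ is the common value, for all $\lambda > 0$, of the expression above.\<close>

definition H_form :: "real \<Rightarrow> wfun \<Rightarrow> wfun \<Rightarrow> complex" where
  "H_form \<alpha> u v = (THE h. \<forall>l>0. H_form_at l \<alpha> u v = h)"

text \<open>The form is Hermitian, so its diagonal is real and taking real parts loses nothing.\<close>

definition H_quad :: "real \<Rightarrow> wfun \<Rightarrow> real" where
  "H_quad \<alpha> u = Re (H_form \<alpha> u u)"

definition W12_point_ip :: "real \<Rightarrow> wfun \<Rightarrow> wfun \<Rightarrow> complex" where
  "W12_point_ip \<alpha> u v = H_form \<alpha> u v + of_real (1 + omega \<alpha>) * L2_ip u v"


text \<open>Like \<^const>\<open>W12_point\<close>, the set $X_\alpha$ does not depend on $\alpha$.\<close>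

definition X_space :: "wfun set" where
  "X_space = {u \<in> W12_point. integrable lborel (\<lambda>x. ln (1 + norm x) * (norm (u x))\<^sup>2)}"

definition X_ip :: "real \<Rightarrow> wfun \<Rightarrow> wfun \<Rightarrow> complex" where
  "X_ip \<alpha> u v = W12_point_ip \<alpha> u v + (LINT x|lborel. of_real (ln (1 + norm x)) * cnj (u x) * v x)"

definition X_norm :: "real \<Rightarrow> wfun \<Rightarrow> real" where
  "X_norm \<alpha> u = sqrt (Re (X_ip \<alpha> u u))"

definition energy :: "real \<Rightarrow> real \<Rightarrow> real \<Rightarrow> wfun \<Rightarrow> real" where
  "energy \<alpha> \<beta> p u =
     1/2 * H_quad \<alpha> u
     + 1/4 * (LINT z|(lborel \<Otimes>\<^sub>M lborel).
         ln (norm (fst z - snd z)) * (norm (u (fst z)))\<^sup>2 * (norm (u (snd z)))\<^sup>2)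
     - \<beta> / p * Lp_norm_pow p u"

definition mass_sphere :: "real \<Rightarrow> wfun set" where
  "mass_sphere c = {u \<in> X_space. mass u = c}"

text \<open>
  The infimum is taken in the extended reals, so that finiteness is not built into the definition.
\<close>

definition ground_level :: "real \<Rightarrow> real \<Rightarrow> real \<Rightarrow> real \<Rightarrow> ereal" where
  "ground_level \<alpha> \<beta> p c = (INF v\<in>mass_sphere c. ereal (energy \<alpha> \<beta> p v))"

definition is_ground_state :: "real \<Rightarrow> real \<Rightarrow> real \<Rightarrow> real \<Rightarrow> wfun \<Rightarrow> bool" where
  "is_ground_state \<alpha> \<beta> p c u \<longleftrightarrow>
     u \<in> mass_sphere c \<and> ereal (energy \<alpha> \<beta> p u) = ground_level \<alpha> \<beta> p c"

definition minimizing_sequence ::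
  "real \<Rightarrow> real \<Rightarrow> real \<Rightarrow> real \<Rightarrow> (nat \<Rightarrow> wfun) \<Rightarrow> bool" where
  "minimizing_sequence \<alpha> \<beta> p c u \<longleftrightarrow>
     (\<forall>n. u n \<in> mass_sphere c) \<and>
     (\<lambda>n. ereal (energy \<alpha> \<beta> p (u n))) \<longlonglongrightarrow> ground_level \<alpha> \<beta> p c"

text \<open>Admissible constants in the Gagliardo--Nirenberg inequality for functions of nonzero charge.\<close>

definition GN_constant :: "real \<Rightarrow> real \<Rightarrow> bool" where
  "GN_constant p K \<longleftrightarrow> K > 0 \<and>
     (\<forall>u \<in> W12_point - W12.
        Lp_norm_pow p u
        \<le> K * (grad_norm (regular_part ((norm (charge u))\<^sup>2 / mass u) u) powr (p - 2)
               + norm (charge u) powr (p - 2)) * mass u)"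

end

theory Submission
  imports Defs "HOL-Probability.Probability" "HOL-Complex_Analysis.Great_Picard" "HOL-Library.Diagonal_Subsequence"
begin

text \<open>
  With $\lambda = |q|^2/c$ the Gagliardo--Nirenberg inequality bounds the power term by a small multiple of
  the Dirichlet energy of the regular part plus a multiple of $1 + |q|^2$, while
  $\alpha + \theta_\lambda \sim \frac{1}{4\pi}\log |q|^2$ supplies a charge term $|q|^2 \log |q|$ that dominates
  the rest; so the energy is coercive, with bounded charges, gradients and logarithmic energies
  $\iint \log(1+|x-y|)\,|u(x)|^2|u(y)|^2$.

  The logarithmic energy keeps a minimizing sequence tight up to translations by some $y_n$: the translates
  have bounded logarithmic moments, hence converge strongly in $L^2$ along a subsequence, and all lower
  order terms pass to the limit. If $|y_n| \to \infty$, the point interaction is lost in the limit, which is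
  then a minimizer without charge. If $y_n$ stays bounded, the sequence itself is compact, the limit is a
  minimizer, and convergence of the energy turns lower semicontinuity of each term into norm convergence.

  A minimizer $u$ without charge cannot exist: all its translates are minimizers, and testing them
  against $u + \varepsilon z G_\lambda$, rescaled to the sphere, yields $\lambda\,(G_\lambda * u)(y) \to 0$ for every $y$ as
  $\lambda \to \infty$, whereas $\lambda G_\lambda$ is an approximate identity, so that $u = 0$.
\<close>

text \<open>Apart from pointwise bounds, what is needed about G_\<lambda> is derived from
  G_\<lambda> = integral of e^(-\<lambda> t) p_t over t > 0, where p_t is the heat kernel: L^2
  products, moments, the gradient and the Laplacian of G_\<lambda> - G_\<mu> all become time
  integrals after exchanging the order of integration. The same kernel smooths functions of finite
  Dirichlet energy, which yields both the L^p bounds and local compactness. The obstacle is that the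
  point interaction singles out the origin, while the logarithmic energy sees configurations only up
  to translation. Escape to infinity is excluded by statement (ii): at \<lambda> = \<omega>_\<alpha>
  the coefficient \<alpha> + \<theta>_\<lambda> vanishes, so losing the charge in the limit does not
  raise the energy. Statement (ii) rests on orders of magnitude. Adding \<epsilon> z G_\<lambda> to
  U and rescaling gains \<lambda> \<epsilon> |<U, G_\<lambda>>| to first order through the mass term
  of the form; the charge term costs O(\<epsilon>^2), the other terms O(\<epsilon> \<lambda>^(-1/2))
  and a fixed multiple of \<epsilon> |<U, G_\<lambda>>|.\<close>

abbreviation nn_integral_lborel (binder "NNL " 10) where "nn_integral_lborel f \<equiv> integral\<^sup>N lborel f"
abbreviation Lp_int where "Lp_int p u \<equiv> LBINT x. norm (u x) powr p"
abbreviation L1 where "L1 \<equiv> integrable lborel"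
abbreviation borel_fun where "borel_fun \<equiv> borel_measurable borel"
abbreviation lborel2 where "lborel2 \<equiv> lborel \<Otimes>\<^sub>M lborel"
abbreviation (input) seq_limit (infix "---->" 60) where "X ----> a \<equiv> X \<longlonglongrightarrow> a"
lemmas integrable_dominated = Bochner_Integration.integrable_bound

section \<open>Square-integrable functions on the plane\<close>

lemma sq_norm_add_le: "(norm (a + b))\<^sup>2 \<le> 2 * (norm a)\<^sup>2 + 2 * (norm (b::'a::real_normed_vector))\<^sup>2"
proof -
 have "(norm (a + b))\<^sup>2 \<le> (norm a + norm b)\<^sup>2"
  by (simp add: norm_triangle_ineq power_mono)
 also have "\<dots> \<le> 2 * (norm a)\<^sup>2 + 2 * (norm b)\<^sup>2"
  using sum_squares_bound[of "norm a" "norm b"] by (simp add: power2_sum)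
 finally show ?thesis .
qed

lemma integrable_mult_squares:
 fixes f g :: "'a \<Rightarrow> real"
 assumes [measurable]: "f \<in> borel_measurable M" "g \<in> borel_measurable M"
  and f: "integrable M (\<lambda>x. (f x)\<^sup>2)" and g: "integrable M (\<lambda>x. (g x)\<^sup>2)"
 shows "integrable M (\<lambda>x. f x * g x)"
proof (rule integrable_dominated[where f="\<lambda>x. (f x)\<^sup>2 + (g x)\<^sup>2"])
 show "AE x in M. norm (f x * g x) \<le> norm ((f x)\<^sup>2 + (g x)\<^sup>2)"
 proof (rule AE_I2)
  fix x
  have "2 * \<bar>f x\<bar> * \<bar>g x\<bar> \<le> \<bar>f x\<bar>\<^sup>2 + \<bar>g x\<bar>\<^sup>2" by (rule sum_squares_bound)
  moreover have "0 \<le> \<bar>f x\<bar> * \<bar>g x\<bar>" by simp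
  ultimately have "\<bar>f x\<bar> * \<bar>g x\<bar> \<le> (f x)\<^sup>2 + (g x)\<^sup>2"
   by (simp only: power2_abs mult.assoc)
  then show "norm (f x * g x) \<le> norm ((f x)\<^sup>2 + (g x)\<^sup>2)"
   by (simp add: abs_mult)
 qed
qed (use f g in auto)

lemma integral_Cauchy_Schwarz:
 fixes f g :: "'a \<Rightarrow> real"
 assumes [measurable]: "f \<in> borel_measurable M" "g \<in> borel_measurable M"
  and f: "integrable M (\<lambda>x. (f x)\<^sup>2)" and g: "integrable M (\<lambda>x. (g x)\<^sup>2)"
 shows "(\<integral>x. f x * g x \<partial>M) \<le> sqrt (\<integral>x. (f x)\<^sup>2 \<partial>M) * sqrt (\<integral>x. (g x)\<^sup>2 \<partial>M)"
proof -
 define A where "A = (\<integral>x. (f x)\<^sup>2 \<partial>M)"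
 define B where "B = (\<integral>x. (g x)\<^sup>2 \<partial>M)"
 define P where "P = (\<integral>x. f x * g x \<partial>M)"
 note fg = integrable_mult_squares[OF assms]
 have A0: "A \<ge> 0" and B0: "B \<ge> 0" unfolding A_def B_def by auto
 have q: "0 \<le> s\<^sup>2 * A - 2 * (s * t) * P + t\<^sup>2 * B" for s t
 proof -
  have "0 \<le> (\<integral>x. (s * f x - t * g x)\<^sup>2 \<partial>M)" by simp
  also have "(\<lambda>x. (s * f x - t * g x)\<^sup>2) = (\<lambda>x. s\<^sup>2 * (f x)\<^sup>2 - 2 * (s * t) * (f x * g x) + t\<^sup>2 * (g x)\<^sup>2)"
   by (simp add: power2_diff power_mult_distrib algebra_simps)
  also have "(\<integral>x. \<dots> x \<partial>M) = s\<^sup>2 * A - 2 * (s * t) * P + t\<^sup>2 * B"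
   unfolding A_def B_def P_def using f g fg by simp
  finally show ?thesis .
 qed
 have "P\<^sup>2 \<le> A * B"
 proof (cases "A = 0")
  case True
  have "P = 0"
  proof (rule ccontr)
   assume "P \<noteq> 0"
   have "0 \<le> - 2 * ((B + 1) / (2*P)) * P + B" using q[of "(B+1)/(2*P)" 1] True by (simp only: mult_zero_right mult_1_right power_one mult_1)
   also have "- 2 * ((B + 1) / (2*P)) * P = - (B + 1)" using \<open>P \<noteq> 0\<close> by simp
   finally show False by simp
  qed
  then show ?thesis using A0 B0 by simp
 next
  case False
  have "0 \<le> P\<^sup>2 * A - 2 * (P * A) * P + A\<^sup>2 * B" by (rule q)
  also have "\<dots> = A * (A * B - P\<^sup>2)" by (simp add: power2_eq_square algebra_simps)
  finally show ?thesis using False A0 by (simp add: zero_le_mult_iff)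
 qed
 then have "P \<le> sqrt (A * B)" by (simp add: real_le_rsqrt)
 then show ?thesis unfolding A_def B_def P_def by (simp add: real_sqrt_mult)
qed

lemma L2D:
 assumes "u \<in> L2"
 shows L2_measurable: "u \<in> borel_fun"
  and L2_integrable: "L1 (\<lambda>x. (norm (u x))\<^sup>2)"
 using assms by (auto simp: L2_def)

lemma L2I:
 assumes "u \<in> borel_fun" "L1 (\<lambda>x. (norm (u x))\<^sup>2)"
 shows "u \<in> L2"
 using assms by (auto simp: L2_def)

lemma L2_bound:
 assumes [measurable]: "u \<in> borel_fun" and g: "L1 g"
  and "AE x in lborel. (norm (u x))\<^sup>2 \<le> g x"
 shows "u \<in> L2"
 by (rule L2I, simp, rule integrable_dominated[OF g])
   (use assms(3) in \<open>auto elim!: eventually_mono\<close>)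

lemma L2_zero [simp]: "(\<lambda>x. 0) \<in> L2"
 by (auto simp: L2_def)

lemma L2_add:
 assumes "u \<in> L2" "v \<in> L2" shows "(\<lambda>x. u x + v x) \<in> L2"
proof (rule L2_bound[where g="\<lambda>x. 2 * (norm (u x))\<^sup>2 + 2 * (norm (v x))\<^sup>2"])
 show "(\<lambda>x. u x + v x) \<in> borel_fun" using assms[THEN L2_measurable] by simp
qed (use assms[THEN L2_integrable] sq_norm_add_le in auto)

lemma L2_cmult:
 assumes "u \<in> L2" shows "(\<lambda>x. c * u x) \<in> L2"
 by (rule L2I) (use L2D[OF assms] in \<open>auto simp: norm_mult power_mult_distrib\<close>)

lemma L2_diff:
 assumes "u \<in> L2" "v \<in> L2" shows "(\<lambda>x. u x - v x) \<in> L2"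
 using L2_add[OF assms(1) L2_cmult[OF assms(2), of "-1"]] by simp

lemma L2_uminus:
 assumes "u \<in> L2" shows "(\<lambda>x. - u x) \<in> L2"
 using L2_cmult[OF assms, of "-1"] by simp

lemma borel_measurable_cnj [measurable (raw)]:
 "f \<in> borel_measurable M \<Longrightarrow> (\<lambda>x. cnj (f x)) \<in> borel_measurable M"
 using borel_measurable_continuous_onI[OF continuous_on_cnj[OF continuous_on_id]]
 by (rule measurable_compose_rev)

lemma L2_cnj:
 assumes "u \<in> L2" shows "(\<lambda>x. cnj (u x)) \<in> L2"
 by (rule L2I) (use L2D[OF assms] in \<open>auto intro: borel_measurable_cnj\<close>)

lemma L2_norm_mult_integrable:
 assumes "u \<in> L2" "v \<in> L2" shows "L1 (\<lambda>x. norm (u x) * norm (v x))"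
 by (rule integrable_mult_squares) (use assms[THEN L2_measurable] assms[THEN L2_integrable] in auto)

lemma L2_mult_integrable:
 assumes "u \<in> L2" "v \<in> L2" shows "L1 (\<lambda>x. u x * v x)"
 by (rule integrable_dominated[OF L2_norm_mult_integrable[OF assms]])
   (use assms[THEN L2_measurable] in \<open>auto simp: norm_mult\<close>)

lemma L2_ip_integrable:
 assumes "u \<in> L2" "v \<in> L2" shows "L1 (\<lambda>x. cnj (u x) * v x)"
 using L2_mult_integrable[OF L2_cnj[OF assms(1)] assms(2)] .

definition nrm :: "wfun \<Rightarrow> real" where "nrm u = sqrt (mass u)"

lemma mass_nonneg [simp]: "0 \<le> mass u" by (simp add: mass_def)

lemma nrm_nonneg [simp]: "0 \<le> nrm u" by (simp add: nrm_def)

lemma nrm_sq [simp]: "(nrm u)\<^sup>2 = mass u" by (simp add: nrm_def)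

lemma mass_zero [simp]: "mass (\<lambda>x. 0) = 0" by (simp add: mass_def)

lemma mass_cmult: "mass (\<lambda>x. c * u x) = (norm c)\<^sup>2 * mass u"
 by (simp add: mass_def norm_mult power_mult_distrib)

lemma mass_uminus [simp]: "mass (\<lambda>x. - u x) = mass u"
 by (simp add: mass_def)

abbreviation L2_dist where "L2_dist u v \<equiv> nrm (\<lambda>x. u x - v x)"

lemma nrm_cmult: "nrm (\<lambda>x. c * u x) = norm c * nrm u"
 by (simp add: nrm_def mass_cmult real_sqrt_mult)

lemma mass_minus_commute: "mass (\<lambda>x. u x - v x) = mass (\<lambda>x. v x - u x)"
proof -
 have "(\<lambda>x. (norm (u x - v x))\<^sup>2) = (\<lambda>x. (norm (v x - u x))\<^sup>2)"
  by (rule ext) (metis norm_minus_commute)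
 then show ?thesis unfolding mass_def by presburger
qed

lemma nrm_minus_commute: "L2_dist u v = L2_dist v u"
 unfolding nrm_def by (subst mass_minus_commute) (rule refl)

lemma L2_norm_mult_le:
 assumes "u \<in> L2" "v \<in> L2"
 shows "(LBINT x. norm (u x) * norm (v x)) \<le> nrm u * nrm v"
 using integral_Cauchy_Schwarz[of "\<lambda>x. norm (u x)" lborel "\<lambda>x. norm (v x)"]
  assms[THEN L2_measurable] assms[THEN L2_integrable] by (simp add: nrm_def mass_def)

lemma L2_mult_le:
 assumes "u \<in> L2" "v \<in> L2"
 shows "norm (LBINT x. u x * v x) \<le> nrm u * nrm v"
proof -
 have "norm (LBINT x. u x * v x) \<le> (LBINT x. norm (u x * v x))"
  by (rule integral_norm_bound)
 also have "\<dots> \<le> nrm u * nrm v" using L2_norm_mult_le[OF assms] by (simp add: norm_mult)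
 finally show ?thesis .
qed

lemma nrm_cnj [simp]: "nrm (\<lambda>x. cnj (u x)) = nrm u"
 by (simp add: nrm_def mass_def)

lemma L2_ip_le:
 assumes "u \<in> L2" "v \<in> L2"
 shows "norm (L2_ip u v) \<le> nrm u * nrm v"
 using L2_mult_le[OF L2_cnj[OF assms(1)] assms(2)] by (simp add: L2_ip_def)

lemma L2_ip_self: "u \<in> L2 \<Longrightarrow> L2_ip u u = of_real (mass u)"
 unfolding L2_ip_def mass_def
 by (subst integral_complex_of_real[symmetric])
   (auto simp: complex_norm_square mult.commute simp del: of_real_power intro!: Bochner_Integration.integral_cong)

lemma L2_ip_add_right:
 assumes "u \<in> L2" "v \<in> L2" "w \<in> L2"
 shows "L2_ip u (\<lambda>x. v x + w x) = L2_ip u v + L2_ip u w"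
 using L2_ip_integrable assms by (simp add: L2_ip_def distrib_left)

lemma L2_ip_add_left:
 assumes "u \<in> L2" "v \<in> L2" "w \<in> L2"
 shows "L2_ip (\<lambda>x. u x + v x) w = L2_ip u w + L2_ip v w"
 using L2_ip_integrable assms by (simp add: L2_ip_def distrib_right)

lemma L2_ip_diff_right:
 assumes "u \<in> L2" "v \<in> L2" "w \<in> L2"
 shows "L2_ip u (\<lambda>x. v x - w x) = L2_ip u v - L2_ip u w"
 using L2_ip_integrable assms by (simp add: L2_ip_def right_diff_distrib)

lemma L2_ip_diff_left:
 assumes "u \<in> L2" "v \<in> L2" "w \<in> L2"
 shows "L2_ip (\<lambda>x. u x - v x) w = L2_ip u w - L2_ip v w"
 using L2_ip_integrable assms by (simp add: L2_ip_def left_diff_distrib)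

lemma L2_ip_cmult_right: "L2_ip u (\<lambda>x. c * v x) = c * L2_ip u v"
proof -
 have "L2_ip u (\<lambda>x. c * v x) = (LBINT x. c * (cnj (u x) * v x))"
  unfolding L2_ip_def by (simp add: ac_simps)
 then show ?thesis by (simp add: L2_ip_def)
qed

lemma L2_ip_commute: "L2_ip v u = cnj (L2_ip u v)"
proof -
 have "L2_ip v u = (LBINT x. cnj (cnj (u x) * v x))"
  unfolding L2_ip_def by (simp add: mult.commute)
 then show ?thesis unfolding L2_ip_def by (simp only: Bochner_Integration.integral_cnj)
qed

lemma mass_add:
 assumes "u \<in> L2" "v \<in> L2"
 shows "mass (\<lambda>x. u x + v x) = mass u + 2 * Re (L2_ip u v) + mass v"
proof -
 have "complex_of_real (mass (\<lambda>x. u x + v x)) = L2_ip (\<lambda>x. u x + v x) (\<lambda>x. u x + v x)"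
  using L2_ip_self[OF L2_add[OF assms]] by simp
 also have "\<dots> = L2_ip u u + L2_ip u v + (cnj (L2_ip u v) + L2_ip v v)"
  using assms by (simp add: L2_ip_add_left L2_ip_add_right L2_add L2_ip_commute[of v u])
 finally have "Re (complex_of_real (mass (\<lambda>x. u x + v x))) = Re \<dots>" by simp
 then show ?thesis using assms by (simp add: L2_ip_self)
qed

lemma mass_diff:
 assumes "u \<in> L2" "v \<in> L2"
 shows "mass (\<lambda>x. u x - v x) = mass u - 2 * Re (L2_ip u v) + mass v"
 using mass_add[OF assms(1) L2_cmult[OF assms(2), of "-1"]]
 by (simp add: L2_ip_cmult_right[of u "-1" v, simplified])

lemma mass_parallelogram:
 assumes "u \<in> L2" "v \<in> L2"
 shows "mass (\<lambda>x. u x - v x) = 2 * mass u + 2 * mass v - mass (\<lambda>x. u x + v x)"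
 using mass_add[OF assms] mass_diff[OF assms] by simp

lemma nrm_triangle:
 assumes "u \<in> L2" "v \<in> L2"
 shows "nrm (\<lambda>x. u x + v x) \<le> nrm u + nrm v"
proof (rule power2_le_imp_le)
 have "Re (L2_ip u v) \<le> nrm u * nrm v"
  using L2_ip_le[OF assms] complex_Re_le_cmod[of "L2_ip u v"] by linarith
 then show "(nrm (\<lambda>x. u x + v x))\<^sup>2 \<le> (nrm u + nrm v)\<^sup>2"
  using mass_add[OF assms] by (simp add: power2_sum)
qed simp

lemma nrm_triangle_diff:
 assumes "u \<in> L2" "v \<in> L2"
 shows "L2_dist u v \<le> nrm u + nrm v"
 using nrm_triangle[OF assms(1) L2_uminus[OF assms(2)]] by (simp add: nrm_def)

lemma nrm_triangle3:
 assumes "u \<in> L2" "v \<in> L2" "w \<in> L2"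
 shows "L2_dist u w \<le> L2_dist u v + L2_dist v w"
 using nrm_triangle[OF L2_diff[OF assms(1,2)] L2_diff[OF assms(2,3)]] by simp

lemma nrm_abs_diff:
 assumes "u \<in> L2" "v \<in> L2"
 shows "\<bar>nrm u - nrm v\<bar> \<le> L2_dist u v"
 using nrm_triangle[OF L2_diff[OF assms] assms(2)] nrm_triangle[OF L2_diff[OF assms(2,1)] assms(1)]
  nrm_minus_commute[of u v] by simp

lemma nrm_tendsto:
 assumes "\<And>n. u n \<in> L2" "v \<in> L2" "(\<lambda>n. L2_dist (u n) v) ----> 0"
 shows "(\<lambda>n. nrm (u n)) ----> nrm v"
proof -
 have "(\<lambda>n. nrm (u n) - nrm v) ----> 0"
  by (rule Lim_null_comparison[OF _ assms(3)]) (use nrm_abs_diff assms(1,2) in auto)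
 then show ?thesis by (simp add: LIM_zero_iff)
qed

lemma mass_tendsto:
 assumes "\<And>n. u n \<in> L2" "v \<in> L2" "(\<lambda>n. L2_dist (u n) v) ----> 0"
 shows "(\<lambda>n. mass (u n)) ----> mass v"
 using tendsto_power[OF nrm_tendsto[OF assms], of 2] by simp

lemma mass_tendsto_zero_iff: "(\<lambda>n. nrm (u n)) ----> 0 \<longleftrightarrow> (\<lambda>n. mass (u n)) ----> 0"
proof
 assume "(\<lambda>n. nrm (u n)) ----> 0"
 from tendsto_power[OF this, of 2] show "(\<lambda>n. mass (u n)) ----> 0" by simp
next
 assume "(\<lambda>n. mass (u n)) ----> 0"
 from tendsto_real_sqrt[OF this] show "(\<lambda>n. nrm (u n)) ----> 0" by (simp add: nrm_def)
qed

lemma mass_nn: "u \<in> L2 \<Longrightarrow> (NNL x. ennreal ((norm (u x))\<^sup>2)) = ennreal (mass u)"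
 unfolding mass_def by (rule nn_integral_eq_integral) (auto simp: L2_integrable)

lemma L2_nnI:
 assumes [measurable]: "u \<in> borel_fun"
  and le: "(NNL x. ennreal ((norm (u x))\<^sup>2)) \<le> ennreal C" and "C \<ge> 0"
 shows "u \<in> L2" "mass u \<le> C"
proof -
 have "L1 (\<lambda>x. (norm (u x))\<^sup>2)"
  by (rule integrableI_bounded) (use le ennreal_less_top[of C] in \<open>auto simp: le_less_trans\<close>)
 then show "u \<in> L2" by (simp add: L2I)
 from mass_nn[OF this] le \<open>C \<ge> 0\<close> show "mass u \<le> C" by simp
qed

lemma mass_cong_AE:
 assumes "AE x in lborel. u x = v x" "u \<in> borel_fun" "v \<in> borel_fun"
 shows "mass u = mass v"
 unfolding mass_def by (rule integral_cong_AE) (use assms in auto)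

text \<open>Multiplying by a fixed positive square-integrable weight embeds $L^2$ into $L^1$.\<close>

lemma exists_L2_weight: "\<exists>w\<in>L2. \<forall>x. w x \<noteq> 0"
proof -
 define f where "f = (\<lambda>x::real^2. 1 / (1 + norm x)^2)"
 \<comment> \<open>Sigma-finiteness provides a positive integrable h; its square root is the
   weight.\<close>
 have "sigma_finite_measure (lborel :: (real^2) measure)" ..
 then obtain h :: "real^2 \<Rightarrow> ennreal" where h: "h \<in> borel_measurable lborel"
  "integral\<^sup>N lborel h \<noteq> \<infinity>" "\<And>x. 0 < h x" "\<And>x. h x < \<infinity>"
  using sigma_finite_measure.Ex_finite_integrable_function[of "lborel :: (real^2) measure"] by auto
 define w where "w = (\<lambda>x. complex_of_real (sqrt (enn2real (h x))))"
 have e: "ennreal ((norm (w x))\<^sup>2) = h x" for x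
  using h(4)[of x] by (simp add: w_def)
 have "w \<in> L2"
 proof (rule L2I)
  show "w \<in> borel_fun" using h(1) by (simp add: w_def)
  show "L1 (\<lambda>x. (norm (w x))\<^sup>2)"
   by (rule integrableI_bounded) (use h(1,2) e in \<open>auto simp: w_def top.not_eq_extremum\<close>)
 qed
 moreover have "w x \<noteq> 0" for x
  using h(3,4)[of x] by (auto simp: w_def enn2real_eq_0_iff)
 ultimately show ?thesis by blast
qed

section \<open>Subsequences, Fatou's lemma and completeness of L^2\<close>

lemma L2_tendsto_AE_subseq:
 assumes u: "\<And>n. u n \<in> L2" and v: "v \<in> L2" and lim: "(\<lambda>n. L2_dist (u n) v) ----> 0"
 shows "\<exists>r::nat\<Rightarrow>nat. strict_mono r \<and> (AE x in lborel. (\<lambda>n. u (r n) x) ----> v x)"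
proof -
 have "(\<lambda>n. mass (\<lambda>x. u n x - v x)) ----> 0" using lim by (simp only: mass_tendsto_zero_iff)
 then obtain r :: "nat \<Rightarrow> nat" where r: "strict_mono r" "AE x in lborel. (\<lambda>n. (norm (u (r n) x - v x))\<^sup>2) ----> 0"
  using tendsto_L1_AE_subseq[of lborel "\<lambda>n x. (norm (u n x - v x))\<^sup>2"] L2_integrable[OF L2_diff[OF u v]]
  by (auto simp: mass_def)
 have "(\<lambda>n. u (r n) x) ----> v x" if "(\<lambda>n. (norm (u (r n) x - v x))\<^sup>2) ----> 0" for x
 proof -
  from tendsto_real_sqrt[OF that] have "(\<lambda>n. norm (u (r n) x - v x)) ----> 0" by simp
  then show ?thesis using tendsto_norm_zero_iff LIM_zero_iff by blast
 qed
 with r(2) have "AE x in lborel. (\<lambda>n. u (r n) x) ----> v x" by (auto elim!: eventually_mono)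
 with r(1) show ?thesis by blast
qed

text \<open>Fatou's lemma for Bochner integrals. Integrability of the limit is part of the
  conclusion, which is how limits acquire finite moments and powers.\<close>

lemma Fatou_real:
 fixes f :: "nat \<Rightarrow> 'a \<Rightarrow> real"
 assumes [measurable]: "\<And>n. f n \<in> borel_measurable M" "g \<in> borel_measurable M"
  and lim: "AE x in M. (\<lambda>n. f n x) ----> g x"
  and nn: "\<And>n x. 0 \<le> f n x" "\<And>x. 0 \<le> g x"
  and int: "\<And>n. integrable M (f n)" and L: "(\<lambda>n. \<integral>x. f n x \<partial>M) ----> L"
 shows "integrable M g" "(\<integral>x. g x \<partial>M) \<le> L"
proof -
 have L0: "0 \<le> L" by (rule LIMSEQ_le_const[OF L]) (use nn in auto)
 have "(\<integral>\<^sup>+x. ennreal (g x) \<partial>M) = (\<integral>\<^sup>+x. liminf (\<lambda>n. ennreal (f n x)) \<partial>M)"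
  by (rule nn_integral_cong_AE) (use lim in \<open>auto elim!: eventually_mono intro!: lim_imp_Liminf[symmetric]\<close>)
 also have "\<dots> \<le> liminf (\<lambda>n. \<integral>\<^sup>+x. ennreal (f n x) \<partial>M)" by (rule nn_integral_liminf) simp
 also have "\<dots> = liminf (\<lambda>n. ennreal (\<integral>x. f n x \<partial>M))"
  using int nn by (simp add: nn_integral_eq_integral)
 also have "\<dots> = ennreal L" using L by (intro lim_imp_Liminf) auto
 finally have le: "(\<integral>\<^sup>+x. ennreal (g x) \<partial>M) \<le> ennreal L" .
 show *: "integrable M g"
  by (rule integrableI_bounded) (use le nn in \<open>auto simp: le_less_trans\<close>)
 show "(\<integral>x. g x \<partial>M) \<le> L" using le nn L0 by (simp add: nn_integral_eq_integral[OF *])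
qed

lemma Fatou_real_bound:
 fixes f :: "nat \<Rightarrow> 'a \<Rightarrow> real"
 assumes [measurable]: "\<And>n. f n \<in> borel_measurable M" "g \<in> borel_measurable M"
  and lim: "AE x in M. (\<lambda>n. f n x) ----> g x"
  and nn: "\<And>n x. 0 \<le> f n x" "\<And>x. 0 \<le> g x"
  and int: "\<And>n. integrable M (f n)" and L: "\<And>n. (\<integral>x. f n x \<partial>M) \<le> L"
 shows "integrable M g" "(\<integral>x. g x \<partial>M) \<le> L"
proof -
 have L0: "0 \<le> L" using L[of 0] nn(1)[of 0] by (meson Bochner_Integration.integral_nonneg order_trans)
 have "(\<integral>\<^sup>+x. ennreal (g x) \<partial>M) = (\<integral>\<^sup>+x. liminf (\<lambda>n. ennreal (f n x)) \<partial>M)"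
  by (rule nn_integral_cong_AE) (use lim in \<open>auto elim!: eventually_mono intro!: lim_imp_Liminf[symmetric]\<close>)
 also have "\<dots> \<le> liminf (\<lambda>n. \<integral>\<^sup>+x. ennreal (f n x) \<partial>M)" by (rule nn_integral_liminf) simp
 also have "\<dots> = liminf (\<lambda>n. ennreal (\<integral>x. f n x \<partial>M))"
  using int nn by (simp add: nn_integral_eq_integral)
 also have "\<dots> \<le> liminf (\<lambda>n::nat. ennreal L)" by (intro Liminf_mono always_eventually) (auto intro: ennreal_leI L)
 also have "\<dots> = ennreal L" by (simp add: Liminf_const)
 finally have le: "(\<integral>\<^sup>+x. ennreal (g x) \<partial>M) \<le> ennreal L" .
 show *: "integrable M g"
  by (rule integrableI_bounded) (use le nn in \<open>auto simp: le_less_trans\<close>)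
 show "(\<integral>x. g x \<partial>M) \<le> L" using le nn L0 by (simp add: nn_integral_eq_integral[OF *])
qed

text \<open>The weight turns an L^2 Cauchy sequence into an L^1 one, which has an almost everywhere
  Cauchy subsequence. Dividing by the weight gives the pointwise limit, and Fatou's lemma shows that
  it is the limit in L^2.\<close>

lemma L2_complete:
 assumes u: "\<And>n. u n \<in> L2"
  and cauchy: "\<And>e. e > 0 \<Longrightarrow> \<exists>N. \<forall>i\<ge>N. \<forall>j\<ge>N. L2_dist (u i) (u j) < e"
 shows "\<exists>v\<in>L2. (\<lambda>n. L2_dist (u n) v) ----> 0"
proof -
 obtain w where w: "w \<in> L2" "\<And>x. w x \<noteq> 0" using exists_L2_weight by blast
 note [measurable] = L2_measurable[OF u] L2_measurable[OF w(1)]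
 have wi: "L1 (\<lambda>x. u n x * w x)" for n using L2_mult_integrable[OF u w(1)] .
 have "\<exists>N. \<forall>i\<ge>N. \<forall>j\<ge>N. (LINT x|lborel. norm (u i x * w x - u j x * w x)) < e" if "e > 0" for e
 proof -
  obtain N where N: "\<And>i j. i \<ge> N \<Longrightarrow> j \<ge> N \<Longrightarrow> L2_dist (u i) (u j) < e / (nrm w + 1)"
   using cauchy[of "e / (nrm w + 1)"] \<open>e > 0\<close> nrm_nonneg[of w] by (auto simp: add_nonneg_pos)
  have "(LINT x|lborel. norm (u i x * w x - u j x * w x)) < e" if "i \<ge> N" "j \<ge> N" for i j
  proof -
   have "(LINT x|lborel. norm (u i x * w x - u j x * w x)) = (LINT x|lborel. norm (u i x - u j x) * norm (w x))"
    by (simp add: norm_mult flip: left_diff_distrib)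
   also have "\<dots> \<le> L2_dist (u i) (u j) * nrm w" by (rule L2_norm_mult_le[OF L2_diff[OF u u] w(1)])
   also have "\<dots> \<le> e / (nrm w + 1) * nrm w" using N[OF that] by (intro mult_right_mono) auto
   also have "\<dots> < e" using \<open>e > 0\<close> nrm_nonneg[of w] by (simp add: field_simps add_pos_nonneg)
   finally show ?thesis .
  qed
  then show ?thesis by blast
 qed
 then obtain r where r: "strict_mono r" "AE x in lborel. Cauchy (\<lambda>i. u (r i) x * w x)"
  by (rule cauchy_L1_AE_cauchy_subseq[of lborel "\<lambda>n x. u n x * w x", OF wi]) blast
 \<comment> \<open>Where the subsequence is not Cauchy, the limit is that of the constant sequence
   0.\<close>
 define v where "v = (\<lambda>x. lim (\<lambda>i. if Cauchy (\<lambda>i. u (r i) x) then u (r i) x else 0))"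
 have [measurable]: "v \<in> borel_fun"
  unfolding v_def by (rule borel_measurable_lim_metric) simp
 have lim: "AE x in lborel. (\<lambda>i. u (r i) x) ----> v x"
  using r(2)
 proof eventually_elim
  case (elim x)
  then have "convergent (\<lambda>i. u (r i) x * w x)" by (simp only: Cauchy_convergent_iff)
  from convergent_mult[OF this convergent_const[of "inverse (w x)"]]
  have "convergent (\<lambda>i. u (r i) x * w x * inverse (w x))" .
  moreover have "(\<lambda>i. u (r i) x * w x * inverse (w x)) = (\<lambda>i. u (r i) x)" using w(2)[of x] by (simp add: fun_eq_iff)
  ultimately have c: "convergent (\<lambda>i. u (r i) x)" by metis
  then show ?case unfolding v_def using convergent_LIMSEQ_iff[of "\<lambda>i. u (r i) x"]
   by (simp add: Cauchy_convergent_iff)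
 qed
 \<comment> \<open>Fatou's lemma in the second index of the Cauchy condition; the shift by
   \<open>N\<close> keeps that index beyond the threshold.\<close>
 have bd: "(\<lambda>x. u n x - v x) \<in> L2 \<and> mass (\<lambda>x. u n x - v x) \<le> e\<^sup>2"
  if "n \<ge> N" "\<And>i j. i \<ge> N \<Longrightarrow> j \<ge> N \<Longrightarrow> L2_dist (u i) (u j) < e" for n N e
 proof -
  have lt: "(LBINT x. (norm (u n x - u (r (i + N)) x))\<^sup>2) \<le> e\<^sup>2" for i
  proof -
   have "r (i + N) \<ge> N" using seq_suble[OF r(1), of "i+N"] by linarith
   then have "nrm (\<lambda>x. u n x - u (r (i+N)) x) < e" using that by blast
   then have "(nrm (\<lambda>x. u n x - u (r (i+N)) x))\<^sup>2 \<le> e\<^sup>2" by (intro power_mono) auto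
   then show ?thesis by (simp only: nrm_sq mass_def)
  qed
  have l: "AE x in lborel. (\<lambda>i. (norm (u n x - u (r (i + N)) x))\<^sup>2) ----> (norm (u n x - v x))\<^sup>2"
   using lim
  proof eventually_elim
   case (elim x)
   then have "(\<lambda>i. u (r (i + N)) x) ----> v x" by (rule LIMSEQ_ignore_initial_segment)
   then show ?case by (intro tendsto_intros)
  qed
  have "L1 (\<lambda>x. (norm (u n x - v x))\<^sup>2)" "(LBINT x. (norm (u n x - v x))\<^sup>2) \<le> e\<^sup>2"
   by (rule Fatou_real_bound[OF _ _ l _ _ _ lt]; use L2_integrable[OF L2_diff[OF u u]] in simp)+
  then show ?thesis by (auto simp: mass_def intro!: L2I)
 qed
 obtain N1 where N1: "\<And>i j. i \<ge> N1 \<Longrightarrow> j \<ge> N1 \<Longrightarrow> L2_dist (u i) (u j) < 1"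
  using cauchy[of 1] by auto
 have "(\<lambda>x. u N1 x - v x) \<in> L2" using bd[OF _ N1] by blast
 from L2_diff[OF u[of N1] this] have v: "v \<in> L2" by simp
 have "(\<lambda>n. L2_dist (u n) v) ----> 0"
 proof (rule LIMSEQ_I)
  fix e :: real assume "e > 0"
  then obtain N where N: "\<And>i j. i \<ge> N \<Longrightarrow> j \<ge> N \<Longrightarrow> L2_dist (u i) (u j) < e/2"
   using cauchy[of "e/2"] by auto
  have "L2_dist (u n) v < e" if "n \<ge> N" for n
  proof -
   have "L2_dist (u n) v \<le> e/2"
    using bd[OF that N] \<open>e > 0\<close> unfolding nrm_def by (intro real_le_lsqrt) auto
   then show ?thesis using \<open>e > 0\<close> by linarith
  qed
  then show "\<exists>no. \<forall>n\<ge>no. norm (L2_dist (u n) v - 0) < e"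
   by (intro exI[of _ N]) simp
 qed
 with v show ?thesis by blast
qed

subsection \<open>Translations and dilations\<close>

lemma lborel_distr_shift: "distr lborel borel (\<lambda>x. x + y) = (lborel :: (real^2) measure)"
proof -
 have "(\<lambda>x. x + y) = (+) y" by (rule ext) (rule add.commute)
 then show ?thesis by (simp only: lborel_distr_plus)
qed

lemma nn_integral_shift:
 fixes f :: "real^2 \<Rightarrow> ennreal"
 assumes [measurable]: "f \<in> borel_fun"
 shows "(NNL x. f (x + y)) = (NNL x. f x)"
 by (subst lborel_distr_shift[symmetric, of y], subst nn_integral_distr) auto

lemma integral_shift:
 fixes f :: "real^2 \<Rightarrow> 'b::{banach,second_countable_topology}"
 assumes [measurable]: "f \<in> borel_fun"
 shows "(LBINT x. f (x + y)) = (LBINT x. f x)"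
 by (subst (2) lborel_distr_shift[symmetric, of y], subst integral_distr) auto

lemma integrable_shift:
 fixes f :: "real^2 \<Rightarrow> 'b::{banach,second_countable_topology}"
 assumes "L1 f"
 shows "L1 (\<lambda>x. f (x + y))"
proof -
 have [measurable]: "f \<in> borel_fun" using assms by auto
 have "integrable (distr lborel borel (\<lambda>x. x + y)) f" using assms by (simp add: lborel_distr_shift)
 then show ?thesis by (subst (asm) integrable_distr_eq) auto
qed

lemma L2_shift: assumes "u \<in> L2" shows "(\<lambda>x. u (x + y)) \<in> L2"
 by (rule L2I) (use L2D[OF assms] integrable_shift[OF L2_integrable[OF assms], of y] in auto)

lemma mass_shift: assumes "u \<in> borel_fun" shows "mass (\<lambda>x. u (x + y)) = mass u"
 unfolding mass_def by (rule integral_shift) (use assms in auto)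

lemma nrm_shift: assumes "u \<in> borel_fun" shows "nrm (\<lambda>x. u (x + y)) = nrm u"
 by (simp add: nrm_def mass_shift[OF assms])

lemma nn_integral_dilation:
 fixes f :: "real^2 \<Rightarrow> ennreal"
 assumes [measurable]: "f \<in> borel_fun" and "c \<noteq> 0"
 shows "(NNL x. f x) = ennreal (c\<^sup>2) * (NNL x. f (c *\<^sub>R x))"
 by (subst lborel_affine[OF \<open>c \<noteq> 0\<close>, of 0])
   (simp add: nn_integral_density nn_integral_distr nn_integral_cmult flip: ennreal_power)

lemma nn_integral_reflect:
 fixes f :: "real^2 \<Rightarrow> ennreal"
 assumes "f \<in> borel_fun"
 shows "(NNL x. f (y - x)) = (NNL x. f x)"
proof -
 have "(NNL x. f (y - x)) = (NNL x. f (- x))"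
  using nn_integral_shift[of "\<lambda>x. f (- x)" "- y"] assms by simp
 then show ?thesis using nn_integral_dilation[of f "-1"] assms by simp
qed

lemma lborel_distr_reflect: "distr lborel borel (\<lambda>x. y - x) = (lborel :: (real^2) measure)"
proof (rule measure_eqI)
 fix A assume A: "A \<in> sets (distr lborel borel (\<lambda>x. y - x))"
 then have [measurable]: "A \<in> sets borel" by simp
 have "emeasure (distr lborel borel (\<lambda>x. y - x)) A = (\<integral>\<^sup>+x. indicator A x \<partial>distr lborel borel (\<lambda>x. y - x))"
  by simp
 also have "\<dots> = (NNL x. indicator A (y - x))" by (subst nn_integral_distr) auto
 also have "\<dots> = emeasure lborel A" by (subst nn_integral_reflect) auto
 finally show "emeasure (distr lborel borel (\<lambda>x. y - x)) A = emeasure lborel A" .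
qed simp

lemma integral_reflect_plane:
 fixes f :: "real^2 \<Rightarrow> 'b::{banach,second_countable_topology}"
 assumes [measurable]: "f \<in> borel_fun"
 shows "(LBINT x. f (y - x)) = (LBINT x. f x)"
 by (subst (2) lborel_distr_reflect[symmetric, of y], subst integral_distr) auto

lemma integrable_reflect_plane:
 fixes f :: "real^2 \<Rightarrow> 'b::{banach,second_countable_topology}"
 assumes "L1 f"
 shows "L1 (\<lambda>x. f (y - x))"
proof -
 have [measurable]: "f \<in> borel_fun" using assms by auto
 have "integrable (distr lborel borel (\<lambda>x. y - x)) f" using assms by (simp add: lborel_distr_reflect)
 then show ?thesis by (subst (asm) integrable_distr_eq) auto
qed

section \<open>An algebra of smooth functions and the fundamental lemma\<close>

text \<open>The smooth cutoffs $x^{-n} e^{-1/x}$: the family is closed under differentiation.\<close>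

definition flat :: "nat \<Rightarrow> real \<Rightarrow> real" where
 "flat n x = (if x \<le> 0 then 0 else exp (- inverse x) * (inverse x) ^ n)"

lemma flat_tendsto_0: "(flat n \<longlongrightarrow> 0) (at_right 0)"
proof -
 have "((\<lambda>x. (inverse x) ^ n / exp (inverse x)) \<longlongrightarrow> (0::real)) (at_right 0)"
  by (rule filterlim_compose[OF tendsto_power_div_exp_0 filterlim_inverse_at_top_right])
 moreover have "eventually (\<lambda>x. (inverse x) ^ n / exp (inverse x) = flat n x) (at_right (0::real))"
  unfolding eventually_at_right_field by (intro exI[of _ 1]) (auto simp: flat_def exp_minus field_simps)
 ultimately show ?thesis using filterlim_cong by force
qed

lemma flat_has_derivative:
 "(flat n has_real_derivative (flat (n + 2) x - real n * flat (n + 1) x)) (at x)"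
proof -
 consider "x < 0" | "x = 0" | "x > 0" by linarith
 then show ?thesis
 proof cases
  case 1
  then have "((\<lambda>x. 0) has_real_derivative (flat (n + 2) x - real n * flat (n + 1) x)) (at x)"
   by (auto simp: flat_def)
  then show ?thesis
   by (rule has_field_derivative_transform_within_open[where S="{..<0}"]) (use 1 in \<open>auto simp: flat_def\<close>)
 next
  case 3
  have "((\<lambda>x. exp (- inverse x) * (inverse x) ^ n) has_real_derivative (flat (n + 2) x - real n * flat (n + 1) x)) (at x)"
  proof -
   have "((\<lambda>x. inverse x ^ n) has_real_derivative real n * (- ((inverse x)\<^sup>2) * inverse x ^ (n - 1))) (at x)"
    using DERIV_power[OF DERIV_inverse[of x UNIV], of n] 3 by (simp add: power2_eq_square mult.assoc)
   moreover have "((\<lambda>x. exp (- inverse x)) has_real_derivative exp (- inverse x) * (inverse x)\<^sup>2) (at x)"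
    using 3 by (auto intro!: derivative_eq_intros simp: power2_eq_square)
   ultimately have "((\<lambda>x. exp (- inverse x) * inverse x ^ n) has_real_derivative
     exp (- inverse x) * (inverse x)\<^sup>2 * inverse x ^ n +
     real n * (- ((inverse x)\<^sup>2) * inverse x ^ (n - 1)) * exp (- inverse x)) (at x)"
    by (rule DERIV_mult[rotated])
   moreover have "exp (- inverse x) * (inverse x)\<^sup>2 * inverse x ^ n +
     real n * (- ((inverse x)\<^sup>2) * inverse x ^ (n - 1)) * exp (- inverse x) = flat (n + 2) x - real n * flat (n + 1) x"
    using 3 by (cases n) (simp_all add: flat_def power2_eq_square algebra_simps)
   ultimately show ?thesis by simp
  qed
  then show ?thesis
   by (rule has_field_derivative_transform_within_open[where S="{0<..}"]) (use 3 in \<open>auto simp: flat_def\<close>)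
 next
  case 2
  \<comment> \<open>At the origin the difference quotient of \<open>flat n\<close> is
    \<open>flat (n + 1)\<close>, which tends to 0 from both sides.\<close>
  have q: "(flat n (0 + h) - flat n 0) / h = flat (n + 1) h" for h
   by (auto simp: flat_def field_simps)
  have "((\<lambda>h. flat (n + 1) h) \<longlongrightarrow> 0) (at_left 0)"
  proof (rule tendsto_eventually)
   show "eventually (\<lambda>h. flat (n + 1) h = 0) (at_left 0)"
    unfolding eventually_at_left_field by (intro exI[of _ "-1"]) (auto simp: flat_def)
  qed
  with flat_tendsto_0[of "n+1"] have "((\<lambda>h. flat (n + 1) h) \<longlongrightarrow> 0) (at 0)"
   by (simp add: filterlim_split_at)
  then show ?thesis unfolding DERIV_def 2 q by (simp add: flat_def)
 qed
qed

lemma flat_nonneg: "flat n x \<ge> 0" by (simp add: flat_def)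

lemma flat0_le_1: "flat 0 x \<le> 1" by (simp add: flat_def)

text \<open>A class closed under partial derivatives: smoothness of a concrete function reduces to
  building it from these rules. It contains the heat kernel and, thanks to \<open>flat\<close>,
  compactly supported cutoffs.\<close>

inductive_set Sm :: "(real^2 \<Rightarrow> real) set" where
 const: "(\<lambda>x. c) \<in> Sm"
| coord: "(\<lambda>x. x $ i) \<in> Sm"
| add: "f \<in> Sm \<Longrightarrow> g \<in> Sm \<Longrightarrow> (\<lambda>x. f x + g x) \<in> Sm"
| mult: "f \<in> Sm \<Longrightarrow> g \<in> Sm \<Longrightarrow> (\<lambda>x. f x * g x) \<in> Sm"
| exp: "f \<in> Sm \<Longrightarrow> (\<lambda>x. exp (f x)) \<in> Sm"
| flat: "f \<in> Sm \<Longrightarrow> (\<lambda>x. flat n (f x)) \<in> Sm"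

lemma Sm_diff: "f \<in> Sm \<Longrightarrow> g \<in> Sm \<Longrightarrow> (\<lambda>x. f x - g x) \<in> Sm"
 using Sm.add[of f "\<lambda>x. (-1) * g x"] Sm.mult[OF Sm.const[of "-1"], of g] by simp

lemma Sm_derivative:
 "f \<in> Sm \<Longrightarrow> \<exists>D. (\<forall>x. (f has_derivative D x) (at x)) \<and> (\<forall>i. (\<lambda>x. D x (axis i 1)) \<in> Sm)"
proof (induction rule: Sm.induct)
 case (const c)
 show ?case by (rule exI[of _ "\<lambda>x y. 0"]) (auto intro: Sm.const)
next
 case (coord j)
 have "((\<lambda>x::real^2. x $ j) has_derivative (\<lambda>y. y $ j)) (at x)" for x
  by (rule bounded_linear.has_derivative[OF bounded_linear_vec_nth has_derivative_ident])
 then show ?case by (intro exI[of _ "\<lambda>x y. y $ j"]) (auto intro: Sm.const simp: axis_def)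
next
 case (add f g)
 then obtain D E where "\<And>x. (f has_derivative D x) (at x)" "\<And>i. (\<lambda>x. D x (axis i 1)) \<in> Sm"
  "\<And>x. (g has_derivative E x) (at x)" "\<And>i. (\<lambda>x. E x (axis i 1)) \<in> Sm" by metis
 then show ?case
  by (intro exI[of _ "\<lambda>x y. D x y + E x y"]) (auto intro: Sm.add has_derivative_add)
next
 case (mult f g)
 then obtain D E where "\<And>x. (f has_derivative D x) (at x)" "\<And>i. (\<lambda>x. D x (axis i 1)) \<in> Sm"
  "\<And>x. (g has_derivative E x) (at x)" "\<And>i. (\<lambda>x. E x (axis i 1)) \<in> Sm" by metis
 with mult.hyps show ?case
  by (intro exI[of _ "\<lambda>x y. f x * E x y + D x y * g x"]) (auto intro!: Sm.add Sm.mult has_derivative_mult)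
next
 case (exp f)
 then obtain D where D: "\<And>x. (f has_derivative D x) (at x)" "\<And>i. (\<lambda>x. D x (axis i 1)) \<in> Sm" by metis
 have "((\<lambda>x. exp (f x)) has_derivative (\<lambda>y. D x y * exp (f x))) (at x)" for x
  using has_derivative_exp[OF D(1)[of x]] by simp
 with D exp.hyps show ?case
  by (intro exI[of _ "\<lambda>x y. D x y * exp (f x)"]) (auto intro!: Sm.exp Sm.mult)
next
 case (flat f n)
 then obtain D where D: "\<And>x. (f has_derivative D x) (at x)" "\<And>i. (\<lambda>x. D x (axis i 1)) \<in> Sm" by metis
 define c where "c = (\<lambda>x. flat (n + 2) (f x) - real n * flat (n + 1) (f x))"
 have c: "c \<in> Sm" unfolding c_def using flat.hyps
  by (intro Sm_diff Sm.flat Sm.mult Sm.const)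
 have "((\<lambda>x. flat n (f x)) has_derivative (\<lambda>y. D x y * c x)) (at x)" for x
 proof -
  have "(flat n has_derivative (\<lambda>h. h * c x)) (at (f x))"
   using flat_has_derivative[of n "f x"] unfolding c_def has_field_derivative_def
   by (subst mult.commute)
  from has_derivative_compose[OF D(1) this] show ?thesis by simp
 qed
 with D c show ?case
  by (intro exI[of _ "\<lambda>x y. D x y * c x"]) (auto intro!: Sm.mult)
qed

lemma pderiv_fun_eq: "(f has_derivative D) (at x) \<Longrightarrow> pderiv_fun i f x = D (axis i 1)"
 by (simp add: pderiv_fun_def frechet_derivative_at[symmetric])

lemma Sm_pderiv:
 assumes "f \<in> Sm"
 shows "pderiv_fun i f \<in> Sm" "f differentiable (at x)"
proof -
 obtain D where D: "\<And>x. (f has_derivative D x) (at x)" "\<And>i. (\<lambda>x. D x (axis i 1)) \<in> Sm"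
  using Sm_derivative[OF assms] by metis
 have "pderiv_fun i f = (\<lambda>x. D x (axis i 1))" using pderiv_fun_eq[OF D(1)] by blast
 with D show "pderiv_fun i f \<in> Sm" "f differentiable (at x)" by (auto simp: differentiable_def)
qed

lemma Sm_continuous: "f \<in> Sm \<Longrightarrow> continuous_on S f"
 by (metis Sm_pderiv(2) differentiable_imp_continuous_within continuous_at_imp_continuous_on)

lemma Sm_C_k: "f \<in> Sm \<Longrightarrow> C_k k f"
 by (induction k arbitrary: f) (auto simp: Sm_continuous Sm_pderiv)

lemma test_functionsI:
 assumes "\<eta> \<in> Sm" "\<And>x. norm x > R \<Longrightarrow> \<eta> x = 0"
 shows "\<eta> \<in> test_functions"
proof -
 have "{x. \<eta> x \<noteq> 0} \<subseteq> cball 0 R" using assms(2) by (auto simp: not_less[symmetric])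
 then have "bounded {x. \<eta> x \<noteq> 0}" using bounded_cball bounded_subset by blast
 then show ?thesis using Sm_C_k[OF assms(1)] by (auto simp: test_functions_def compact_closure)
qed

lemma test_functionsD:
 assumes "\<eta> \<in> test_functions"
 shows "\<eta> differentiable (at x)" "continuous_on UNIV \<eta>" "continuous_on UNIV (pderiv_fun i \<eta>)"
  "(\<eta> has_derivative frechet_derivative \<eta> (at x)) (at x)"
  "\<exists>R>0. \<forall>x. norm x > R \<longrightarrow> \<eta> x = 0 \<and> (\<forall>i. pderiv_fun i \<eta> x = 0)"
proof -
 have C: "C_k k \<eta>" for k using assms by (auto simp: test_functions_def)
 show d: "\<eta> differentiable (at x)" for x using C[of 1] by auto
 then show "(\<eta> has_derivative frechet_derivative \<eta> (at x)) (at x)" by (simp add: frechet_derivative_works)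
 show "continuous_on UNIV \<eta>" using C[of 0] by simp
 show "continuous_on UNIV (pderiv_fun i \<eta>)" using C[of "Suc 0"] by simp
 have "bounded {x. \<eta> x \<noteq> 0}"
  using assms compact_imp_bounded bounded_closure closure_subset bounded_subset
  by (fastforce simp: test_functions_def)
 then obtain R where R: "\<And>x. \<eta> x \<noteq> 0 \<Longrightarrow> norm x \<le> R" by (auto simp: bounded_iff)
 define R' where "R' = max R 1"
 have z: "\<eta> x = 0" if "norm x > R'" for x using R[of x] that by (force simp: R'_def)
 have "pderiv_fun i \<eta> x = 0" if "norm x > R'" for x i
 proof -
  have "((\<lambda>x. 0) has_derivative (\<lambda>x. 0)) (at x)" by simp
  then have "(\<eta> has_derivative (\<lambda>x. 0)) (at x)"
  proof (rule has_derivative_transform_within_open)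
   show "open (- cball (0::real^2) R')" by (simp add: open_Compl)
  qed (use that z in auto)
  then show ?thesis by (simp add: pderiv_fun_eq)
 qed
 with z show "\<exists>R>0. \<forall>x. norm x > R \<longrightarrow> \<eta> x = 0 \<and> (\<forall>i. pderiv_fun i \<eta> x = 0)"
  by (intro exI[of _ R']) (auto simp: R'_def)
qed

lemma pderiv_fun_shift:
 assumes "f differentiable (at (x + y))"
 shows "pderiv_fun i (\<lambda>x. f (x + y)) x = pderiv_fun i f (x + y)"
  and "(\<lambda>x. f (x + y)) differentiable (at x)"
proof -
 obtain D where D: "(f has_derivative D) (at (x + y))" using assms by (auto simp: differentiable_def)
 have "((\<lambda>x. x + y) has_derivative (\<lambda>x. x)) (at x)" by (auto intro!: derivative_eq_intros)
 from has_derivative_compose[OF this D] have E: "((\<lambda>x. f (x + y)) has_derivative D) (at x)" by simp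
 show "pderiv_fun i (\<lambda>x. f (x + y)) x = pderiv_fun i f (x + y)"
  using pderiv_fun_eq[OF D] pderiv_fun_eq[OF E] by simp
 show "(\<lambda>x. f (x + y)) differentiable (at x)" using E by (auto simp: differentiable_def)
qed

lemma C_k_shift: "C_k k f \<Longrightarrow> C_k k (\<lambda>x. f (x + y))"
proof (induction k arbitrary: f)
 case 0
 then have "continuous_on UNIV (f \<circ> (\<lambda>x. x + y))"
  by (intro continuous_on_compose) (auto intro!: continuous_intros intro: continuous_on_subset)
 then show ?case by (simp add: o_def)
next
 case (Suc k)
 have "pderiv_fun i (\<lambda>x. f (x + y)) = (\<lambda>x. pderiv_fun i f (x + y))" for i
  by (rule ext, rule pderiv_fun_shift(1)) (use Suc.prems in auto)
 then show ?case using Suc by (auto intro: pderiv_fun_shift(2))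
qed

lemma test_functions_shift:
 assumes "\<eta> \<in> test_functions" shows "(\<lambda>x. \<eta> (x + y)) \<in> test_functions"
proof -
 obtain R where R: "\<And>x. norm x > R \<Longrightarrow> \<eta> x = 0" using test_functionsD(5)[OF assms] by blast
 have "{x. \<eta> (x + y) \<noteq> 0} \<subseteq> cball 0 (R + norm y)"
 proof safe
  fix x assume "\<eta> (x + y) \<noteq> 0"
  then have "norm (x + y) \<le> R" using R not_less by blast
  then show "x \<in> cball 0 (R + norm y)" using norm_triangle_ineq4[of "x + y" y] by simp
 qed
 then have "bounded {x. \<eta> (x + y) \<noteq> 0}" using bounded_cball bounded_subset by blast
 then show ?thesis using assms C_k_shift by (auto simp: test_functions_def compact_closure)
qed

lemma pderiv_fun_test_shift:
 assumes "\<eta> \<in> test_functions"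
 shows "pderiv_fun i (\<lambda>x. \<eta> (x + y)) x = pderiv_fun i \<eta> (x + y)"
 by (rule pderiv_fun_shift(1)[OF test_functionsD(1)[OF assms]])

lemma compact_support_bounded:
 fixes f :: "real^2 \<Rightarrow> real"
 assumes "continuous_on UNIV f" "\<And>x. norm x > R \<Longrightarrow> f x = 0"
 shows "\<exists>B>0. \<forall>x. \<bar>f x\<bar> \<le> B * indicator (cball 0 R) x"
proof -
 have "compact (f ` cball 0 R)"
  by (intro compact_continuous_image continuous_on_subset[OF assms(1)]) auto
 then obtain B where "\<forall>y\<in>f ` cball 0 R. norm y \<le> B"
  using compact_imp_bounded[of "f ` cball 0 R"] unfolding bounded_iff by blast
 then have B: "\<bar>f x\<bar> \<le> B" if "x \<in> cball 0 R" for x using that by auto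
 have "\<bar>f x\<bar> \<le> max B 1 * indicator (cball 0 R) x" for x
  using B[of x] assms(2)[of x] by (auto split: split_indicator)
 then show ?thesis by (intro exI[of _ "max B 1"]) auto
qed

lemma test_functions_bound:
 assumes "\<eta> \<in> test_functions"
 shows "\<exists>B>0. \<exists>R>0. \<forall>x. \<bar>\<eta> x\<bar> \<le> B * indicator (cball 0 R) x \<and>
  (\<forall>i. \<bar>pderiv_fun i \<eta> x\<bar> \<le> B * indicator (cball 0 R) x)"
proof -
 obtain R where R: "R > 0" "\<And>x. norm x > R \<Longrightarrow> \<eta> x = 0" "\<And>x i. norm x > R \<Longrightarrow> pderiv_fun i \<eta> x = 0"
  using test_functionsD(5)[OF assms] by blast
 obtain B where B: "B > 0" "\<And>x. \<bar>\<eta> x\<bar> \<le> B * indicator (cball 0 R) x"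
  using compact_support_bounded[OF test_functionsD(2)[OF assms] R(2)] by auto
 obtain C where C: "\<And>i. C i > 0" "\<And>i x. \<bar>pderiv_fun i \<eta> x\<bar> \<le> C i * indicator (cball 0 R) x"
  using compact_support_bounded[OF test_functionsD(3)[OF assms] R(3)] by metis
 define M where "M = B + (\<Sum>i\<in>UNIV. C i)"
 have Ci: "C i \<le> (\<Sum>i\<in>UNIV. C i)" for i using C(1) by (intro member_le_sum) (auto intro: less_imp_le)
 have CM: "C i \<le> M" "B \<le> M" for i
  using Ci[of i] B(1) C(1)[of i] by (auto simp: M_def)
 have "\<bar>\<eta> x\<bar> \<le> M * indicator (cball 0 R) x" "\<bar>pderiv_fun i \<eta> x\<bar> \<le> M * indicator (cball 0 R) x" for x i
  using B(2)[of x] C(2)[of i x] CM by (auto split: split_indicator intro: order_trans)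
 moreover have "M > 0" using B CM(2) by linarith
 ultimately show ?thesis using R(1) by blast
qed

lemma integrable_indicator_cball [simp]: "L1 (indicator (cball (0::real^2) R) :: _ \<Rightarrow> real)"
 by (rule integrable_real_indicator) (use emeasure_bounded_finite[OF bounded_cball[of "0::real^2" R]] in auto)

lemma indicator_cball_measurable [measurable, simp]:
 "(indicator (cball (a::real^2) R) :: _ \<Rightarrow> real) \<in> borel_fun"
 by (rule borel_measurable_indicator) simp

lemma L2_of_bounded_support:
 assumes [measurable]: "f \<in> borel_fun" and B: "\<And>x. \<bar>f x\<bar> \<le> B * indicator (cball 0 R) x"
 shows "(\<lambda>x. complex_of_real (f x)) \<in> L2"
proof (rule L2_bound[where g="\<lambda>x. B\<^sup>2 * indicator (cball 0 R) x"])
 show "AE x in lborel. (norm (complex_of_real (f x)))\<^sup>2 \<le> B\<^sup>2 * indicator (cball 0 R) x"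
 proof (rule AE_I2)
  fix x
  have "(\<bar>f x\<bar>)\<^sup>2 \<le> (B * indicator (cball 0 R) x)\<^sup>2" using B by (rule power_mono) simp
  then show "(norm (complex_of_real (f x)))\<^sup>2 \<le> B\<^sup>2 * indicator (cball 0 R) x"
   by (auto split: split_indicator)
 qed
qed auto

lemma borel_continuous: "continuous_on UNIV (f :: real^2 \<Rightarrow> 'b::topological_space) \<Longrightarrow> f \<in> borel_fun"
 by (rule borel_measurable_continuous_onI)

lemma test_measurable:
 assumes "\<eta> \<in> test_functions"
 shows "\<eta> \<in> borel_fun" "pderiv_fun i \<eta> \<in> borel_fun"
 using test_functionsD(2,3)[OF assms] borel_continuous by blast+

lemma test_L2:
 assumes "\<eta> \<in> test_functions"
 shows "(\<lambda>x. complex_of_real (\<eta> x)) \<in> L2" "(\<lambda>x. complex_of_real (pderiv_fun i \<eta> x)) \<in> L2"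
proof -
 obtain B R where "\<And>x. \<bar>\<eta> x\<bar> \<le> B * indicator (cball 0 R) x"
  "\<And>x i. \<bar>pderiv_fun i \<eta> x\<bar> \<le> B * indicator (cball 0 R) x"
  using test_functions_bound[OF assms] by blast
 then show "(\<lambda>x. complex_of_real (\<eta> x)) \<in> L2" "(\<lambda>x. complex_of_real (pderiv_fun i \<eta> x)) \<in> L2"
  using L2_of_bounded_support[OF test_measurable(1)[OF assms]]
   L2_of_bounded_support[OF test_measurable(2)[OF assms]] by blast+
qed

section \<open>Integration by parts via averages along segments\<close>

lemma integrable_indicator_Icc [simp]: "L1 (indicator {a..b::real} :: _ \<Rightarrow> real)"
 by (rule integrable_real_indicator) (use emeasure_bounded_finite[OF bounded_closed_interval[of a b]] in auto)

text \<open>Fubini over the segment from x to x + y. All translates of \<open>b\<close> have the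
  same L^2 norm, which makes the double integrand integrable.\<close>

lemma pairing_Fubini:
 fixes y :: "real^2"
 assumes a: "a \<in> L2" and b: "b \<in> L2"
 shows "(LBINT x. a x * (LBINT s. indicator {0..1} s *\<^sub>R b (x + s *\<^sub>R y))) =
  (LBINT s. indicator {0..1} s *\<^sub>R (LBINT x. a x * b (x + s *\<^sub>R y)))"
proof -
 note [measurable] = L2_measurable[OF a] L2_measurable[OF b]
 let ?F = "\<lambda>s x. indicator {0..1::real} s *\<^sub>R (a x * b (x + s *\<^sub>R y))"
 have i: "integrable lborel2 (\<lambda>(s, x). ?F s x)"
 proof (rule lborel_pair.Fubini_integrable)
  show "AE s in lborel. L1 (\<lambda>x. case (s, x) of (s, x) \<Rightarrow> ?F s x)"
   using L2_mult_integrable[OF a L2_shift[OF b]] by simp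
  show "L1 (\<lambda>s. \<integral>x. norm (case (s, x) of (s, x) \<Rightarrow> ?F s x) \<partial>lborel)"
  proof (rule integrable_dominated[where f="\<lambda>s. indicator {0..1} s * (nrm a * nrm b)"])
   show "AE s in lborel. norm (LBINT x. norm (case (s, x) of (s, x) \<Rightarrow> ?F s x)) \<le> norm (indicator {0..1} s * (nrm a * nrm b))"
    using L2_norm_mult_le[OF a L2_shift[OF b]]
    by (intro AE_I2) (auto simp: nrm_shift norm_mult indicator_def)
  qed (simp, measurable)
 qed measurable
 have "(LBINT x. a x * (LBINT s. indicator {0..1} s *\<^sub>R b (x + s *\<^sub>R y))) = (LBINT x. (LBINT s. ?F s x))"
  by (simp flip: integral_mult_right_zero)
 also have "\<dots> = (LBINT s. (LBINT x. ?F s x))" by (rule lborel_pair.Fubini_integral[OF i])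
 finally show ?thesis by simp
qed

lemma FTC_line:
 fixes g :: "real^2 \<Rightarrow> real"
 assumes g: "\<And>x. (g has_derivative D x) (at x)" and c: "continuous_on UNIV (\<lambda>x. D x y)"
 shows "(LBINT s. indicator {0..1} s *\<^sub>R complex_of_real (D (x + s *\<^sub>R - y) y)) = of_real (g x - g (x - y))"
proof -
 have d: "((\<lambda>s. - g (x + s *\<^sub>R - y)) has_real_derivative D (x + s *\<^sub>R - y) y) (at s)" for s
 proof -
  have "((\<lambda>s. x + s *\<^sub>R - y) has_derivative (\<lambda>t. t *\<^sub>R - y)) (at s)" by (auto intro!: derivative_eq_intros)
  from has_derivative_minus[OF has_derivative_compose[OF this g]]
  have "((\<lambda>s. - g (x + s *\<^sub>R - y)) has_derivative (\<lambda>t. - D (x + s *\<^sub>R - y) (t *\<^sub>R - y))) (at s)" .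
  moreover have "- D z (t *\<^sub>R - y) = D z y * t" for z t
   using linear_cmul[OF has_derivative_linear[OF g], of z "-t" y] by simp
  ultimately show ?thesis by (simp add: has_field_derivative_def)
 qed
 have "continuous_on UNIV (\<lambda>s. D (x + s *\<^sub>R - y) y)"
  by (rule continuous_on_compose2[OF c]) (auto intro!: continuous_intros)
 then have "isCont (\<lambda>s. D (x + s *\<^sub>R - y) y) s" for s by (simp add: continuous_on_eq_continuous_at)
 from integral_FTC_Icc_real[OF zero_le_one d this]
 have "(LBINT s. indicator {0..1} s * D (x + s *\<^sub>R - y) y) = g x - g (x - y)" by (simp add: mult.commute)
 moreover have "(LBINT s. indicator {0..1} s *\<^sub>R complex_of_real (D (x + s *\<^sub>R - y) y)) =
   of_real (LBINT s. indicator {0..1} s * D (x + s *\<^sub>R - y) y)"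
  unfolding integral_complex_of_real[symmetric] by (simp add: scaleR_conv_of_real)
 ultimately show ?thesis by simp
qed

text \<open>The integral of g(x) - g(x - e) vanishes by translation invariance. The fundamental
  theorem along the segment turns it into an average over s of integrals of the shifted derivative,
  and these all have the same value.\<close>

lemma integral_derivative_eq_0:
 fixes g :: "real^2 \<Rightarrow> real"
 assumes g: "\<And>x. (g has_derivative D x) (at x)" and c: "continuous_on UNIV (\<lambda>x. D x (axis i 1))"
  and s: "\<And>x. norm x > R \<Longrightarrow> g x = 0"
 shows "(LBINT x. D x (axis i 1)) = 0"
proof -
 define e :: "real^2" where "e = axis i 1"
 have ne: "norm e = 1" by (simp add: e_def norm_axis_1)
 note c = c[folded e_def]
 have gc: "continuous_on UNIV g" using has_derivative_continuous[OF g] by (intro continuous_at_imp_continuous_on) auto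
 note [measurable] = borel_continuous[OF gc] borel_continuous[OF c]
 have z: "D x e = 0" if "norm x > R" for x
 proof -
  have "((\<lambda>x. 0) has_derivative (\<lambda>x. 0)) (at x)" by simp
  then have "(g has_derivative (\<lambda>x. 0)) (at x)"
  proof (rule has_derivative_transform_within_open)
   show "open (- cball (0::real^2) R)" by (simp add: open_Compl)
  qed (use that s in auto)
  from has_derivative_unique[OF g this] show ?thesis by simp
 qed
 obtain A where A: "\<And>x. \<bar>g x\<bar> \<le> A * indicator (cball 0 R) x" using compact_support_bounded[OF gc s] by blast
 obtain B where "\<And>x. \<bar>D x e\<bar> \<le> B * indicator (cball 0 R) x" using compact_support_bounded[OF c z] by blast
 from L2_of_bounded_support[OF _ this] have DL: "(\<lambda>x. complex_of_real (D x e)) \<in> L2" by simp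
 \<comment> \<open>The ball is enlarged by 1 to contain the supports of all shifts by s e with s in
   [0, 1]. Cutting off with it changes nothing and makes the left factor of the pairing
   square-integrable.\<close>
 define a where "a x = complex_of_real (indicator (cball 0 (R + 1)) x)" for x :: "real^2"
 have aL: "a \<in> L2" unfolding a_def by (rule L2_of_bounded_support[where B=1 and R="R + 1"]) auto
 have far: "norm (x + s *\<^sub>R - e) > R" if "norm x > R + 1" "s \<in> {0..1}" for x s
  using norm_triangle_ineq2[of x "s *\<^sub>R e"] that ne by simp
 have gi: "L1 g"
  by (rule integrable_dominated[of lborel "\<lambda>x. A * indicator (cball 0 R) x"])
    (auto intro!: AE_I2 order_trans[OF A])
 have "0 = complex_of_real (LBINT x. g x - g (x + - e))"
  using gi integrable_shift[OF gi, of "- e"] integral_shift[of g "- e"] by simp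
 also have "\<dots> = (LBINT x. a x * of_real (g x - g (x - e)))"
  unfolding integral_complex_of_real[symmetric]
  using s far[of _ 1] by (intro Bochner_Integration.integral_cong) (auto simp: a_def indicator_def not_le)
 also have "\<dots> = (LBINT s. indicator {0..1} s *\<^sub>R (LBINT x. a x * of_real (D (x + s *\<^sub>R - e) e)))"
  unfolding FTC_line[OF g c, symmetric] by (rule pairing_Fubini[OF aL DL])
 also have "\<dots> = (LBINT s. indicator {0..1::real} s *\<^sub>R complex_of_real (LBINT x. D x e))"
 proof (rule Bochner_Integration.integral_cong[OF refl])
  fix s :: real
  have "(LBINT x. a x * of_real (D (x + s *\<^sub>R - e) e)) = (LBINT x. of_real (D (x + s *\<^sub>R - e) e))" if "s \<in> {0..1}"
   using far[OF _ that] z by (intro Bochner_Integration.integral_cong) (auto simp: a_def indicator_def not_le)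
  moreover have "(LBINT x. D (x + s *\<^sub>R - e) e) = (LBINT x. D x e)"
   by (rule integral_shift[of "\<lambda>x. D x e"]) simp
  ultimately show "indicator {0..1} s *\<^sub>R (LBINT x. a x * of_real (D (x + s *\<^sub>R - e) e)) = indicator {0..1} s *\<^sub>R complex_of_real (LBINT x. D x e)"
   by (cases "s \<in> {0..1}") auto
 qed
 finally show ?thesis by (simp add: e_def)
qed

lemma weak_pderiv_smooth:
 assumes f: "f \<in> Sm" and \<eta>: "\<eta> \<in> test_functions"
 shows "(LBINT x. f x * pderiv_fun i \<eta> x) = - (LBINT x. pderiv_fun i f x * \<eta> x)"
  "L1 (\<lambda>x. f x * pderiv_fun i \<eta> x)" "L1 (\<lambda>x. pderiv_fun i f x * \<eta> x)"
proof -
 obtain D where D: "\<And>x. (f has_derivative D x) (at x)" using Sm_derivative[OF f] by metis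
 note E = test_functionsD(4)[OF \<eta>]
 obtain R where R: "\<And>x. norm x > R \<Longrightarrow> \<eta> x = 0" "\<And>x i. norm x > R \<Longrightarrow> pderiv_fun i \<eta> x = 0"
  using test_functionsD(5)[OF \<eta>] by blast
 have c: "continuous_on UNIV (\<lambda>x. f x * pderiv_fun i \<eta> x)" "continuous_on UNIV (\<lambda>x. pderiv_fun i f x * \<eta> x)"
  using Sm_continuous[OF f] Sm_continuous[OF Sm_pderiv(1)[OF f]] test_functionsD(2,3)[OF \<eta>]
  by (auto intro!: continuous_on_mult)
 have int: "L1 g" if g: "continuous_on UNIV g" "\<And>x. norm x > R \<Longrightarrow> g x = 0" for g :: "real^2 \<Rightarrow> real"
 proof -
  obtain B' where "\<And>x. \<bar>g x\<bar> \<le> B' * indicator (cball 0 R) x" using compact_support_bounded[OF g] by blast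
  then show ?thesis using borel_continuous[OF g(1)]
   by (intro integrable_dominated[of lborel "\<lambda>x. B' * indicator (cball 0 R) x" g])
     (auto intro: order_trans[OF _ abs_ge_self])
 qed
 show i: "L1 (\<lambda>x. f x * pderiv_fun i \<eta> x)" "L1 (\<lambda>x. pderiv_fun i f x * \<eta> x)"
  using c R by (auto intro!: int)
 have d: "((\<lambda>x. f x * \<eta> x) has_derivative (\<lambda>y. f x * frechet_derivative \<eta> (at x) y + D x y * \<eta> x)) (at x)" for x
  by (rule has_derivative_mult[OF D E])
 have eq: "(\<lambda>x. f x * frechet_derivative \<eta> (at x) (axis i 1) + D x (axis i 1) * \<eta> x)
   = (\<lambda>x. f x * pderiv_fun i \<eta> x + pderiv_fun i f x * \<eta> x)"
  by (simp add: pderiv_fun_def frechet_derivative_at[OF D, symmetric])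
 have "(LBINT x. f x * frechet_derivative \<eta> (at x) (axis i 1) + D x (axis i 1) * \<eta> x) = 0"
 proof (rule integral_derivative_eq_0[OF d, of i R])
  show "continuous_on UNIV (\<lambda>x. f x * frechet_derivative \<eta> (at x) (axis i 1) + D x (axis i 1) * \<eta> x)"
   unfolding eq using c by (rule continuous_on_add)
 qed (use R in auto)
 then show "(LBINT x. f x * pderiv_fun i \<eta> x) = - (LBINT x. pderiv_fun i f x * \<eta> x)"
  unfolding eq using i by simp
qed

lemma Sm_measurable: "f \<in> Sm \<Longrightarrow> f \<in> borel_fun"
 using Sm_continuous borel_continuous by blast

lemma Sm_has_weak_pderiv:
 assumes "f \<in> Sm"
 shows "has_weak_pderiv i (\<lambda>x. of_real (f x)) (\<lambda>x. of_real (pderiv_fun i f x))"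
 unfolding has_weak_pderiv_def
proof
 fix \<eta> assume "\<eta> \<in> test_functions"
 from weak_pderiv_smooth(1)[OF assms this, of i]
 have "complex_of_real (LBINT x. f x * pderiv_fun i \<eta> x) = of_real (- (LBINT x. pderiv_fun i f x * \<eta> x))"
  by (rule arg_cong)
 then show "(LBINT x. complex_of_real (f x) * of_real (pderiv_fun i \<eta> x)) =
   - (LBINT x. complex_of_real (pderiv_fun i f x) * of_real (\<eta> x))"
  by (simp flip: of_real_mult)
qed

lemma Sm_W12:
 assumes "f \<in> Sm" "(\<lambda>x. of_real (f x)) \<in> L2" "\<And>i. (\<lambda>x. of_real (pderiv_fun i f x)) \<in> L2"
 shows "(\<lambda>x. of_real (f x)) \<in> W12"
 using assms Sm_has_weak_pderiv[OF assms(1)] by (auto simp: W12_def)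

text \<open>A smooth cutoff supported in the square |x_i| \<le> 1/c. Each of the four factors equals
  exp(-1) at the origin, so \<open>exp 4\<close> normalises the value there to 1.\<close>

definition bump :: "real \<Rightarrow> real^2 \<Rightarrow> real" where
 "bump c x = exp 4 * ((flat 0 (1 + c * x $ 1) * flat 0 (1 + - c * x $ 1)) *
            (flat 0 (1 + c * x $ 2) * flat 0 (1 + - c * x $ 2)))"

lemma bump_Sm: "bump c \<in> Sm"
 unfolding bump_def[abs_def] by (intro Sm.const Sm.coord Sm.mult Sm.add Sm.flat)

lemma bump_bounds: "0 \<le> bump c x" "bump c x \<le> exp 4"
proof -
 have "a * b \<le> 1" if "0 \<le> a" "a \<le> 1" "0 \<le> b" "b \<le> (1::real)" for a b using mult_le_one that by blast
 then show "0 \<le> bump c x" "bump c x \<le> exp 4"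
  by (simp_all add: bump_def flat_nonneg flat0_le_1)
qed

lemma bump_zero:
 assumes "c > 0" "norm x > 2 / c" shows "bump c x = 0"
proof (rule ccontr)
 assume nz: "bump c x \<noteq> 0"
 have l: "\<bar>x $ j\<bar> < 1 / c" if "flat 0 (1 + c * x $ j) \<noteq> 0" "flat 0 (1 + - c * x $ j) \<noteq> 0" for j
  using that \<open>c > 0\<close> by (auto simp: flat_def not_le field_simps abs_if split: if_splits)
 have "\<bar>x $ 1\<bar> < 1 / c" "\<bar>x $ 2\<bar> < 1 / c" using nz l[of 1] l[of 2] by (auto simp: bump_def)
 then have "norm x \<le> 1/c + 1/c"
  using norm_le_l1_cart[of x] by (simp add: sum_2)
 then show False using assms by simp
qed

lemma bump_test: "c > 0 \<Longrightarrow> bump c \<in> test_functions"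
 by (rule test_functionsI[OF bump_Sm bump_zero])

lemma bump_0: "bump c 0 = 1"
 by (simp add: bump_def flat_def flip: exp_add)

lemma bump_dilation: "bump c x = bump 1 (c *\<^sub>R x)"
 by (simp add: bump_def)

lemma bump_tendsto: "(\<lambda>n. bump (1 / real (Suc n)) x) ----> 1"
proof -
 have "isCont (bump 1) 0" using Sm_continuous[OF bump_Sm, of UNIV 1]
  by (simp add: continuous_on_eq_continuous_at)
 moreover have "(\<lambda>n. (1 / real (Suc n)) *\<^sub>R x) ----> 0"
  using tendsto_scaleR[OF LIMSEQ_inverse_real_of_nat tendsto_const[of x]] by (simp add: inverse_eq_divide)
 ultimately have "(\<lambda>n. bump 1 ((1 / real (Suc n)) *\<^sub>R x)) ----> bump 1 0"
  by (rule isCont_tendsto_compose)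
 then show ?thesis by (simp add: bump_0 flip: bump_dilation)
qed

lemma pderiv_bump: "pderiv_fun i (bump c) x = c * pderiv_fun i (bump 1) (c *\<^sub>R x)"
proof -
 obtain D where D: "\<And>x. (bump 1 has_derivative D x) (at x)" using Sm_derivative[OF bump_Sm] by metis
 have "((\<lambda>x. c *\<^sub>R x) has_derivative (\<lambda>y. c *\<^sub>R y)) (at x)" by (auto intro!: derivative_eq_intros)
 from has_derivative_compose[OF this D] have "(bump c has_derivative (\<lambda>y. D (c *\<^sub>R x) (c *\<^sub>R y))) (at x)"
  by (simp flip: bump_dilation)
 from pderiv_fun_eq[OF this] have "pderiv_fun i (bump c) x = D (c *\<^sub>R x) (c *\<^sub>R axis i 1)" .
 also have "\<dots> = c * D (c *\<^sub>R x) (axis i 1)"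
  using linear_cmul[OF bounded_linear.linear[OF has_derivative_bounded_linear[OF D]]] by simp
 finally show ?thesis by (simp add: pderiv_fun_eq[OF D])
qed

lemma pderiv_fun_mult:
 assumes "f differentiable (at x)" "g differentiable (at x)"
 shows "pderiv_fun i (\<lambda>x. f x * g x) x = f x * pderiv_fun i g x + pderiv_fun i f x * g x"
 using pderiv_fun_eq[OF has_derivative_mult[OF assms[unfolded frechet_derivative_works]]]
 by (simp add: pderiv_fun_def)

lemma bounded_multiplier_limit:
 fixes h :: "nat \<Rightarrow> real^2 \<Rightarrow> real"
 assumes a: "a \<in> L2" and b: "b \<in> L2" and h: "\<And>n. h n \<in> borel_fun"
  and M: "\<And>n x. \<bar>h n x\<bar> \<le> M" and l: "\<And>x. (\<lambda>n. h n x) ----> l"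
 shows "(\<lambda>n. \<integral>x. a x * (of_real (h n x) * b x) \<partial>lborel) ----> (LBINT x. a x * (of_real l * b x))"
  "L1 (\<lambda>x. a x * (of_real (h n x) * b x))"
proof -
 note [measurable] = L2_measurable[OF a] L2_measurable[OF b] h
 have "norm (a x * (of_real (h n x) * b x)) \<le> M * (norm (a x) * norm (b x))" for n x
  using mult_right_mono[OF M[of n x], of "norm (a x) * norm (b x)"] by (simp add: norm_mult ac_simps)
 then have 1: "AE x in lborel. norm (a x * (of_real (h n x) * b x)) \<le> M * (norm (a x) * norm (b x))" for n by simp
 have 2: "AE x in lborel. (\<lambda>n. a x * (of_real (h n x) * b x)) ----> a x * (of_real l * b x)"
  by (intro AE_I2 tendsto_intros l)
 have 3: "L1 (\<lambda>x. M * (norm (a x) * norm (b x)))" using L2_norm_mult_integrable[OF a b] by simp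
 show "(\<lambda>n. \<integral>x. a x * (of_real (h n x) * b x) \<partial>lborel) ----> (LBINT x. a x * (of_real l * b x))"
  by (rule integral_dominated_convergence[OF _ _ 3 2 1]) measurable
 show "L1 (\<lambda>x. a x * (of_real (h n x) * b x))"
  by (rule integrable_dominated_convergence2[OF _ _ 3 2 1]) measurable
qed

text \<open>Integration by parts against smooth functions that are merely square integrable,
 by cutting off with \<^const>\<open>bump\<close>.\<close>

lemma weak_pderiv_Sm:
 assumes \<phi>: "\<phi> \<in> L2" and g: "g \<in> L2" "has_weak_pderiv i \<phi> g"
  and f: "f \<in> Sm" and fL: "(\<lambda>x. complex_of_real (f x)) \<in> L2" "(\<lambda>x. complex_of_real (pderiv_fun i f x)) \<in> L2"
 shows "(LBINT x. \<phi> x * of_real (pderiv_fun i f x)) = - (LBINT x. g x * of_real (f x))"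
proof -
 define c where "c n = 1 / real (Suc n)" for n
 have c: "c n > 0" "c n \<le> 1" for n by (auto simp: c_def)
 have cl: "c ----> 0" unfolding c_def using LIMSEQ_inverse_real_of_nat by (simp add: inverse_eq_divide)
 obtain B R where BR: "B > 0" "\<And>x. \<bar>pderiv_fun i (bump 1) x\<bar> \<le> B * indicator (cball 0 R) x"
  using test_functions_bound[OF bump_test[of 1]] by auto
 have B: "\<bar>pderiv_fun i (bump 1) x\<bar> \<le> B" for x
  by (rule order_trans[OF BR(2)]) (use BR(1) in \<open>auto split: split_indicator\<close>)
 note m = Sm_measurable[OF bump_Sm] Sm_measurable[OF Sm_pderiv(1)[OF bump_Sm]]
 let ?f = "\<lambda>x. complex_of_real (f x)" and ?d = "\<lambda>x. complex_of_real (pderiv_fun i f x)"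
  and ?h = "\<lambda>n x. c n * pderiv_fun i (bump 1) (c n *\<^sub>R x)"
 have b: "\<bar>bump (c n) x\<bar> \<le> exp 4" "(\<lambda>n. bump (c n) x) ----> 1" for n x
  using bump_bounds[of "c n" x] bump_tendsto[of x] by (auto simp: c_def)
 have hb: "\<bar>?h n x\<bar> \<le> c n * B" for n x
  using B c(1)[of n] by (auto simp: abs_mult intro!: mult_left_mono)
 have hl: "(\<lambda>n. ?h n x) ----> 0" for x
  by (rule Lim_null_comparison[OF always_eventually tendsto_mult_left_zero[OF cl, of B]]) (use hb in auto)
 have hB: "\<bar>?h n x\<bar> \<le> B" for n x
  using mult_mono[OF c(2)[of n] B[of "c n *\<^sub>R x"]] c(1)[of n] by (simp add: abs_mult)
 note 1 = bounded_multiplier_limit[where h = "\<lambda>n. bump (c n)" and a = \<phi> and b = "?d", OF \<phi> fL(2) m(1) b]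
 note 2 = bounded_multiplier_limit[where h = "?h" and a = \<phi> and b = "?f", OF \<phi> fL(1) _ hB hl]
 note 3 = bounded_multiplier_limit[where h = "\<lambda>n. bump (c n)" and a = g and b = "?f", OF g(1) fL(1) m(1) b]
 have hm: "?h n \<in> borel_fun" for n by (intro borel_measurable_times borel_measurable_const measurable_compose[OF _ m(2)]) simp
 \<comment> \<open>Weak derivative tested against the compactly supported product; the derivative of
   the cutoff carries the factor \<open>c n\<close>, which tends to 0.\<close>
 have e: "(LBINT x. \<phi> x * (of_real (bump (c n) x) * ?d x)) + (LBINT x. \<phi> x * (of_real (?h n x) * ?f x))
   = - (LBINT x. g x * (of_real (bump (c n) x) * ?f x))" for n
 proof -
  have pd: "pderiv_fun i (\<lambda>x. bump (c n) x * f x) x = bump (c n) x * pderiv_fun i f x + ?h n x * f x" for x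
   using pderiv_fun_mult[OF Sm_pderiv(2)[OF bump_Sm] Sm_pderiv(2)[OF f]] pderiv_bump[of i "c n"] by simp
  have T: "(\<lambda>x. bump (c n) x * f x) \<in> test_functions"
   by (rule test_functionsI[of _ "2 / c n"]) (use f c bump_zero bump_Sm in \<open>auto intro!: Sm.mult\<close>)
  have "(LBINT x. \<phi> x * (of_real (bump (c n) x) * ?d x)) + (LBINT x. \<phi> x * (of_real (?h n x) * ?f x)) =
    (LBINT x. \<phi> x * of_real (pderiv_fun i (\<lambda>x. bump (c n) x * f x) x))"
   unfolding pd by (subst Bochner_Integration.integral_add[OF 1(2) 2(2)[OF hm], symmetric]) (simp add: distrib_left mult.assoc)
  also have "\<dots> = - (LBINT x. g x * of_real (bump (c n) x * f x))"
   using g(2) T unfolding has_weak_pderiv_def by blast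
  finally show ?thesis by simp
 qed
 from tendsto_add[OF 1(1) 2(1)[OF hm]]
 have "(\<lambda>n. - (LBINT x. g x * (of_real (bump (c n) x) * ?f x))) ----> (LBINT x. \<phi> x * ?d x)"
  unfolding e by simp
 from LIMSEQ_unique[OF this tendsto_minus[OF 3(1)]] show ?thesis by simp
qed

subsection \<open>The fundamental lemma of the calculus of variations\<close>

lemma flat_scaled_tendsto: "(\<lambda>n. flat 0 (real (Suc n) * t)) ----> indicator {0<..} t"
proof (cases "t > 0")
 case True
 have "(\<lambda>n. exp (- (inverse (real (Suc n)) * inverse t))) ----> exp (- (0 * inverse t))"
  by (intro tendsto_intros LIMSEQ_inverse_real_of_nat)
 moreover have "flat 0 (real (Suc n) * t) = exp (- (inverse (real (Suc n)) * inverse t))" for n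
 proof -
  have "real (Suc n) * t > 0" using True by simp
  then show ?thesis by (simp add: flat_def not_le[symmetric])
 qed
 ultimately show ?thesis using True by simp
next
 case False
 then have "flat 0 (real (Suc n) * t) = 0" for n
  by (simp add: flat_def mult_nonneg_nonpos)
 then show ?thesis using False by simp
qed

text \<open>\<open>flat 0 (n t)\<close> tends to the indicator of t > 0. Products of four such
  factors are test functions that vanish outside the box and converge boundedly to its
  indicator.\<close>

lemma fundamental_box:
 assumes v: "v \<in> L2" and z: "\<And>\<eta>. \<eta> \<in> test_functions \<Longrightarrow> (LBINT x. v x * of_real (\<eta> x)) = 0"
 shows "(LBINT x. v x * of_real (indicator (box a b) x)) = 0"
proof -
 define \<rho> :: "nat \<Rightarrow> real^2 \<Rightarrow> real" where "\<rho> = (\<lambda>n x. (flat 0 (real (Suc n) * (x $ 1 - a $ 1)) * flat 0 (real (Suc n) * (b $ 1 - x $ 1))) *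
   (flat 0 (real (Suc n) * (x $ 2 - a $ 2)) * flat 0 (real (Suc n) * (b $ 2 - x $ 2))))"
 have \<rho>S: "\<rho> n \<in> Sm" for n unfolding \<rho>_def
  by (intro Sm.const Sm.coord Sm.mult Sm_diff Sm.flat)
 obtain R where R: "\<And>x. x \<in> box a b \<Longrightarrow> norm x \<le> R" using bounded_box[of a b] by (auto simp: bounded_iff)
 have nz: "x \<in> box a b" if "\<rho> n x \<noteq> 0" for n x
  using that by (auto simp: \<rho>_def flat_def mem_box_cart forall_2 not_le zero_less_mult_iff split: if_splits)
 have \<rho>b: "\<bar>\<rho> n x\<bar> \<le> 1 * indicator (cball 0 R) x" for n x
 proof (cases "\<rho> n x = 0")
  case False
  have "a * b \<le> 1" if "0 \<le> a" "a \<le> 1" "0 \<le> b" "b \<le> (1::real)" for a b using mult_le_one that by blast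
  then have "0 \<le> \<rho> n x \<and> \<rho> n x \<le> 1"
   by (simp_all add: \<rho>_def flat_nonneg flat0_le_1)
  then show ?thesis using R[OF nz[OF False]] by simp
 qed simp
 have t: "\<rho> n \<in> test_functions" for n
  by (rule test_functionsI[OF \<rho>S, of R]) (use nz R in \<open>force\<close>)
 note [measurable] = L2_measurable[OF v] Sm_measurable[OF \<rho>S]
 have "(\<lambda>n. \<integral>x. v x * of_real (\<rho> n x) \<partial>lborel) ----> (LBINT x. v x * of_real (indicator (box a b) x))"
 proof (rule integral_dominated_convergence[where w="\<lambda>x. norm (indicator (cball 0 R) x *\<^sub>R v x)"])
  show "AE x in lborel. (\<lambda>n. v x * of_real (\<rho> n x)) ----> v x * of_real (indicator (box a b) x)"
  proof (intro AE_I2 tendsto_intros)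
   fix x
   have "(\<lambda>n. \<rho> n x) ----> (indicator {0<..} (x $ 1 - a $ 1) * indicator {0<..} (b $ 1 - x $ 1)) *
     (indicator {0<..} (x $ 2 - a $ 2) * indicator {0<..} (b $ 2 - x $ 2))"
    unfolding \<rho>_def by (intro tendsto_mult flat_scaled_tendsto)
   moreover have "(indicator {0<..} (x $ 1 - a $ 1) * indicator {0<..} (b $ 1 - x $ 1)) *
     (indicator {0<..} (x $ 2 - a $ 2) * indicator {0<..} (b $ 2 - x $ 2)) = (indicator (box a b) x :: real)"
    by (auto simp: mem_box_cart forall_2 split: split_indicator)
   ultimately show "(\<lambda>n. \<rho> n x) ----> indicator (box a b) x" by simp
  qed
  show "AE x in lborel. norm (v x * of_real (\<rho> n x)) \<le> norm (indicator (cball 0 R) x *\<^sub>R v x)" for n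
  proof (rule AE_I2)
   fix x
   show "norm (v x * of_real (\<rho> n x)) \<le> norm (indicator (cball 0 R) x *\<^sub>R v x)"
    using mult_left_mono[OF \<rho>b[of n x], of "norm (v x)"] by (simp add: norm_mult ac_simps)
  qed
  have "(\<lambda>x. complex_of_real (indicator (cball 0 R) x)) \<in> L2"
   by (rule L2_of_bounded_support[where B=1 and R=R]) auto
  from L2_mult_integrable[OF this v] show "L1 (\<lambda>x. norm (indicator (cball 0 R) x *\<^sub>R v x))"
   by (simp add: scaleR_conv_of_real)
 qed auto
 with z[OF t] show ?thesis using LIMSEQ_unique[of "\<lambda>n. 0::complex"] by simp
qed

text \<open>Boxes generate the Borel sets and are stable under intersection, so the integrals of v
  vanish over all Borel subsets of a large box, on which v is integrable. This forces v = 0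
  there.\<close>

lemma fundamental_lemma:
 assumes v: "v \<in> L2" and z: "\<And>\<eta>. \<eta> \<in> test_functions \<Longrightarrow> (LBINT x. v x * of_real (\<eta> x)) = 0"
 shows "AE x in lborel. v x = 0"
proof -
 note [measurable] = L2_measurable[OF v]
 define Q :: "nat \<Rightarrow> (real^2) set" where "Q = (\<lambda>n. box (\<chi> i. - real n) (\<chi> i. real n))"
 define w where "w = (\<lambda>n x. indicator (Q n) x *\<^sub>R v x)"
 have [measurable]: "Q n \<in> sets borel" for n by (simp add: Q_def)
 have wi: "L1 (w n)" for n
 proof -
  obtain R where R: "\<And>x. x \<in> Q n \<Longrightarrow> norm x \<le> R" using bounded_box unfolding Q_def by (metis bounded_iff)
  have "(\<lambda>x. complex_of_real (indicator (Q n) x)) \<in> L2"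
   by (rule L2_of_bounded_support[where B=1 and R=R]) (use R in \<open>auto split: split_indicator\<close>)
  from L2_mult_integrable[OF v this] show ?thesis by (simp add: w_def scaleR_conv_of_real mult.commute)
 qed
 have P: "(LBINT x. indicator A x *\<^sub>R w n x) = 0" if "A \<in> sets borel" for A n
 proof -
  define G where "G = range (\<lambda>(a, b::real^2). box a b)"
  have "Int_stable G" unfolding G_def by (auto simp: Int_stable_def box_Int_box)
  moreover have "G \<subseteq> Pow UNIV" by auto
  moreover have "A \<in> sigma_sets UNIV G" using that by (simp add: borel_eq_box G_def)
  ultimately show ?thesis
  proof (induction rule: sigma_sets_induct_disjoint)
   case (basic A)
   then obtain a b where "A = box a b" by (auto simp: G_def)
   moreover obtain c d where "A \<inter> Q n = box c d" using box_Int_box unfolding \<open>A = box a b\<close> Q_def by blast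
   moreover have "indicator A x *\<^sub>R w n x = v x * of_real (indicator (A \<inter> Q n) x)" for x
    by (auto simp: w_def split: split_indicator)
   ultimately show ?case using fundamental_box[OF v z] by simp
  next
   case empty then show ?case by simp
  next
   case (compl A)
   then have [measurable]: "A \<in> sets borel" by (simp add: borel_eq_box G_def)
   have 0: "(LBINT x. w n x) = 0"
    using fundamental_box[OF v z, where a="\<chi> i. - real n" and b="\<chi> i. real n"] by (simp add: w_def Q_def scaleR_conv_of_real mult.commute)
   have "(LBINT x. indicator (UNIV - A) x *\<^sub>R w n x) = (LBINT x. w n x - indicator A x *\<^sub>R w n x)"
    by (intro Bochner_Integration.integral_cong) (auto split: split_indicator)
   also have "\<dots> = 0" using integrable_mult_indicator[OF _ wi, of A] wi 0 compl by simp
   finally show ?case .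
  next
   case (union A)
   then have [measurable]: "A i \<in> sets borel" for i by (auto simp: borel_eq_box G_def)
   have si: "set_integrable lborel (\<Union>i. A i) (w n)"
    using integrable_mult_indicator[OF _ wi, of "\<Union>i. A i"] by (simp add: set_integrable_def)
   have "set_lebesgue_integral lborel (\<Union>i. A i) (w n) = (\<Sum>i. set_lebesgue_integral lborel (A i) (w n))"
    by (rule lebesgue_integral_countable_add) (use union si in \<open>auto simp: disjoint_family_on_def\<close>)
   then show ?case using union by (simp add: set_lebesgue_integral_def)
  qed
 qed
 have "AE x in lborel. w n x = 0" for n
  by (rule sigma_finite_measure.density_unique_banach[OF sigma_finite_lborel wi, of "\<lambda>x. 0"]) (use P in \<open>auto simp: set_lebesgue_integral_def\<close>)
 then have "AE x in lborel. \<forall>n. w n x = 0" by (simp add: AE_all_countable)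
 moreover have "v x = 0" if "\<forall>n. w n x = 0" for x
 proof -
  obtain N where N: "real N > norm x" using reals_Archimedean2 by blast
  have "x \<in> Q N" unfolding Q_def mem_box_cart
   using component_le_norm_cart[of x] N by (auto simp: abs_le_iff intro: le_less_trans dest!: spec)
    (smt (verit) component_le_norm_cart)+
  then show ?thesis using that[rule_format, of N] by (simp add: w_def)
 qed
 ultimately show ?thesis by (auto elim!: eventually_mono)
qed

section \<open>The Sobolev space\<close>

lemma W12_D:
 assumes "u \<in> W12"
 shows W12_L2: "u \<in> L2" and weak_pderiv_L2: "weak_pderiv i u \<in> L2"
  and weak_pderiv_has: "has_weak_pderiv i u (weak_pderiv i u)"
proof -
 show "u \<in> L2" using assms by (auto simp: W12_def)
 have "\<exists>g. g \<in> L2 \<and> has_weak_pderiv i u g" using assms by (auto simp: W12_def)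
 from someI_ex[OF this] show "weak_pderiv i u \<in> L2" "has_weak_pderiv i u (weak_pderiv i u)"
  by (auto simp: weak_pderiv_def)
qed

lemma W12I:
 assumes "u \<in> L2" "\<And>i. g i \<in> L2" "\<And>i. has_weak_pderiv i u (g i)"
 shows "u \<in> W12"
 using assms by (auto simp: W12_def)

lemma weak_pderiv_unique:
 assumes "g \<in> L2" "h \<in> L2" "has_weak_pderiv i u g" "has_weak_pderiv i u h"
 shows "AE x in lborel. g x = h x"
proof -
 have "AE x in lborel. g x - h x = 0"
 proof (rule fundamental_lemma[OF L2_diff[OF assms(1,2)]])
  fix \<eta> assume t: "\<eta> \<in> test_functions"
  have "(LBINT x. g x * of_real (\<eta> x)) = (LBINT x. h x * of_real (\<eta> x))"
   using assms(3)[unfolded has_weak_pderiv_def, rule_format, OF t]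
    assms(4)[unfolded has_weak_pderiv_def, rule_format, OF t] by simp
  then show "(LBINT x. (g x - h x) * of_real (\<eta> x)) = 0"
   using L2_mult_integrable[OF assms(1) test_L2(1)[OF t]] L2_mult_integrable[OF assms(2) test_L2(1)[OF t]]
   by (simp add: left_diff_distrib)
 qed
 then show ?thesis by simp
qed

lemma has_weak_pderiv_add:
 assumes "u \<in> L2" "v \<in> L2" "g \<in> L2" "h \<in> L2" "has_weak_pderiv i u g" "has_weak_pderiv i v h"
 shows "has_weak_pderiv i (\<lambda>x. u x + v x) (\<lambda>x. g x + h x)"
 unfolding has_weak_pderiv_def
proof
 fix \<eta> assume t: "\<eta> \<in> test_functions"
 have "(LBINT x. u x * of_real (pderiv_fun i \<eta> x)) = - (LBINT x. g x * of_real (\<eta> x))"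
  "(LBINT x. v x * of_real (pderiv_fun i \<eta> x)) = - (LBINT x. h x * of_real (\<eta> x))"
  using assms t by (auto simp: has_weak_pderiv_def)
 then show "(LBINT x. (u x + v x) * of_real (pderiv_fun i \<eta> x)) = - (LBINT x. (g x + h x) * of_real (\<eta> x))"
  using L2_mult_integrable[OF _ test_L2(2)[OF t]] L2_mult_integrable[OF _ test_L2(1)[OF t]] assms
  by (simp add: distrib_right)
qed

lemma has_weak_pderiv_cmult:
 assumes "has_weak_pderiv i u g"
 shows "has_weak_pderiv i (\<lambda>x. c * u x) (\<lambda>x. c * g x)"
 using assms by (auto simp: has_weak_pderiv_def mult.assoc)

lemma W12_add:
 assumes "u \<in> W12" "v \<in> W12" shows "(\<lambda>x. u x + v x) \<in> W12"
 by (rule W12I[where g="\<lambda>i x. weak_pderiv i u x + weak_pderiv i v x"])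
   (use W12_D[OF assms(1)] W12_D[OF assms(2)] in \<open>auto intro: L2_add has_weak_pderiv_add\<close>)

lemma W12_cmult:
 assumes "u \<in> W12" shows "(\<lambda>x. c * u x) \<in> W12"
 by (rule W12I[where g="\<lambda>i x. c * weak_pderiv i u x"])
   (use W12_D[OF assms] in \<open>auto intro: L2_cmult has_weak_pderiv_cmult\<close>)

lemma W12_diff:
 assumes "u \<in> W12" "v \<in> W12" shows "(\<lambda>x. u x - v x) \<in> W12"
 using W12_add[OF assms(1) W12_cmult[OF assms(2), of "-1"]] by simp

lemma W12_zero [simp]: "(\<lambda>x. 0) \<in> W12"
 by (rule W12I[where g="\<lambda>i x. 0"]) (auto simp: has_weak_pderiv_def)

lemma L2_ip_cong_AE:
 assumes "AE x in lborel. u x = u' x" "AE x in lborel. v x = v' x"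
  "u \<in> L2" "u' \<in> L2" "v \<in> L2" "v' \<in> L2"
 shows "L2_ip u v = L2_ip u' v'"
 unfolding L2_ip_def
proof (rule integral_cong_AE)
 show "AE x in lborel. cnj (u x) * v x = cnj (u' x) * v' x"
  using assms(1,2) by eventually_elim simp
qed (use assms(3-6) L2_measurable in \<open>auto intro!: borel_measurable_times borel_measurable_cnj\<close>)

text \<open>Removes the choice operator: weak derivatives are unique almost everywhere, so the form
  may be computed from any square-integrable ones.\<close>

lemma grad_ip_eq:
 assumes u: "u \<in> W12" and v: "v \<in> W12" and g: "\<And>i. g i \<in> L2" "\<And>i. has_weak_pderiv i u (g i)"
  and h: "\<And>i. h i \<in> L2" "\<And>i. has_weak_pderiv i v (h i)"
 shows "grad_ip u v = (\<Sum>i\<in>UNIV. L2_ip (g i) (h i))"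
 unfolding grad_ip_def
proof (rule sum.cong)
 fix i
 show "L2_ip (weak_pderiv i u) (weak_pderiv i v) = L2_ip (g i) (h i)"
  using weak_pderiv_unique[OF weak_pderiv_L2[OF u] g(1) weak_pderiv_has[OF u] g(2), of i]
   weak_pderiv_unique[OF weak_pderiv_L2[OF v] h(1) weak_pderiv_has[OF v] h(2), of i]
  by (rule L2_ip_cong_AE) (use u v g h W12_D in auto)
qed simp

lemma grad_ip_add_right:
 assumes "u \<in> W12" "v \<in> W12" "w \<in> W12"
 shows "grad_ip u (\<lambda>x. v x + w x) = grad_ip u v + grad_ip u w"
proof -
 note U = W12_D[OF assms(1)] and V = W12_D[OF assms(2)] and W = W12_D[OF assms(3)]
 have "grad_ip u (\<lambda>x. v x + w x) =
   (\<Sum>i\<in>UNIV. L2_ip (weak_pderiv i u) (\<lambda>x. weak_pderiv i v x + weak_pderiv i w x))"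
  by (rule grad_ip_eq) (use assms U V W in \<open>auto intro: W12_add L2_add has_weak_pderiv_add\<close>)
 then show ?thesis using U V W by (simp add: L2_ip_add_right grad_ip_def sum.distrib)
qed

lemma grad_ip_cmult_right:
 assumes "u \<in> W12" "v \<in> W12"
 shows "grad_ip u (\<lambda>x. c * v x) = c * grad_ip u v"
proof -
 note U = W12_D[OF assms(1)] and V = W12_D[OF assms(2)]
 have "grad_ip u (\<lambda>x. c * v x) =
   (\<Sum>i\<in>UNIV. L2_ip (weak_pderiv i u) (\<lambda>x. c * weak_pderiv i v x))"
  by (rule grad_ip_eq) (use assms U V in \<open>auto intro: W12_cmult L2_cmult has_weak_pderiv_cmult\<close>)
 then show ?thesis by (simp add: L2_ip_cmult_right grad_ip_def sum_distrib_left)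
qed

lemma grad_ip_commute: "grad_ip v u = cnj (grad_ip u v)"
 by (simp add: grad_ip_def L2_ip_commute[of "weak_pderiv i v" "weak_pderiv i u" for i])

text \<open>The square of \<open>grad_norm\<close>, in the quadratic form to which expansions and
  the parallelogram law apply.\<close>

definition gmass :: "wfun \<Rightarrow> real" where "gmass u = Re (grad_ip u u)"

lemma gmass_eq_sum:
 assumes "u \<in> W12" shows "gmass u = (\<Sum>i\<in>UNIV. mass (weak_pderiv i u))"
 using weak_pderiv_L2[OF assms] by (simp add: gmass_def grad_ip_def L2_ip_self)

lemma grad_ip_self:
 assumes "u \<in> W12" shows "grad_ip u u = of_real (gmass u)"
 using weak_pderiv_L2[OF assms] by (simp add: gmass_eq_sum[OF assms] grad_ip_def L2_ip_self)

lemma gmass_nonneg: "u \<in> W12 \<Longrightarrow> 0 \<le> gmass u"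
 by (simp add: gmass_eq_sum sum_nonneg)

lemma grad_norm_eq: "grad_norm u = sqrt (gmass u)"
 by (simp add: grad_norm_def gmass_def)

lemma gmass_add:
 assumes "u \<in> W12" "v \<in> W12"
 shows "gmass (\<lambda>x. u x + v x) = gmass u + 2 * Re (grad_ip u v) + gmass v"
proof -
 let ?w = "\<lambda>x. u x + v x"
 note w = W12_add[OF assms]
 have "grad_ip ?w ?w = grad_ip ?w u + grad_ip ?w v" using assms w by (rule_tac grad_ip_add_right)
 also have "grad_ip ?w u = cnj (grad_ip u ?w)" by (rule grad_ip_commute)
 also have "grad_ip ?w v = cnj (grad_ip v ?w)" by (rule grad_ip_commute)
 also have "grad_ip u ?w = grad_ip u u + grad_ip u v" using assms by (rule_tac grad_ip_add_right)
 also have "grad_ip v ?w = grad_ip v u + grad_ip v v" using assms by (rule_tac grad_ip_add_right)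
 also have "grad_ip v u = cnj (grad_ip u v)" by (rule grad_ip_commute)
 finally show ?thesis by (simp add: gmass_def)
qed

lemma gmass_cmult:
 assumes "u \<in> W12" shows "gmass (\<lambda>x. c * u x) = (norm c)\<^sup>2 * gmass u"
proof -
 have "grad_ip (\<lambda>x. c * u x) (\<lambda>x. c * u x) = c * cnj (grad_ip u (\<lambda>x. c * u x))"
  using grad_ip_cmult_right[OF W12_cmult[OF assms] assms, of c c] grad_ip_commute[of "\<lambda>x. c * u x" u] by simp
 also have "\<dots> = (c * cnj c) * grad_ip u u"
  using grad_ip_cmult_right[OF assms assms, of c] grad_ip_self[OF assms] by simp
 also have "\<dots> = of_real ((norm c)\<^sup>2 * gmass u)"
  by (simp add: grad_ip_self[OF assms] complex_norm_square[symmetric])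
 finally show ?thesis by (simp add: gmass_def)
qed

lemma gmass_diff:
 assumes "u \<in> W12" "v \<in> W12"
 shows "gmass (\<lambda>x. u x - v x) = gmass u - 2 * Re (grad_ip u v) + gmass v"
 using gmass_add[OF assms(1) W12_cmult[OF assms(2), of "-1"]] grad_ip_cmult_right[OF assms, of "-1"]
  gmass_cmult[OF assms(2), of "-1"] by simp

lemma gmass_parallelogram:
 assumes "u \<in> W12" "v \<in> W12"
 shows "gmass (\<lambda>x. u x - v x) = 2 * gmass u + 2 * gmass v - gmass (\<lambda>x. u x + v x)"
 using gmass_add[OF assms] gmass_diff[OF assms] by simp

lemma gmass_add_le:
 assumes "u \<in> W12" "v \<in> W12"
 shows "gmass (\<lambda>x. u x + v x) \<le> 2 * gmass u + 2 * gmass v"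
 using gmass_parallelogram[OF assms] gmass_nonneg[OF W12_diff[OF assms]] by simp

lemma grad_ip_le:
 assumes "u \<in> W12" "v \<in> W12"
 shows "norm (grad_ip u v) \<le> sqrt (gmass u) * sqrt (gmass v)"
proof -
 define a b where "a = (\<lambda>i. nrm (weak_pderiv i u))" and "b = (\<lambda>i. nrm (weak_pderiv i v))"
 have "norm (grad_ip u v) \<le> (\<Sum>i\<in>UNIV. norm (L2_ip (weak_pderiv i u) (weak_pderiv i v)))"
  unfolding grad_ip_def by (rule norm_sum)
 also have "\<dots> \<le> (\<Sum>i\<in>UNIV. a i * b i)"
  unfolding a_def b_def using assms by (intro sum_mono L2_ip_le weak_pderiv_L2)
 also have "\<dots> \<le> sqrt ((\<Sum>i\<in>UNIV. (a i)\<^sup>2) * (\<Sum>i\<in>UNIV. (b i)\<^sup>2))"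
  by (rule real_le_rsqrt, rule Cauchy_Schwarz_ineq_sum)
 finally show ?thesis using assms by (simp add: real_sqrt_mult a_def b_def gmass_eq_sum)
qed

subsection \<open>Translations\<close>

lemma has_weak_pderiv_shift:
 assumes [measurable]: "u \<in> borel_fun" "g \<in> borel_fun"
  and w: "has_weak_pderiv i u g"
 shows "has_weak_pderiv i (\<lambda>x. u (x + y)) (\<lambda>x. g (x + y))"
 unfolding has_weak_pderiv_def
proof
 fix \<eta> assume t: "\<eta> \<in> test_functions"
 define \<zeta> where "\<zeta> = (\<lambda>x. \<eta> (x + - y))"
 have z: "\<zeta> \<in> test_functions" unfolding \<zeta>_def by (rule test_functions_shift[OF t])
 note [measurable] = test_measurable[OF z]
 have "pderiv_fun i \<zeta> (x + y) = pderiv_fun i \<eta> x" for x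
  unfolding \<zeta>_def using pderiv_fun_test_shift[OF t, of i "-y" "x + y"] by simp
 moreover have "\<zeta> (x + y) = \<eta> x" for x by (simp add: \<zeta>_def)
 moreover have "(LBINT x. u (x + y) * of_real (pderiv_fun i \<zeta> (x + y))) = (LBINT x. u x * of_real (pderiv_fun i \<zeta> x))"
  by (rule integral_shift) simp
 moreover have "(LBINT x. g (x + y) * of_real (\<zeta> (x + y))) = (LBINT x. g x * of_real (\<zeta> x))"
  by (rule integral_shift) simp
 moreover have "(LBINT x. u x * of_real (pderiv_fun i \<zeta> x)) = - (LBINT x. g x * of_real (\<zeta> x))"
  using w z by (auto simp: has_weak_pderiv_def)
 ultimately show "(LBINT x. u (x + y) * of_real (pderiv_fun i \<eta> x)) = - (LBINT x. g (x + y) * of_real (\<eta> x))"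
  by simp
qed

lemma W12_shift:
 assumes "u \<in> W12"
 shows "(\<lambda>x. u (x + y)) \<in> W12" "gmass (\<lambda>x. u (x + y)) = gmass u"
proof -
 note U = W12_D[OF assms]
 have g: "(\<lambda>x. weak_pderiv i u (x + y)) \<in> L2" "has_weak_pderiv i (\<lambda>x. u (x + y)) (\<lambda>x. weak_pderiv i u (x + y))" for i
  using U L2_measurable by (auto intro: L2_shift has_weak_pderiv_shift)
 show w: "(\<lambda>x. u (x + y)) \<in> W12" by (rule W12I[OF L2_shift[OF U(1)] g])
 have "grad_ip (\<lambda>x. u (x + y)) (\<lambda>x. u (x + y)) = (\<Sum>i\<in>UNIV. L2_ip (\<lambda>x. weak_pderiv i u (x + y)) (\<lambda>x. weak_pderiv i u (x + y)))"
  by (rule grad_ip_eq[OF w w g g])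
 also have "\<dots> = of_real (gmass u)"
  using U(2) L2_measurable[OF U(2)] by (simp add: L2_ip_self[OF g(1)] mass_shift gmass_eq_sum[OF assms])
 finally show "gmass (\<lambda>x. u (x + y)) = gmass u" by (simp add: gmass_def)
qed

section \<open>Averages of translates\<close>

text \<open>The underlying space is left open: the uniform density on [0, 1] averages along
  segments, densities on the plane average over all translates.\<close>

definition prob_density :: "('a::euclidean_space \<Rightarrow> real) \<Rightarrow> bool" where
 "prob_density k \<longleftrightarrow> k \<in> borel_fun \<and> (\<forall>x. 0 \<le> k x) \<and> (NNL x. ennreal (k x)) = 1"

lemma prob_densityD:
 assumes "prob_density k"
 shows "k \<in> borel_fun" "0 \<le> k x" "(NNL x. ennreal (k x)) = 1"
  "L1 k" "integral\<^sup>L lborel k = 1"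
proof -
 show k: "k \<in> borel_fun" "0 \<le> k x" "(NNL x. ennreal (k x)) = 1" for x
  using assms by (auto simp: prob_density_def)
 show "L1 k" by (rule integrableI_bounded) (use k in auto)
 from nn_integral_eq_integral[OF this] k show "integral\<^sup>L lborel k = 1"
  by (simp add: integral_nonneg_AE)
qed

text \<open>Cauchy-Schwarz for the factors sqrt k and sqrt k |f|. If k f is not integrable, its
  Bochner integral is 0 and the bound is trivial.\<close>

lemma prob_density_jensen:
 fixes f :: "'a::euclidean_space \<Rightarrow> complex"
 assumes k: "prob_density k" and [measurable]: "f \<in> borel_fun"
 shows "ennreal ((norm (LBINT y. k y *\<^sub>R f y))\<^sup>2) \<le> (NNL y. ennreal (k y) * ennreal ((norm (f y))\<^sup>2))"
proof -
 note [measurable] = prob_densityD(1)[OF k]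
 have "ennreal (norm (LBINT y. k y *\<^sub>R f y)) \<le> (NNL y. ennreal (norm (k y *\<^sub>R f y)))"
 proof (cases "L1 (\<lambda>y. k y *\<^sub>R f y)")
  case True then show ?thesis by (rule integral_norm_bound_ennreal)
 qed (simp add: not_integrable_integral_eq)
 also have "\<dots> = (NNL y. ennreal (sqrt (k y)) * ennreal (sqrt (k y) * norm (f y)))"
  by (intro nn_integral_cong) (simp add: prob_densityD(2)[OF k] flip: ennreal_mult mult.assoc)
 finally have "(ennreal (norm (LBINT y. k y *\<^sub>R f y)))\<^sup>2 \<le>
   (NNL y. ennreal (sqrt (k y)) * ennreal (sqrt (k y) * norm (f y)))\<^sup>2"
  by (intro power_mono) auto
 also have "\<dots> \<le> (NNL y. (ennreal (sqrt (k y)))\<^sup>2) * (NNL y. (ennreal (sqrt (k y) * norm (f y)))\<^sup>2)"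
  by (rule Cauchy_Schwarz_nn_integral) auto
 finally show ?thesis
  using prob_densityD(2,3)[OF k] by (simp add: ennreal_power power_mult_distrib ennreal_mult)
qed

lemma prob_density_Fubini:
 fixes h :: "real^2 \<Rightarrow> 'a::euclidean_space \<Rightarrow> ennreal"
 assumes k: "prob_density k" and [measurable]: "(\<lambda>z. h (fst z) (snd z)) \<in> borel_measurable lborel2"
 shows "(NNL x. (NNL y. ennreal (k y) * h x y)) = (NNL y. ennreal (k y) * (NNL x. h x y))"
proof -
 note [measurable] = prob_densityD(1)[OF k]
 have [measurable]: "(\<lambda>z. h (snd z) (fst z)) \<in> borel_measurable lborel2"
  using measurable_compose[OF measurable_Pair[OF measurable_snd measurable_fst] assms(2)] by simp
 have [measurable]: "(\<lambda>x. h x y) \<in> borel_measurable lborel" for y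
  using measurable_compose[OF measurable_Pair[OF measurable_ident_sets[OF refl] measurable_const[of y]] assms(2)] by simp
 have "(NNL x. (NNL y. ennreal (k y) * h x y)) = (NNL y. (NNL x. ennreal (k y) * h x y))"
  by (rule lborel_pair.Fubini') measurable
 then show ?thesis by (simp add: nn_integral_cmult)
qed

text \<open>Jensen's inequality, then Tonelli and translation invariance of the mass. Integrability
  for almost every x comes from t \<le> 1 + t^2.\<close>

lemma average_shift:
 fixes \<tau> :: "'a::euclidean_space \<Rightarrow> real^2"
 assumes k: "prob_density k" and u: "u \<in> L2" and [measurable]: "\<tau> \<in> borel_fun"
 shows "(\<lambda>x. \<integral>y. k y *\<^sub>R u (x + \<tau> y) \<partial>lborel) \<in> L2" "mass (\<lambda>x. \<integral>y. k y *\<^sub>R u (x + \<tau> y) \<partial>lborel) \<le> mass u"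
  "AE x in lborel. L1 (\<lambda>y. k y *\<^sub>R u (x + \<tau> y))"
proof -
 note [measurable] = prob_densityD(1)[OF k] L2_measurable[OF u]
 let ?V = "\<lambda>x. \<integral>y. k y *\<^sub>R u (x + \<tau> y) \<partial>lborel" and ?I = "\<lambda>x. \<integral>\<^sup>+y. ennreal (k y) * ennreal ((norm (u (x + \<tau> y)))\<^sup>2) \<partial>lborel"
 have "(NNL x. ?I x) = (NNL y. ennreal (k y) * ennreal (mass u))"
  using nn_integral_shift[of "\<lambda>x. ennreal ((norm (u x))\<^sup>2)"] by (subst prob_density_Fubini[OF k]) (auto simp: mass_nn[OF u])
 also have "\<dots> = ennreal (mass u)" by (subst nn_integral_multc) (auto simp: prob_densityD(3)[OF k])
 finally have eq: "(NNL x. ?I x) = ennreal (mass u)" .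
 have "(NNL x. ennreal ((norm (?V x))\<^sup>2)) \<le> ennreal (mass u)"
  unfolding eq[symmetric] by (intro nn_integral_mono prob_density_jensen[OF k]) measurable
 then show "?V \<in> L2" "mass ?V \<le> mass u" by (rule_tac L2_nnI[OF _ _ mass_nonneg]; simp)+
 have "AE x in lborel. ?I x \<noteq> \<infinity>" by (rule nn_integral_PInf_AE) (use eq in auto)
 then show "AE x in lborel. L1 (\<lambda>y. k y *\<^sub>R u (x + \<tau> y))"
 proof eventually_elim
  case (elim x)
  have "t \<le> 1 + t\<^sup>2" for t :: real using zero_le_power2[of "t - 1/2"] by (simp add: power2_diff field_simps)
  then have "ennreal (norm (k y *\<^sub>R u (x + \<tau> y))) \<le> ennreal (k y) + ennreal (k y) * ennreal ((norm (u (x + \<tau> y)))\<^sup>2)" for y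
   using prob_densityD(2)[OF k, of y] mult_left_mono[of "norm (u (x + \<tau> y))" "1 + (norm (u (x + \<tau> y)))\<^sup>2" "k y"]
   by (simp add: distrib_left flip: ennreal_mult ennreal_plus)
  then have "(NNL y. ennreal (norm (k y *\<^sub>R u (x + \<tau> y)))) \<le> (NNL y. ennreal (k y) + ennreal (k y) * ennreal ((norm (u (x + \<tau> y)))\<^sup>2))"
   by (intro nn_integral_mono)
  also have "\<dots> = 1 + ?I x" by (subst nn_integral_add) (auto simp: prob_densityD(3)[OF k])
  also have "\<dots> < \<infinity>" using elim by (simp add: top.not_eq_extremum)
  finally show ?case by (intro integrableI_bounded) auto
 qed
qed

text \<open>Along the segment from \<open>x\<close> to \<open>x + y\<close>, \<open>u\<close> is the integral of its directional derivative.\<close>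

lemma translation_estimate:
 assumes u: "u \<in> W12"
 shows "mass (\<lambda>x. u (x + y) - u x) \<le> (norm y)\<^sup>2 * gmass u"
proof -
 note U = W12_D[OF u]
 define G where "G x = of_real (y $ 1) * weak_pderiv 1 u x + of_real (y $ 2) * weak_pderiv 2 u x" for x
 have GL: "G \<in> L2" unfolding G_def by (intro L2_add L2_cmult U)
 define V where "V x = (LBINT s. indicator {0..1} s *\<^sub>R G (x + s *\<^sub>R y))" for x
 have k: "prob_density (indicator {0..1::real})" by (simp add: prob_density_def ennreal_indicator)
 note V = average_shift[OF k GL, of "\<lambda>s. s *\<^sub>R y", folded V_def[abs_def], simplified]
 note uy = L2_shift[OF U(1), of y]
 have "AE x in lborel. (u (x + y) - u x) - V x = 0"
 proof (rule fundamental_lemma[OF L2_diff[OF L2_diff[OF uy U(1)] V(1)]])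
  fix \<eta> assume t: "\<eta> \<in> test_functions"
  let ?\<eta> = "\<lambda>x. complex_of_real (\<eta> x)" and ?p = "\<lambda>i x. complex_of_real (pderiv_fun i \<eta> x)"
  define D where "D x = frechet_derivative \<eta> (at x)" for x
  note D = test_functionsD(4)[OF t, folded D_def]
  have Dy: "D x y = y $ 1 * pderiv_fun 1 \<eta> x + y $ 2 * pderiv_fun 2 \<eta> x" for x
  proof -
   have "D x y = D x (y $ 1 *\<^sub>R axis 1 1 + y $ 2 *\<^sub>R axis 2 1)"
    using basis_expansion[of y] by (simp add: sum_2 scalar_mult_eq_scaleR)
   then show ?thesis
    using linear_add[OF has_derivative_linear[OF D]] linear_cmul[OF has_derivative_linear[OF D]] by (simp add: pderiv_fun_eq[OF D])
  qed
  have Dc: "continuous_on UNIV (\<lambda>x. D x y)" unfolding Dy by (intro continuous_intros test_functionsD(3)[OF t])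
  have D2: "complex_of_real (D x y) = of_real (y $ 1) * ?p 1 x + of_real (y $ 2) * ?p 2 x" for x by (simp add: Dy)
  note tL = test_L2[OF t]
  have DL: "(\<lambda>x. complex_of_real (D x y)) \<in> L2" unfolding D2 by (intro L2_add L2_cmult tL)
  \<comment> \<open>Here the weak derivatives of u enter; afterwards the shift is moved from the
    test function onto \<open>G\<close>.\<close>
  have weak: "(LBINT x. u x * of_real (D (x + s *\<^sub>R - y) y)) = - (LBINT x. ?\<eta> x * G (x + s *\<^sub>R y))" for s
  proof -
   let ?z = "s *\<^sub>R - y"
   have w: "(LBINT x. u x * ?p i (x + ?z)) = - (LBINT x. weak_pderiv i u x * ?\<eta> (x + ?z))" for i
    using U(3)[of i] test_functions_shift[OF t, of ?z] pderiv_fun_test_shift[OF t, of i ?z] unfolding has_weak_pderiv_def by auto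
   have "(LBINT x. u x * of_real (D (x + ?z) y)) =
     (LBINT x. of_real (y $ 1) * (u x * ?p 1 (x + ?z)) + of_real (y $ 2) * (u x * ?p 2 (x + ?z)))"
    unfolding D2 by (simp add: algebra_simps)
   also have "\<dots> = - (of_real (y $ 1) * (LBINT x. weak_pderiv 1 u x * ?\<eta> (x + ?z)) + of_real (y $ 2) * (LBINT x. weak_pderiv 2 u x * ?\<eta> (x + ?z)))"
    using L2_mult_integrable[OF U(1) L2_shift[OF tL(2), where y = "?z"]] by (simp add: w[simplified])
   also have "\<dots> = - (LBINT x. G x * ?\<eta> (x + ?z))"
    using L2_mult_integrable[OF U(2) L2_shift[OF tL(1), where y = "?z"]] by (simp add: G_def distrib_right mult.assoc)
   also have "(LBINT x. G x * ?\<eta> (x + ?z)) = (LBINT x. ?\<eta> x * G (x + s *\<^sub>R y))"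
    using integral_shift[of "\<lambda>x. G x * ?\<eta> (x + ?z)" "s *\<^sub>R y"] L2_measurable[OF GL] test_measurable[OF t] by (simp add: mult.commute)
   finally show ?thesis .
  qed
  note i = L2_mult_integrable[OF _ tL(1)]
  have "(LBINT x. (u (x + y) - u x) * ?\<eta> x) = (LBINT x. u (x + y) * ?\<eta> x) - (LBINT x. u x * ?\<eta> x)"
   using i[OF uy] i[OF U(1)] by (simp add: left_diff_distrib)
  also have "(LBINT x. u (x + y) * ?\<eta> x) = (LBINT x. u x * ?\<eta> (x - y))"
   using integral_shift[of "\<lambda>x. u x * ?\<eta> (x - y)" y] L2_measurable[OF U(1)] test_measurable[OF t] by simp
  also have "\<dots> - (LBINT x. u x * ?\<eta> x) = - (LBINT x. u x * of_real (\<eta> x - \<eta> (x - y)))"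
   using L2_mult_integrable[OF U(1) L2_shift[OF tL(1), of "- y"]] i[OF U(1)] by (simp add: right_diff_distrib)
  also have "\<dots> = - (LBINT s. indicator {0..1} s *\<^sub>R (LBINT x. u x * of_real (D (x + s *\<^sub>R - y) y)))"
   unfolding FTC_line[OF D Dc, symmetric] by (subst pairing_Fubini[OF U(1) DL]) simp
  also have "\<dots> = (LBINT s. indicator {0..1} s *\<^sub>R (LBINT x. ?\<eta> x * G (x + s *\<^sub>R y)))"
   unfolding weak by simp
  also have "\<dots> = (LBINT x. ?\<eta> x * V x)" unfolding V_def by (rule pairing_Fubini[OF tL(1) GL, symmetric])
  also have "\<dots> = (LBINT x. V x * ?\<eta> x)" by (simp only: mult.commute)
  finally show "(LBINT x. (u (x + y) - u x - V x) * ?\<eta> x) = 0"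
   using i[OF V(1)] i[OF L2_diff[OF uy U(1)]] by (simp add: left_diff_distrib[of "u (x + y) - u x" "V x" for x])
 qed
 then have "AE x in lborel. u (x + y) - u x = V x" by (auto elim!: eventually_mono)
 then have "mass (\<lambda>x. u (x + y) - u x) = mass V"
  by (rule mass_cong_AE) (use L2_measurable[OF V(1)] L2_measurable[OF L2_diff[OF uy U(1)]] in auto)
 also have "\<dots> \<le> (nrm G)\<^sup>2" using V(2) by simp
 also have "\<dots> \<le> (\<Sum>i\<in>UNIV. \<bar>y $ i\<bar> * nrm (weak_pderiv i u))\<^sup>2"
 proof (rule power_mono)
  have "nrm G \<le> nrm (\<lambda>x. of_real (y $ 1) * weak_pderiv 1 u x) + nrm (\<lambda>x. of_real (y $ 2) * weak_pderiv 2 u x)"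
   unfolding G_def by (intro nrm_triangle L2_cmult U)
  then show "nrm G \<le> (\<Sum>i\<in>UNIV. \<bar>y $ i\<bar> * nrm (weak_pderiv i u))" by (simp add: nrm_cmult sum_2)
 qed simp
 also have "\<dots> \<le> (\<Sum>i\<in>UNIV. \<bar>y $ i\<bar>\<^sup>2) * (\<Sum>i\<in>UNIV. (nrm (weak_pderiv i u))\<^sup>2)"
  by (rule Cauchy_Schwarz_ineq_sum)
 also have "(\<Sum>i\<in>UNIV. \<bar>y $ i\<bar>\<^sup>2) = (norm y)\<^sup>2"
  by (simp add: norm_vec_def L2_set_def sum_nonneg)
 finally show ?thesis by (simp add: gmass_eq_sum[OF u])
qed

section \<open>Convolution with probability densities\<close>

text \<open>Written as an average of the translates \<open>u (x + y)\<close>; for the even kernels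
  to which it is applied this is the usual convolution.\<close>

definition conv :: "(real^2 \<Rightarrow> real) \<Rightarrow> wfun \<Rightarrow> wfun" where
 "conv k u x = (LBINT y. k y *\<^sub>R u (x + y))"

lemma conv_measurable [measurable]:
 assumes [measurable]: "k \<in> borel_fun" "u \<in> borel_fun"
 shows "conv k u \<in> borel_fun"
 unfolding conv_def[abs_def] by measurable

lemma conv_contraction:
 assumes k: "prob_density k" and u: "u \<in> L2"
 shows "conv k u \<in> L2" "mass (conv k u) \<le> mass u"
  "AE x in lborel. L1 (\<lambda>y. k y *\<^sub>R u (x + y))"
 using average_shift[OF k u, of "\<lambda>y. y"] by (simp_all add: conv_def[abs_def])

text \<open>Jensen's inequality bounds the left side by the k-average of the squared translation
  errors, each at most |y|^2 times the Dirichlet energy; \<open>S\<close> bounds the second moment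
  of the kernel.\<close>

lemma conv_estimate:
 assumes k: "prob_density k" and u: "u \<in> W12" and S: "S \<ge> 0"
  and m: "(NNL y. ennreal (k y * (norm y)\<^sup>2)) \<le> ennreal S"
 shows "mass (\<lambda>x. conv k u x - u x) \<le> S * gmass u"
proof -
 note U = W12_L2[OF u]
 note [measurable] = prob_densityD(1)[OF k] L2_measurable[OF U]
 have "(NNL x. ennreal ((norm (conv k u x - u x))\<^sup>2)) \<le>
   (NNL x. (NNL y. ennreal (k y) * ennreal ((norm (u (x + y) - u x))\<^sup>2)))"
 proof (rule nn_integral_mono_AE)
  show "AE x in lborel. ennreal ((norm (conv k u x - u x))\<^sup>2) \<le> (NNL y. ennreal (k y) * ennreal ((norm (u (x + y) - u x))\<^sup>2))"
   using conv_contraction(3)[OF k U]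
  proof eventually_elim
   case (elim x)
   have "L1 (\<lambda>y. k y *\<^sub>R u x)" using prob_densityD(4)[OF k] by simp
   moreover have "(LBINT y. k y *\<^sub>R u x) = u x"
    using prob_densityD(4,5)[OF k] by (subst integral_scaleR_left) auto
   ultimately have "conv k u x - u x = (LBINT y. k y *\<^sub>R (u (x + y) - u x))"
    using elim by (simp add: conv_def scaleR_diff_right)
   then show ?case using prob_density_jensen[OF k, of "\<lambda>y. u (x + y) - u x"] by simp
  qed
 qed
 also have "\<dots> = (NNL y. ennreal (k y) * (NNL x. ennreal ((norm (u (x + y) - u x))\<^sup>2)))"
  by (rule prob_density_Fubini[OF k]) measurable
 also have "\<dots> \<le> (NNL y. ennreal (k y * (norm y)\<^sup>2) * ennreal (gmass u))"
 proof (rule nn_integral_mono)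
  fix y
  have "(NNL x. ennreal ((norm (u (x + y) - u x))\<^sup>2)) = ennreal (mass (\<lambda>x. u (x + y) - u x))"
   by (rule mass_nn[OF L2_diff[OF L2_shift[OF U] U]])
  also have "\<dots> \<le> ennreal ((norm y)\<^sup>2 * gmass u)" by (intro ennreal_leI translation_estimate[OF u])
  finally show "ennreal (k y) * (NNL x. ennreal ((norm (u (x + y) - u x))\<^sup>2)) \<le> ennreal (k y * (norm y)\<^sup>2) * ennreal (gmass u)"
   using prob_densityD(2)[OF k, of y] gmass_nonneg[OF u]
   by (simp add: ennreal_mult mult.assoc mult_left_mono)
 qed
 also have "\<dots> = (NNL y. ennreal (k y * (norm y)\<^sup>2)) * ennreal (gmass u)"
  by (rule nn_integral_multc) simp
 also have "\<dots> \<le> ennreal (S * gmass u)"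
  using m S gmass_nonneg[OF u] by (simp add: ennreal_mult mult_right_mono)
 finally show ?thesis using S gmass_nonneg[OF u] by (rule_tac L2_nnI(2)) auto
qed

subsection \<open>The heat kernel\<close>

definition heat :: "real \<Rightarrow> real^2 \<Rightarrow> real" where
 "heat t x = exp (- (norm x)\<^sup>2 / (4 * t)) / (4 * pi * t)"

lemma norm_plane_sq: "(norm (x::real^2))\<^sup>2 = (x $ 1)\<^sup>2 + (x $ 2)\<^sup>2"
 by (simp add: norm_vec_def L2_set_def sum_2)

lemma heat_pos: "t > 0 \<Longrightarrow> 0 < heat t x" by (simp add: heat_def)

lemma heat_nonneg: "t > 0 \<Longrightarrow> 0 \<le> heat t x" using heat_pos[of t x] by simp

lemma heat_le: "t > 0 \<Longrightarrow> heat t x \<le> 1 / (4 * pi * t)"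
 by (simp add: heat_def divide_right_mono)

lemma heat_Sm: "heat t \<in> Sm"
proof -
 have "heat t = (\<lambda>x. exp ((- 1 / (4 * t)) * (x $ 1 * x $ 1 + x $ 2 * x $ 2)) * (1 / (4 * pi * t)))"
  unfolding heat_def[abs_def] norm_plane_sq by (simp add: power2_eq_square diff_divide_distrib add_divide_distrib)
 also have "\<dots> \<in> Sm" by (intro Sm.mult Sm.exp Sm.const Sm.add Sm.coord)
 finally show ?thesis .
qed

lemma heat_measurable [measurable]: "heat t \<in> borel_fun"
 by (rule Sm_measurable[OF heat_Sm])

lemma norm_sq_derivative:
 "((\<lambda>x::real^2. (norm x)\<^sup>2) has_derivative (\<lambda>y. 2 * (x \<bullet> y))) (at x)"
 by (auto intro!: derivative_eq_intros simp: power2_norm_eq_inner inner_commute)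

lemma pderiv_heat:
 assumes "t > 0" shows "pderiv_fun i (heat t) x = - (x $ i / (2 * t)) * heat t x"
proof -
 have "((\<lambda>x. exp (- (norm x)\<^sup>2 / (4 * t)) / (4 * pi * t)) has_derivative
   (\<lambda>y. (- (2 * (x \<bullet> y)) / (4 * t)) * exp (- (norm x)\<^sup>2 / (4 * t)) / (4 * pi * t))) (at x)"
  using assms by (auto intro!: derivative_eq_intros norm_sq_derivative simp: field_simps)
 then have "(heat t has_derivative (\<lambda>y. (- (2 * (x \<bullet> y)) / (4 * t)) * exp (- (norm x)\<^sup>2 / (4 * t)) / (4 * pi * t))) (at x)"
  by (simp only: heat_def[abs_def])
 from pderiv_fun_eq[OF this, of i] show ?thesis
  using assms by (simp add: heat_def inner_axis)
qed

lemma pderiv_heat2: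
 assumes t: "t > 0"
 shows "pderiv_fun i (pderiv_fun i (heat t)) x = ((x $ i)\<^sup>2 / (4 * t\<^sup>2) - 1 / (2 * t)) * heat t x"
proof -
 have e: "pderiv_fun i (heat t) = (\<lambda>x. (- 1 / (2 * t) * x $ i) * heat t x)"
  using pderiv_heat[OF t] by (simp add: fun_eq_iff)
 have S: "(\<lambda>x::real^2. - 1 / (2 * t) * x $ i) \<in> Sm" by (intro Sm.mult Sm.const Sm.coord)
 have "((\<lambda>x::real^2. - 1 / (2 * t) * x $ i) has_derivative (\<lambda>y. - 1 / (2 * t) * y $ i)) (at x)"
  by (rule has_derivative_mult_right, rule bounded_linear.has_derivative[OF bounded_linear_vec_nth has_derivative_ident])
 from pderiv_fun_eq[OF this] have "pderiv_fun i (\<lambda>x::real^2. - 1 / (2 * t) * x $ i) x = - 1 / (2 * t)"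
  by (simp add: axis_def)
 then show ?thesis
  unfolding e by (subst pderiv_fun_mult[OF Sm_pderiv(2)[OF S] Sm_pderiv(2)[OF heat_Sm]])
   (simp add: pderiv_heat[OF t] power2_eq_square field_simps)
qed

text \<open>The kernel is the product of two centred normal densities of variance 2t.\<close>

lemma heat_nn_integral:
 assumes t: "t > 0" shows "(NNL x. ennreal (heat t x)) = 1"
proof -
 define f where "f = (\<lambda>(b::real^2) y. normal_density 0 (sqrt (2 * t)) y)"
 have sq: "(norm x)\<^sup>2 = (\<Sum>b\<in>Basis. (x \<bullet> b)\<^sup>2)" for x :: "real^2"
  unfolding power2_norm_eq_inner by (subst euclidean_inner) (simp add: power2_eq_square)
 have "ennreal (heat t x) = ennreal (\<Prod>b\<in>Basis. f b (x \<bullet> b))" for x :: "real^2"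
 proof -
  have "(\<Prod>b\<in>Basis. f b (x \<bullet> b)) = (1 / sqrt (2 * pi * (2 * t))) ^ 2 * exp (\<Sum>b\<in>Basis. - (x \<bullet> b)\<^sup>2 / (4 * t))"
   using t unfolding f_def normal_density_def
   by (simp add: exp_sum prod.distrib prod_constant prod_dividef power2_eq_square)
  also have "(1 / sqrt (2 * pi * (2 * t))) ^ 2 = 1 / (4 * pi * t)"
   using t by (simp add: power_divide)
  also have "(\<Sum>b\<in>Basis. - (x \<bullet> b)\<^sup>2 / (4 * t)) = - (norm x)\<^sup>2 / (4 * t)"
   by (simp add: sq sum_divide_distrib sum_negf)
  finally show ?thesis by (simp add: heat_def)
 qed
 also have "(\<lambda>x. ennreal (\<Prod>b\<in>Basis. f b (x \<bullet> b))) = (\<lambda>x. \<Prod>b\<in>Basis. ennreal (f b (x \<bullet> b)))"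
  by (simp add: prod_ennreal f_def)
 ultimately have "(NNL x. ennreal (heat t x)) = (NNL x. (\<Prod>b\<in>Basis. ennreal (f b (x \<bullet> b))))"
  by presburger
 also have "\<dots> = (\<Prod>b\<in>(Basis :: (real^2) set). \<integral>\<^sup>+y. ennreal (f b y) \<partial>lborel)"
  by (rule nn_integral_lborel_prod) (auto simp: f_def)
 also have "\<dots> = 1"
  using t by (intro prod.neutral ballI) (simp add: f_def nn_integral_eq_integral)
 finally show ?thesis .
qed

lemma heat_prob_density: "t > 0 \<Longrightarrow> prob_density (heat t)"
 by (simp add: prob_density_def heat_nn_integral heat_nonneg)

text \<open>With z = |x|^2 / (8t), the inequality z e^(-z) \<le> 1 trades the weight |x|^2 for the
  kernel at time 2t. Moments then follow from total mass 1, without polar coordinates.\<close>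

lemma heat_moment:
 assumes t: "t > 0" shows "heat t x * (norm x)\<^sup>2 \<le> 16 * t * heat (2 * t) x"
proof -
 define z where "z = (norm x)\<^sup>2 / (8 * t)"
 have "z * exp (- z) \<le> 1"
 proof -
  have "z \<le> exp z" using exp_ge_add_one_self[of z] by linarith
  then show ?thesis by (simp add: exp_minus divide_simps)
 qed
 then have m: "(z * exp (- z)) * (exp (- z) * (8 * t) / (4 * pi * t)) \<le> 1 * (exp (- z) * (8 * t) / (4 * pi * t))"
  using t by (intro mult_right_mono) auto
 have h: "heat t x = exp (- z) * exp (- z) / (4 * pi * t)" "heat (2 * t) x = exp (- z) / (8 * pi * t)"
  using t by (simp_all add: heat_def z_def flip: exp_add)
 have n: "(norm x)\<^sup>2 = z * (8 * t)" using t by (simp add: z_def)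
 have "heat t x * (norm x)\<^sup>2 = (z * exp (- z)) * (exp (- z) * (8 * t) / (4 * pi * t))"
  unfolding h n by simp
 also note m
 also have "1 * (exp (- z) * (8 * t) / (4 * pi * t)) = 16 * t * heat (2 * t) x"
  unfolding h using t by simp
 finally show ?thesis .
qed

lemma heat_nn_moment:
 assumes t: "t > 0" shows "(NNL y. ennreal (heat t y * (norm y)\<^sup>2)) \<le> ennreal (16 * t)"
proof -
 have "(NNL y. ennreal (heat t y * (norm y)\<^sup>2)) \<le> (NNL y. ennreal (16 * t) * ennreal (heat (2 * t) y))"
  using t heat_moment[OF t] by (intro nn_integral_mono) (simp add: heat_nonneg ennreal_leI flip: ennreal_mult)
 also have "\<dots> = ennreal (16 * t)" using t by (subst nn_integral_cmult) (auto simp: heat_nn_integral)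
 finally show ?thesis .
qed

lemma heat_conv_estimate:
 assumes "t > 0" "u \<in> W12"
 shows "mass (\<lambda>x. conv (heat t) u x - u x) \<le> 16 * t * gmass u"
 by (rule conv_estimate[OF heat_prob_density]) (use assms heat_nn_moment in auto)

lemma heat_L2:
 assumes t: "t > 0" shows "(\<lambda>x. complex_of_real (heat t x)) \<in> L2"
proof (rule L2_bound[where g="\<lambda>x. 1 / (4 * pi * t) * heat t x"])
 show "L1 (\<lambda>x. 1 / (4 * pi * t) * heat t x)"
  using prob_densityD(4)[OF heat_prob_density[OF t]] by simp
 show "AE x in lborel. (norm (complex_of_real (heat t x)))\<^sup>2 \<le> 1 / (4 * pi * t) * heat t x"
 proof (rule AE_I2)
  fix x
  have "heat t x * heat t x \<le> 1 / (4 * pi * t) * heat t x"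
   using heat_le[OF t, of x] heat_nonneg[OF t, of x] by (rule mult_right_mono)
  then show "(norm (complex_of_real (heat t x)))\<^sup>2 \<le> 1 / (4 * pi * t) * heat t x"
   by (simp only: norm_of_real power2_abs power2_eq_square)
 qed
qed simp

lemma pderiv_heat_L2:
 assumes t: "t > 0" shows "(\<lambda>x. complex_of_real (pderiv_fun i (heat t) x)) \<in> L2"
proof (rule L2_bound[where g="\<lambda>x. (1 / (4 * t\<^sup>2) * (1 / (4 * pi * t)) * (16 * t)) * heat (2 * t) x"])
 have m: "pderiv_fun i (heat t) \<in> borel_fun"
  by (rule Sm_measurable[OF Sm_pderiv(1)[OF heat_Sm]])
 then show "(\<lambda>x. complex_of_real (pderiv_fun i (heat t) x)) \<in> borel_fun" by simp
 show "L1 (\<lambda>x. (1 / (4 * t\<^sup>2) * (1 / (4 * pi * t)) * (16 * t)) * heat (2 * t) x)"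
  using prob_densityD(4)[OF heat_prob_density] t by simp
 show "AE x in lborel. (norm (complex_of_real (pderiv_fun i (heat t) x)))\<^sup>2 \<le> (1 / (4 * t\<^sup>2) * (1 / (4 * pi * t)) * (16 * t)) * heat (2 * t) x"
 proof (rule AE_I2)
  fix x :: "real^2"
  have "(x $ i)\<^sup>2 \<le> (norm x)\<^sup>2" using component_le_norm_cart[of x i]
   by (metis abs_le_square_iff abs_norm_cancel)
  then have "(x $ i)\<^sup>2 * heat t x * heat t x \<le> ((norm x)\<^sup>2 * heat t x) * (1 / (4 * pi * t))"
   using heat_le[OF t, of x] heat_nonneg[OF t, of x] by (intro mult_mono mult_right_mono) auto
  also have "\<dots> \<le> (16 * t * heat (2 * t) x) * (1 / (4 * pi * t))"
   using heat_moment[OF t, of x] t by (intro mult_right_mono) (auto simp: mult.commute)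
  finally have "1 / (4 * t\<^sup>2) * ((x $ i)\<^sup>2 * heat t x * heat t x) \<le> 1 / (4 * t\<^sup>2) * ((16 * t * heat (2 * t) x) * (1 / (4 * pi * t)))"
   by (intro mult_left_mono) auto
  moreover have "(pderiv_fun i (heat t) x)\<^sup>2 = 1 / (4 * t\<^sup>2) * ((x $ i)\<^sup>2 * heat t x * heat t x)"
   by (simp add: pderiv_heat[OF t] power_mult_distrib power_divide power2_eq_square)
  ultimately have "(pderiv_fun i (heat t) x)\<^sup>2 \<le> 1 / (4 * t\<^sup>2) * ((16 * t * heat (2 * t) x) * (1 / (4 * pi * t)))"
   by simp
  also have "\<dots> = (1 / (4 * t\<^sup>2) * (1 / (4 * pi * t)) * (16 * t)) * heat (2 * t) x"
   by (simp only: ac_simps)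
  finally show "(norm (complex_of_real (pderiv_fun i (heat t) x)))\<^sup>2 \<le> (1 / (4 * t\<^sup>2) * (1 / (4 * pi * t)) * (16 * t)) * heat (2 * t) x"
   by (simp only: norm_of_real power2_abs)
 qed
qed

lemma heat_W12: "t > 0 \<Longrightarrow> (\<lambda>x. complex_of_real (heat t x)) \<in> W12"
 by (rule Sm_W12[OF heat_Sm heat_L2 pderiv_heat_L2])

section \<open>Integrability of powers\<close>

lemma nn_integral_powr_0:
 assumes "a > -1" "c \<ge> 0"
 shows "(NNL s. ennreal (s powr a) * indicator {0..c} s) = ennreal (c powr (a + 1) / (a + 1))"
proof -
 have "((\<lambda>s. if s \<in> {0..c} then s powr a else 0) has_integral (c powr (a + 1) / (a + 1))) UNIV"
  using has_integral_powr_from_0[OF assms] by (simp only: has_integral_restrict_UNIV)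
 then have "(NNL s. ennreal (if s \<in> {0..c} then s powr a else 0)) = ennreal (c powr (a + 1) / (a + 1))"
  by (rule nn_integral_has_integral_lborel[rotated 2]) auto
 moreover have "(NNL s. ennreal (s powr a) * indicator {0..c} s) = (NNL s. ennreal (if s \<in> {0..c} then s powr a else 0))"
  by (intro nn_integral_cong) (auto split: split_indicator)
 ultimately show ?thesis by (simp only:)
qed

lemma nn_integral_powr_inf:
 assumes "e < -1" "a > 0"
 shows "(NNL s. ennreal (s powr e) * indicator {a..} s) = ennreal (- (a powr (e + 1)) / (e + 1))"
proof -
 have "((\<lambda>s. if s \<in> {a..} then s powr e else 0) has_integral (- (a powr (e + 1)) / (e + 1))) UNIV"
  using has_integral_powr_to_inf[OF assms] by (simp only: has_integral_restrict_UNIV)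
 then have "(NNL s. ennreal (if s \<in> {a..} then s powr e else 0)) = ennreal (- (a powr (e + 1)) / (e + 1))"
  by (rule nn_integral_has_integral_lborel[rotated 2]) auto
 moreover have "(NNL s. ennreal (s powr e) * indicator {a..} s) = (NNL s. ennreal (if s \<in> {a..} then s powr e else 0))"
  by (intro nn_integral_cong) (auto split: split_indicator)
 ultimately show ?thesis by (simp only:)
qed

text \<open>With $4\pi t = B s^{-r}$ the smoothed function stays below $2s$, so $|u| \ge 3s$ forces
 $|u - p_t * u| \ge s$.\<close>

lemma level_set_estimate:
 assumes u: "u \<in> W12" and r: "r \<ge> 2" and i: "L1 (\<lambda>x. norm (u x) powr r)"
  and B: "Lp_int r u \<le> B" "B > 0" and s: "s > 0"
 shows "emeasure lborel {x. 3 * s \<le> norm (u x)} \<le> ennreal (4 / pi * B * gmass u * s powr (- r - 2))"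
proof -
 note [measurable] = L2_measurable[OF W12_L2[OF u]]
 define t where "t = B * s powr (- r) / (4 * pi)"
 have t: "t > 0" using B s by (simp add: t_def)
 have bd: "norm (conv (heat t) u x) \<le> 2 * s" for x
 proof (cases "L1 (\<lambda>y. heat t y *\<^sub>R u (x + y))")
  case True
  have i': "L1 (\<lambda>y. norm (u (x + y)) powr r)"
   using integrable_shift[OF i, of x] by (simp add: add.commute)
  have I: "(LBINT y. norm (u (x + y)) powr r) \<le> B"
   using integral_shift[of "\<lambda>y. norm (u y) powr r" x] B by (simp add: add.commute)
  have "norm (conv (heat t) u x) \<le> (LBINT y. norm (heat t y *\<^sub>R u (x + y)))"
   unfolding conv_def by (rule integral_norm_bound)
  also have "\<dots> \<le> (LBINT y. s * heat t y + s powr (1 - r) * (1 / (4 * pi * t)) * norm (u (x + y)) powr r)"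
  proof (rule integral_mono)
   fix y
   \<comment> \<open>Above the level s one has |u| \<le> s^(1-r) |u|^r because 1 - r is negative. In
     front of |u|^r the heat kernel can then be replaced by its maximum 1/(4 pi t).\<close>
   have "norm (u (x + y)) \<le> s + s powr (1 - r) * norm (u (x + y)) powr r"
   proof (cases "norm (u (x + y)) \<le> s")
    case False
    define n where "n = norm (u (x + y))"
    have "n = n powr (1 - r) * n powr r" using False s by (simp add: n_def flip: powr_add)
    also have "\<dots> \<le> s powr (1 - r) * n powr r"
     using False r s by (intro mult_right_mono powr_mono2') (auto simp: n_def)
    finally show ?thesis using s by (simp add: n_def)
   qed (simp add: add_increasing2)
   then have "heat t y * norm (u (x + y)) \<le> heat t y * s + heat t y * (s powr (1 - r) * norm (u (x + y)) powr r)"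
    using heat_nonneg[OF t, of y] by (simp add: mult_left_mono flip: distrib_left)
   also have "heat t y * (s powr (1 - r) * norm (u (x + y)) powr r) \<le> 1 / (4 * pi * t) * (s powr (1 - r) * norm (u (x + y)) powr r)"
    using heat_le[OF t, of y] by (intro mult_right_mono) auto
   finally show "norm (heat t y *\<^sub>R u (x + y)) \<le> s * heat t y + s powr (1 - r) * (1 / (4 * pi * t)) * norm (u (x + y)) powr r"
    using heat_nonneg[OF t, of y] by (simp add: ac_simps)
  qed (use integrable_norm[OF True] i' prob_densityD(4)[OF heat_prob_density[OF t]] in auto)
  also have "\<dots> = s + s powr (1 - r) * (1 / (4 * pi * t)) * (LBINT y. norm (u (x + y)) powr r)"
   using i' prob_densityD(4,5)[OF heat_prob_density[OF t]] by simp
  also have "\<dots> \<le> s + s powr (1 - r) * (1 / (4 * pi * t)) * B"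
   using I t by (intro add_left_mono mult_left_mono) auto
  also have "s powr (1 - r) * (1 / (4 * pi * t)) * B = s"
  proof -
   have "1 / (4 * pi * t) * B = s powr r" using B s by (simp add: t_def powr_minus field_simps)
   then have "s powr (1 - r) * (1 / (4 * pi * t)) * B = s powr (1 - r) * s powr r" by (simp only: mult.assoc)
   also have "\<dots> = s" using s by (simp flip: powr_add)
   finally show ?thesis .
  qed
  finally show ?thesis by simp
 qed (use s in \<open>simp add: conv_def not_integrable_integral_eq\<close>)
 define D where "D = (\<lambda>x. conv (heat t) u x - u x)"
 have D: "D \<in> L2" unfolding D_def
  by (rule L2_diff[OF conv_contraction(1)[OF heat_prob_density[OF t] W12_L2[OF u]] W12_L2[OF u]])
 note [measurable] = L2_measurable[OF D]
 \<comment> \<open>Chebyshev's inequality for the smoothing error \<open>D\<close>, which has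
   modulus at least s on this set.\<close>
 have "emeasure lborel {x. 3 * s \<le> norm (u x)} = (NNL x. indicator {x. 3 * s \<le> norm (u x)} x)"
  by simp
 also have "\<dots> \<le> (NNL x. ennreal (1 / s\<^sup>2) * ennreal ((norm (D x))\<^sup>2))"
 proof (rule nn_integral_mono)
  fix x
  show "indicator {x. 3 * s \<le> norm (u x)} x \<le> ennreal (1 / s\<^sup>2) * ennreal ((norm (D x))\<^sup>2)"
  proof (cases "3 * s \<le> norm (u x)")
   case True
   have "norm (u x) - norm (conv (heat t) u x) \<le> norm (D x)"
    unfolding D_def by (metis norm_minus_commute norm_triangle_ineq2)
   then have "s \<le> norm (D x)" using True bd[of x] by linarith
   then have "s\<^sup>2 \<le> (norm (D x))\<^sup>2" using s by (intro power_mono) auto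
   then have "1 \<le> 1 / s\<^sup>2 * (norm (D x))\<^sup>2" using s by (simp add: field_simps)
   then show ?thesis using True by (simp add: ennreal_leI flip: ennreal_mult ennreal_1)
  qed simp
 qed
 also have "\<dots> = ennreal (1 / s\<^sup>2) * ennreal (mass D)"
  by (subst nn_integral_cmult) (auto simp: mass_nn[OF D])
 also have "\<dots> \<le> ennreal (1 / s\<^sup>2) * ennreal (16 * t * gmass u)"
  unfolding D_def using heat_conv_estimate[OF t u] by (intro mult_left_mono ennreal_leI) auto
 also have "\<dots> = ennreal (4 / pi * B * gmass u * s powr (- r - 2))"
 proof -
  have "s powr (- r - 2) = s powr (- r) / s\<^sup>2" using s by (simp add: powr_diff)
  then have "1 / s\<^sup>2 * (16 * t * gmass u) = 4 / pi * B * gmass u * s powr (- r - 2)"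
   by (simp add: t_def field_simps)
  then show ?thesis using t gmass_nonneg[OF u] by (simp flip: ennreal_mult)
 qed
 finally show ?thesis .
qed

lemma chebyshev_mass:
 assumes u: "u \<in> L2" and s: "s > 0"
 shows "emeasure lborel {x. 3 * s \<le> norm (u x)} \<le> ennreal (mass u / (9 * s\<^sup>2))"
proof -
 note [measurable] = L2_measurable[OF u]
 have "emeasure lborel {x. 3 * s \<le> norm (u x)} = (NNL x. indicator {x. 3 * s \<le> norm (u x)} x)"
  by simp
 also have "\<dots> \<le> (NNL x. ennreal (1 / (9 * s\<^sup>2)) * ennreal ((norm (u x))\<^sup>2))"
 proof (rule nn_integral_mono)
  fix x
  show "indicator {x. 3 * s \<le> norm (u x)} x \<le> ennreal (1 / (9 * s\<^sup>2)) * ennreal ((norm (u x))\<^sup>2)"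
  proof (cases "3 * s \<le> norm (u x)")
   case True
   then have "(3 * s)\<^sup>2 \<le> (norm (u x))\<^sup>2" using s by (intro power_mono) auto
   then have "1 \<le> 1 / (9 * s\<^sup>2) * (norm (u x))\<^sup>2" using s by (simp add: field_simps power_mult_distrib)
   then show ?thesis using True by (simp add: ennreal_leI flip: ennreal_mult ennreal_1)
  qed simp
 qed
 also have "\<dots> = ennreal (mass u / (9 * s\<^sup>2))"
  by (subst nn_integral_cmult) (auto simp: mass_nn[OF u] simp flip: ennreal_mult)
 finally show ?thesis .
qed

text \<open>Layer-cake formula, with Chebyshev's inequality for levels below M and
  \<open>level_set_estimate\<close> above. The tail integrates s^(p-r-3), which converges because p
  < r + 2, so integrability climbs from r to every such p. The splitting level M stays free: a large
  M makes the coefficient of the Dirichlet energy small.\<close>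

lemma Lp_step:
 assumes u: "u \<in> W12" and r: "r \<ge> 2" and i: "L1 (\<lambda>x. norm (u x) powr r)"
  and B: "Lp_int r u \<le> B" "B > 0" and p: "2 < p" "p < r + 2" and M: "M > 0"
 shows "L1 (\<lambda>x. norm (u x) powr p)"
  and "Lp_int p u \<le>
   3 powr p * p * (mass u / 9 * (M powr (p - 2) / (p - 2)) +
    4 / pi * B * gmass u * (M powr (p - r - 2) / (r + 2 - p)))" (is "_ \<le> ?C")
proof -
 note [measurable] = L2_measurable[OF W12_L2[OF u]]
 have g0: "gmass u \<ge> 0" by (rule gmass_nonneg[OF u])
 have C0: "?C \<ge> 0" using p B g0 by (intro mult_nonneg_nonneg add_nonneg_nonneg) auto
 \<comment> \<open>Levels are written as 3 s to match \<open>level_set_estimate\<close>; hence the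
   factor 3^p.\<close>
 have layer: "ennreal (norm (u x) powr p) =
   (NNL s. ennreal (3 powr p * p) * (ennreal (s powr (p - 1)) * indicator {0..norm (u x) / 3} s))" for x
 proof -
  have "(NNL s. ennreal (3 powr p * p) * (ennreal (s powr (p - 1)) * indicator {0..norm (u x) / 3} s))
   = ennreal (3 powr p * p) * ennreal ((norm (u x) / 3) powr p / p)"
   using p by (subst nn_integral_cmult) (auto simp: nn_integral_powr_0)
  also have "\<dots> = ennreal (norm (u x) powr p)"
   using p by (simp add: powr_divide flip: ennreal_mult)
  finally show ?thesis by simp
 qed
 have "(NNL x. ennreal (norm (u x) powr p)) =
   (NNL x. (NNL s. ennreal (3 powr p * p) * (ennreal (s powr (p - 1)) * indicator {0..norm (u x) / 3} s)))"
  by (simp only: layer)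
 also have "\<dots> = (NNL x. (NNL s. ennreal (3 powr p * p) * (ennreal (s powr (p - 1)) * (if 0 \<le> s \<and> 3 * s \<le> norm (u x) then 1 else 0))))"
  by (intro nn_integral_cong) (auto split: split_indicator)
 also have "\<dots> = (NNL s. (NNL x. ennreal (3 powr p * p) * (ennreal (s powr (p - 1)) * (if 0 \<le> s \<and> 3 * s \<le> norm (u x) then 1 else 0))))"
  by (rule lborel_pair.Fubini') measurable
 also have "\<dots> \<le> (NNL s. ennreal (3 powr p * p) * (ennreal (mass u / 9) * (ennreal (s powr (p - 3)) * indicator {0..M} s) +
   ennreal (4 / pi * B * gmass u) * (ennreal (s powr (p - r - 3)) * indicator {M..} s)))"
 proof (rule nn_integral_mono)
  fix s :: real
  show "(NNL x. ennreal (3 powr p * p) * (ennreal (s powr (p - 1)) * (if 0 \<le> s \<and> 3 * s \<le> norm (u x) then 1 else 0)))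
   \<le> ennreal (3 powr p * p) * (ennreal (mass u / 9) * (ennreal (s powr (p - 3)) * indicator {0..M} s) +
   ennreal (4 / pi * B * gmass u) * (ennreal (s powr (p - r - 3)) * indicator {M..} s))"
  proof (cases "s > 0")
   case False
   then have "ennreal (s powr (p - 1)) * (if 0 \<le> s \<and> 3 * s \<le> norm (u x) then 1 else 0) = 0" for x
    by (cases "s = 0") auto
   then show ?thesis by (simp only: mult_zero_right nn_integral_const) simp
  next
   case True
   have "(NNL x. ennreal (3 powr p * p) * (ennreal (s powr (p - 1)) * (if 0 \<le> s \<and> 3 * s \<le> norm (u x) then 1 else 0)))
     = (NNL x. ennreal (3 powr p * p) * ennreal (s powr (p - 1)) * indicator {x. 3 * s \<le> norm (u x)} x)"
    using True by (intro nn_integral_cong) (auto split: split_indicator)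
   also have "\<dots> = ennreal (3 powr p * p) * (ennreal (s powr (p - 1)) * emeasure lborel {x. 3 * s \<le> norm (u x)})"
    by (simp add: nn_integral_cmult mult.assoc)
   also have "\<dots> \<le> ennreal (3 powr p * p) * (ennreal (mass u / 9) * (ennreal (s powr (p - 3)) * indicator {0..M} s) +
   ennreal (4 / pi * B * gmass u) * (ennreal (s powr (p - r - 3)) * indicator {M..} s))"
   proof (rule mult_left_mono)
    show "ennreal (s powr (p - 1)) * emeasure lborel {x. 3 * s \<le> norm (u x)} \<le>
     ennreal (mass u / 9) * (ennreal (s powr (p - 3)) * indicator {0..M} s) +
     ennreal (4 / pi * B * gmass u) * (ennreal (s powr (p - r - 3)) * indicator {M..} s)"
    proof (cases "s \<le> M")
     case sM: True
     have e1: "s powr (p - 1) * (mass u / (9 * s\<^sup>2)) = mass u / 9 * s powr (p - 3)"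
     proof -
      have "s powr (p - 1) = s powr (p - 3) * s powr 2" by (simp only: powr_add[symmetric]) simp
      then show ?thesis using True by (simp add: field_simps)
     qed
     have "ennreal (s powr (p - 1)) * emeasure lborel {x. 3 * s \<le> norm (u x)} \<le> ennreal (s powr (p - 1)) * ennreal (mass u / (9 * s\<^sup>2))"
      by (intro mult_left_mono chebyshev_mass[OF W12_L2[OF u] True]) simp
     also have "\<dots> = ennreal (mass u / 9) * (ennreal (s powr (p - 3)) * indicator {0..M} s)"
      using True sM e1 by (simp flip: ennreal_mult)
     finally show ?thesis by (simp add: add_increasing2)
    next
     case sM: False
     have e2: "s powr (p - 1) * s powr (- r - 2) = s powr (p - r - 3)" by (simp flip: powr_add)
     have "ennreal (s powr (p - 1)) * emeasure lborel {x. 3 * s \<le> norm (u x)} \<le>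
       ennreal (s powr (p - 1)) * ennreal (4 / pi * B * gmass u * s powr (- r - 2))"
      by (intro mult_left_mono level_set_estimate[OF u r i B True]) simp
     also have "\<dots> = ennreal (s powr (p - 1) * (4 / pi * B * gmass u * s powr (- r - 2)))"
      using B g0 by (subst ennreal_mult) auto
     also have "s powr (p - 1) * (4 / pi * B * gmass u * s powr (- r - 2)) = 4 / pi * B * gmass u * s powr (p - r - 3)"
      unfolding e2[symmetric] by (simp add: ac_simps)
     also have "ennreal (4 / pi * B * gmass u * s powr (p - r - 3)) = ennreal (4 / pi * B * gmass u) * (ennreal (s powr (p - r - 3)) * indicator {M..} s)"
      using B g0 sM by (subst ennreal_mult) auto
     finally show ?thesis by (simp add: add_increasing)
    qed
   qed simp
   finally show ?thesis .
  qed
 qed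
 also have "\<dots> = ennreal (3 powr p * p) * (ennreal (mass u / 9) * ennreal (M powr (p - 2) / (p - 2)) +
   ennreal (4 / pi * B * gmass u) * ennreal (M powr (p - r - 2) / (r + 2 - p)))"
 proof -
  have n1: "(NNL s. ennreal (s powr (p - 3)) * indicator {0..M} s) = ennreal (M powr (p - 2) / (p - 2))"
   using nn_integral_powr_0[of "p - 3" M] p M by (simp add: algebra_simps)
  have "- (M powr (p - r - 3 + 1)) / (p - r - 3 + 1) = M powr (p - r - 2) / (r + 2 - p)"
   using p by (simp add: field_simps)
  then have n2: "(NNL s. ennreal (s powr (p - r - 3)) * indicator {M..} s) = ennreal (M powr (p - r - 2) / (r + 2 - p))"
   using nn_integral_powr_inf[of "p - r - 3" M] p M by simp
  show ?thesis by (subst nn_integral_cmult, simp, subst nn_integral_add) (auto simp: nn_integral_cmult n1 n2)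
 qed
 also have "\<dots> = ennreal ?C"
  using p B g0 by (simp flip: ennreal_mult ennreal_plus)
 finally have le: "(NNL x. ennreal (norm (u x) powr p)) \<le> ennreal ?C" .
 show int: "L1 (\<lambda>x. norm (u x) powr p)"
  by (rule integrableI_bounded) (use le in \<open>auto simp: le_less_trans\<close>)
 show "Lp_int p u \<le> ?C"
  using le C0 by (simp add: nn_integral_eq_integral[OF int])
qed

lemma powr_2_eq: "norm (z::'a::real_normed_vector) powr 2 = (norm z)\<^sup>2"
 by (cases "norm z = 0") auto

text \<open>A bootstrap: the exponent rises by 1 at each stage, within the gain below 2 that
  \<open>Lp_step\<close> permits.\<close>

lemma Lp_bound_nat:
 "\<exists>C. \<forall>u\<in>W12. mass u \<le> A \<longrightarrow> gmass u \<le> G \<longrightarrow>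
   L1 (\<lambda>x. norm (u x) powr (real n + 2)) \<and> (Lp_int (real n + 2) u) \<le> C"
proof (induction n)
 case 0
 show ?case
  by (rule exI[of _ A]) (auto simp: powr_2_eq mass_def[symmetric] L2_integrable W12_L2)
next
 case (Suc n)
 then obtain C where C: "\<And>u. u \<in> W12 \<Longrightarrow> mass u \<le> A \<Longrightarrow> gmass u \<le> G \<Longrightarrow>
   L1 (\<lambda>x. norm (u x) powr (real n + 2)) \<and> (Lp_int (real n + 2) u) \<le> C" by blast
 define r p where "r = real n + 2" and "p = real (Suc n) + 2"
 define B where "B = max C 1"
 have rp: "r \<ge> 2" "2 < p" "p < r + 2" "B > 0" by (auto simp: r_def p_def B_def)
 have "L1 (\<lambda>x. norm (u x) powr p) \<and> (Lp_int p u) \<le>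
    3 powr p * p * (A / 9 * (1 powr (p - 2) / (p - 2)) + 4 / pi * B * G * (1 powr (p - r - 2) / (r + 2 - p)))"
  if u: "u \<in> W12" "mass u \<le> A" "gmass u \<le> G" for u
 proof -
  have i: "L1 (\<lambda>x. norm (u x) powr r)" "Lp_int r u \<le> B"
   using C[OF u] by (auto simp: r_def B_def)
  note st = Lp_step[OF u(1) rp(1) i rp(4) rp(2,3), of 1]
  have "3 powr p * p * (mass u / 9 * (1 powr (p - 2) / (p - 2)) + 4 / pi * B * gmass u * (1 powr (p - r - 2) / (r + 2 - p)))
   \<le> 3 powr p * p * (A / 9 * (1 powr (p - 2) / (p - 2)) + 4 / pi * B * G * (1 powr (p - r - 2) / (r + 2 - p)))"
   using u rp by (intro mult_left_mono add_mono mult_right_mono divide_right_mono) auto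
  from order_trans[OF st(2) this] st(1) show ?thesis by simp
 qed
 then show ?case unfolding p_def by blast
qed

lemma powr_le_add_powr:
 assumes "a \<le> b" "b \<le> c" "0 \<le> (t::real)" shows "t powr b \<le> t powr a + t powr c"
proof (cases "t \<le> 1")
 case True
 then have "t powr b \<le> t powr a" using assms by (cases "t = 0") (auto intro: powr_mono')
 then show ?thesis by (simp add: add_increasing2)
next
 case False
 then have "t powr b \<le> t powr c" using assms by (intro powr_mono) auto
 then show ?thesis by (simp add: add_increasing)
qed

lemma Lp_bound:
 assumes p: "p \<ge> 2"
 shows "\<exists>C. \<forall>u\<in>W12. mass u \<le> A \<longrightarrow> gmass u \<le> G \<longrightarrow>
   L1 (\<lambda>x. norm (u x) powr p) \<and> (Lp_int p u) \<le> C"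
proof -
 obtain n where n: "p \<le> real n" using real_arch_simple by blast
 obtain C where C: "\<And>u. u \<in> W12 \<Longrightarrow> mass u \<le> A \<Longrightarrow> gmass u \<le> G \<Longrightarrow>
   L1 (\<lambda>x. norm (u x) powr (real n + 2)) \<and> (Lp_int (real n + 2) u) \<le> C"
  using Lp_bound_nat[of A G n] by blast
 have "L1 (\<lambda>x. norm (u x) powr p) \<and> (Lp_int p u) \<le> A + C"
  if u: "u \<in> W12" "mass u \<le> A" "gmass u \<le> G" for u
 proof -
  note [measurable] = L2_measurable[OF W12_L2[OF u(1)]]
  have i2: "L1 (\<lambda>x. norm (u x) powr 2)"
   using L2_integrable[OF W12_L2[OF u(1)]] by (simp only: powr_2_eq)
  have iC: "L1 (\<lambda>x. norm (u x) powr (real n + 2))" using C[OF u] by blast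
  have le: "norm (u x) powr p \<le> norm (u x) powr 2 + norm (u x) powr (real n + 2)" for x
   using p n by (intro powr_le_add_powr) auto
  have i: "L1 (\<lambda>x. norm (u x) powr p)"
   by (rule integrable_dominated[OF Bochner_Integration.integrable_add[OF i2 iC]]) (use le in auto)
  have "Lp_int p u \<le> (LBINT x. norm (u x) powr 2 + norm (u x) powr (real n + 2))"
   by (rule integral_mono[OF i Bochner_Integration.integrable_add[OF i2 iC] le])
  also have "\<dots> = mass u + Lp_int (real n + 2) u"
   using i2 iC by (simp add: mass_def powr_2_eq)
  finally show ?thesis using i C[OF u] u by auto
 qed
 then show ?thesis by blast
qed

section \<open>Lower semicontinuity and compactness\<close>

definition restr :: "real \<Rightarrow> wfun \<Rightarrow> wfun" where
 "restr R u = (\<lambda>x. indicator (cball 0 R) x *\<^sub>R u x)"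

lemma restr_L2: assumes "u \<in> L2" shows "restr R u \<in> L2"
proof (rule L2_bound[OF _ L2_integrable[OF assms]])
 show "restr R u \<in> borel_fun" using L2_measurable[OF assms] by (simp add: restr_def[abs_def])
qed (auto simp: restr_def split: split_indicator)

lemma mass_restr_le: assumes "u \<in> L2" shows "mass (restr R u) \<le> mass u"
 unfolding mass_def by (rule integral_mono[OF L2_integrable[OF restr_L2[OF assms]] L2_integrable[OF assms]])
  (auto simp: restr_def split: split_indicator)

lemma mass_restr_mono:
 assumes "u \<in> L2" "R \<le> S" shows "mass (restr R u) \<le> mass (restr S u)"
 unfolding mass_def by (rule integral_mono[OF L2_integrable[OF restr_L2[OF assms(1)]] L2_integrable[OF restr_L2[OF assms(1)]]])
  (use assms(2) in \<open>auto simp: restr_def split: split_indicator\<close>)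

lemma restr_diff: "restr R (\<lambda>x. u x - v x) = (\<lambda>x. restr R u x - restr R v x)"
 by (simp add: restr_def scaleR_diff_right)

lemma mass_restr_tendsto:
 assumes "u \<in> L2" shows "(\<lambda>n. mass (restr (real n) u)) ----> mass u"
 unfolding mass_def
proof (rule integral_dominated_convergence[OF _ _ L2_integrable[OF assms]])
 show "AE x in lborel. (\<lambda>n. (norm (restr (real n) u x))\<^sup>2) ----> (norm (u x))\<^sup>2"
 proof (rule AE_I2)
  fix x :: "real^2"
  obtain N where "norm x \<le> real N" using real_arch_simple by blast
  then have "eventually (\<lambda>n. (norm (restr (real n) u x))\<^sup>2 = (norm (u x))\<^sup>2) sequentially"
   by (intro eventually_sequentiallyI[of N]) (auto simp: restr_def split: split_indicator)
  then show "(\<lambda>n. (norm (restr (real n) u x))\<^sup>2) ----> (norm (u x))\<^sup>2" by (rule tendsto_eventually)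
 qed
qed (use L2_measurable[OF assms] L2_measurable[OF restr_L2[OF assms]] in \<open>auto simp: restr_def split: split_indicator\<close>)

lemma gmass_diff_sum:
 assumes "u \<in> W12" "v \<in> W12"
 shows "gmass (\<lambda>x. u x - v x) = (\<Sum>i\<in>UNIV. mass (\<lambda>x. weak_pderiv i u x - weak_pderiv i v x))"
proof -
 note U = W12_D[OF assms(1)] and V = W12_D[OF assms(2)]
 have h: "has_weak_pderiv i (\<lambda>x. u x - v x) (\<lambda>x. weak_pderiv i u x - weak_pderiv i v x)" for i
 proof -
  have "has_weak_pderiv i (\<lambda>x. (-1) * v x) (\<lambda>x. (-1) * weak_pderiv i v x)"
   by (rule has_weak_pderiv_cmult[OF V(3)])
  from has_weak_pderiv_add[OF U(1) L2_cmult[OF V(1)] U(2) L2_cmult[OF V(2)] U(3) this] show ?thesis by simp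
 qed
 have l: "(\<lambda>x. weak_pderiv i u x - weak_pderiv i v x) \<in> L2" for i by (rule L2_diff[OF U(2) V(2)])
 have "grad_ip (\<lambda>x. u x - v x) (\<lambda>x. u x - v x) =
  (\<Sum>i\<in>UNIV. L2_ip (\<lambda>x. weak_pderiv i u x - weak_pderiv i v x) (\<lambda>x. weak_pderiv i u x - weak_pderiv i v x))"
  by (rule grad_ip_eq[OF W12_diff[OF assms] W12_diff[OF assms] l h l h])
 then show ?thesis by (simp add: gmass_def L2_ip_self[OF l])
qed

lemma gmass_eq_sum_of:
 assumes "u \<in> W12" "\<And>i. g i \<in> L2" "\<And>i. has_weak_pderiv i u (g i)"
 shows "gmass u = (\<Sum>i\<in>UNIV. mass (g i))"
 using grad_ip_eq[OF assms(1,1,2,3,2,3)] by (simp add: gmass_def L2_ip_self assms(2))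

lemma L2_pairing_tendsto:
 assumes f: "\<And>n. f n \<in> L2" "f0 \<in> L2" and g: "g \<in> L2" and l: "(\<lambda>n. L2_dist (f n) f0) ----> 0"
 shows "(\<lambda>n. \<integral>x. f n x * g x \<partial>lborel) ----> (LBINT x. f0 x * g x)"
proof -
 have "(LBINT x. f n x * g x) - (LBINT x. f0 x * g x) = (LBINT x. (f n x - f0 x) * g x)" for n
  using L2_mult_integrable[OF f(1) g] L2_mult_integrable[OF f(2) g] by (simp add: left_diff_distrib)
 then have "norm ((LBINT x. f n x * g x) - (LBINT x. f0 x * g x)) \<le> L2_dist (f n) f0 * nrm g" for n
  using L2_mult_le[OF L2_diff[OF f] g] by simp
 then show ?thesis
  by (intro LIM_zero_cancel[OF Lim_null_comparison[OF always_eventually tendsto_mult_left_zero[OF l]]]) auto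
qed

text \<open>Weak lower semicontinuity of the Dirichlet integral, without weak compactness: minimise it over the
 convex sets of functions close to the limit; by the parallelogram law the minimising gradients are Cauchy.\<close>

lemma grad_lsc:
 assumes \<phi>n: "\<And>n. \<phi>n n \<in> W12" and \<phi>: "\<phi> \<in> L2"
  and loc: "\<And>R. (\<lambda>n. mass (restr R (\<lambda>x. \<phi>n n x - \<phi> x))) ----> 0"
  and a: "(\<lambda>n. gmass (\<phi>n n)) ----> a"
 shows "\<phi> \<in> W12" "gmass \<phi> \<le> a"
proof -
 \<comment> \<open>Competitors close to \<phi> on the ball of radius m. These sets decrease in m,
   and each contains the given sequence from some index on.\<close>
 define K where "K = (\<lambda>m. {\<psi>\<in>W12. mass (restr (real m) (\<lambda>x. \<psi> x - \<phi> x)) \<le> inverse (real (Suc m))})"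
 have Kev: "eventually (\<lambda>n. \<phi>n n \<in> K m) sequentially" for m
  using order_tendstoD(2)[OF loc[of "real m"], of "inverse (real (Suc m))"]
  by (auto simp: K_def \<phi>n elim!: eventually_mono)
 have Kdec: "K n \<subseteq> K m" if "m \<le> n" for m n
 proof
  fix \<psi> assume "\<psi> \<in> K n"
  then have p: "\<psi> \<in> W12" "mass (restr (real n) (\<lambda>x. \<psi> x - \<phi> x)) \<le> inverse (real (Suc n))" by (auto simp: K_def)
  have "mass (restr (real m) (\<lambda>x. \<psi> x - \<phi> x)) \<le> mass (restr (real n) (\<lambda>x. \<psi> x - \<phi> x))"
   using that by (intro mass_restr_mono L2_diff W12_L2 p \<phi>) auto
  also have "\<dots> \<le> inverse (real (Suc m))" using p(2) that by (rule_tac order_trans) (auto intro!: le_imp_inverse_le)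
  finally show "\<psi> \<in> K m" using p by (simp add: K_def)
 qed
 define d where "d = (\<lambda>m. Inf (gmass ` K m))"
 have bdd: "bdd_below (gmass ` K m)" for m by (rule bdd_belowI[of _ 0]) (auto simp: K_def gmass_nonneg)
 have ne: "gmass ` K m \<noteq> {}" for m
  using eventually_happens[OF Kev[of m]] by auto
 have dle: "d m \<le> gmass \<psi>" if "\<psi> \<in> K m" for m \<psi> unfolding d_def by (rule cInf_lower[OF _ bdd]) (use that in auto)
 have da: "d m \<le> a" for m
  by (rule tendsto_lowerbound[OF a]) (use Kev[of m] dle in \<open>auto elim!: eventually_mono\<close>)
 have dinc: "incseq d"
  unfolding d_def by (intro monoI cInf_superset_mono[OF ne bdd] image_mono Kdec)
 then obtain D where D: "d ----> D" using incseq_convergent[OF dinc, of a] da by blast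
 have Da: "D \<le> a" by (rule LIMSEQ_le_const2[OF D]) (use da in auto)
 have "\<exists>\<psi>\<in>K m. gmass \<psi> < d m + inverse (real (Suc m))" for m
  using cInf_lessD[OF ne, of m "d m + inverse (real (Suc m))"] by (auto simp: d_def)
 then obtain \<psi> where \<psi>: "\<And>m. \<psi> m \<in> K m" "\<And>m. gmass (\<psi> m) < d m + inverse (real (Suc m))" by metis
 have \<psi>W: "\<psi> m \<in> W12" for m using \<psi>(1) by (auto simp: K_def)
 note P = W12_D[OF \<psi>W]
 \<comment> \<open>Midpoints remain admissible, so their energy is at least \<open>d m\<close>. In
   the parallelogram law this leaves only 2 (D - d m) + 4/(m+1) for the energy of the
   difference.\<close>
 have mid: "d m \<le> gmass (\<lambda>x. (1/2) * (\<psi> m x + \<psi> j x))" if "m \<le> j" for m j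
 proof (rule dle)
  have j: "\<psi> j \<in> K m" using \<psi>(1) Kdec[OF that] by blast
  let ?f = "restr (real m) (\<lambda>x. \<psi> m x - \<phi> x)" and ?g = "restr (real m) (\<lambda>x. \<psi> j x - \<phi> x)"
  have L: "?f \<in> L2" "?g \<in> L2" by (intro restr_L2 L2_diff P \<phi>)+
  have e: "restr (real m) (\<lambda>x. (1/2) * (\<psi> m x + \<psi> j x) - \<phi> x) = (\<lambda>x. (1/2) * (?f x + ?g x))"
   by (rule ext) (simp add: restr_def algebra_simps scaleR_conv_of_real)
  have "mass (\<lambda>x. ?f x + ?g x) \<le> 2 * mass ?f + 2 * mass ?g"
   using mass_parallelogram[OF L] mass_nonneg[of "\<lambda>x. ?f x - ?g x"] by linarith
  then have "mass (restr (real m) (\<lambda>x. (1/2) * (\<psi> m x + \<psi> j x) - \<phi> x)) \<le> (1/4) * (2 * mass ?f + 2 * mass ?g)"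
   unfolding e mass_cmult by (simp add: power2_eq_square)
  also have "\<dots> \<le> inverse (real (Suc m))" using \<psi>(1)[of m] j by (simp add: K_def)
  finally show "(\<lambda>x. (1/2) * (\<psi> m x + \<psi> j x)) \<in> K m"
   unfolding K_def using W12_cmult[OF W12_add[OF \<psi>W \<psi>W]] by blast
 qed
 have cauchy: "gmass (\<lambda>x. \<psi> m x - \<psi> j x) \<le> 2 * (D - d m) + 4 * inverse (real (Suc m))" if "m \<le> j" for m j
 proof -
  have "gmass (\<lambda>x. (1/2) * (\<psi> m x + \<psi> j x)) = (1/4) * gmass (\<lambda>x. \<psi> m x + \<psi> j x)"
   by (subst gmass_cmult[OF W12_add[OF \<psi>W \<psi>W]]) (simp add: power2_eq_square)
  with mid[OF that] have "4 * d m \<le> gmass (\<lambda>x. \<psi> m x + \<psi> j x)" by simp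
  moreover have "d j \<le> D" using incseq_le[OF dinc D] .
  moreover have "inverse (real (Suc j)) \<le> inverse (real (Suc m))" using that by (intro le_imp_inverse_le) auto
  moreover have "Q \<le> 2 * (E - dm) + 4 * k"
   if "4 * dm \<le> S" "dj \<le> E" "l \<le> k" "Q = 2 * gm + 2 * gj - S" "gm < dm + k" "gj < dj + l"
   for Q E dm k S dj l gm gj :: real using that by argo
  ultimately show ?thesis
   using gmass_parallelogram[OF \<psi>W \<psi>W, of m j] \<psi>(2)[of m] \<psi>(2)[of j] by blast
 qed
 have lim0: "(\<lambda>m. 2 * (D - d m) + 4 * inverse (real (Suc m))) ----> 0"
 proof -
  have "(\<lambda>m. 2 * (D - d m) + 4 * inverse (real (Suc m))) ----> 2 * (D - D) + 4 * 0"
   by (intro tendsto_intros D LIMSEQ_inverse_real_of_nat)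
  then show ?thesis by simp
 qed
 have "\<exists>g\<in>L2. (\<lambda>m. L2_dist (weak_pderiv i (\<psi> m)) g) ----> 0" for i
 proof (rule L2_complete[OF P(2)])
  fix e :: real assume "e > 0"
  then obtain N where N: "\<And>m. m \<ge> N \<Longrightarrow> 2 * (D - d m) + 4 * inverse (real (Suc m)) < e\<^sup>2"
   using order_tendstoD(2)[OF lim0, of "e\<^sup>2"] by (auto simp: eventually_sequentially)
  have lt: "L2_dist (weak_pderiv i (\<psi> m)) (weak_pderiv i (\<psi> j)) < e" if "N \<le> m" "m \<le> j" for m j
  proof -
   have "mass (\<lambda>x. weak_pderiv i (\<psi> m) x - weak_pderiv i (\<psi> j) x) \<le> gmass (\<lambda>x. \<psi> m x - \<psi> j x)"
    unfolding gmass_diff_sum[OF \<psi>W \<psi>W] by (rule member_le_sum) auto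
   also have "\<dots> < e\<^sup>2" using cauchy[OF that(2)] N[OF that(1)] by linarith
   finally have "sqrt (mass (\<lambda>x. weak_pderiv i (\<psi> m) x - weak_pderiv i (\<psi> j) x)) < sqrt (e\<^sup>2)" by (rule real_sqrt_less_mono)
   then show ?thesis using \<open>e > 0\<close> by (simp add: nrm_def)
  qed
  have "L2_dist (weak_pderiv i (\<psi> m)) (weak_pderiv i (\<psi> j)) < e" if "N \<le> m" "N \<le> j" for m j
  proof (cases "m \<le> j")
   case True then show ?thesis using lt that by blast
  next
   case False then show ?thesis using lt[of j m] that by (subst nrm_minus_commute) simp
  qed
  then show "\<exists>N. \<forall>m\<ge>N. \<forall>j\<ge>N. L2_dist (weak_pderiv i (\<psi> m)) (weak_pderiv i (\<psi> j)) < e" by blast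
 qed
 then have "\<forall>i. \<exists>g. g \<in> L2 \<and> (\<lambda>m. L2_dist (weak_pderiv i (\<psi> m)) g) ----> 0" by blast
 from choice[OF this] obtain g where g: "\<And>i. g i \<in> L2" "\<And>i. (\<lambda>m. L2_dist (weak_pderiv i (\<psi> m)) (g i)) ----> 0"
  by blast
 have loc0: "(\<lambda>m. nrm (\<lambda>x. restr R (\<psi> m) x - restr R \<phi> x)) ----> 0" for R
 proof (rule Lim_null_comparison)
  show "\<forall>\<^sub>F m in sequentially. norm (nrm (\<lambda>x. restr R (\<psi> m) x - restr R \<phi> x)) \<le> sqrt (inverse (real (Suc m)))"
  proof (rule eventually_sequentiallyI[of "nat \<lceil>R\<rceil>"])
   fix m assume "nat \<lceil>R\<rceil> \<le> m"
   then have "mass (restr R (\<lambda>x. \<psi> m x - \<phi> x)) \<le> mass (restr (real m) (\<lambda>x. \<psi> m x - \<phi> x))"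
    by (intro mass_restr_mono L2_diff P \<phi>) linarith
   also have "\<dots> \<le> inverse (real (Suc m))" using \<psi>(1)[of m] by (simp add: K_def)
   finally show "norm (nrm (\<lambda>x. restr R (\<psi> m) x - restr R \<phi> x)) \<le> sqrt (inverse (real (Suc m)))"
    by (simp add: nrm_def restr_diff del: of_nat_Suc)
  qed
  show "(\<lambda>m. sqrt (inverse (real (Suc m)))) ----> 0"
   using tendsto_real_sqrt[OF LIMSEQ_inverse_real_of_nat] by simp
 qed
 have wk: "has_weak_pderiv i \<phi> (g i)" for i
  unfolding has_weak_pderiv_def
 proof
  fix \<eta> assume t: "\<eta> \<in> test_functions"
  let ?d = "\<lambda>x. complex_of_real (pderiv_fun i \<eta> x)" and ?e = "\<lambda>x. complex_of_real (\<eta> x)"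
  obtain R where R: "\<And>x i. norm x > R \<Longrightarrow> pderiv_fun i \<eta> x = 0"
   using test_functionsD(5)[OF t] by blast
  have rd: "restr R f x * ?d x = f x * ?d x" for f x using R[of x] by (auto simp: restr_def indicator_def not_le)
  note l1 = L2_pairing_tendsto[OF restr_L2[OF P(1)] restr_L2[OF \<phi>] test_L2(2)[OF t] loc0[of R], of i, unfolded rd]
   and l2 = L2_pairing_tendsto[OF P(2) g(1) test_L2(1)[OF t] g(2), of i]
  have "(LBINT x. \<psi> m x * ?d x) = - (LBINT x. weak_pderiv i (\<psi> m) x * ?e x)" for m
   using P(3)[where i=i] t by (auto simp: has_weak_pderiv_def)
  with l1 have "(\<lambda>m. - (LBINT x. weak_pderiv i (\<psi> m) x * ?e x)) ----> (LBINT x. \<phi> x * ?d x)" by simp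
  from LIMSEQ_unique[OF this tendsto_minus[OF l2]] show "(LBINT x. \<phi> x * ?d x) = - (LBINT x. g i x * ?e x)" .
 qed
 show \<phi>W: "\<phi> \<in> W12" by (rule W12I[OF \<phi> g(1) wk])
 have "(\<lambda>m. \<Sum>i\<in>UNIV. mass (weak_pderiv i (\<psi> m))) ----> (\<Sum>i\<in>UNIV. mass (g i))"
  by (intro tendsto_sum mass_tendsto P(2) g)
 then have "(\<lambda>m. gmass (\<psi> m)) ----> gmass \<phi>"
  by (simp add: gmass_eq_sum[OF \<psi>W] gmass_eq_sum_of[OF \<phi>W g(1) wk])
 moreover have "(\<lambda>m. d m + inverse (real (Suc m))) ----> D + 0" by (intro tendsto_intros D LIMSEQ_inverse_real_of_nat)
 ultimately have "gmass \<phi> \<le> D + 0" by (rule LIMSEQ_le) (use \<psi>(2) in \<open>auto intro: less_imp_le\<close>)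
 then show "gmass \<phi> \<le> a" using Da by simp
qed

lemma restr_mass_le_full:
 assumes "\<And>n. u n \<in> L2" "v \<in> L2" "(\<lambda>n. L2_dist (u n) v) ----> 0"
 shows "(\<lambda>n. mass (restr R (\<lambda>x. u n x - v x))) ----> 0"
proof (rule Lim_null_comparison)
 show "(\<lambda>n. mass (\<lambda>x. u n x - v x)) ----> 0"
  using assms(3) mass_tendsto_zero_iff[of "\<lambda>n x. u n x - v x"] by blast
 show "\<forall>\<^sub>F n in sequentially. norm (mass (restr R (\<lambda>x. u n x - v x))) \<le> mass (\<lambda>x. u n x - v x)"
  using mass_restr_le[OF L2_diff[OF assms(1,2)]] by simp
qed

lemma conv_heat_pairing:
 assumes t: "t > 0" and u: "u \<in> L2"
 shows "conv (heat t) u x = (LBINT y. complex_of_real (heat t (y + - x)) * u y)"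
proof -
 note [measurable] = L2_measurable[OF u]
 show ?thesis
  using integral_shift[of "\<lambda>y. complex_of_real (heat t (y + - x)) * u y" x]
  by (simp add: conv_def scaleR_conv_of_real add.commute)
qed

text \<open>Both bounds are Cauchy-Schwarz. The Lipschitz constant comes from
  \<open>translation_estimate\<close> for the heat kernel itself and depends on u only through its
  norm, which gives equicontinuity on bounded sets of L^2.\<close>

lemma conv_heat_bounds:
 assumes t: "t > 0" and u: "u \<in> L2"
 shows "norm (conv (heat t) u x) \<le> nrm (\<lambda>x. complex_of_real (heat t x)) * nrm u"
  and "norm (conv (heat t) u x - conv (heat t) u y) \<le> norm (x - y) * sqrt (gmass (\<lambda>x. complex_of_real (heat t x))) * nrm u"
proof -
 let ?h = "\<lambda>x. complex_of_real (heat t x)"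
 note hL = heat_L2[OF t]
 have hs: "(\<lambda>y. ?h (y + - x)) \<in> L2" for x by (rule L2_shift[OF hL])
 have "norm (conv (heat t) u x) \<le> nrm (\<lambda>y. ?h (y + - x)) * nrm u"
  unfolding conv_heat_pairing[OF t u] by (rule L2_mult_le[OF hs u])
 also have "nrm (\<lambda>y. ?h (y + - x)) = nrm ?h" by (rule nrm_shift) simp
 finally show "norm (conv (heat t) u x) \<le> nrm ?h * nrm u" .
 have "conv (heat t) u x - conv (heat t) u y = (LBINT z. (?h (z + - x) - ?h (z + - y)) * u z)"
  unfolding conv_heat_pairing[OF t u]
  using L2_mult_integrable[OF hs u] by (simp add: left_diff_distrib)
 then have "norm (conv (heat t) u x - conv (heat t) u y) \<le> nrm (\<lambda>z. ?h (z + - x) - ?h (z + - y)) * nrm u"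
  using L2_mult_le[OF L2_diff[OF hs hs] u] by simp
 also have "nrm (\<lambda>z. ?h (z + - x) - ?h (z + - y)) = nrm (\<lambda>z. ?h (z + (y - x)) - ?h z)"
  using nrm_shift[of "\<lambda>z. ?h (z + (y - x)) - ?h z" "- y"] by (simp add: algebra_simps)
 also have "\<dots> \<le> sqrt ((norm (y - x))\<^sup>2 * gmass ?h)"
  unfolding nrm_def by (intro real_sqrt_le_mono translation_estimate heat_W12 t)
 also have "\<dots> = norm (x - y) * sqrt (gmass ?h)" by (simp add: real_sqrt_mult norm_minus_commute)
 finally show "norm (conv (heat t) u x - conv (heat t) u y) \<le> norm (x - y) * sqrt (gmass ?h) * nrm u"
  by (simp add: mult_right_mono)
qed

lemma conv_heat_diff:
 assumes t: "t > 0" and u: "u \<in> L2" and v: "v \<in> L2"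
 shows "conv (heat t) (\<lambda>x. u x - v x) x = conv (heat t) u x - conv (heat t) v x"
 unfolding conv_heat_pairing[OF t u] conv_heat_pairing[OF t v] conv_heat_pairing[OF t L2_diff[OF u v]]
 using L2_mult_integrable[OF L2_shift[OF heat_L2[OF t], of "- x"], simplified] u v by (simp add: right_diff_distrib)

section \<open>The logarithmic weight and compactness in L^2\<close>

definition lw :: "real^2 \<Rightarrow> real" where "lw x = ln (1 + norm x)"

abbreviation lmom :: "wfun \<Rightarrow> real" where "lmom u \<equiv> LBINT x. lw x * (norm (u x))\<^sup>2"
abbreviation L1_lw :: "wfun \<Rightarrow> bool" where "L1_lw u \<equiv> L1 (\<lambda>x. lw x * (norm (u x))\<^sup>2)"

lemma lw_nonneg [simp]: "0 \<le> lw x" by (simp add: lw_def)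

lemma lw_measurable [measurable]: "lw \<in> borel_fun" by (simp add: lw_def[abs_def])

lemma lw_add: "lw (x + y) \<le> lw x + lw y"
proof -
 have "1 + norm (x + y) \<le> (1 + norm x) * (1 + norm y)"
  using norm_triangle_ineq[of x y]
   mult_nonneg_nonneg[OF norm_ge_zero norm_ge_zero, of x y] unfolding distrib_left distrib_right by linarith
 then have "ln (1 + norm (x + y)) \<le> ln ((1 + norm x) * (1 + norm y))"
  by (intro ln_mono) (auto intro: add_pos_nonneg mult_pos_pos)
 also have "\<dots> = lw x + lw y"
 proof -
  have "1 + norm z \<noteq> 0" for z :: "real^2" using norm_ge_zero[of z] by linarith
  then show ?thesis unfolding lw_def by (subst ln_mult) auto
 qed
 finally show ?thesis by (simp add: lw_def)
qed

lemma lw_uminus [simp]: "lw (- x) = lw x" by (simp add: lw_def)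

lemma lw_diff: "lw (x - y) \<le> lw x + lw y"
 using lw_add[of x "- y"] by simp

lemma tail_estimate:
 assumes u: "u \<in> L2" and i: "L1_lw u"
  and C: "lmom u \<le> C" and R: "R > 0"
 shows "mass (\<lambda>x. u x - restr R u x) \<le> C / ln (1 + R)"
proof -
 have l: "ln (1 + R) > 0" using R by simp
 have L: "(\<lambda>x. u x - restr R u x) \<in> L2" by (rule L2_diff[OF u restr_L2[OF u]])
 have "mass (\<lambda>x. u x - restr R u x) \<le> (LBINT x. lw x * (norm (u x))\<^sup>2 / ln (1 + R))"
  unfolding mass_def
 proof (rule integral_mono[OF L2_integrable[OF L]])
  show "L1 (\<lambda>x. lw x * (norm (u x))\<^sup>2 / ln (1 + R))" using i by simp
  fix x
  show "(norm (u x - restr R u x))\<^sup>2 \<le> lw x * (norm (u x))\<^sup>2 / ln (1 + R)"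
  proof (cases "norm x \<le> R")
   case True then show ?thesis using l by (simp add: restr_def)
  next
   case False
   then have "ln (1 + R) \<le> lw x" using R by (simp add: lw_def)
   then have "ln (1 + R) * (norm (u x))\<^sup>2 \<le> lw x * (norm (u x))\<^sup>2" by (intro mult_right_mono) auto
   then show ?thesis using False l by (simp add: restr_def field_simps)
  qed
 qed
 also have "\<dots> \<le> C / ln (1 + R)" using C l by (simp add: divide_right_mono)
 finally show ?thesis .
qed

lemma nrm_triangle5:
 assumes "a \<in> L2" "b \<in> L2" "c \<in> L2" "d \<in> L2"
 shows "L2_dist a d \<le> L2_dist a b + L2_dist b c + L2_dist c d"
 using nrm_triangle3[of a b d] nrm_triangle3[of b c d] assms by simp

text \<open>The tails are small by the logarithmic moments; on a ball the heat regularisations are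
  uniformly bounded and equicontinuous, so Arzela-Ascoli applies. Instead of a bound in
  \<open>W12\<close>, which charged functions do not satisfy, approximation by functions of bounded
  Dirichlet energy is assumed at every error e.\<close>

lemma L2_compactness:
 assumes w: "\<And>n. w n \<in> L2" and A: "\<And>n. nrm (w n) \<le> A"
  and iC: "\<And>n. L1_lw (w n)"
  and C: "\<And>n. lmom (w n) \<le> C"
  and app: "\<And>e. e > 0 \<Longrightarrow> \<exists>G. \<forall>n. \<exists>a\<in>W12. gmass a \<le> G \<and> L2_dist (w n) a \<le> e"
 shows "\<exists>r v. strict_mono (r :: nat \<Rightarrow> nat) \<and> v \<in> L2 \<and> (\<lambda>n. L2_dist (w (r n)) v) ----> 0"
proof -
 have A0: "A \<ge> 0" using A[of 0] nrm_nonneg[of "w 0"] by linarith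
 have C0: "C \<ge> 0" using C[of 0] by (rule_tac order_trans[OF integral_nonneg_AE]) auto
 define P where "P = (\<lambda>(n::nat) (s::nat\<Rightarrow>nat). \<forall>i j. L2_dist (w (s i)) (w (s j)) \<le> inverse (real (Suc n)))"
 have sub: "\<exists>r'. strict_mono r' \<and> P n (s \<circ> r')" for n and s :: "nat \<Rightarrow> nat"
 proof -
  \<comment> \<open>Error budget: 3 + 1 + 3 for comparing two members on the ball through their
    regularisations, and 1 for each of the two tails.\<close>
  define \<epsilon> where "\<epsilon> = inverse (real (Suc n)) / 9"
  have e0: "\<epsilon> > 0" by (simp add: \<epsilon>_def)
  obtain G0 where G0: "\<And>n. \<exists>a\<in>W12. gmass a \<le> G0 \<and> L2_dist (w n) a \<le> \<epsilon>" using app[OF e0] by blast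
  define G where "G = max G0 1"
  have G: "G > 0" "\<And>n. \<exists>a\<in>W12. gmass a \<le> G \<and> L2_dist (w n) a \<le> \<epsilon>"
   using G0 by (auto simp: G_def) (meson max.coboundedI1)
  define t where "t = \<epsilon>\<^sup>2 / (16 * G)"
  have t: "t > 0" using e0 G(1) by (simp add: t_def)
  define F where "F = (\<lambda>m. conv (heat t) (w m))"
  have FL: "F m \<in> L2" for m unfolding F_def by (rule conv_contraction(1)[OF heat_prob_density[OF t] w])
  have Fw: "L2_dist (F m) (w m) \<le> 3 * \<epsilon>" for m
  proof -
   obtain a where a: "a \<in> W12" "gmass a \<le> G" "L2_dist (w m) a \<le> \<epsilon>" using G(2) by blast
   note aL = W12_L2[OF a(1)]
   have cL: "conv (heat t) a \<in> L2" by (rule conv_contraction(1)[OF heat_prob_density[OF t] aL])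
   have "L2_dist (F m) (w m) \<le> L2_dist (F m) (conv (heat t) a) + L2_dist (conv (heat t) a) a + L2_dist a (w m)"
    by (rule nrm_triangle5[OF FL cL aL w])
   moreover have "L2_dist (F m) (conv (heat t) a) \<le> \<epsilon>"
   proof -
    have "(\<lambda>x. F m x - conv (heat t) a x) = conv (heat t) (\<lambda>x. w m x - a x)"
     unfolding F_def by (rule ext) (simp add: conv_heat_diff[OF t w aL])
    then have "L2_dist (F m) (conv (heat t) a) \<le> L2_dist (w m) a"
     unfolding nrm_def using conv_contraction(2)[OF heat_prob_density[OF t] L2_diff[OF w aL]]
     by (simp add: real_sqrt_le_mono)
    then show ?thesis using a(3) by linarith
   qed
   moreover have "L2_dist (conv (heat t) a) a \<le> \<epsilon>"
   proof -
    have "mass (\<lambda>x. conv (heat t) a x - a x) \<le> 16 * t * gmass a" by (rule heat_conv_estimate[OF t a(1)])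
    also have "\<dots> \<le> 16 * t * G" using a(2) t by (intro mult_left_mono) auto
    also have "\<dots> = \<epsilon>\<^sup>2" using G(1) by (simp add: t_def)
    finally show ?thesis unfolding nrm_def using e0 by (intro real_le_lsqrt) auto
   qed
   moreover have "L2_dist a (w m) \<le> \<epsilon>" using a(3) nrm_minus_commute[of a "w m"] by simp
   ultimately show ?thesis by linarith
  qed
  obtain R where R: "R > 0" "C / ln (1 + R) \<le> \<epsilon>\<^sup>2"
  proof -
   define R where "R = exp (C / \<epsilon>\<^sup>2 + 1) - 1"
   have "R > 0" using C0 e0 by (simp add: R_def add_nonneg_pos)
   moreover have "ln (1 + R) = C / \<epsilon>\<^sup>2 + 1" by (simp add: R_def)
   moreover have "C / (C / \<epsilon>\<^sup>2 + 1) \<le> \<epsilon>\<^sup>2"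
   proof -
    have "C / \<epsilon>\<^sup>2 + 1 > 0" using C0 e0 by (intro add_nonneg_pos) auto
    then show ?thesis using e0 by (simp add: pos_divide_le_eq distrib_left)
   qed
   ultimately show ?thesis using that by auto
  qed
  have tail: "L2_dist (w m) (restr R (w m)) \<le> \<epsilon>" for m
   using tail_estimate[OF w iC C R(1), of m] R(2) e0 unfolding nrm_def
   by (intro real_le_lsqrt) auto
  define B where "B = measure lborel (cball (0::real^2) R)"
  \<comment> \<open>A uniform distance 2 e' on a ball of area B amounts to at most 2 e' sqrt B \<le>
    \<epsilon> in L^2.\<close>
  define e' where "e' = \<epsilon> / (2 * (sqrt B + 1))"
  have B0: "B \<ge> 0" by (simp add: B_def)
  have e': "e' > 0" using e0 B0 by (simp add: e'_def add_nonneg_pos)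
  obtain g k where k: "strict_mono (k::nat\<Rightarrow>nat)"
   "\<And>e. 0 < e \<Longrightarrow> \<exists>N. \<forall>n x. n \<ge> N \<and> x \<in> cball 0 R \<longrightarrow> norm (F (s (k n)) x - g x) < e"
  proof (rule Arzela_Ascoli[where S="cball (0::real^2) R" and \<F>="\<lambda>n. F (s n)" and M="nrm (\<lambda>x. complex_of_real (heat t x)) * A"])
   show "norm (F (s n) x) \<le> nrm (\<lambda>x. complex_of_real (heat t x)) * A" for n x
    unfolding F_def using conv_heat_bounds(1)[OF t w, of "s n" x] mult_left_mono[OF A[of "s n"] nrm_nonneg]
    by (rule order_trans)
   fix x :: "real^2" and e :: real assume "0 < e"
   define L where "L = sqrt (gmass (\<lambda>x. complex_of_real (heat t x))) * A"
   have L0: "L \<ge> 0" unfolding L_def using A0 gmass_nonneg[OF heat_W12[OF t]] by simp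
   have Lip: "norm (F m x - F m y) \<le> norm (x - y) * L" for m y
   proof -
    have "norm (F m x - F m y) \<le> norm (x - y) * sqrt (gmass (\<lambda>x. complex_of_real (heat t x))) * nrm (w m)"
     unfolding F_def by (rule conv_heat_bounds(2)[OF t w])
    also have "\<dots> \<le> norm (x - y) * sqrt (gmass (\<lambda>x. complex_of_real (heat t x))) * A"
     using A gmass_nonneg[OF heat_W12[OF t]] by (intro mult_left_mono) auto
    finally show ?thesis by (simp add: L_def mult.assoc)
   qed
   show "\<exists>d>0. \<forall>n y. y \<in> cball 0 R \<and> norm (x - y) < d \<longrightarrow> norm (F (s n) x - F (s n) y) < e"
   proof (intro exI conjI allI impI)
    show "e / (L + 1) > 0" using \<open>0 < e\<close> L0 by simp
    fix n y assume "y \<in> cball 0 R \<and> norm (x - y) < e / (L + 1)"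
    then have "norm (x - y) * (L + 1) < e" using L0 by (simp add: pos_less_divide_eq)
    moreover have "norm (x - y) * L \<le> norm (x - y) * (L + 1)" by (intro mult_left_mono) auto
    ultimately show "norm (F (s n) x - F (s n) y) < e" using Lip[of "s n" y] by linarith
   qed
  qed auto
  obtain N where N: "\<And>n x. n \<ge> N \<Longrightarrow> x \<in> cball 0 R \<Longrightarrow> norm (F (s (k n)) x - g x) < e'"
   using k(2)[OF e'] by blast
  define r' where "r' = (\<lambda>n. k (n + N))"
  have "strict_mono r'" using k(1) by (auto simp: r'_def strict_mono_def)
  moreover have "P n (s \<circ> r')" unfolding P_def
  proof (intro allI)
   fix i j
   define a b where "a = s (r' i)" and "b = s (r' j)"
   have close: "nrm (restr R (\<lambda>x. F a x - F b x)) \<le> \<epsilon>"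
   proof -
    have "mass (restr R (\<lambda>x. F a x - F b x)) \<le> (LBINT x. (2 * e')\<^sup>2 * indicator (cball (0::real^2) R) x)"
     unfolding mass_def
    proof (rule integral_mono)
     show "L1 (\<lambda>x. (norm (restr R (\<lambda>x. F a x - F b x) x))\<^sup>2)"
      by (intro L2_integrable restr_L2 L2_diff FL)
     fix x
     show "(norm (restr R (\<lambda>x. F a x - F b x) x))\<^sup>2 \<le> (2 * e')\<^sup>2 * indicator (cball 0 R) x"
     proof (cases "x \<in> cball 0 R")
      case True
      have "norm (F a x - g x) < e'" "norm (F b x - g x) < e'"
       using N[of _ x] True by (auto simp: a_def b_def r'_def)
      then have "norm (F a x - F b x) \<le> 2 * e'"
       using norm_triangle_ineq4[of "F a x - g x" "F b x - g x"] by simp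
      then have "(norm (F a x - F b x))\<^sup>2 \<le> (2 * e')\<^sup>2" by (rule power_mono) simp
      then show ?thesis using True by (simp add: restr_def)
     qed (simp add: restr_def)
    qed simp
    also have "\<dots> = (2 * e' * sqrt B)\<^sup>2" using B0 by (simp add: B_def power_mult_distrib)
    finally have "nrm (restr R (\<lambda>x. F a x - F b x)) \<le> 2 * e' * sqrt B"
     unfolding nrm_def using e' B0 by (intro real_le_lsqrt) auto
    also have "\<dots> \<le> \<epsilon>" using e0 B0 by (simp add: e'_def divide_le_eq add_nonneg_pos)
    finally show ?thesis .
   qed
   have rd: "nrm (restr R (\<lambda>x. F m x - w m x)) \<le> 3 * \<epsilon>" for m
   proof -
    have "nrm (restr R (\<lambda>x. F m x - w m x)) \<le> L2_dist (F m) (w m)"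
     unfolding nrm_def by (intro real_sqrt_le_mono mass_restr_le L2_diff FL w)
    then show ?thesis using Fw[of m] by linarith
   qed
   have "L2_dist (restr R (w a)) (restr R (w b)) \<le>
     L2_dist (restr R (w a)) (restr R (F a)) + L2_dist (restr R (F a)) (restr R (F b)) + L2_dist (restr R (F b)) (restr R (w b))"
    by (intro nrm_triangle5 restr_L2 FL w)
   also have "L2_dist (restr R (w a)) (restr R (F a)) = nrm (restr R (\<lambda>x. F a x - w a x))"
    by (subst nrm_minus_commute) (simp add: restr_diff)
   also have "L2_dist (restr R (F b)) (restr R (w b)) = nrm (restr R (\<lambda>x. F b x - w b x))" by (simp add: restr_diff)
   also have "L2_dist (restr R (F a)) (restr R (F b)) = nrm (restr R (\<lambda>x. F a x - F b x))" by (simp add: restr_diff)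
   finally have "L2_dist (restr R (w a)) (restr R (w b)) \<le> 7 * \<epsilon>" using rd[of a] rd[of b] close by linarith
   moreover have "L2_dist (w a) (w b) \<le> L2_dist (w a) (restr R (w a)) + L2_dist (restr R (w a)) (restr R (w b)) + L2_dist (restr R (w b)) (w b)"
    by (intro nrm_triangle5 restr_L2 w)
   moreover have "L2_dist (restr R (w b)) (w b) \<le> \<epsilon>" using tail[of b] by (subst nrm_minus_commute)
   ultimately have "L2_dist (w a) (w b) \<le> 9 * \<epsilon>" using tail[of a] by linarith
   then show "nrm (\<lambda>x. w ((s \<circ> r') i) x - w ((s \<circ> r') j) x) \<le> inverse (real (Suc n))"
    by (simp add: a_def b_def \<epsilon>_def)
  qed
  ultimately show ?thesis by blast
 qed
 interpret subseqs P by unfold_locales (use sub in blast)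
 \<comment> \<open>The property of stage k survives passage to subsequences, so the diagonal
   sequence has it from index \<open>Suc k\<close> on.\<close>
 have diag: "P k (diagseq \<circ> ((+) (Suc k)))" for k
  by (rule diagseq_holds) (auto simp: P_def)
 have "\<exists>v\<in>L2. (\<lambda>n. L2_dist (w (diagseq n)) v) ----> 0"
 proof (rule L2_complete[OF w])
  fix e :: real assume "e > 0"
  then obtain k where k: "inverse (real (Suc k)) < e" using reals_Archimedean by blast
  have "L2_dist (w (diagseq i)) (w (diagseq j)) < e" if "i \<ge> Suc k" "j \<ge> Suc k" for i j
  proof -
   have "nrm (\<lambda>x. w (diagseq (Suc k + (i - Suc k))) x - w (diagseq (Suc k + (j - Suc k))) x) \<le> inverse (real (Suc k))"
    using diag[of k] unfolding P_def by (auto simp del: of_nat_Suc)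
   then show ?thesis using k that by simp
  qed
  then show "\<exists>N. \<forall>i\<ge>N. \<forall>j\<ge>N. L2_dist (w (diagseq i)) (w (diagseq j)) < e" by blast
 qed
 then show ?thesis using subseq_diagseq by blast
qed

section \<open>The Green function\<close>

definition gr :: "real \<Rightarrow> real^2 \<Rightarrow> real" where
 "gr l x = bessel_K0 (sqrt l * norm x) / (2 * pi)"

lemma Green_gr: "Green l x = complex_of_real (gr l x)"
 by (simp add: Green_def gr_def)

lemma exp_minus_le_powr:
 assumes "z > 0" "0 < a" "a \<le> (1::real)" shows "exp (- z) \<le> z powr (- a)"
proof -
 have "z powr a \<le> exp z"
 proof (cases "z \<le> 1")
  case True
  then have "z powr a \<le> 1" using assms by (intro powr_le1) auto
  also have "1 \<le> exp z" using assms by simp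
  finally show ?thesis .
 next
  case False
  then have "z powr a \<le> z powr 1" using assms by (intro powr_mono) auto
  also have "z powr 1 = z" using assms by simp
  also have "z \<le> exp z" using exp_ge_add_one_self[of z] by linarith
  finally show ?thesis .
 qed
 then show ?thesis using assms by (simp add: exp_minus powr_minus le_imp_inverse_le)
qed

lemma nn_integral_exp:
 assumes "a > 0"
 shows "(NNL t. ennreal (exp (- a * t)) * indicator {0..} t) = ennreal (1 / a)"
proof -
 have "((\<lambda>t. - exp (- a * t) / a) \<longlongrightarrow> - 0 / a) at_top"
 proof (intro tendsto_divide tendsto_minus tendsto_const)
  have "filterlim (\<lambda>t. - a * t) at_bot at_top"
   using assms by (simp add: filterlim_tendsto_pos_mult_at_top[OF tendsto_const _ filterlim_ident] filterlim_uminus_at_bot)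
  then show "((\<lambda>t. exp (- a * t)) \<longlongrightarrow> 0) at_top" by (rule filterlim_compose[OF exp_at_bot])
 qed (use assms in simp)
 then have "(NNL t. ennreal (exp (- a * t)) * indicator {0..} t) = ennreal (- 0 / a - (- exp (- a * 0) / a))"
  by (intro nn_integral_FTC_atLeast) (use assms in \<open>auto intro!: derivative_eq_intros\<close>)
 then show ?thesis by simp
qed

lemma nn_integral_Ioi_Ici:
 "(NNL t. f t * indicator {0<..} t) = (NNL t. f t * indicator {0..} (t::real))"
 by (intro nn_integral_cong_AE AE_I[where N="{0}"]) (auto split: split_indicator)

lemma nn_integral_exp':
 assumes "a > 0"
 shows "(NNL t. ennreal (exp (- a * t)) * indicator {0<..} t) = ennreal (1 / a)"
 unfolding nn_integral_Ioi_Ici by (rule nn_integral_exp[OF assms])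

lemma cosh_ge: "cosh t \<ge> (1::real)" "cosh t \<ge> exp t / 2"
 by (rule cosh_real_ge_1, simp add: cosh_def)

text \<open>From cosh t \<ge> 1 and cosh t \<ge> e^t / 2 one gets r cosh t \<ge> r/2 + (r/4) e^t.
  Estimating the second exponential by a power keeps integrability in t at the price of a
  singularity r^(-a) in place of the logarithmic one; a can be taken small, which suffices for every
  L^p.\<close>

lemma K0_nn_bound:
 assumes r: "r > 0" and a: "0 < a" "a \<le> 1"
 shows "(NNL t. ennreal (exp (- r * cosh t)) * indicator {0..} t)
   \<le> ennreal (exp (- r / 2) * (r / 4) powr (- a) / a)"
proof -
 have "(NNL t. ennreal (exp (- r * cosh t)) * indicator {0..} t) \<le>
   (NNL t. ennreal (exp (- r / 2) * (r / 4) powr (- a)) * (ennreal (exp (- a * t)) * indicator {0..} t))"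
 proof (rule nn_integral_mono)
  fix t :: real
  define z where "z = (r / 4) * exp t"
  have z: "z > 0" using r by (simp add: z_def)
  have "r * cosh t \<ge> r / 2 + z"
  proof -
   have "r * 1 \<le> r * cosh t" using r cosh_ge(1) by (intro mult_left_mono) auto
   moreover have "r * (exp t / 2) \<le> r * cosh t" using r cosh_ge(2) by (intro mult_left_mono) auto
   ultimately show ?thesis by (simp add: z_def)
  qed
  then have "exp (- r * cosh t) \<le> exp (- r / 2) * exp (- z)" by (simp flip: exp_add)
  also have "\<dots> \<le> exp (- r / 2) * z powr (- a)" by (intro mult_left_mono exp_minus_le_powr z a) auto
  also have "z powr (- a) = (r / 4) powr (- a) * exp (- a * t)"
  proof -
   have "z powr (- a) = (r / 4) powr (- a) * exp t powr (- a)"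
    unfolding z_def using r by (subst powr_mult) auto
   then show ?thesis by (simp add: exp_powr_real mult.commute)
  qed
  finally have "exp (- r * cosh t) \<le> exp (- r / 2) * (r / 4) powr (- a) * exp (- a * t)" by (simp add: mult.assoc)
  then show "ennreal (exp (- r * cosh t)) * indicator {0..} t \<le>
   ennreal (exp (- r / 2) * (r / 4) powr (- a)) * (ennreal (exp (- a * t)) * indicator {0..} t)"
   by (auto split: split_indicator simp: ennreal_leI simp flip: ennreal_mult)
 qed
 also have "\<dots> = ennreal (exp (- r / 2) * (r / 4) powr (- a)) * ennreal (1 / a)"
  by (subst nn_integral_cmult, measurable, simp only: nn_integral_exp[OF a(1)])
 also have "\<dots> = ennreal (exp (- r / 2) * (r / 4) powr (- a) / a)"
  using a by (simp flip: ennreal_mult)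
 finally show ?thesis .
qed

lemma bessel_K0_eq: "bessel_K0 r = (LBINT t. exp (- r * cosh t) * indicator {0..} t)"
 by (simp add: bessel_K0_def set_lebesgue_integral_def mult.commute)

lemma bessel_K0_nonneg: "bessel_K0 r \<ge> 0"
 unfolding bessel_K0_eq by (intro integral_nonneg_AE) auto

lemma cosh_measurable [measurable]: "(cosh :: real \<Rightarrow> real) \<in> borel_fun"
 by (intro borel_measurable_continuous_onI continuous_intros)

lemma bessel_K0_measurable [measurable]: "bessel_K0 \<in> borel_fun"
 unfolding bessel_K0_eq[abs_def] by measurable

lemma K0_nn:
 assumes r: "r > 0"
 shows "(NNL t. ennreal (exp (- r * cosh t)) * indicator {0..} t) = ennreal (bessel_K0 r)"
proof -
 have eq: "(NNL t. ennreal (exp (- r * cosh t)) * indicator {0..} t) =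
   (NNL t. ennreal (exp (- r * cosh t) * indicator {0..} t))"
  by (intro nn_integral_cong) (auto split: split_indicator)
 have "L1 (\<lambda>t. exp (- r * cosh t) * indicator {0..} t)"
 proof (rule integrableI_bounded)
  have "(NNL t. ennreal (norm (exp (- r * cosh t) * indicator {0..} t))) =
   (NNL t. ennreal (exp (- r * cosh t)) * indicator {0..} t)"
   by (intro nn_integral_cong) (auto split: split_indicator)
  also have "\<dots> < \<infinity>" using K0_nn_bound[OF r, of 1] by (auto simp: le_less_trans)
  finally show "(NNL t. ennreal (norm (exp (- r * cosh t) * indicator {0..} t))) < \<infinity>" .
 qed measurable
 then show ?thesis unfolding eq bessel_K0_eq by (rule nn_integral_eq_integral) auto
qed

lemma K0_bound:
 assumes r: "r > 0" and a: "0 < a" "a \<le> 1"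
 shows "bessel_K0 r \<le> exp (- r / 2) * (r / 4) powr (- a) / a"
 using K0_nn_bound[OF assms] a unfolding K0_nn[OF r] by simp

lemma gr_nonneg [simp]: "gr l x \<ge> 0" by (simp add: gr_def bessel_K0_nonneg)

lemma gr_measurable [measurable]: "gr l \<in> borel_fun"
 unfolding gr_def[abs_def] by measurable

lemma Green_measurable [measurable]: "Green l \<in> borel_fun"
 unfolding Green_gr[abs_def] by measurable

lemma K0_nn_full:
 assumes r: "r > 0"
 shows "(NNL t. ennreal (exp (- r * cosh t))) = ennreal (2 * bessel_K0 r)"
proof -
 have "(NNL t. ennreal (exp (- r * cosh t)) * indicator {..<0} t) =
   (NNL t. ennreal (exp (- r * cosh t)) * indicator {0<..} t)"
  by (subst nn_integral_real_affine[where c="-1" and t=0]) (auto intro!: nn_integral_cong split: split_indicator)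
 also have "\<dots> = ennreal (bessel_K0 r)" by (simp only: nn_integral_Ioi_Ici K0_nn[OF r])
 finally have neg: "(NNL t. ennreal (exp (- r * cosh t)) * indicator {..<0} t) = ennreal (bessel_K0 r)" .
 have "(NNL t. ennreal (exp (- r * cosh t))) =
  (NNL t. ennreal (exp (- r * cosh t)) * indicator {0..} t + ennreal (exp (- r * cosh t)) * indicator {..<0} t)"
  by (intro nn_integral_cong) (auto split: split_indicator)
 also have "\<dots> = ennreal (bessel_K0 r) + ennreal (bessel_K0 r)"
  by (subst nn_integral_add, measurable, simp only: neg K0_nn[OF r])
 also have "\<dots> = ennreal (2 * bessel_K0 r)" by (simp add: bessel_K0_nonneg flip: ennreal_plus)
 finally show ?thesis .
qed

text \<open>The substitution $t = \frac{|x|}{2\sqrt\lambda} e^\tau$ turns the heat kernel representation into that of $K_0$.\<close>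

lemma gr_heat:
 assumes l: "l > 0" and x: "x \<noteq> 0"
 shows "(NNL t. ennreal (exp (- l * t) * heat t x) * indicator {0<..} t) = ennreal (gr l x)"
proof -
 define r where "r = sqrt l * norm x"
 define c where "c = norm x / (2 * sqrt l)"
 have r: "r > 0" and c: "c > 0" using l x by (auto simp: r_def c_def)
 define f where "f = (\<lambda>t. exp (- l * t) * heat t x)"
 have fg: "f (c * exp \<tau>) * (c * exp \<tau>) = exp (- r * cosh \<tau>) / (4 * pi)" for \<tau>
 proof -
  have sl: "sqrt l * sqrt l = l" using l by simp
  have e: "l * (c * exp \<tau>) + (norm x)\<^sup>2 / (4 * (c * exp \<tau>)) = r * cosh \<tau>"
  proof -
   have "l * (c * exp \<tau>) = r / 2 * exp \<tau>"
    using l unfolding c_def r_def by (subst sl[symmetric]) (simp add: field_simps)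
   moreover have "(norm x)\<^sup>2 / (4 * (c * exp \<tau>)) = r / 2 * exp (- \<tau>)"
    using l x unfolding c_def r_def by (simp add: field_simps power2_eq_square exp_minus)
   ultimately show ?thesis by (simp add: cosh_def field_simps)
  qed
  have "f (c * exp \<tau>) * (c * exp \<tau>) = exp (- (l * (c * exp \<tau>) + (norm x)\<^sup>2 / (4 * (c * exp \<tau>)))) / (4 * pi)"
   using c by (simp add: f_def heat_def exp_add[symmetric] exp_diff exp_minus field_simps)
  then show ?thesis unfolding e by simp
 qed
 have int: "L1 (\<lambda>\<tau>. exp (- r * cosh \<tau>))"
  by (rule integrableI_bounded) (use K0_nn_full[OF r] in auto)
 have I: "(\<integral>\<tau>. exp (- r * cosh \<tau>) \<partial>lborel) = 2 * bessel_K0 r"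
  using nn_integral_eq_integral[OF int] K0_nn_full[OF r] bessel_K0_nonneg[of r] by (simp add: integral_nonneg_AE)
 have P1: "isCont f (c * exp \<tau>)" for \<tau> unfolding f_def heat_def using c by (intro continuous_intros) auto
 have P2: "0 \<le> f (c * exp \<tau>)" for \<tau> unfolding f_def using c by (simp add: heat_nonneg)
 have P3: "((ereal \<circ> (\<lambda>\<tau>. c * exp \<tau>) \<circ> real_of_ereal) \<longlongrightarrow> ereal 0) (at_right (- \<infinity>))"
  unfolding ereal_tendsto_simps using tendsto_mult_right_zero[OF exp_at_bot, of c] .
 have P4: "((ereal \<circ> (\<lambda>\<tau>. c * exp \<tau>) \<circ> real_of_ereal) \<longlongrightarrow> \<infinity>) (at_left \<infinity>)"
  unfolding ereal_tendsto_simps using filterlim_tendsto_pos_mult_at_top[OF tendsto_const c exp_at_top] .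
 have P5: "set_integrable lborel (einterval (- \<infinity>) \<infinity>) (\<lambda>\<tau>. f (c * exp \<tau>) * (c * exp \<tau>))"
  unfolding fg set_integrable_def using int by simp
 have P6: "((\<lambda>\<tau>. c * exp \<tau>) has_real_derivative c * exp \<tau>) (at \<tau>)" for \<tau> by (auto intro!: derivative_eq_intros)
 have P7: "isCont (\<lambda>\<tau>. c * exp \<tau>) \<tau>" for \<tau> by (intro continuous_intros)
 have P8: "0 \<le> c * exp \<tau>" for \<tau> using c by simp
 have P0: "- \<infinity> < (\<infinity>::ereal)" by simp
 note s = interval_integral_substitution_nonneg[OF P0 P6 P1 P7 P2 P8 P3 P4 P5]
 have i: "L1 (\<lambda>t. indicator {0<..} t * f t)" using s(1) by (simp add: set_integrable_def)
 have "(LBINT t. indicator {0<..} t * f t) = 2 * bessel_K0 r / (4 * pi)"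
  using s(2) I by (simp add: fg interval_lebesgue_integral_def set_lebesgue_integral_def)
 also have "\<dots> = gr l x" by (simp add: gr_def r_def)
 finally have e: "(LBINT t. indicator {0<..} t * f t) = gr l x" .
 have "(NNL t. ennreal (exp (- l * t) * heat t x) * indicator {0<..} t) = (NNL t. ennreal (indicator {0<..} t * f t))"
  by (intro nn_integral_cong) (auto simp: f_def split: split_indicator)
 also have "\<dots> = ennreal (gr l x)"
 proof (subst nn_integral_eq_integral[OF i])
  show "AE t in lborel. 0 \<le> indicator {0<..} t * f t"
   by (intro AE_I2) (auto simp: f_def heat_nonneg split: split_indicator)
 qed (simp only: e)
 finally show ?thesis .
qed

lemma heat_joint_measurable [measurable (raw)]:
 assumes [measurable]: "f \<in> borel_measurable M" "g \<in> borel_measurable M"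
 shows "(\<lambda>z. heat (f z) (g z)) \<in> borel_measurable M"
 unfolding heat_def by measurable

lemma heat_product:
 assumes "t > 0" "s > 0"
 shows "heat t x * heat s x = heat (t * s / (t + s)) x * (1 / (4 * pi * (t + s)))"
proof -
 define N where "N = (norm x)\<^sup>2"
 have "- N / (4 * t) + - N / (4 * s) = - N / (4 * (t * s / (t + s)))" using assms by (simp add: field_simps)
 then have e: "exp (- N / (4 * t)) * exp (- N / (4 * s)) = exp (- N / (4 * (t * s / (t + s))))"
  by (simp only: exp_add[symmetric])
 define X where "X = exp (- N / (4 * (t * s / (t + s))))"
 have "heat t x * heat s x = exp (- N / (4 * t)) * exp (- N / (4 * s)) / (16 * pi\<^sup>2 * (t * s))"
  unfolding heat_def N_def[symmetric] by (simp add: power2_eq_square)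
 also have "\<dots> = X / (16 * pi\<^sup>2 * (t * s))" unfolding e X_def ..
 also have "\<dots> = X / (4 * pi * (t * s / (t + s))) * (1 / (4 * pi * (t + s)))"
  using assms by (simp add: power2_eq_square)
 also have "X / (4 * pi * (t * s / (t + s))) = heat (t * s / (t + s)) x"
  unfolding heat_def X_def N_def ..
 finally show ?thesis .
qed

text \<open>This is 4 pi times the L^2 product of G_l and G_m; on the diagonal the quotient is
  replaced by its limit.\<close>

definition green_J :: "real \<Rightarrow> real \<Rightarrow> real" where
 "green_J l m = (if l = m then 1 / l else ln (l / m) / (l - m))"

lemma green_J_nonneg: "l > 0 \<Longrightarrow> m > 0 \<Longrightarrow> green_J l m \<ge> 0"
 by (auto simp: green_J_def zero_le_divide_iff)

lemma nn_integral_J: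
 assumes l: "l > 0" and m: "m > 0"
 shows "(NNL \<nu>. ennreal (1 / ((l + \<nu>) * (m + \<nu>))) * indicator {0..} \<nu>) = ennreal (green_J l m)"
proof (cases "l = m")
 case True
 have "((\<lambda>\<nu>. - inverse (l + \<nu>)) \<longlongrightarrow> - 0) at_top"
  by (intro tendsto_minus tendsto_inverse_0_at_top filterlim_tendsto_add_at_top[OF tendsto_const] filterlim_ident)
 then have "(NNL \<nu>. ennreal (1 / ((l + \<nu>) * (m + \<nu>))) * indicator {0..} \<nu>) = ennreal (- 0 - (- inverse (l + 0)))"
  by (intro nn_integral_FTC_atLeast)
   (use l True in \<open>auto intro!: derivative_eq_intros simp: power2_eq_square field_simps\<close>)
 then show ?thesis using True by (simp add: green_J_def inverse_eq_divide)
next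
 case False
 define F where "F = (\<lambda>\<nu>. (ln (m + \<nu>) - ln (l + \<nu>)) / (l - m))"
 have "((\<lambda>\<nu>. ln (m + \<nu>) - ln (l + \<nu>)) \<longlongrightarrow> 0) at_top" by real_asymp
 then have "(F \<longlongrightarrow> 0 / (l - m)) at_top" unfolding F_def using False by (intro tendsto_divide tendsto_const) auto
 then have "(NNL \<nu>. ennreal (1 / ((l + \<nu>) * (m + \<nu>))) * indicator {0..} \<nu>) = ennreal (0 / (l - m) - F 0)"
 proof (intro nn_integral_FTC_atLeast)
  fix \<nu> :: real assume "0 \<le> \<nu>"
  have "(F has_real_derivative (1 / (m + \<nu>) - 1 / (l + \<nu>)) / (l - m)) (at \<nu>)"
   unfolding F_def using l m False \<open>0 \<le> \<nu>\<close> by (auto intro!: derivative_eq_intros)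
  also have "(1 / (m + \<nu>) - 1 / (l + \<nu>)) / (l - m) = 1 / ((l + \<nu>) * (m + \<nu>))"
   using l m False \<open>0 \<le> \<nu>\<close> by (simp add: divide_simps)
  finally show "(F has_real_derivative 1 / ((l + \<nu>) * (m + \<nu>))) (at \<nu>)" .
 qed (use l m in auto)
 also have "0 / (l - m) - F 0 = green_J l m"
  using False l m by (simp add: F_def green_J_def ln_div minus_divide_left)
 finally show ?thesis .
qed

lemma AE_neq_0: "AE x in lborel. (x::real^2) \<noteq> 0"
 by (rule AE_I[where N="{0}"]) auto

text \<open>Tonelli for the heat representation: integrals against G_l become Laplace transforms of
  integrals against the heat kernel.\<close>

lemma gr_swap:
 fixes f :: "real^2 \<Rightarrow> ennreal"
 assumes l: "l > 0" and [measurable]: "f \<in> borel_fun"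
 shows "(NNL x. ennreal (gr l x) * f x) =
  (NNL t. (ennreal (exp (- l * t)) * indicator {0<..} t) * (NNL x. ennreal (heat t x) * f x))"
proof -
 define E where "E t = ennreal (exp (- l * t)) * indicator {0<..} t" for t
 have E [measurable]: "E \<in> borel_fun" unfolding E_def by measurable
 have e: "ennreal (exp (- l * t) * heat t x) * indicator {0<..} t = E t * ennreal (heat t x)" for t x
  by (auto simp: E_def ennreal_mult heat_nonneg split: split_indicator)
 have "(NNL x. ennreal (gr l x) * f x) = (NNL x. (NNL t. E t * (ennreal (heat t x) * f x)))"
 proof (rule nn_integral_cong_AE, rule eventually_mono[OF AE_neq_0])
  fix x :: "real^2" assume "x \<noteq> 0"
  then have "ennreal (gr l x) = (NNL t. E t * ennreal (heat t x))" unfolding e[symmetric] by (intro gr_heat[OF l, symmetric])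
  then show "ennreal (gr l x) * f x = (NNL t. E t * (ennreal (heat t x) * f x))"
   by (simp add: nn_integral_multc flip: mult.assoc)
 qed
 also have "\<dots> = (NNL t. (NNL x. E t * (ennreal (heat t x) * f x)))"
  by (rule lborel_pair.Fubini') measurable
 finally show ?thesis unfolding E_def by (simp add: nn_integral_cmult)
qed

text \<open>The value is p_(t+s)(0), as the semigroup property predicts.\<close>

lemma heat_pairing:
 assumes ts: "t > 0" "s > 0"
 shows "(NNL x. ennreal (heat t x) * ennreal (heat s x)) = ennreal (1 / (4 * pi)) * ennreal (1 / (t + s))"
proof -
 define q where "q = t * s / (t + s)"
 have q: "q > 0" using ts by (simp add: q_def)
 have "(NNL x. ennreal (heat t x) * ennreal (heat s x)) = (NNL x. ennreal (1 / (4 * pi * (t + s))) * ennreal (heat q x))"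
  unfolding ennreal_mult''[OF heat_nonneg[OF ts(2)], symmetric] ennreal_mult''[OF heat_nonneg[OF q], symmetric]
  unfolding heat_product[OF ts] q_def by (simp only: mult.commute)
 also have "\<dots> = ennreal (1 / (4 * pi) * (1 / (t + s)))" by (subst nn_integral_cmult) (auto simp: heat_nn_integral[OF q])
 finally show ?thesis using ts by (subst (asm) ennreal_mult) auto
qed

text \<open>The two time integrals are coupled only through 1/(t + s). Writing this as the integral
  of e^(-(t+s) \<nu>) over \<nu> decouples them, and they become 1/(l + \<nu>) and 1/(m +
  \<nu>).\<close>

lemma gr_product_nn:
 assumes l: "l > 0" and m: "m > 0"
 shows "(NNL x. ennreal (gr l x * gr m x)) = ennreal (green_J l m / (4 * pi))"
proof -
 define e where "e a t = ennreal (exp (- a * t)) * indicator {0<..} t" for a t :: real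
 define N where "N \<nu> = ennreal (1 / (4 * pi)) * indicator {0..} \<nu>" for \<nu> :: real
 have [measurable]: "(\<lambda>z. e (f z) (g z)) \<in> borel_measurable M" "(\<lambda>z. N (f z)) \<in> borel_measurable M"
  if "f \<in> borel_measurable M" "g \<in> borel_measurable M" for f g and M :: "'a measure"
  unfolding e_def N_def using that by measurable
 have ei: "(NNL t. e a t) = ennreal (1 / a)" if "a > 0" for a unfolding e_def by (rule nn_integral_exp'[OF that])
 have "(NNL x. ennreal (gr l x * gr m x)) = (NNL t. e l t * (NNL x. ennreal (gr m x) * ennreal (heat t x)))"
  using gr_swap[OF l, of "\<lambda>x. ennreal (gr m x)"] by (simp add: e_def ennreal_mult mult.commute)
 also have "\<dots> = (NNL t. (NNL s. e l t * (e m s * (NNL x. ennreal (heat s x) * ennreal (heat t x)))))"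
  unfolding gr_swap[OF m measurable_compose[OF heat_measurable measurable_ennreal]] by (simp add: e_def nn_integral_cmult)
 also have "\<dots> = (NNL t. (NNL s. (NNL \<nu>. N \<nu> * (e (l + \<nu>) t * e (m + \<nu>) s))))"
 proof (intro nn_integral_cong)
  fix t s :: real
  show "e l t * (e m s * (NNL x. ennreal (heat s x) * ennreal (heat t x))) = (NNL \<nu>. N \<nu> * (e (l + \<nu>) t * e (m + \<nu>) s))"
  proof (cases "t > 0 \<and> s > 0")
   case True
   then have p: "(NNL x. ennreal (heat s x) * ennreal (heat t x)) = ennreal (1 / (4 * pi)) * (NNL \<nu>. ennreal (exp (- (s + t) * \<nu>)) * indicator {0..} \<nu>)"
    by (subst nn_integral_exp) (simp_all only: heat_pairing, simp)
   have "e l t * (e m s * (NNL x. ennreal (heat s x) * ennreal (heat t x))) = (NNL \<nu>. e l t * (e m s * (ennreal (1 / (4 * pi)) * (ennreal (exp (- (s + t) * \<nu>)) * indicator {0..} \<nu>))))"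
    unfolding p by (simp add: nn_integral_cmult)
   also have "\<dots> = (NNL \<nu>. N \<nu> * (e (l + \<nu>) t * e (m + \<nu>) s))"
   proof (rule nn_integral_cong)
    fix \<nu> :: real
    have "exp (- (l + \<nu>) * t) * exp (- (m + \<nu>) * s) = exp (- l * t) * (exp (- m * s) * exp (- (s + t) * \<nu>))"
     by (simp flip: exp_add) (simp add: algebra_simps)
    then show "e l t * (e m s * (ennreal (1 / (4 * pi)) * (ennreal (exp (- (s + t) * \<nu>)) * indicator {0..} \<nu>))) = N \<nu> * (e (l + \<nu>) t * e (m + \<nu>) s)"
     using True by (simp add: e_def N_def ac_simps flip: ennreal_mult)
   qed
   finally show ?thesis .
  qed (auto simp: e_def)
 qed
 also have "\<dots> = (NNL t. (NNL \<nu>. (NNL s. N \<nu> * (e (l + \<nu>) t * e (m + \<nu>) s))))"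
  by (intro nn_integral_cong lborel_pair.Fubini') measurable
 also have "\<dots> = (NNL \<nu>. (NNL t. (NNL s. N \<nu> * (e (l + \<nu>) t * e (m + \<nu>) s))))"
  by (rule lborel_pair.Fubini') measurable
 also have "\<dots> = (NNL \<nu>. ennreal (1 / (4 * pi)) * (ennreal (1 / ((l + \<nu>) * (m + \<nu>))) * indicator {0..} \<nu>))"
 proof (rule nn_integral_cong)
  fix \<nu> :: real
  have "(NNL t. (NNL s. N \<nu> * (e (l + \<nu>) t * e (m + \<nu>) s))) = N \<nu> * ((NNL t. e (l + \<nu>) t) * (NNL s. e (m + \<nu>) s))"
   by (simp add: nn_integral_cmult nn_integral_multc)
  also have "\<dots> = ennreal (1 / (4 * pi)) * (ennreal (1 / ((l + \<nu>) * (m + \<nu>))) * indicator {0..} \<nu>)"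
   using l m by (cases "\<nu> \<ge> 0") (auto simp: N_def ei simp flip: ennreal_mult)
  finally show "(NNL t. (NNL s. N \<nu> * (e (l + \<nu>) t * e (m + \<nu>) s))) = ennreal (1 / (4 * pi)) * (ennreal (1 / ((l + \<nu>) * (m + \<nu>))) * indicator {0..} \<nu>)" .
 qed
 also have "\<dots> = ennreal (1 / (4 * pi)) * ennreal (green_J l m)"
  by (subst nn_integral_cmult, measurable, subst nn_integral_J[OF l m]) simp
 also have "\<dots> = ennreal (green_J l m / (4 * pi))"
  using green_J_nonneg[OF l m] by (simp flip: ennreal_mult)
 finally show ?thesis .
qed

lemma gr_product:
 assumes l: "l > 0" and m: "m > 0"
 shows "L1 (\<lambda>x. gr l x * gr m x)" "(LBINT x. gr l x * gr m x) = green_J l m / (4 * pi)"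
proof -
 show i: "L1 (\<lambda>x. gr l x * gr m x)"
  by (rule integrableI_bounded) (use gr_product_nn[OF l m] in auto)
 show "(LBINT x. gr l x * gr m x) = green_J l m / (4 * pi)"
  using gr_product_nn[OF l m] green_J_nonneg[OF l m]
  by (subst (asm) nn_integral_eq_integral[OF i]) (auto simp: integral_nonneg_AE)
qed

lemma Green_L2: assumes l: "l > 0" shows "Green l \<in> L2"
proof (rule L2I)
 have "(\<lambda>x. (norm (Green l x))\<^sup>2) = (\<lambda>x. gr l x * gr l x)" by (simp add: Green_gr power2_eq_square)
 then show "L1 (\<lambda>x. (norm (Green l x))\<^sup>2)" using gr_product(1)[OF l l] by simp
qed simp

lemma Green_ip:
 assumes l: "l > 0" and m: "m > 0" shows "L2_ip (Green l) (Green m) = of_real (green_J l m / (4 * pi))"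
proof -
 have "L2_ip (Green l) (Green m) = (LBINT x. complex_of_real (gr l x * gr m x))"
  by (simp add: L2_ip_def Green_gr)
 also have "\<dots> = of_real (LBINT x. gr l x * gr m x)" by (rule integral_complex_of_real)
 finally show ?thesis by (simp only: gr_product(2)[OF l m])
qed

lemma Green_mass: assumes l: "l > 0" shows "mass (Green l) = 1 / (4 * pi * l)"
proof -
 have "complex_of_real (mass (Green l)) = of_real (green_J l l / (4 * pi))"
  using L2_ip_self[OF Green_L2[OF l]] Green_ip[OF l l] by simp
 then have "mass (Green l) = green_J l l / (4 * pi)" by (simp only: of_real_eq_iff)
 then show ?thesis by (simp add: green_J_def)
qed

subsection \<open>Integrability with weights\<close>

text \<open>Reflection and scaling reduce the integral to Gamma(1/2).\<close>

lemma nn_integral_sqrt_exp_finite: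
 assumes b: "b > 0"
 shows "(NNL y. (if y = 0 then \<top> else ennreal (\<bar>y\<bar> powr (-1/2) * exp (- b * \<bar>y\<bar>)))) < \<top>"
proof -
 define h where "h = (\<lambda>y::real. ennreal (\<bar>y\<bar> powr (-1/2) * exp (- b * \<bar>y\<bar>)))"
 have "(NNL y. (if y = 0 then \<top> else ennreal (\<bar>y\<bar> powr (-1/2) * exp (- b * \<bar>y\<bar>)))) = (NNL y. h y)"
  unfolding h_def by (intro nn_integral_cong_AE AE_I[where N="{0}"]) auto
 also have "\<dots> = (NNL y. h y * indicator {0..} y + h y * indicator {..<0} y)"
  by (intro nn_integral_cong) (auto split: split_indicator)
 also have "\<dots> = (NNL y. h y * indicator {0..} y) + (NNL y. h y * indicator {..<0} y)"
  unfolding h_def by (rule nn_integral_add) measurable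
 also have "(NNL y. h y * indicator {..<0} y) = (NNL y. h y * indicator {0<..} y)"
  unfolding h_def by (subst nn_integral_real_affine[where c="-1" and t=0])
   (auto intro!: nn_integral_cong split: split_indicator)
 also have "\<dots> = (NNL y. h y * indicator {0..} y)" by (rule nn_integral_Ioi_Ici)
 finally have eq: "(NNL y. (if y = 0 then \<top> else ennreal (\<bar>y\<bar> powr (-1/2) * exp (- b * \<bar>y\<bar>)))) =
  (NNL y. h y * indicator {0..} y) + (NNL y. h y * indicator {0..} y)" .
 define f where "f t = ennreal (indicator {0..} t * t powr (1/2 - 1) / exp t)" for t :: real
 have "f (0 + b * y) = ennreal (b powr (-1/2)) * (h y * indicator {0..} y)" for y
 proof (cases "y \<ge> 0")
  case True
  have "(b * y) powr (1/2 - 1) / exp (b * y) = b powr (-1/2) * (y powr (-1/2) * exp (- b * y))"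
   using b True by (simp only: powr_mult exp_minus divide_inverse mult.assoc) (simp add: exp_minus)
  then show ?thesis using b True unfolding f_def h_def by (simp add: ennreal_mult'')
 next
  case False
  then show ?thesis using b by (simp add: f_def zero_le_mult_iff)
 qed
 then have "ennreal \<bar>b\<bar> * (ennreal (b powr (-1/2)) * (NNL y. h y * indicator {0..} y)) = ennreal \<bar>b\<bar> * (NNL y. f (0 + b * y))"
  by (simp add: nn_integral_cmult h_def)
 also have "\<dots> = (NNL y. f y)" using b by (intro nn_integral_real_affine[symmetric]) (auto simp: f_def)
 also have "\<dots> = ennreal (Gamma (1/2))" unfolding f_def by (rule Gamma_conv_nn_integral_real[symmetric]) simp
 finally have "(NNL y. h y * indicator {0..} y) \<noteq> \<top>" using b by (auto simp: ennreal_mult_top)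
 then show ?thesis unfolding eq by (simp add: less_top)
qed

lemma Basis_plane: "(Basis :: (real^2) set) = {axis 1 1, axis 2 1}"
proof -
 have "(Basis :: (real^2) set) = range (\<lambda>i. axis i 1)" by (auto simp: Basis_vec_def)
 then show ?thesis by (simp add: UNIV_2)
qed

text \<open>Since |x|^2 \<ge> |x_1| |x_2| and 2 |x| \<ge> |x_1| + |x_2|, the integrand is bounded by
  a product of one-dimensional functions |s|^(-1/2) e^(-b|s|/2). On the coordinate axes, a null set,
  the factors are set to infinity, because the totalised power would be 0 there.\<close>

lemma integrable_exp_over_norm:
 assumes b: "b > 0"
 shows "L1 (\<lambda>x::real^2. exp (- b * norm x) / norm x)"
proof (rule integrableI_bounded)
 define h where "h = (\<lambda>y::real. if y = 0 then \<top> else ennreal (\<bar>y\<bar> powr (-1/2) * exp (- (b/2) * \<bar>y\<bar>)))"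
 have [measurable]: "h \<in> borel_fun" unfolding h_def by measurable
 have hnz: "h y \<noteq> 0" for y by (auto simp: h_def)
 have "(NNL x. ennreal (norm (exp (- b * norm (x::real^2)) / norm x))) \<le> (NNL x. (\<Prod>e\<in>Basis. h ((x::real^2) \<bullet> e)))"
 proof (rule nn_integral_mono)
  fix x :: "real^2"
  have ne: "axis 1 1 \<noteq> (axis 2 1 :: real^2)" by (simp add: axis_eq_axis)
  have P: "(\<Prod>e\<in>Basis. h (x \<bullet> e)) = h (x $ 1) * h (x $ 2)"
   using ne by (simp add: Basis_plane inner_axis)
  show "ennreal (norm (exp (- b * norm x) / norm x)) \<le> (\<Prod>e\<in>Basis. h (x \<bullet> e))"
  proof (cases "x $ 1 = 0 \<or> x $ 2 = 0")
   case True
   then have "h (x $ 1) * h (x $ 2) = \<top>" using hnz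
    by (auto simp: h_def ennreal_top_mult ennreal_mult_top)
   then show ?thesis using P by simp
  next
   case False
   define u v where "u = \<bar>x $ 1\<bar>" and "v = \<bar>x $ 2\<bar>"
   have uv: "u > 0" "v > 0" using False by (auto simp: u_def v_def)
   have n2: "(norm x)\<^sup>2 = u\<^sup>2 + v\<^sup>2" by (simp add: norm_plane_sq u_def v_def)
   have n0: "norm x > 0" using False by auto
   have "u * v \<le> u\<^sup>2 + v\<^sup>2" using sum_squares_bound[of u v] uv mult_pos_pos[OF uv] by linarith
   then have "sqrt (u * v) \<le> sqrt ((norm x)\<^sup>2)" unfolding n2 by (rule real_sqrt_le_mono)
   then have s: "sqrt u * sqrt v \<le> norm x" by (simp add: real_sqrt_mult)
   have "u \<le> norm x" "v \<le> norm x" unfolding u_def v_def by (rule component_le_norm_cart)+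
   then have e: "exp (- b * norm x) \<le> exp (- (b/2) * u) * exp (- (b/2) * v)"
    using mult_left_mono[of "u + v" "2 * norm x" "b/2"] b by (simp add: algebra_simps flip: exp_add)
   have "exp (- b * norm x) / norm x \<le> exp (- (b/2) * u) * exp (- (b/2) * v) / (sqrt u * sqrt v)"
    using e s uv n0 by (intro frac_le) auto
   also have "\<dots> = (u powr (-1/2) * exp (- (b/2) * u)) * (v powr (-1/2) * exp (- (b/2) * v))"
    using uv by (simp add: powr_minus_divide powr_half_sqrt field_simps)
   finally have "ennreal (exp (- b * norm x) / norm x) \<le> h (x $ 1) * h (x $ 2)"
    using False by (simp add: h_def u_def v_def ennreal_leI flip: ennreal_mult)
   then show ?thesis using n0 P by simp
  qed
 qed
 also have "\<dots> = (\<Prod>e\<in>(Basis::(real^2) set). \<integral>\<^sup>+y. h y \<partial>lborel)"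
  by (rule nn_integral_lborel_prod) auto
 also have "\<dots> < \<infinity>"
  using nn_integral_sqrt_exp_finite[of "b/2"] b
  by (simp add: h_def[symmetric] prod_constant power2_eq_square ennreal_mult_less_top)
 finally show "(NNL x. ennreal (norm (exp (- b * norm (x::real^2)) / norm x))) < \<infinity>" .
qed measurable

lemma gr_bound:
 assumes l: "l > 0" and x: "x \<noteq> 0" and a: "0 < a" "a \<le> 1"
 shows "gr l x \<le> exp (- (sqrt l * norm x) / 2) * (sqrt l * norm x / 4) powr (- a) / (2 * pi * a)"
proof -
 have "sqrt l * norm x > 0" using l x by simp
 from K0_bound[OF this a] show ?thesis
  by (simp add: gr_def divide_right_mono field_simps)
qed

text \<open>The choice a = 1/p turns the singularity of the p-th power into 1/|x|, which is
  integrable in the plane.\<close>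

lemma gr_powr_bound:
 assumes l: "l > 0" and x: "x \<noteq> 0" and p: "p \<ge> 1"
 shows "gr l x powr p \<le> (p / (2 * pi)) powr p * (4 / sqrt l) * (exp (- (p * sqrt l / 2) * norm x) / norm x)"
proof -
 define r where "r = sqrt l * norm x"
 have r: "r > 0" using l x by (simp add: r_def)
 have "gr l x powr p \<le> (exp (- r / 2) * (r / 4) powr (- (1/p)) / (2 * pi * (1/p))) powr p"
  unfolding r_def using gr_bound[OF l x, of "1/p"] p by (intro powr_mono2) auto
 also have "\<dots> = (p / (2 * pi)) powr p * (exp (- r / 2) powr p * ((r / 4) powr (- (1/p))) powr p)"
  using p r by (simp add: powr_mult[symmetric] powr_divide[symmetric] field_simps)
 also have "exp (- r / 2) powr p = exp (- (p * r / 2))" by (simp add: exp_powr_real mult.commute)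
 also have "((r / 4) powr (- (1/p))) powr p = 4 / r" using p r by (subst powr_powr) (simp add: powr_minus_divide)
 also have "(p / (2 * pi)) powr p * (exp (- (p * r / 2)) * (4 / r)) =
   (p / (2 * pi)) powr p * (4 / sqrt l) * (exp (- (p * sqrt l / 2) * norm x) / norm x)"
  by (simp add: r_def field_simps)
 finally show ?thesis .
qed

lemma gr_powr_integrable:
 assumes l: "l > 0" and p: "p \<ge> 1"
 shows "L1 (\<lambda>x. gr l x powr p)"
proof (rule integrable_dominated)
 show "L1 (\<lambda>x::real^2. (p / (2 * pi)) powr p * (4 / sqrt l) * (exp (- (p * sqrt l / 2) * norm x) / norm x))"
  using l p by (intro integrable_mult_right integrable_exp_over_norm) auto
 show "AE x in lborel. norm (gr l x powr p) \<le> norm ((p / (2 * pi)) powr p * (4 / sqrt l) * (exp (- (p * sqrt l / 2) * norm x) / norm x))"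
 proof (rule eventually_mono[OF AE_neq_0])
  fix x :: "real^2" assume "x \<noteq> 0"
  then show "norm (gr l x powr p) \<le> norm ((p / (2 * pi)) powr p * (4 / sqrt l) * (exp (- (p * sqrt l / 2) * norm x) / norm x))"
   unfolding real_norm_def abs_of_nonneg[OF powr_ge_zero] by (rule order_trans[OF gr_powr_bound[OF l _ p] abs_ge_self])
 qed
qed simp

text \<open>Half of the exponential decay absorbs |x|^2, and the rest is again of the form
  e^(-b|x|)/|x|. The logarithmic weight lies below 1 + |x|^2.\<close>

lemma gr_sq_moment:
 assumes l: "l > 0"
 shows "L1 (\<lambda>x. (norm x)\<^sup>2 * (gr l x)\<^sup>2)" "L1 (\<lambda>x. lw x * (gr l x)\<^sup>2)"
proof -
 define C where "C = (2 / (2 * pi)) powr 2 * (4 / sqrt l)"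
 have C: "C \<ge> 0" using l by (simp add: C_def)
 show m: "L1 (\<lambda>x. (norm x)\<^sup>2 * (gr l x)\<^sup>2)"
 proof (rule integrable_dominated)
  show "L1 (\<lambda>x::real^2. C * (8 / l) * (exp (- (sqrt l / 2) * norm x) / norm x))"
   using l by (intro integrable_mult_right integrable_exp_over_norm) auto
  show "AE x in lborel. norm ((norm x)\<^sup>2 * (gr l x)\<^sup>2) \<le> norm (C * (8 / l) * (exp (- (sqrt l / 2) * norm x) / norm x))"
  proof (rule eventually_mono[OF AE_neq_0])
   fix x :: "real^2" assume x: "x \<noteq> 0"
   define r where "r = sqrt l * norm x"
   have r: "r > 0" "r\<^sup>2 = l * (norm x)\<^sup>2" using l x by (auto simp: r_def power_mult_distrib)
   have "(gr l x)\<^sup>2 = gr l x powr 2" by (cases "gr l x = 0") auto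
   also have "\<dots> \<le> C * (exp (- (2 * sqrt l / 2) * norm x) / norm x)"
    unfolding C_def by (rule gr_powr_bound[OF l x]) simp
   also have "exp (- (2 * sqrt l / 2) * norm x) = exp (- (r / 2)) * exp (- (r / 2))"
    by (simp add: r_def flip: exp_add)
   finally have 1: "(gr l x)\<^sup>2 \<le> C * (exp (- (r / 2)) * exp (- (r / 2)) / norm x)" .
   have "(r / 2)\<^sup>2 / 2 \<le> exp (r / 2)" using exp_lower_Taylor_quadratic[of "r / 2"] r(1) by simp
   then have "(norm x)\<^sup>2 * exp (- (r / 2)) \<le> 8 / l"
    using l r by (simp add: exp_minus power_divide divide_simps mult.commute)
   then have "((norm x)\<^sup>2 * exp (- (r / 2))) * (C * (exp (- (r / 2)) / norm x)) \<le> 8 / l * (C * (exp (- (r / 2)) / norm x))"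
    using C by (intro mult_right_mono) auto
   moreover have "(norm x)\<^sup>2 * (gr l x)\<^sup>2 \<le> (norm x)\<^sup>2 * (C * (exp (- (r / 2)) * exp (- (r / 2)) / norm x))"
    using 1 by (rule mult_left_mono) simp
   ultimately have "(norm x)\<^sup>2 * (gr l x)\<^sup>2 \<le> C * (8 / l) * (exp (- (sqrt l / 2) * norm x) / norm x)"
    by (simp add: r_def ac_simps)
   then show "norm ((norm x)\<^sup>2 * (gr l x)\<^sup>2) \<le> norm (C * (8 / l) * (exp (- (sqrt l / 2) * norm x) / norm x))"
    using C l by simp
  qed
 qed simp
 have sq: "L1 (\<lambda>x. (gr l x)\<^sup>2)" using gr_product(1)[OF l l] by (simp add: power2_eq_square)
 show "L1 (\<lambda>x. lw x * (gr l x)\<^sup>2)"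
 proof (rule integrable_dominated[OF Bochner_Integration.integrable_add[OF sq m]])
  show "AE x in lborel. norm (lw x * (gr l x)\<^sup>2) \<le> norm ((gr l x)\<^sup>2 + (norm x)\<^sup>2 * (gr l x)\<^sup>2)"
  proof (rule AE_I2)
   fix x
   have "lw x \<le> norm x" using ln_add_one_self_le_self[of "norm x"] by (simp add: lw_def)
   also have "\<dots> \<le> 1 + (norm x)\<^sup>2" using sum_squares_bound[of 1 "norm x"] norm_ge_zero[of x] by (simp; linarith)
   finally have "lw x * (gr l x)\<^sup>2 \<le> (1 + (norm x)\<^sup>2) * (gr l x)\<^sup>2" by (intro mult_right_mono) auto
   then show "norm (lw x * (gr l x)\<^sup>2) \<le> norm ((gr l x)\<^sup>2 + (norm x)\<^sup>2 * (gr l x)\<^sup>2)"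
    by (simp add: algebra_simps)
  qed
 qed simp
qed

lemma gr_dilation: assumes "l > 0" shows "gr l x = gr 1 (sqrt l *\<^sub>R x)"
 using assms by (simp add: gr_def)

lemma gr_powr_scaling:
 assumes l: "l > 0" and p: "p \<ge> 1"
 shows "(LBINT x. gr l x powr p) = (LBINT x. gr 1 x powr p) / l"
proof -
 have "(NNL x. ennreal (gr 1 x powr p)) = ennreal ((sqrt l)\<^sup>2) * (NNL x. ennreal (gr 1 (sqrt l *\<^sub>R x) powr p))"
  by (rule nn_integral_dilation) (use l in auto)
 also have "\<dots> = ennreal l * (NNL x. ennreal (gr l x powr p))" using l by (simp add: gr_dilation[OF l])
 finally have "ennreal (LBINT x. gr 1 x powr p) = ennreal (l * (LBINT x. gr l x powr p))"
  using l by (simp add: nn_integral_eq_integral[OF gr_powr_integrable] p ennreal_mult integral_nonneg_AE)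
 then have "(LBINT x. gr 1 x powr p) = l * (LBINT x. gr l x powr p)"
  using l by (subst (asm) ennreal_inj) (auto intro!: integral_nonneg_AE mult_nonneg_nonneg)
 then show ?thesis using l by simp
qed

text \<open>Laplace transforms of the mass 1 and of the moment bound 16 t of the heat kernel. The
  moment 16/l is what makes l G_l an approximate identity in \<open>conv_estimate\<close>.\<close>

lemma gr_prob_density:
 assumes l: "l > 0"
 shows "prob_density (\<lambda>x. l * gr l x)" "(NNL y. ennreal (l * gr l y * (norm y)\<^sup>2)) \<le> ennreal (16 / l)"
proof -
 have "(NNL x. ennreal (gr l x)) = (NNL t. ennreal (exp (- l * t)) * indicator {0<..} t)"
  using gr_swap[OF l, of "\<lambda>x. 1"] by (auto simp: heat_nn_integral split: split_indicator intro!: nn_integral_cong)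
 also have "\<dots> = ennreal (1 / l)" by (rule nn_integral_exp'[OF l])
 finally have "(NNL x. ennreal (l * gr l x)) = 1"
  using l by (simp add: ennreal_mult nn_integral_cmult flip: ennreal_1) (simp flip: ennreal_mult)
 then show "prob_density (\<lambda>x. l * gr l x)" using l by (simp add: prob_density_def)
 have tm: "(NNL t. ennreal (t * exp (- l * t)) * indicator {0<..} t) \<le> ennreal (1 / l\<^sup>2)"
 proof -
  have "((\<lambda>t. - (t / l + 1 / l\<^sup>2) * exp (- l * t)) \<longlongrightarrow> 0) at_top" using l by real_asymp
  then have "(NNL t. ennreal (t * exp (- l * t)) * indicator {0..} t) = ennreal (0 - - (0 / l + 1 / l\<^sup>2) * exp (- l * 0))"
   by (intro nn_integral_FTC_atLeast)
    (use l in \<open>auto intro!: derivative_eq_intros simp: field_simps power2_eq_square\<close>)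
  then show ?thesis by (simp add: nn_integral_Ioi_Ici)
 qed
 have "(NNL y. ennreal (l * gr l y * (norm y)\<^sup>2)) = ennreal l * (NNL y. ennreal (gr l y) * ennreal ((norm y)\<^sup>2))"
  using l by (simp add: ennreal_mult mult.assoc nn_integral_cmult)
 also have "(NNL y. ennreal (gr l y) * ennreal ((norm y)\<^sup>2)) \<le> (NNL t. ennreal 16 * (ennreal (t * exp (- l * t)) * indicator {0<..} t))"
  unfolding gr_swap[OF l, of "\<lambda>y. ennreal ((norm y)\<^sup>2)", simplified]
 proof (rule nn_integral_mono)
  fix t :: real
  show "ennreal (exp (- (l * t))) * indicator {0<..} t * (NNL x. ennreal (heat t x) * ennreal ((norm x)\<^sup>2)) \<le>
    ennreal 16 * (ennreal (t * exp (- l * t)) * indicator {0<..} t)"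
  proof (cases "t > 0")
   case True
   have "(NNL x. ennreal (heat t x) * ennreal ((norm x)\<^sup>2)) \<le> ennreal (16 * t)"
    using heat_nn_moment[OF True] True by (simp add: ennreal_mult heat_nonneg)
   then have "ennreal (exp (- (l * t))) * (NNL x. ennreal (heat t x) * ennreal ((norm x)\<^sup>2)) \<le> ennreal (exp (- (l * t))) * ennreal (16 * t)"
    by (rule mult_left_mono) simp
   then show ?thesis using True by (simp add: mult.commute mult.left_commute flip: ennreal_mult ennreal_numeral)
  qed simp
 qed
 also have "\<dots> = ennreal 16 * (NNL t. ennreal (t * exp (- l * t)) * indicator {0<..} t)"
  by (rule nn_integral_cmult) measurable
 also have "ennreal l * \<dots> \<le> ennreal l * (ennreal 16 * ennreal (1 / l\<^sup>2))"
  using tm by (intro mult_left_mono) auto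
 also have "\<dots> = ennreal (l * (16 * (1 / l\<^sup>2)))"
  using l by (subst ennreal_mult, simp, simp, subst ennreal_mult) auto
 also have "l * (16 * (1 / l\<^sup>2)) = 16 / l" using l by (simp add: power2_eq_square)
 finally show "(NNL y. ennreal (l * gr l y * (norm y)\<^sup>2)) \<le> ennreal (16 / l)"
  by (meson dual_order.trans mult_left_mono zero_le)
qed

section \<open>Differences of Green functions and the charge\<close>

text \<open>The weight of G_l - G_m in the heat representation. It vanishes to first order at t = 0,
  which compensates the factor 1/t produced by differentiating the heat kernel.\<close>

definition hk :: "real \<Rightarrow> real \<Rightarrow> real \<Rightarrow> real" where
 "hk l m t = indicator {0<..} t * (exp (- l * t) - exp (- m * t))"

lemma hk_measurable [measurable]: "hk l m \<in> borel_fun"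
 unfolding hk_def[abs_def] by measurable

lemma exp_diff_bound:
 assumes "0 \<le> a" "0 \<le> (b::real)"
 shows "\<bar>exp (- a) - exp (- b)\<bar> \<le> \<bar>a - b\<bar> * exp (- min a b)"
proof -
 have *: "exp (- a) - exp (- b) \<le> (b - a) * exp (- a)" for a b :: real
 proof -
  have "exp (- b) = exp (- a) * exp (a - b)" by (simp flip: exp_add)
  moreover have "1 + (a - b) \<le> exp (a - b)" by (rule exp_ge_add_one_self)
  ultimately have "exp (- a) * (1 + (a - b)) \<le> exp (- b)" by (simp add: mult_left_mono)
  then show ?thesis by (simp add: algebra_simps)
 qed
 show ?thesis
 proof (cases "a \<le> b")
  case True
  then show ?thesis using *[of a b] by (simp add: min_def)
 next
  case False
  then show ?thesis using *[of b a] by (simp add: min_def)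
 qed
qed

lemma hk_bound:
 assumes "l > 0" "m > 0"
 shows "\<bar>hk l m t\<bar> \<le> indicator {0<..} t * (\<bar>l - m\<bar> * t * exp (- min l m * t))"
proof (cases "t > 0")
 case True
 have "min (l * t) (m * t) = min l m * t" using True by (simp add: min_def)
 moreover have "\<bar>l * t - m * t\<bar> = \<bar>l - m\<bar> * t" using True by (simp add: abs_mult flip: left_diff_distrib)
 ultimately show ?thesis using exp_diff_bound[of "l * t" "m * t"] assms True by (simp add: hk_def)
qed (simp add: hk_def)

lemma gr_heat_integral:
 assumes l: "l > 0" and x: "x \<noteq> 0"
 shows "L1 (\<lambda>t. indicator {0<..} t * (exp (- l * t) * heat t x))"
  "(LBINT t. indicator {0<..} t * (exp (- l * t) * heat t x)) = gr l x"
proof -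
 have nn: "0 \<le> indicator {0<..} t * (exp (- l * t) * heat t x)" for t
  by (auto simp: heat_nonneg split: split_indicator)
 have eq: "(NNL t. ennreal (indicator {0<..} t * (exp (- l * t) * heat t x))) = ennreal (gr l x)"
  unfolding gr_heat[OF assms, symmetric] by (intro nn_integral_cong) (auto split: split_indicator)
 show i: "L1 (\<lambda>t. indicator {0<..} t * (exp (- l * t) * heat t x))"
  by (rule integrableI_nonneg) (use nn eq in auto)
 have "ennreal (LBINT t. indicator {0<..} t * (exp (- l * t) * heat t x)) = ennreal (gr l x)"
  using nn_integral_eq_integral[OF i] nn eq by simp
 then show "(LBINT t. indicator {0<..} t * (exp (- l * t) * heat t x)) = gr l x"
  using nn by (subst (asm) ennreal_inj) (auto intro!: integral_nonneg_AE)
qed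

text \<open>One statement serves G_l - G_m and its first and second derivatives: an envelope
  \<open>B\<close> in L^2 for the absolute time integral controls all three cases.\<close>

lemma time_Fubini:
 fixes K :: "real \<Rightarrow> real^2 \<Rightarrow> real" and B :: "real^2 \<Rightarrow> real"
 assumes [measurable]: "(\<lambda>z. K (fst z) (snd z)) \<in> borel_measurable (borel \<Otimes>\<^sub>M borel)" "B \<in> borel_fun"
  and bd: "AE x in lborel. (NNL t. ennreal \<bar>K t x\<bar>) \<le> ennreal (B x)"
  and B0: "\<And>x. B x \<ge> 0" and BL: "(\<lambda>x. complex_of_real (B x)) \<in> L2"
 shows "(\<lambda>x. complex_of_real (LBINT t. K t x)) \<in> L2"
  and "f \<in> L2 \<Longrightarrow> (LBINT x. complex_of_real (LBINT t. K t x) * f x) =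
    (LBINT t. (LBINT x. complex_of_real (K t x) * f x))"
  and "AE x in lborel. L1 (\<lambda>t. K t x)"
proof -
 have m1: "(\<lambda>(t, x). K t x) \<in> borel_measurable lborel2" by (simp add: split_beta')
 have mt [measurable]: "(\<lambda>t. K t x) \<in> borel_fun" for x
  using measurable_compose[OF _ assms(1), of "\<lambda>t. (t, x)" borel] by simp
 have mx [measurable]: "K t \<in> borel_fun" for t
  using measurable_compose[OF _ assms(1), of "\<lambda>x. (t, x)" borel] by simp
 have mI [measurable]: "(\<lambda>x. \<integral>t. K t x \<partial>lborel) \<in> borel_fun"
 proof -
  have "(\<lambda>(x, t). K t x) \<in> borel_measurable (borel \<Otimes>\<^sub>M lborel)"
   using measurable_compose[OF _ assms(1), of "\<lambda>z. (snd z, fst z)" "borel \<Otimes>\<^sub>M borel"] by (simp add: split_beta')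
  from lborel.borel_measurable_lebesgue_integral[OF this] show ?thesis .
 qed
 show ai: "AE x in lborel. L1 (\<lambda>t. K t x)"
  using bd by eventually_elim (auto intro!: integrableI_bounded simp: le_less_trans)
 have I: "AE x in lborel. \<bar>\<integral>t. K t x \<partial>lborel\<bar> \<le> B x"
  using bd ai
 proof eventually_elim
  case (elim x)
  have "ennreal \<bar>\<integral>t. K t x \<partial>lborel\<bar> \<le> (NNL t. ennreal \<bar>K t x\<bar>)"
   using integral_norm_bound_ennreal[OF elim(2)] by simp
  then have "ennreal \<bar>\<integral>t. K t x \<partial>lborel\<bar> \<le> ennreal (B x)" using elim(1) by (rule order_trans)
  then show ?case using B0 by simp
 qed
 show "(\<lambda>x. complex_of_real (LBINT t. K t x)) \<in> L2"
 proof (rule L2_bound[where g="\<lambda>x. (B x)\<^sup>2"])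
  show "L1 (\<lambda>x. (B x)\<^sup>2)" using L2_integrable[OF BL] by simp
  show "AE x in lborel. (norm (complex_of_real (LBINT t. K t x)))\<^sup>2 \<le> (B x)\<^sup>2"
   using I
  proof eventually_elim
   case (elim x)
   then have "\<bar>\<integral>t. K t x \<partial>lborel\<bar>\<^sup>2 \<le> (B x)\<^sup>2" by (rule power_mono) simp
   then show ?case by simp
  qed
 qed simp
 show "(LBINT x. complex_of_real (LBINT t. K t x) * f x) =
    (LBINT t. (LBINT x. complex_of_real (K t x) * f x))" if f: "f \<in> L2"
 proof -
  note [measurable] = L2_measurable[OF f]
  have int: "integrable lborel2 (\<lambda>(t, x). complex_of_real (K t x) * f x)"
  proof (rule integrableI_bounded)
   show "(\<lambda>(t, x). complex_of_real (K t x) * f x) \<in> borel_measurable lborel2"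
    by (simp add: split_beta')
   have "(\<integral>\<^sup>+z. ennreal (norm (case z of (t, x) \<Rightarrow> complex_of_real (K t x) * f x)) \<partial>lborel2) =
     (NNL x. (NNL t. ennreal (norm (complex_of_real (K t x) * f x))))"
    by (subst lborel_pair.nn_integral_snd[symmetric]) (auto simp: split_beta')
   also have "\<dots> = (NNL x. (NNL t. ennreal \<bar>K t x\<bar>) * ennreal (norm (f x)))"
    by (simp add: norm_mult ennreal_mult nn_integral_multc)
   also have "\<dots> \<le> (NNL x. ennreal (norm (complex_of_real (B x)) * norm (f x)))"
    by (rule nn_integral_mono_AE, use bd in eventually_elim) (simp add: ennreal_mult B0 mult_right_mono)
   also have "\<dots> < \<infinity>"
    using L2_norm_mult_integrable[OF BL f] by (subst nn_integral_eq_integral) auto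
   finally show "(\<integral>\<^sup>+z. ennreal (norm (case z of (t, x) \<Rightarrow> complex_of_real (K t x) * f x)) \<partial>lborel2) < \<infinity>" .
  qed
  have "(LBINT x. (LBINT t. complex_of_real (K t x) * f x)) = (LBINT t. (LBINT x. complex_of_real (K t x) * f x))"
   by (rule lborel_pair.Fubini_integral[OF int])
  moreover have "(LBINT t. complex_of_real (K t x) * f x) = complex_of_real (LBINT t. K t x) * f x" for x
   by simp
  ultimately show ?thesis by simp
 qed
qed

section \<open>Weak derivatives of a difference of Green functions\<close>

context
 fixes l m :: real
 assumes l: "l > 0" and m: "m > 0"

begin

text \<open>\<open>K0f\<close>, \<open>K1f\<close> and \<open>K2f\<close> are the time integrands of
  G_l - G_m, of its i-th derivative and of its second derivative in direction i.\<close>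

definition K0f :: "real \<Rightarrow> real^2 \<Rightarrow> real" where
 "K0f t x = hk l m t * heat t x"

definition K1f :: "2 \<Rightarrow> real \<Rightarrow> real^2 \<Rightarrow> real" where
 "K1f i t x = hk l m t * (- (x $ i / (2 * t)) * heat t x)"

definition K2f :: "2 \<Rightarrow> real \<Rightarrow> real^2 \<Rightarrow> real" where
 "K2f i t x = hk l m t * (((x $ i)\<^sup>2 / (4 * t\<^sup>2) - 1 / (2 * t)) * heat t x)"

lemma vec_nth_measurable [measurable (raw)]:
 assumes "f \<in> borel_measurable M" shows "(\<lambda>z. (f z :: real^2) $ i) \<in> borel_measurable M"
 using measurable_compose[OF assms borel_measurable_continuous_onI[OF continuous_on_component[OF continuous_on_id]], of i]
 by simp

lemma K0f_meas: "(\<lambda>z. K0f (fst z) (snd z)) \<in> borel_measurable (borel \<Otimes>\<^sub>M borel)"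
 unfolding K0f_def by measurable

lemma K1f_meas: "(\<lambda>z. K1f i (fst z) (snd z)) \<in> borel_measurable (borel \<Otimes>\<^sub>M borel)"
 unfolding K1f_def by measurable

lemma K2f_meas: "(\<lambda>z. K2f i (fst z) (snd z)) \<in> borel_measurable (borel \<Otimes>\<^sub>M borel)"
 unfolding K2f_def by measurable

lemma K0f_integral:
 assumes x: "x \<noteq> 0" shows "(LBINT t. K0f t x) = gr l x - gr m x"
proof -
 have "(\<lambda>t. K0f t x) = (\<lambda>t. indicator {0<..} t * (exp (- l * t) * heat t x) - indicator {0<..} t * (exp (- m * t) * heat t x))"
  by (simp add: K0f_def hk_def fun_eq_iff algebra_simps)
 then show ?thesis using gr_heat_integral[OF l x] gr_heat_integral[OF m x] by simp
qed

lemma K0f_bound: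
 assumes x: "x \<noteq> 0" shows "(NNL t. ennreal \<bar>K0f t x\<bar>) \<le> ennreal (gr l x + gr m x)"
proof -
 have "(NNL t. ennreal \<bar>K0f t x\<bar>) \<le> (NNL t. ennreal (exp (- l * t) * heat t x) * indicator {0<..} t +
   ennreal (exp (- m * t) * heat t x) * indicator {0<..} t)"
 proof (rule nn_integral_mono)
  fix t :: real
  show "ennreal \<bar>K0f t x\<bar> \<le> ennreal (exp (- l * t) * heat t x) * indicator {0<..} t + ennreal (exp (- m * t) * heat t x) * indicator {0<..} t"
  proof (cases "t > 0")
   case True
   have "\<bar>exp (- l * t) - exp (- m * t)\<bar> \<le> exp (- l * t) + exp (- m * t)" by (simp add: abs_le_iff)
   then have "\<bar>K0f t x\<bar> \<le> (exp (- l * t) + exp (- m * t)) * heat t x"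
    using heat_nonneg[OF True, of x] True by (simp add: K0f_def hk_def abs_mult mult_right_mono)
   also have "\<dots> = exp (- l * t) * heat t x + exp (- m * t) * heat t x" by (rule distrib_right)
   finally have "ennreal \<bar>K0f t x\<bar> \<le> ennreal (exp (- l * t) * heat t x + exp (- m * t) * heat t x)" by (rule ennreal_leI)
   then show ?thesis using True heat_nonneg[OF True, of x] by (simp flip: ennreal_plus)
  qed (simp add: K0f_def hk_def)
 qed
 also have "\<dots> = ennreal (gr l x) + ennreal (gr m x)"
  by (subst nn_integral_add, measurable, simp only: gr_heat[OF l x] gr_heat[OF m x])
 finally show ?thesis by simp
qed

lemma K1f_bound:
 assumes x: "x \<noteq> 0"
 shows "(NNL t. ennreal \<bar>K1f i t x\<bar>) \<le> ennreal (\<bar>l - m\<bar> / 2 * (norm x * gr (min l m) x))"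
proof -
 define n where "n = min l m"
 have n: "n > 0" using l m by (simp add: n_def)
 have "(NNL t. ennreal \<bar>K1f i t x\<bar>) \<le> (NNL t. ennreal (\<bar>l - m\<bar> / 2 * norm x) * (ennreal (exp (- n * t) * heat t x) * indicator {0<..} t))"
 proof (rule nn_integral_mono)
  fix t :: real
  show "ennreal \<bar>K1f i t x\<bar> \<le> ennreal (\<bar>l - m\<bar> / 2 * norm x) * (ennreal (exp (- n * t) * heat t x) * indicator {0<..} t)"
  proof (cases "t > 0")
   case True
   have "\<bar>K1f i t x\<bar> = \<bar>hk l m t\<bar> * (\<bar>x $ i\<bar> / (2 * t) * heat t x)"
    using True heat_nonneg[OF True, of x] by (simp add: K1f_def abs_mult)
   also have "\<dots> \<le> (\<bar>l - m\<bar> * t * exp (- n * t)) * (norm x / (2 * t) * heat t x)"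
    using hk_bound[OF l m, of t] True heat_nonneg[OF True, of x] component_le_norm_cart[of x i]
    by (intro mult_mono mult_right_mono divide_right_mono) (auto simp: n_def)
   also have "\<dots> = (\<bar>l - m\<bar> / 2 * norm x) * (exp (- n * t) * heat t x)" using True by simp
   finally show ?thesis using True heat_nonneg[OF True, of x] by (simp add: ennreal_leI flip: ennreal_mult)
  qed (simp add: K1f_def hk_def)
 qed
 also have "\<dots> = ennreal (\<bar>l - m\<bar> / 2 * norm x) * ennreal (gr n x)"
  by (subst nn_integral_cmult, measurable, simp only: gr_heat[OF n x])
 also have "\<dots> = ennreal (\<bar>l - m\<bar> / 2 * (norm x * gr n x))" by (simp add: mult.assoc flip: ennreal_mult)
 finally show ?thesis by (simp add: n_def)
qed

lemma heat_second_bound: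
 assumes t: "t > 0" shows "((norm x)\<^sup>2 / (4 * t\<^sup>2) + 1 / t) * heat t x \<le> 4 / t * heat (2 * t) x"
proof -
 define z where "z = (norm x)\<^sup>2 / (4 * t)"
 have "z + 1 \<le> 2 * exp (z / 2)" using exp_ge_add_one_self[of "z/2"] by linarith
 then have "(z + 1) * exp (- z) \<le> 2 * exp (z / 2) * exp (- z)" by (rule mult_right_mono) simp
 also have "\<dots> = 2 * exp (- (z / 2))" by (simp flip: exp_add)
 finally have "(z + 1) * exp (- z) / (4 * pi * t\<^sup>2) \<le> 2 * exp (- (z / 2)) / (4 * pi * t\<^sup>2)"
  by (rule divide_right_mono) simp
 moreover have "((norm x)\<^sup>2 / (4 * t\<^sup>2) + 1 / t) * heat t x = (z + 1) * exp (- z) / (4 * pi * t\<^sup>2)"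
  using t by (simp add: heat_def z_def power2_eq_square field_simps)
 moreover have "4 / t * heat (2 * t) x = 2 * exp (- (z / 2)) / (4 * pi * t\<^sup>2)"
  using t by (simp add: heat_def z_def power2_eq_square field_simps)
 ultimately show ?thesis by simp
qed

lemma heat_second_component:
 assumes t: "t > 0"
 shows "\<bar>((x $ i)\<^sup>2 / (4 * t\<^sup>2) - 1 / (2 * t)) * heat t x\<bar> \<le> 4 / t * heat (2 * t) x"
proof -
 have "(x $ i)\<^sup>2 \<le> (norm x)\<^sup>2" using component_le_norm_cart[of x i]
  by (metis abs_le_square_iff abs_norm_cancel)
 then have "(x $ i)\<^sup>2 / (4 * t\<^sup>2) \<le> (norm x)\<^sup>2 / (4 * t\<^sup>2)" by (rule divide_right_mono) simp
 moreover have "0 \<le> (x $ i)\<^sup>2 / (4 * t\<^sup>2)" "1 / (2 * t) \<le> 1 / t" "0 \<le> 1 / (2 * t)" using t by (auto simp: divide_simps)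
 ultimately have "\<bar>(x $ i)\<^sup>2 / (4 * t\<^sup>2) - 1 / (2 * t)\<bar> \<le> (norm x)\<^sup>2 / (4 * t\<^sup>2) + 1 / t" by (simp only: abs_le_iff) linarith
 then have "\<bar>((x $ i)\<^sup>2 / (4 * t\<^sup>2) - 1 / (2 * t)) * heat t x\<bar> \<le> ((norm x)\<^sup>2 / (4 * t\<^sup>2) + 1 / t) * heat t x"
  using heat_nonneg[OF t, of x] by (simp add: abs_mult mult_right_mono)
 then show ?thesis using heat_second_bound[OF t, of x] by linarith
qed

text \<open>The factor t of \<open>hk_bound\<close> cancels 1/t. The kernel at time 2t is brought
  back by a change of variable, which halves the parameter since e^(-n t) = e^(-(n/2) 2t).\<close>

lemma K2f_bound:
 assumes x: "x \<noteq> 0"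
 shows "(NNL t. ennreal \<bar>K2f i t x\<bar>) \<le> ennreal (2 * \<bar>l - m\<bar> * gr (min l m / 2) x)"
proof -
 define n where "n = min l m"
 have n: "n > 0" "n / 2 > 0" using l m by (auto simp: n_def)
 define A where "A t = ennreal (exp (- (n/2) * t) * heat t x) * indicator {0<..} t" for t
 have [measurable]: "A \<in> borel_fun" unfolding A_def by measurable
 have "(NNL t. ennreal \<bar>K2f i t x\<bar>) \<le> (NNL t. ennreal (4 * \<bar>l - m\<bar>) * A (0 + 2 * t))"
 proof (rule nn_integral_mono)
  fix t :: real
  show "ennreal \<bar>K2f i t x\<bar> \<le> ennreal (4 * \<bar>l - m\<bar>) * A (0 + 2 * t)"
  proof (cases "t > 0")
   case True
   have "\<bar>K2f i t x\<bar> = \<bar>hk l m t\<bar> * \<bar>((x $ i)\<^sup>2 / (4 * t\<^sup>2) - 1 / (2 * t)) * heat t x\<bar>"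
    by (simp add: K2f_def abs_mult)
   also have "\<dots> \<le> (\<bar>l - m\<bar> * t * exp (- n * t)) * (4 / t * heat (2 * t) x)"
    using hk_bound[OF l m, of t] True heat_second_component[OF True, of x i]
    by (intro mult_mono) (auto simp: n_def)
   also have "\<dots> = (4 * \<bar>l - m\<bar>) * (exp (- (n/2) * (0 + 2 * t)) * heat (0 + 2 * t) x)" using True by simp
   finally show ?thesis using True heat_nonneg[of "2 * t" x]
    by (simp add: A_def ennreal_leI flip: ennreal_mult)
  qed (simp add: K2f_def hk_def)
 qed
 also have "\<dots> = ennreal (2 * \<bar>l - m\<bar>) * (ennreal \<bar>2\<bar> * (NNL t. A (0 + 2 * t)))"
 proof -
  have "ennreal (4 * \<bar>l - m\<bar>) = ennreal (2 * \<bar>l - m\<bar>) * ennreal \<bar>2\<bar>" by (subst ennreal_mult[symmetric]) auto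
  then show ?thesis by (subst nn_integral_cmult) (simp_all only: mult.assoc, measurable)
 qed
 also have "ennreal \<bar>2\<bar> * (NNL t. A (0 + 2 * t)) = (NNL t. A t)"
  by (rule nn_integral_real_affine[symmetric]) auto
 also have "\<dots> = ennreal (gr (n / 2) x)" unfolding A_def by (rule gr_heat[OF n(2) x])
 finally show ?thesis by (simp add: n_def flip: ennreal_mult)
qed

lemma gr_L2: "k > 0 \<Longrightarrow> (\<lambda>x. complex_of_real (gr k x)) \<in> L2"
 using Green_L2[of k] by (simp add: Green_gr[abs_def])

lemma B0_L2: "(\<lambda>x. complex_of_real (gr l x + gr m x)) \<in> L2"
 using L2_add[OF gr_L2[OF l] gr_L2[OF m]] by simp

lemma B1_L2: "(\<lambda>x. complex_of_real (\<bar>l - m\<bar> / 2 * (norm x * gr (min l m) x))) \<in> L2"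
proof (rule L2I)
 have n: "min l m > 0" using l m by simp
 have "L1 (\<lambda>x. (\<bar>l - m\<bar> / 2)\<^sup>2 * ((norm x)\<^sup>2 * (gr (min l m) x)\<^sup>2))"
  using gr_sq_moment(1)[OF n] by simp
 then show "L1 (\<lambda>x. (norm (complex_of_real (\<bar>l - m\<bar> / 2 * (norm x * gr (min l m) x))))\<^sup>2)"
  by (simp only: norm_of_real power2_abs power_mult_distrib)
qed simp

lemma B2_L2: "(\<lambda>x. complex_of_real (2 * \<bar>l - m\<bar> * gr (min l m / 2) x)) \<in> L2"
proof -
 have "min l m / 2 > 0" using l m by simp
 from L2_cmult[OF gr_L2[OF this], of "complex_of_real (2 * \<bar>l - m\<bar>)"] show ?thesis by simp
qed

lemma AE_bound:
 assumes "\<And>x. x \<noteq> 0 \<Longrightarrow> P x" shows "AE x in lborel. P (x::real^2)"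
 using AE_neq_0 by eventually_elim (rule assms)

lemmas F0 = time_Fubini[OF K0f_meas _ AE_bound[OF K0f_bound] _ B0_L2]

lemmas F1 = time_Fubini[OF K1f_meas _ AE_bound[OF K1f_bound] _ B1_L2]

lemmas F2 = time_Fubini[OF K2f_meas _ AE_bound[OF K2f_bound] _ B2_L2]

definition gd :: "2 \<Rightarrow> wfun" where "gd i x = complex_of_real (LBINT t. K1f i t x)"

lemma gd_L2: "gd i \<in> L2" unfolding gd_def[abs_def] by (rule F1(1)) auto

lemma Green_diff_L2: "(\<lambda>x. Green l x - Green m x) \<in> L2"
 by (rule L2_diff[OF Green_L2[OF l] Green_L2[OF m]])

lemma Green_diff_AE: "AE x in lborel. Green l x - Green m x = complex_of_real (LBINT t. K0f t x)"
 by (rule AE_bound) (simp add: Green_gr K0f_integral)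

text \<open>At each fixed time this is integration by parts for the smooth heat kernel; on both
  sides the time integral is exchanged with the pairing.\<close>

lemma Green_diff_weak: "has_weak_pderiv i (\<lambda>x. Green l x - Green m x) (gd i)"
 unfolding has_weak_pderiv_def
proof
 fix \<eta> assume t: "\<eta> \<in> test_functions"
 let ?d = "\<lambda>x. complex_of_real (pderiv_fun i \<eta> x)" and ?e = "\<lambda>x. complex_of_real (\<eta> x)"
 note [measurable] = L2_measurable[OF F0(1)] test_measurable[OF t]
 have "(LBINT x. (Green l x - Green m x) * ?d x) = (LBINT x. complex_of_real (LBINT t. K0f t x) * ?d x)"
 proof (rule integral_cong_AE)
  show "(\<lambda>x. complex_of_real (LBINT t. K0f t x) * ?d x) \<in> borel_measurable lborel"
   using L2_measurable[OF F0(1)] by simp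
  show "AE x in lborel. (Green l x - Green m x) * ?d x = complex_of_real (LBINT t. K0f t x) * ?d x"
   using Green_diff_AE by eventually_elim simp
 qed simp
 also have "\<dots> = (LBINT s. (LBINT x. complex_of_real (K0f s x) * ?d x))"
  by (rule F0(2)) (auto simp: test_L2[OF t])
 also have "\<dots> = (LBINT s. - (LBINT x. complex_of_real (K1f i s x) * ?e x))"
 proof (rule Bochner_Integration.integral_cong[OF refl])
  fix s :: real
  show "(LBINT x. complex_of_real (K0f s x) * ?d x) = - (LBINT x. complex_of_real (K1f i s x) * ?e x)"
  proof (cases "s > 0")
   case True
   have "(LBINT x. complex_of_real (K0f s x) * ?d x) = complex_of_real (hk l m s) * (LBINT x. complex_of_real (heat s x) * ?d x)"
    by (simp add: K0f_def mult.assoc)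
   also have "(LBINT x. complex_of_real (heat s x) * ?d x) = - (LBINT x. complex_of_real (pderiv_fun i (heat s) x) * ?e x)"
    using Sm_has_weak_pderiv[OF heat_Sm, of i s] t unfolding has_weak_pderiv_def by blast
   finally show ?thesis by (simp add: K1f_def pderiv_heat[OF True] mult.assoc)
  qed (simp add: K0f_def K1f_def hk_def)
 qed
 also have "\<dots> = - (LBINT s. (LBINT x. complex_of_real (K1f i s x) * ?e x))" by simp
 also have "(LBINT s. (LBINT x. complex_of_real (K1f i s x) * ?e x)) = (LBINT x. gd i x * ?e x)"
  unfolding gd_def by (rule F1(2)[symmetric]) (auto simp: test_L2[OF t])
 finally show "(LBINT x. (Green l x - Green m x) * ?d x) = - (LBINT x. gd i x * ?e x)" .
qed

lemma Green_diff_W12: "(\<lambda>x. Green l x - Green m x) \<in> W12"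
 by (rule W12I[OF Green_diff_L2 gd_L2 Green_diff_weak])

lemma pderiv_heat2_L2:
 assumes t: "t > 0" shows "(\<lambda>x. complex_of_real (pderiv_fun i (pderiv_fun i (heat t)) x)) \<in> L2"
proof (rule L2_bound[where g="\<lambda>x. (norm ((4 / t) * complex_of_real (heat (2 * t) x)))\<^sup>2"])
 show "(\<lambda>x. complex_of_real (pderiv_fun i (pderiv_fun i (heat t)) x)) \<in> borel_fun"
  using Sm_measurable[OF Sm_pderiv(1)[OF Sm_pderiv(1)[OF heat_Sm]]] by simp
 have "0 < 2 * t" using t by simp
 from L2_integrable[OF L2_cmult[OF heat_L2[OF this], of "complex_of_real (4 / t)"]]
 show "L1 (\<lambda>x. (norm ((4 / t) * complex_of_real (heat (2 * t) x)))\<^sup>2)" by simp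
 show "AE x in lborel. (norm (complex_of_real (pderiv_fun i (pderiv_fun i (heat t)) x)))\<^sup>2 \<le> (norm ((4 / t) * complex_of_real (heat (2 * t) x)))\<^sup>2"
 proof (rule AE_I2, rule power_mono)
  fix x
  show "norm (complex_of_real (pderiv_fun i (pderiv_fun i (heat t)) x)) \<le> norm ((4 / t) * complex_of_real (heat (2 * t) x))"
  proof -
   have "norm ((4 / t) * complex_of_real (heat (2 * t) x)) = 4 / t * heat (2 * t) x"
    using t heat_nonneg[of "2 * t" x] by (simp add: norm_mult norm_divide)
   then show ?thesis using heat_second_component[OF t, of x i] by (simp only: pderiv_heat2[OF t] norm_of_real)
  qed
 qed simp
qed

lemma heat_time_derivative:
 assumes t: "t > 0"
 shows "((\<lambda>t. heat t x) has_real_derivative ((norm x)\<^sup>2 / (4 * t\<^sup>2) - 1 / t) * heat t x) (at t)"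
 unfolding heat_def using t
 by (auto intro!: derivative_eq_intros simp: power2_eq_square field_simps)

text \<open>The Laplacian of the heat kernel is its time derivative, so the integrand is k(t) d/dt
  p_t with k(t) = e^(-lt) - e^(-mt). Integration by parts in t leaves - k' p_t, whose integral is l
  G_l - m G_m. The boundary terms vanish: k is O(t) near 0 while p_t(x) stays bounded for x \<noteq>
  0, and p_t is O(1/t) at infinity.\<close>

lemma K2f_sum_integral:
 assumes x: "x \<noteq> 0" shows "(LBINT t. (\<Sum>i\<in>UNIV. K2f i t x)) = l * gr l x - m * gr m x"
proof -
 define k where "k = (\<lambda>t. exp (- l * t) - exp (- m * t))"
 define F where "F = (\<lambda>t. k t * heat t x)"
 define f where "f = (\<lambda>t. (- l * exp (- l * t) + m * exp (- m * t)) * heat t x + k t * (((norm x)\<^sup>2 / (4 * t\<^sup>2) - 1 / t) * heat t x))"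
 have S: "(\<Sum>i\<in>UNIV. K2f i t x) = indicator {0<..} t * (k t * (((norm x)\<^sup>2 / (4 * t\<^sup>2) - 1 / t) * heat t x))" for t
  unfolding K2f_def hk_def k_def sum_2 norm_plane_sq by (simp add: algebra_simps add_divide_distrib)
 have K2i: "L1 (\<lambda>t. K2f i t x)" for i
 proof (rule integrableI_bounded)
  show "(\<lambda>t. K2f i t x) \<in> borel_measurable lborel" unfolding K2f_def by measurable
  show "(NNL t. ennreal (norm (K2f i t x))) < \<infinity>" using K2f_bound[OF x, of i] by (auto simp: le_less_trans)
 qed
 then have Si: "L1 (\<lambda>t. \<Sum>i\<in>UNIV. K2f i t x)" by simp
 define E where "E = (\<lambda>t. indicator {0<..} t * ((- l * exp (- l * t) + m * exp (- m * t)) * heat t x))"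
 have Eeq: "E = (\<lambda>t. - l * (indicator {0<..} t * (exp (- l * t) * heat t x)) + m * (indicator {0<..} t * (exp (- m * t) * heat t x)))"
  by (simp add: E_def fun_eq_iff algebra_simps)
 have Ei: "L1 E" unfolding Eeq using gr_heat_integral(1)[OF l x] gr_heat_integral(1)[OF m x] by simp
 have EI: "(LBINT t. E t) = - l * gr l x + m * gr m x"
  unfolding Eeq using gr_heat_integral[OF l x] gr_heat_integral[OF m x] by simp
 have fe: "indicator {0<..} t * f t = E t + (\<Sum>i\<in>UNIV. K2f i t x)" for t
  unfolding S E_def f_def by (simp add: algebra_simps)
 have D: "(F has_real_derivative f t) (at t)" if "t > 0" for t
 proof -
  have "(k has_real_derivative (- l * exp (- l * t) + m * exp (- m * t))) (at t)"
   unfolding k_def by (auto intro!: derivative_eq_intros)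
  from DERIV_mult[OF this heat_time_derivative[OF that]] show ?thesis
   unfolding F_def f_def by (rule DERIV_cong) (simp add: mult.commute)
 qed
 have "(LBINT t=ereal 0..\<infinity>. f t) = 0 - 0"
 proof (rule interval_integral_FTC_integrable)
  show "ereal 0 < \<infinity>" by simp
  show "(F has_vector_derivative f t) (at t)" if "ereal 0 < ereal t" for t
   using D[of t] that by (simp add: has_real_derivative_iff_has_vector_derivative)
  show "isCont f t" if "ereal 0 < ereal t" for t
   unfolding f_def k_def heat_def using that by (intro continuous_intros) auto
  show "set_integrable lborel (einterval (ereal 0) \<infinity>) f"
   unfolding set_integrable_def using Ei Si fe by simp
  have nx: "norm x > 0" using x by simp
  show "((F \<circ> real_of_ereal) \<longlongrightarrow> 0) (at_right (ereal 0))"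
   unfolding ereal_tendsto_simps
  proof (rule Lim_null_comparison)
   define C where "C = \<bar>l - m\<bar> * (2 / (pi * (norm x)\<^sup>2))"
   show "\<forall>\<^sub>F t in at_right 0. norm (F t) \<le> C * t"
    unfolding eventually_at_right_field
   proof (intro exI[of _ 1] conjI allI impI)
    fix t :: real assume t: "0 < t" "t < 1"
    have "heat t x * (norm x)\<^sup>2 \<le> 16 * t * heat (2 * t) x" by (rule heat_moment[OF t(1)])
    also have "\<dots> \<le> 16 * t * (1 / (4 * pi * (2 * t)))" using t by (intro mult_left_mono heat_le) auto
    also have "\<dots> = 2 / pi" using t by simp
    finally have h: "heat t x \<le> 2 / (pi * (norm x)\<^sup>2)" using nx by (simp add: field_simps)
    have "\<bar>k t\<bar> \<le> \<bar>l - m\<bar> * t * exp (- min l m * t)"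
     using hk_bound[OF l m, of t] t by (simp add: hk_def k_def)
    also have "\<dots> \<le> \<bar>l - m\<bar> * t * 1" using t l m by (intro mult_left_mono) auto
    finally have "\<bar>k t\<bar> * heat t x \<le> (\<bar>l - m\<bar> * t) * (2 / (pi * (norm x)\<^sup>2))"
     using h heat_nonneg[OF t(1), of x] t by (intro mult_mono) auto
    then show "norm (F t) \<le> C * t"
     using heat_nonneg[OF t(1), of x] by (simp add: F_def C_def abs_mult ac_simps)
   qed simp
   show "((\<lambda>t. C * t) \<longlongrightarrow> 0) (at_right 0)"
    by (auto intro!: tendsto_eq_intros)
  qed
  show "((F \<circ> real_of_ereal) \<longlongrightarrow> 0) (at_left \<infinity>)"
   unfolding ereal_tendsto_simps
  proof (rule Lim_null_comparison)
   show "\<forall>\<^sub>F t in at_top. norm (F t) \<le> 1 / (2 * pi * t)"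
    using eventually_gt_at_top[of 0]
   proof eventually_elim
    case (elim t)
    have "exp (- l * t) \<le> 1" "exp (- m * t) \<le> 1" "exp (- l * t) > 0" "exp (- m * t) > 0" using elim l m by auto
    then have "\<bar>k t\<bar> \<le> 2" unfolding k_def by linarith
    then have "\<bar>k t\<bar> * heat t x \<le> 2 * (1 / (4 * pi * t))"
     using heat_le[OF elim, of x] heat_nonneg[OF elim, of x] by (intro mult_mono) auto
    then show ?case using heat_nonneg[OF elim, of x] by (simp add: F_def abs_mult)
   qed
   show "((\<lambda>t. 1 / (2 * pi * t)) \<longlongrightarrow> 0) at_top" by real_asymp
  qed
 qed
 then have "(LBINT t. indicator {0<..} t * f t) = 0"
  by (simp add: interval_lebesgue_integral_def set_lebesgue_integral_def)
 then have "(LBINT t. E t) + (LBINT t. (\<Sum>i\<in>UNIV. K2f i t x)) = 0"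
  using Ei Si by (simp add: fe)
 then show ?thesis using EI by linarith
qed

text \<open>The distributional identity $-\Delta(G_\lambda - G_\mu) = -\lambda G_\lambda + \mu G_\mu$ in weak form.\<close>

lemma grad_ip_Green_diff:
 assumes \<phi>: "\<phi> \<in> W12"
 shows "grad_ip \<phi> (\<lambda>x. Green l x - Green m x) = L2_ip \<phi> (\<lambda>x. of_real m * Green m x - of_real l * Green l x)"
proof -
 note P = W12_D[OF \<phi>]
 have cL: "(\<lambda>x. cnj (\<phi> x)) \<in> L2" by (rule L2_cnj[OF P(1)])
 have k2L: "(\<lambda>x. complex_of_real (LBINT t. K2f i t x)) \<in> L2" for i by (rule F2(1)) auto
 have one: "L2_ip (weak_pderiv i \<phi>) (gd i) = - (LBINT x. complex_of_real (LBINT t. K2f i t x) * cnj (\<phi> x))" for i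
 proof -
  have "L2_ip (weak_pderiv i \<phi>) (gd i) = (LBINT x. complex_of_real (LBINT t. K1f i t x) * cnj (weak_pderiv i \<phi> x))"
   by (simp add: L2_ip_def gd_def mult.commute)
  also have "\<dots> = (LBINT s. (LBINT x. complex_of_real (K1f i s x) * cnj (weak_pderiv i \<phi> x)))"
   by (rule F1(2)) (auto intro: L2_cnj P)
  also have "\<dots> = (LBINT s. - (LBINT x. complex_of_real (K2f i s x) * cnj (\<phi> x)))"
  proof (rule Bochner_Integration.integral_cong[OF refl])
   fix s :: real
   show "(LBINT x. complex_of_real (K1f i s x) * cnj (weak_pderiv i \<phi> x)) = - (LBINT x. complex_of_real (K2f i s x) * cnj (\<phi> x))"
   proof (cases "s > 0")
    case True
    let ?h = "pderiv_fun i (heat s)"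
    have "(LBINT x. \<phi> x * of_real (pderiv_fun i ?h x)) = - (LBINT x. weak_pderiv i \<phi> x * of_real (?h x))"
     by (rule weak_pderiv_Sm[OF P(1) P(2) P(3) Sm_pderiv(1)[OF heat_Sm] pderiv_heat_L2[OF True] pderiv_heat2_L2[OF True]])
    then have "cnj (LBINT x. \<phi> x * of_real (pderiv_fun i ?h x)) = cnj (- (LBINT x. weak_pderiv i \<phi> x * of_real (?h x)))"
     by (rule arg_cong)
    then have c: "(LBINT x. cnj (\<phi> x) * of_real (pderiv_fun i ?h x)) = - (LBINT x. cnj (weak_pderiv i \<phi> x) * of_real (?h x))"
     by (simp flip: Bochner_Integration.integral_cnj)
    have "(LBINT x. complex_of_real (K1f i s x) * cnj (weak_pderiv i \<phi> x)) =
      complex_of_real (hk l m s) * (LBINT x. cnj (weak_pderiv i \<phi> x) * of_real (?h x))"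
     by (subst integral_mult_right_zero[symmetric]) (simp add: K1f_def pderiv_heat[OF True] ac_simps)
    also have "(LBINT x. cnj (weak_pderiv i \<phi> x) * of_real (?h x)) = - (LBINT x. cnj (\<phi> x) * of_real (pderiv_fun i ?h x))"
     using c by simp
    also have "complex_of_real (hk l m s) * - (LBINT x. cnj (\<phi> x) * of_real (pderiv_fun i ?h x)) =
      - (LBINT x. complex_of_real (hk l m s) * (cnj (\<phi> x) * of_real (pderiv_fun i ?h x)))" by simp
    also have "\<dots> = - (LBINT x. complex_of_real (K2f i s x) * cnj (\<phi> x))"
     by (simp add: K2f_def pderiv_heat2[OF True] ac_simps)
    finally show ?thesis .
   qed (simp add: K1f_def K2f_def hk_def)
  qed
  also have "\<dots> = - (LBINT s. (LBINT x. complex_of_real (K2f i s x) * cnj (\<phi> x)))" by simp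
  also have "(LBINT s. (LBINT x. complex_of_real (K2f i s x) * cnj (\<phi> x))) =
    (LBINT x. complex_of_real (LBINT t. K2f i t x) * cnj (\<phi> x))"
   by (rule F2(2)[symmetric]) (auto intro: cL)
  finally show ?thesis .
 qed
 have "grad_ip \<phi> (\<lambda>x. Green l x - Green m x) = (\<Sum>i\<in>UNIV. L2_ip (weak_pderiv i \<phi>) (gd i))"
  by (rule grad_ip_eq[OF \<phi> Green_diff_W12 P(2) P(3) gd_L2 Green_diff_weak])
 also have "\<dots> = - (\<Sum>i\<in>UNIV. (LBINT x. complex_of_real (LBINT t. K2f i t x) * cnj (\<phi> x)))"
  by (simp add: one sum_negf)
 also have "(\<Sum>i\<in>UNIV. (LBINT x. complex_of_real (LBINT t. K2f i t x) * cnj (\<phi> x))) =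
   (LBINT x. (\<Sum>i\<in>UNIV. complex_of_real (LBINT t. K2f i t x) * cnj (\<phi> x)))"
  by (rule Bochner_Integration.integral_sum[symmetric]) (rule L2_mult_integrable[OF k2L cL])
 also have "\<dots> = (LBINT x. cnj (\<phi> x) * (of_real l * Green l x - of_real m * Green m x))"
 proof (rule integral_cong_AE)
  have K2: "AE x in lborel. \<forall>i. L1 (\<lambda>t. K2f i t x)"
   unfolding AE_all_countable by (intro allI F2(3)) auto
  show "AE x in lborel. (\<Sum>i\<in>UNIV. complex_of_real (LBINT t. K2f i t x) * cnj (\<phi> x)) = cnj (\<phi> x) * (of_real l * Green l x - of_real m * Green m x)"
   using K2 AE_neq_0
  proof eventually_elim
   case (elim x)
   have "(\<Sum>i\<in>UNIV. complex_of_real (LBINT t. K2f i t x)) = complex_of_real (LBINT t. (\<Sum>i\<in>UNIV. K2f i t x))"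
    using elim(1) by (subst Bochner_Integration.integral_sum) auto
   also have "\<dots> = complex_of_real (l * gr l x - m * gr m x)" by (simp only: K2f_sum_integral[OF elim(2)])
   finally show ?case by (simp add: Green_gr sum_distrib_right[symmetric])
  qed
  show "(\<lambda>x. \<Sum>i\<in>UNIV. complex_of_real (LBINT t. K2f i t x) * cnj (\<phi> x)) \<in> borel_measurable lborel"
   using L2_measurable[OF k2L] L2_measurable[OF cL] by simp
  show "(\<lambda>x. cnj (\<phi> x) * (of_real l * Green l x - of_real m * Green m x)) \<in> borel_measurable lborel"
   using L2_measurable[OF cL] by simp
 qed
 also have "- \<dots> = L2_ip \<phi> (\<lambda>x. of_real m * Green m x - of_real l * Green l x)"
  by (subst Bochner_Integration.integral_minus[symmetric]) (simp add: L2_ip_def algebra_simps)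
 finally show ?thesis .
qed

end

lemma grad_ip_Green_diff':
 assumes "l > 0" "m > 0" "\<phi> \<in> W12"
 shows "grad_ip \<phi> (\<lambda>x. Green l x - Green m x) = of_real m * L2_ip \<phi> (Green m) - of_real l * L2_ip \<phi> (Green l)"
 unfolding grad_ip_Green_diff[OF assms]
 using assms by (simp add: L2_ip_diff_right W12_L2 L2_cmult Green_L2 L2_ip_cmult_right)

text \<open>Testing the weak identity with G_l - G_m itself reduces the energy to L^2 products of
  Green functions.\<close>

lemma gmass_Green_diff:
 assumes l: "l > 0" and m: "m > 0"
 shows "gmass (\<lambda>x. Green l x - Green m x) = ((l + m) * green_J l m - 2) / (4 * pi)"
proof -
 have s: "green_J m l = green_J l m"
 proof -
  have "ln (m / l) = - ln (l / m)" using l m by (simp add: ln_div)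
  then have "ln (m / l) / (m - l) = ln (l / m) / (l - m)" by (metis minus_diff_eq minus_divide_divide)
  then show ?thesis by (auto simp: green_J_def)
 qed
 have "grad_ip (\<lambda>x. Green l x - Green m x) (\<lambda>x. Green l x - Green m x) =
   complex_of_real (m * (green_J l m / (4 * pi) - green_J m m / (4 * pi)) - l * (green_J l l / (4 * pi) - green_J m l / (4 * pi)))"
  unfolding grad_ip_Green_diff'[OF l m Green_diff_W12[OF l m]]
  using l m by (simp add: L2_ip_diff_left Green_L2 Green_ip)
 then have "gmass (\<lambda>x. Green l x - Green m x) = m * (green_J l m / (4 * pi) - green_J m m / (4 * pi)) - l * (green_J l l / (4 * pi) - green_J m l / (4 * pi))"
  by (simp only: gmass_def Re_complex_of_real)
 also have "\<dots> = ((l + m) * green_J l m - 2) / (4 * pi)"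
  unfolding s using l m by (simp add: green_J_def[of l l] green_J_def[of m m] field_simps)
 finally show ?thesis .
qed

text \<open>If G_l had Dirichlet energy g, Cauchy-Schwarz for its pairing b with G_l - G_m would
  give b^2 \<le> g a, where the energy a of the difference is at most b; hence b \<le> g. But b
  grows like log m.\<close>

lemma Green_not_W12:
 assumes l: "l > 0" shows "Green l \<notin> W12"
proof
 assume G: "Green l \<in> W12"
 define g where "g = gmass (Green l)"
 have g0: "g \<ge> 0" unfolding g_def by (rule gmass_nonneg[OF G])
 \<comment> \<open>With m = l e^N the logarithm in \<open>green_J\<close> is N up to sign; the
   constants are chosen so that b \<ge> (N - 1)/(4 pi) \<ge> g + 1.\<close>
 define N where "N = 4 * pi * (g + 1) + 2"
 define m where "m = l * exp N"
 have N: "N > 2" using g0 by (simp add: N_def add_pos_nonneg)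
 have "N\<^sup>2 > 0" using N by simp
 then have eN: "exp N > 1 + N" using exp_lower_Taylor_quadratic[of N] N by linarith
 have m: "m > 0" using l by (simp add: m_def)
 have J: "green_J l m = N / (l * (exp N - 1))"
  using l N by (simp add: green_J_def m_def ln_div ln_mult field_simps)
 have lJ: "l * green_J l m \<le> 1" "0 \<le> l * green_J l m"
  unfolding J using l N eN by (auto simp: divide_le_eq)
 have mJ: "m * green_J l m \<ge> N"
 proof -
  have "m * green_J l m = N * (exp N / (exp N - 1))" unfolding J using l by (simp add: m_def)
  moreover have "exp N / (exp N - 1) \<ge> 1" using eN N by (simp add: le_divide_eq)
  ultimately show ?thesis using N mult_left_mono[of 1 "exp N / (exp N - 1)" N] by simp
 qed
 define b where "b = (m * green_J l m - 1) / (4 * pi)"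
 define a where "a = gmass (\<lambda>x. Green l x - Green m x)"
 have bb: "grad_ip (Green l) (\<lambda>x. Green l x - Green m x) = of_real b"
  unfolding grad_ip_Green_diff'[OF l m G] using l m
  by (simp add: Green_ip b_def green_J_def[of l l] diff_divide_distrib)
 have a: "a = b + (l * green_J l m - 1) / (4 * pi)"
  unfolding a_def gmass_Green_diff[OF l m] b_def by (simp add: field_simps)
 have b: "b \<ge> g + 1" using mJ by (simp add: b_def N_def field_simps)
 have "a \<le> b" using lJ by (simp add: a divide_nonpos_pos)
 moreover have "a \<ge> 0" unfolding a_def by (rule gmass_nonneg[OF Green_diff_W12[OF l m]])
 moreover have "b \<le> sqrt g * sqrt a"
  using grad_ip_le[OF G Green_diff_W12[OF l m]] b g0 unfolding bb a_def g_def by simp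
 ultimately have "b\<^sup>2 \<le> g * a" using g0 b power_mono[of b "sqrt g * sqrt a" 2] by (simp add: power_mult_distrib)
 also have "\<dots> \<le> g * b" using \<open>a \<le> b\<close> g0 by (rule mult_left_mono)
 finally have "b * b \<le> g * b" by (simp add: power2_eq_square)
 then show False using b g0 by (simp add: mult_le_cancel_right)
qed

section \<open>Charge, regular part and the quadratic form\<close>

text \<open>Differences of Green functions lie in \<open>W12\<close>, so two different charges would
  put G_l itself there.\<close>

lemma charge_unique:
 assumes "\<phi>1 \<in> W12" "\<phi>2 \<in> W12" "l > 0" "m > 0"
  and eq: "(\<lambda>x. \<phi>1 x + q1 * Green l x) = (\<lambda>x. \<phi>2 x + q2 * Green m x)"
 shows "q1 = q2"
proof (rule ccontr)
 assume "q1 \<noteq> q2"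
 have "(\<lambda>x. (1 / (q1 - q2)) * ((\<phi>2 x - \<phi>1 x) + q2 * (Green m x - Green l x))) \<in> W12"
  by (intro W12_cmult W12_add W12_diff Green_diff_W12 assms)
 also have "(\<lambda>x. (1 / (q1 - q2)) * ((\<phi>2 x - \<phi>1 x) + q2 * (Green m x - Green l x))) = Green l"
 proof
  fix x
  have "\<phi>1 x + q1 * Green l x = \<phi>2 x + q2 * Green m x" using fun_cong[OF eq] .
  then have "(\<phi>2 x - \<phi>1 x) + q2 * (Green m x - Green l x) = (q1 - q2) * Green l x" by (simp add: algebra_simps)
  then show "(1 / (q1 - q2)) * ((\<phi>2 x - \<phi>1 x) + q2 * (Green m x - Green l x)) = Green l x"
   using \<open>q1 \<noteq> q2\<close> by simp
 qed
 finally show False using Green_not_W12[OF \<open>l > 0\<close>] by blast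
qed

lemma charge_eq:
 assumes "\<phi> \<in> W12" "l > 0"
 shows "charge (\<lambda>x. \<phi> x + q * Green l x) = q"
 unfolding charge_def
proof (rule the_equality)
 show "\<exists>\<phi>'\<in>W12. \<exists>m>0. (\<lambda>x. \<phi> x + q * Green l x) = (\<lambda>x. \<phi>' x + q * Green m x)"
  using assms by blast
 fix q' assume "\<exists>\<phi>'\<in>W12. \<exists>m>0. (\<lambda>x. \<phi> x + q * Green l x) = (\<lambda>x. \<phi>' x + q' * Green m x)"
 then obtain \<phi>' m where "\<phi>' \<in> W12" "m > 0" "(\<lambda>x. \<phi> x + q * Green l x) = (\<lambda>x. \<phi>' x + q' * Green m x)" by blast
 from charge_unique[OF assms(1) this(1) assms(2) this(2,3)] show "q' = q" by (rule sym)
qed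

lemma regular_part_W12:
 assumes u: "u \<in> W12_point" and l: "l > 0"
 shows "regular_part l u \<in> W12"
proof -
 obtain \<phi> q m where p: "u = (\<lambda>x. \<phi> x + q * Green m x)" "\<phi> \<in> W12" "m > 0"
  using u by (auto simp: W12_point_def)
 have "regular_part l u = (\<lambda>x. \<phi> x + q * (Green m x - Green l x))"
  unfolding regular_part_def p(1) charge_eq[OF p(2,3)] by (simp add: algebra_simps)
 also have "\<dots> \<in> W12" by (intro W12_add W12_cmult Green_diff_W12 p l)
 finally show ?thesis .
qed

lemma decomposition: "u = (\<lambda>x. regular_part l u x + charge u * Green l x)"
 by (simp add: regular_part_def)

lemma W12_pointI: "\<phi> \<in> W12 \<Longrightarrow> l > 0 \<Longrightarrow> (\<lambda>x. \<phi> x + q * Green l x) \<in> W12_point"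
 by (auto simp: W12_point_def)

lemma regular_part_eq:
 assumes "\<phi> \<in> W12" "l > 0"
 shows "regular_part l (\<lambda>x. \<phi> x + q * Green l x) = \<phi>"
 unfolding regular_part_def charge_eq[OF assms] by simp

lemma W12_point_L2: assumes "u \<in> W12_point" shows "u \<in> L2"
proof -
 have "(\<lambda>x. regular_part 1 u x + charge u * Green 1 x) \<in> L2"
  by (intro L2_add L2_cmult Green_L2 W12_L2 regular_part_W12 assms) auto
 then show ?thesis using decomposition[of u 1] by simp
qed

lemma W12_charge:
 assumes "u \<in> W12" shows "u \<in> W12_point" "charge u = 0" "regular_part l u = u"
proof -
 have e: "u = (\<lambda>x. u x + 0 * Green 1 x)" by simp
 show "u \<in> W12_point" using W12_pointI[OF assms, of 1 0] by simp
 show c: "charge u = 0" using charge_eq[OF assms, of 1 0] by simp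
 show "regular_part l u = u" by (simp add: regular_part_def c)
qed

lemma charge_zero_W12: "u \<in> W12_point \<Longrightarrow> charge u = 0 \<Longrightarrow> u \<in> W12"
 using regular_part_W12[of u 1] decomposition[of u 1] by simp

lemma theta_diff:
 assumes "l > 0" "m > 0" shows "theta l - theta m = (l - m) * green_J l m / (4 * pi)"
 using assms by (auto simp: theta_def green_J_def ln_div ln_sqrt field_simps)

lemma H_form_at_self:
 assumes u: "u \<in> W12_point" and l: "l > 0"
 shows "H_form_at l \<alpha> u u = of_real (gmass (regular_part l u) + l * (mass (regular_part l u) - mass u) + (\<alpha> + theta l) * (norm (charge u))\<^sup>2)"
proof -
 have R: "regular_part l u \<in> W12" by (rule regular_part_W12[OF assms])
 have q: "cnj (charge u) * charge u = of_real ((norm (charge u))\<^sup>2)"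
  by (simp add: complex_norm_square mult.commute del: of_real_power)
 show ?thesis
  unfolding H_form_at_def grad_ip_self[OF R] L2_ip_self[OF W12_L2[OF R]] L2_ip_self[OF W12_point_L2[OF u]] mult.assoc q by simp
qed

text \<open>Passing from l to m adds q (G_l - G_m) to the regular part. In the expansion the cross
  terms cancel by the weak identity for the Laplacian, and the change of \<theta> matches the
  remaining multiple of |q|^2. Energies and norms see only the diagonal of the form.\<close>

lemma H_form_at_indep:
 assumes u: "u \<in> W12_point" and l: "l > 0" and m: "m > 0"
 shows "H_form_at l \<alpha> u u = H_form_at m \<alpha> u u"
proof -
 define q where "q = charge u"
 define \<phi> where "\<phi> = regular_part l u"
 define D where "D = (\<lambda>x. Green l x - Green m x)"
 have W: "\<phi> \<in> W12" "D \<in> W12" unfolding \<phi>_def D_def by (rule regular_part_W12[OF u l], rule Green_diff_W12[OF l m])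
 note L = W[THEN W12_L2] Green_L2[OF l] Green_L2[OF m] and qD = W12_cmult[OF W(2), of q]
 have \<psi>: "regular_part m u = (\<lambda>x. \<phi> x + q * D x)"
  unfolding regular_part_def \<phi>_def D_def q_def by (simp add: algebra_simps)
 define X Y Q J P where "X = Re (q * L2_ip \<phi> (Green l))" and "Y = Re (q * L2_ip \<phi> (Green m))"
  and "Q = (norm q)\<^sup>2" and "J = green_J l m / (4 * pi)" and "P = 1 / (4 * pi)"
 have mu: "mass u = mass \<phi> + 2 * X + Q * (P / l)"
 proof -
  have "mass u = mass (\<lambda>x. \<phi> x + q * Green l x)" unfolding \<phi>_def q_def using decomposition[of u l] by simp
  also have "\<dots> = mass \<phi> + 2 * X + Q * (P / l)"
   unfolding mass_add[OF L(1) L2_cmult[OF L(3)]] by (simp add: X_def Q_def P_def L2_ip_cmult_right mass_cmult Green_mass[OF l])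
  finally show ?thesis .
 qed
 have mD: "mass D = P / l - 2 * J + P / m"
  unfolding D_def mass_diff[OF L(3,4)] by (simp add: Green_mass l m Green_ip J_def P_def)
 have m\<psi>: "mass (regular_part m u) = mass \<phi> + 2 * (X - Y) + Q * mass D"
 proof -
  have "Re (L2_ip \<phi> (\<lambda>x. q * D x)) = X - Y"
   unfolding D_def L2_ip_cmult_right L2_ip_diff_right[OF L(1,3,4)] by (simp add: X_def Y_def right_diff_distrib)
  then show ?thesis unfolding \<psi> mass_add[OF L(1) L2_cmult[OF L(2)]] by (simp add: Q_def mass_cmult)
 qed
 have g\<psi>: "gmass (regular_part m u) = gmass \<phi> + 2 * (m * Y - l * X) + Q * ((l + m) * J - 2 * P)"
 proof -
  have "grad_ip \<phi> (\<lambda>x. q * D x) = of_real m * (q * L2_ip \<phi> (Green m)) - of_real l * (q * L2_ip \<phi> (Green l))"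
   unfolding grad_ip_cmult_right[OF W] unfolding D_def grad_ip_Green_diff'[OF l m W(1)] by (simp add: algebra_simps)
  moreover have "Re (of_real r * z) = r * Re z" for r z by simp
  ultimately have "Re (grad_ip \<phi> (\<lambda>x. q * D x)) = m * Y - l * X" by (simp only: X_def Y_def minus_complex.sel)
  moreover have "gmass D = (l + m) * J - 2 * P" unfolding D_def gmass_Green_diff[OF l m] J_def P_def by (simp add: diff_divide_distrib)
  ultimately show ?thesis unfolding \<psi> gmass_add[OF W(1) qD] by (simp add: Q_def gmass_cmult[OF W(2)])
 qed
 have th: "theta l = theta m + (l - m) * J" using theta_diff[OF l m] by (simp add: J_def)
 show ?thesis
  unfolding H_form_at_self[OF u l] H_form_at_self[OF u m] \<phi>_def[symmetric] q_def[symmetric] Q_def[symmetric] m\<psi> g\<psi> mu mD th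
  using l m by (simp add: algebra_simps)
qed

lemma H_form_eq:
 assumes "u \<in> W12_point" "l > 0" shows "H_form \<alpha> u u = H_form_at l \<alpha> u u"
 unfolding H_form_def
 by (rule the_equality) (use assms H_form_at_indep in blast)+

lemma H_quad_eq:
 assumes u: "u \<in> W12_point" and l: "l > 0"
 shows "H_quad \<alpha> u = gmass (regular_part l u) + l * (mass (regular_part l u) - mass u) + (\<alpha> + theta l) * (norm (charge u))\<^sup>2"
 by (simp only: H_quad_def H_form_eq[OF assms] H_form_at_self[OF assms] Re_complex_of_real)

lemma H_form_self:
 assumes u: "u \<in> W12_point" shows "H_form \<alpha> u u = of_real (H_quad \<alpha> u)"
 by (simp only: H_form_eq[OF u zero_less_one] H_form_at_self[OF u zero_less_one] H_quad_eq[OF u zero_less_one])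

lemma W12_point_add:
 assumes "u \<in> W12_point" "v \<in> W12_point"
 shows "(\<lambda>x. u x + c * v x) \<in> W12_point" "charge (\<lambda>x. u x + c * v x) = charge u + c * charge v"
  "l > 0 \<Longrightarrow> regular_part l (\<lambda>x. u x + c * v x) = (\<lambda>x. regular_part l u x + c * regular_part l v x)"
proof -
 have e: "(\<lambda>x. u x + c * v x) = (\<lambda>x. (regular_part l u x + c * regular_part l v x) + (charge u + c * charge v) * Green l x)" for l
  by (simp add: regular_part_def algebra_simps)
 have W: "(\<lambda>x. regular_part l u x + c * regular_part l v x) \<in> W12" if "l > 0" for l
  by (intro W12_add W12_cmult regular_part_W12 assms that)
 show "(\<lambda>x. u x + c * v x) \<in> W12_point" unfolding e[of 1] by (intro W12_pointI W) auto
 show "charge (\<lambda>x. u x + c * v x) = charge u + c * charge v" unfolding e[of 1] by (intro charge_eq W) auto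
 show "l > 0 \<Longrightarrow> regular_part l (\<lambda>x. u x + c * v x) = (\<lambda>x. regular_part l u x + c * regular_part l v x)"
  unfolding e[of l] by (intro regular_part_eq W)
qed

section \<open>The logarithmic interaction\<close>

text \<open>Complement of \<open>lw\<close> in the splitting ln |z| = lw z - kf z of the
  sign-changing kernel into nonnegative ones: \<open>lw\<close> carries the growth at infinity,
  \<open>kf\<close> the singularity at 0.\<close>

definition kf :: "real^2 \<Rightarrow> real" where "kf z = ln (1 + 1 / norm z)"

lemma kf_nonneg [simp]: "0 \<le> kf z" by (simp add: kf_def)

lemma kf_measurable [measurable]: "kf \<in> borel_fun" by (simp add: kf_def[abs_def])

lemma kf_uminus: "kf (- z) = kf z" by (simp add: kf_def)

text \<open>At \<open>z = 0\<close> all three terms vanish, since \<open>ln 0 = 0\<close> and \<open>1 / 0 = 0\<close>.\<close>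

lemma ln_norm_split: "ln (norm z) = lw z - kf z"
proof (cases "z = 0")
 case False
 then have n: "norm z > 0" by simp
 have "1 + 1 / norm z = (1 + norm z) / norm z" using n by (simp add: field_simps)
 then have "kf z = ln (1 + norm z) - ln (norm z)" using n add_pos_nonneg[of 1 "norm z"] by (simp add: kf_def ln_div less_imp_neq[symmetric])
 then show ?thesis by (simp add: lw_def)
qed (simp add: lw_def kf_def)

lemma kf_far: "norm z \<ge> 1 \<Longrightarrow> kf z \<le> ln 2"
 unfolding kf_def by (rule ln_mono) (auto simp: divide_le_eq intro: add_pos_nonneg)

lemma cube_le_exp: assumes "0 \<le> s" shows "s ^ 3 \<le> 27 * exp (s::real)"
proof -
 have "s / 3 \<le> exp (s / 3)" using exp_ge_add_one_self[of "s/3"] by linarith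
 then have "(s / 3) ^ 3 \<le> exp (s / 3) ^ 3" using assms by (intro power_mono) auto
 also have "\<dots> = exp s" by (simp flip: exp_of_nat_mult)
 finally show ?thesis by (simp add: power_divide)
qed

definition kf3 :: "real^2 \<Rightarrow> real" where "kf3 z = (if norm z \<le> 1 then kf z ^ 3 else 0)"

lemma kf3_nonneg [simp]: "0 \<le> kf3 z" by (simp add: kf3_def)

lemma kf3_measurable [measurable]: "kf3 \<in> borel_fun" unfolding kf3_def[abs_def] by measurable

text \<open>Exponentiating removes the logarithm: s^3 \<le> 27 e^s with s = \<open>kf x\<close>
  leaves 1 + 1/|x|, which is integrable near 0.\<close>

lemma kf3_integrable: "L1 kf3"
proof (rule integrable_dominated)
 show "L1 (\<lambda>x::real^2. 54 * exp 1 * (exp (- 1 * norm x) / norm x))"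
  by (intro integrable_mult_right integrable_exp_over_norm) simp
 show "AE x in lborel. norm (kf3 x) \<le> norm (54 * exp 1 * (exp (- 1 * norm x) / norm x))"
 proof (rule AE_I2)
  fix x :: "real^2"
  show "norm (kf3 x) \<le> norm (54 * exp 1 * (exp (- 1 * norm x) / norm x))"
  proof (cases "norm x \<le> 1 \<and> x \<noteq> 0")
   case True
   then have n: "norm x > 0" "norm x \<le> 1" by auto
   have "kf x ^ 3 \<le> 27 * exp (kf x)" by (rule cube_le_exp) simp
   also have "exp (kf x) = 1 + 1 / norm x" using n by (simp add: kf_def add_pos_nonneg)
   also have "27 * (1 + 1 / norm x) \<le> 54 * (1 / norm x)" using n by (simp add: field_simps)
   also have "\<dots> \<le> 54 * (exp (1 - norm x) / norm x)" using n by (intro mult_left_mono divide_right_mono) auto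
   also have "\<dots> = 54 * exp 1 * (exp (- 1 * norm x) / norm x)" by (simp add: exp_diff exp_minus field_simps)
   finally show ?thesis using True by (simp add: kf3_def)
  qed (auto simp: kf3_def kf_def)
 qed
qed simp

text \<open>A Young inequality with exponents 3 and 3/2. On the unit disc one compares sqrt g with
  \<open>kf z\<close>; outside, \<open>kf\<close> is at most ln 2.\<close>

lemma kf_mult_le:
 assumes "g \<ge> 0" shows "kf z * g \<le> kf3 z + ln 2 * g + g powr (3/2)"
proof (cases "norm z \<le> 1")
 case True
 show ?thesis
 proof (cases "sqrt g \<le> kf z")
  case sg: True
  have "g = (sqrt g)\<^sup>2" using assms by simp
  also have "\<dots> \<le> (kf z)\<^sup>2" using sg assms by (intro power_mono) auto
  finally have "kf z * g \<le> kf z * (kf z)\<^sup>2" by (intro mult_left_mono) auto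
  then show ?thesis using True assms by (simp add: kf3_def power2_eq_square power3_eq_cube add_increasing2)
 next
  case False
  then have "kf z * g \<le> sqrt g * g" using assms by (intro mult_right_mono) auto
  also have "\<dots> = g powr (1/2) * g powr 1" using assms by (simp add: powr_half_sqrt)
  also have "\<dots> = g powr (3/2)" unfolding powr_add[symmetric] by simp
  finally show ?thesis using assms by (simp add: add_increasing)
 qed
next
 case False
 then have "kf z * g \<le> ln 2 * g" using kf_far[of z] assms by (intro mult_right_mono) auto
 then show ?thesis by (simp add: add_increasing add_increasing2)
qed

text \<open>The properties of |u|^2 on which both parts of the interaction depend; for this density
  the power 3/2 is the cube of |u|.\<close>

definition dens :: "(real^2 \<Rightarrow> real) \<Rightarrow> bool" where
 "dens f \<longleftrightarrow> f \<in> borel_fun \<and> (\<forall>x. 0 \<le> f x) \<and> L1 f \<and>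
   L1 (\<lambda>x. lw x * f x) \<and> L1 (\<lambda>x. f x powr (3/2))"

lemma densD:
 assumes "dens f"
 shows "f \<in> borel_fun" "0 \<le> f x" "L1 f"
  "L1 (\<lambda>x. lw x * f x)" "L1 (\<lambda>x. f x powr (3/2))"
 using assms by (auto simp: dens_def)

text \<open>A bound, uniform in the position, for the potential that g generates through
  \<open>kf\<close>.\<close>

definition pot :: "(real^2 \<Rightarrow> real) \<Rightarrow> real" where
 "pot g = (LBINT x. kf3 x) + ln 2 * (LBINT x. g x) + (LBINT x. g x powr (3/2))"

lemma pot_nonneg: "dens g \<Longrightarrow> pot g \<ge> 0"
 unfolding pot_def using densD(2)[of g] by (intro add_nonneg_nonneg mult_nonneg_nonneg integral_nonneg_AE) auto

lemma pot_bound: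
 assumes g: "dens g"
 shows "(NNL y. ennreal (kf (x - y) * g y)) \<le> ennreal (pot g)"
proof -
 note D = densD[OF g]
 note [measurable] = D(1)
 have i: "L1 (\<lambda>y. kf3 (x - y))" by (rule integrable_reflect_plane[OF kf3_integrable])
 have int: "L1 (\<lambda>y. kf3 (x - y) + ln 2 * g y + g y powr (3/2))" using i D by simp
 have "(NNL y. ennreal (kf (x - y) * g y)) \<le> (NNL y. ennreal (kf3 (x - y) + ln 2 * g y + g y powr (3/2)))"
  by (intro nn_integral_mono ennreal_leI kf_mult_le D)
 also have "\<dots> = ennreal (LBINT y. kf3 (x - y) + ln 2 * g y + g y powr (3/2))"
  by (rule nn_integral_eq_integral[OF int]) (simp add: D add_nonneg_nonneg)
 also have "(LBINT y. kf3 (x - y) + ln 2 * g y + g y powr (3/2)) = pot g"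
  using i D integral_reflect_plane[of kf3 x] by (simp add: pot_def)
 finally show ?thesis .
qed

definition bil :: "(real^2 \<Rightarrow> real) \<Rightarrow> (real^2 \<Rightarrow> real) \<Rightarrow> (real^2 \<Rightarrow> real) \<Rightarrow> (real^2) \<times> (real^2) \<Rightarrow> real" where
 "bil k f g = (\<lambda>z. k (fst z - snd z) * f (fst z) * g (snd z))"

lemma pair_nn_bound:
 assumes [measurable]: "h \<in> borel_measurable lborel2" and nn: "\<And>z. 0 \<le> h z"
  and le: "(NNL x. (NNL y. ennreal (h (x, y)))) \<le> ennreal C" and C: "C \<ge> 0"
 shows "integrable lborel2 (h :: (real^2) \<times> (real^2) \<Rightarrow> real)" "(\<integral>z. h z \<partial>lborel2) \<le> C"
proof -
 have eq: "(\<integral>\<^sup>+z. ennreal (h z) \<partial>lborel2) \<le> ennreal C"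
  using le by (subst lborel.nn_integral_fst[symmetric]) auto
 show i: "integrable lborel2 h"
  by (rule integrableI_nonneg) (use nn eq in \<open>auto simp: le_less_trans\<close>)
 show "(\<integral>z. h z \<partial>lborel2) \<le> C"
  using eq C nn by (simp add: nn_integral_eq_integral[OF i])
qed

lemma bil_measurable [measurable]:
 assumes [measurable]: "k \<in> borel_fun" "f \<in> borel_fun" "g \<in> borel_fun"
 shows "bil k f g \<in> borel_measurable lborel2"
proof -
 have "(\<lambda>z. k (fst z - snd z) * f (fst z) * g (snd z)) \<in> borel_measurable (borel \<Otimes>\<^sub>M borel)" by measurable
 then show ?thesis by (simp add: bil_def cong: measurable_cong_sets)
qed

lemma bil_kf:
 assumes f: "f \<in> borel_fun" "\<And>x. 0 \<le> f x" "L1 f" and g: "dens g"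
 shows "integrable lborel2 (bil kf f g)"
  "(\<integral>z. bil kf f g z \<partial>lborel2) \<le> (LBINT x. f x) * pot g"
proof -
 note [measurable] = f(1) densD(1)[OF g]
 have "(NNL x. (NNL y. ennreal (bil kf f g (x, y)))) = (NNL x. ennreal (f x) * (NNL y. ennreal (kf (x - y) * g y)))"
  by (intro nn_integral_cong, subst nn_integral_cmult[symmetric], measurable)
    (auto simp: bil_def ennreal_mult[symmetric] f densD[OF g] ac_simps intro!: nn_integral_cong)
 also have "\<dots> \<le> (NNL x. ennreal (f x) * ennreal (pot g))"
  by (intro nn_integral_mono mult_left_mono pot_bound g) simp
 also have "\<dots> = ennreal ((LBINT x. f x) * pot g)"
  using f pot_nonneg[OF g] by (simp add: nn_integral_multc nn_integral_eq_integral ennreal_mult integral_nonneg_AE)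
 finally have le: "(NNL x. (NNL y. ennreal (bil kf f g (x, y)))) \<le> ennreal ((LBINT x. f x) * pot g)" .
 have nn: "0 \<le> bil kf f g z" for z by (simp add: bil_def f densD[OF g])
 have C: "0 \<le> (LBINT x. f x) * pot g" using f pot_nonneg[OF g] by (simp add: integral_nonneg_AE)
 show "integrable lborel2 (bil kf f g)" "(\<integral>z. bil kf f g z \<partial>lborel2) \<le> (LBINT x. f x) * pot g"
  by (rule pair_nn_bound[OF _ nn le C], measurable)+
qed

lemma bil_lw:
 assumes f: "f \<in> borel_fun" "\<And>x. 0 \<le> f x" "L1 f" "L1 (\<lambda>x. lw x * f x)"
  and g: "g \<in> borel_fun" "\<And>x. 0 \<le> g x" "L1 g" "L1 (\<lambda>x. lw x * g x)"
 shows "integrable lborel2 (bil lw f g)"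
  "(\<integral>z. bil lw f g z \<partial>lborel2) \<le>
    (LBINT x. lw x * f x) * (LBINT x. g x) + (LBINT x. f x) * (LBINT x. lw x * g x)"
proof -
 note [measurable] = f(1) g(1)
 let ?C = "(LBINT x. lw x * f x) * (LBINT x. g x) + (LBINT x. f x) * (LBINT x. lw x * g x)"
 have "(NNL x. (NNL y. ennreal (bil lw f g (x, y)))) \<le>
  (NNL x. (NNL y. ennreal (lw x * f x) * ennreal (g y) + ennreal (f x) * ennreal (lw y * g y)))"
 proof (intro nn_integral_mono)
  fix x y :: "real^2"
  have "bil lw f g (x, y) \<le> (lw x + lw y) * (f x * g y)"
   using lw_diff[of x y] f g by (simp add: bil_def mult.assoc mult_right_mono)
  also have "\<dots> = (lw x * f x) * g y + f x * (lw y * g y)" by (simp add: algebra_simps)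
  finally have "ennreal (bil lw f g (x, y)) \<le> ennreal ((lw x * f x) * g y + f x * (lw y * g y))" by (rule ennreal_leI)
  then show "ennreal (bil lw f g (x, y)) \<le> ennreal (lw x * f x) * ennreal (g y) + ennreal (f x) * ennreal (lw y * g y)"
   using f g by (simp add: ennreal_mult[symmetric] ennreal_plus[symmetric] del: ennreal_plus)
 qed
 also have "\<dots> = (NNL x. ennreal (lw x * f x) * ennreal (LBINT y. g y) + ennreal (f x) * ennreal (LBINT y. lw y * g y))"
  using f g by (intro nn_integral_cong) (simp add: nn_integral_add nn_integral_cmult nn_integral_eq_integral)
 also have "\<dots> = ennreal (LBINT x. lw x * f x) * ennreal (LBINT y. g y) + ennreal (LBINT x. f x) * ennreal (LBINT y. lw y * g y)"
  using f g by (simp add: nn_integral_add nn_integral_multc nn_integral_eq_integral)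
 also have "\<dots> = ennreal ?C"
  using f g by (simp add: ennreal_mult[symmetric] ennreal_plus[symmetric] integral_nonneg_AE del: ennreal_plus)
 finally have le: "(NNL x. (NNL y. ennreal (bil lw f g (x, y)))) \<le> ennreal ?C" .
 have nn: "0 \<le> bil lw f g z" for z by (simp add: bil_def f g)
 have C: "0 \<le> ?C" using f g by (intro add_nonneg_nonneg mult_nonneg_nonneg integral_nonneg_AE) auto
 show "integrable lborel2 (bil lw f g)" "(\<integral>z. bil lw f g z \<partial>lborel2) \<le> ?C"
  by (rule pair_nn_bound[OF _ nn le C], measurable)+
qed

lemma bil_swap:
 assumes k: "\<And>z. k (- z) = k z" and i: "integrable lborel2 (bil k f g)"
 shows "integrable lborel2 (bil k g f)"
  "(\<integral>z. bil k g f z \<partial>lborel2) = (\<integral>z. bil k f g z \<partial>lborel2)"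
proof -
 have e: "bil k g f = (\<lambda>(x, y). bil k f g (y, x))"
  using k[of "snd z - fst z" for z :: "(real^2) \<times> (real^2)"] by (auto simp: bil_def fun_eq_iff)
 show "integrable lborel2 (bil k g f)"
  unfolding e by (rule lborel_pair.integrable_product_swap[OF i])
 show "(\<integral>z. bil k g f z \<partial>lborel2) = (\<integral>z. bil k f g z \<partial>lborel2)"
  unfolding e by (rule lborel_pair.integral_product_swap[OF borel_measurable_integrable[OF i]])
qed

text \<open>Polarisation: f(x) f(y) - g(x) g(y) = (f - g)(x) f(y) + g(x) (f - g)(y), followed by the
  symmetry of the kernel.\<close>

lemma bil_difference:
 assumes k: "\<And>z. k (- z) = k z" "\<And>z. 0 \<le> k z" and h: "\<And>x. h x = \<bar>f x - g x\<bar>"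
  and nn: "\<And>x. 0 \<le> f x" "\<And>x. 0 \<le> g x"
  and i: "integrable lborel2 (bil k f f)" "integrable lborel2 (bil k g g)"
   "integrable lborel2 (bil k h f)" "integrable lborel2 (bil k h g)"
 shows "\<bar>(\<integral>z. bil k f f z \<partial>lborel2) - (\<integral>z. bil k g g z \<partial>lborel2)\<bar> \<le>
  (\<integral>z. bil k h f z \<partial>lborel2) + (\<integral>z. bil k h g z \<partial>lborel2)"
proof -
 let ?M = "lborel \<Otimes>\<^sub>M lborel :: ((real^2) \<times> (real^2)) measure"
 note sw = bil_swap[OF k(1) i(4)]
 have "\<bar>(\<integral>z. bil k f f z \<partial>?M) - (\<integral>z. bil k g g z \<partial>?M)\<bar> = \<bar>\<integral>z. bil k f f z - bil k g g z \<partial>?M\<bar>"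
  using i by simp
 also have "\<dots> \<le> (\<integral>z. \<bar>bil k f f z - bil k g g z\<bar> \<partial>?M)" by (rule integral_abs_bound)
 also have "\<dots> \<le> (\<integral>z. bil k h f z + bil k g h z \<partial>?M)"
 proof (rule integral_mono)
  fix z
  have "f (fst z) * f (snd z) - g (fst z) * g (snd z) = (f (fst z) - g (fst z)) * f (snd z) + g (fst z) * (f (snd z) - g (snd z))"
   by (simp add: algebra_simps)
  then have "\<bar>f (fst z) * f (snd z) - g (fst z) * g (snd z)\<bar> \<le> h (fst z) * f (snd z) + g (fst z) * h (snd z)"
   using abs_triangle_ineq[of "(f (fst z) - g (fst z)) * f (snd z)" "g (fst z) * (f (snd z) - g (snd z))"] nn
   by (simp add: h abs_mult)
  then have "k (fst z - snd z) * \<bar>f (fst z) * f (snd z) - g (fst z) * g (snd z)\<bar> \<le> k (fst z - snd z) * (h (fst z) * f (snd z) + g (fst z) * h (snd z))"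
   by (rule mult_left_mono) (rule k)
  moreover have "\<bar>bil k f f z - bil k g g z\<bar> = k (fst z - snd z) * \<bar>f (fst z) * f (snd z) - g (fst z) * g (snd z)\<bar>"
  proof -
   have "bil k f f z - bil k g g z = k (fst z - snd z) * (f (fst z) * f (snd z) - g (fst z) * g (snd z))"
    by (simp add: bil_def algebra_simps)
   then show ?thesis using k(2) by (simp add: abs_mult)
  qed
  moreover have "bil k h f z + bil k g h z = k (fst z - snd z) * (h (fst z) * f (snd z) + g (fst z) * h (snd z))"
   by (simp add: bil_def algebra_simps)
  ultimately show "\<bar>bil k f f z - bil k g g z\<bar> \<le> bil k h f z + bil k g h z" by simp
 qed (use i sw in auto)
 also have "\<dots> = (\<integral>z. bil k h f z \<partial>?M) + (\<integral>z. bil k h g z \<partial>?M)" using i sw by simp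
 finally show ?thesis .
qed

section \<open>The two parts of the interaction energy\<close>

definition sqf :: "wfun \<Rightarrow> real^2 \<Rightarrow> real" where "sqf u x = (norm (u x))\<^sup>2"

definition V1 :: "wfun \<Rightarrow> real" where "V1 u = (\<integral>z. bil lw (sqf u) (sqf u) z \<partial>lborel2)"

definition V2 :: "wfun \<Rightarrow> real" where "V2 u = (\<integral>z. bil kf (sqf u) (sqf u) z \<partial>lborel2)"

lemma sqf_nonneg [simp]: "0 \<le> sqf u x" by (simp add: sqf_def)

lemma sqf_powr: "sqf u x powr (3/2) = norm (u x) powr 3"
proof (cases "u x = 0")
 case False
 have "sqf u x powr (3/2) = (norm (u x) powr 2) powr (3/2)" using False by (simp add: sqf_def)
 also have "\<dots> = norm (u x) powr 3" unfolding powr_powr by simp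
 finally show ?thesis .
qed (simp add: sqf_def)

lemma dens_sqf:
 assumes "u \<in> L2" "L1_lw u" "L1 (\<lambda>x. norm (u x) powr 3)"
 shows "dens (sqf u)"
 unfolding dens_def sqf_powr using assms L2D[OF assms(1)] by (auto simp: sqf_def[abs_def])

lemma interaction_split:
 assumes d: "dens (sqf u)"
 shows "(\<integral>z. ln (norm (fst z - snd z)) * (norm (u (fst z)))\<^sup>2 * (norm (u (snd z)))\<^sup>2 \<partial>lborel2) = V1 u - V2 u"
  "integrable lborel2 (bil lw (sqf u) (sqf u))" "integrable lborel2 (bil kf (sqf u) (sqf u))"
proof -
 note D = densD[OF d]
 show i: "integrable lborel2 (bil lw (sqf u) (sqf u))" "integrable lborel2 (bil kf (sqf u) (sqf u))"
  by (rule bil_lw(1)[OF D(1,2,3,4,1,2,3,4)], rule bil_kf(1)[OF D(1,2,3) d])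
 have "(\<lambda>z. ln (norm (fst z - snd z)) * (norm (u (fst z)))\<^sup>2 * (norm (u (snd z)))\<^sup>2) = (\<lambda>z. bil lw (sqf u) (sqf u) z - bil kf (sqf u) (sqf u) z)"
  by (auto simp: bil_def ln_norm_split sqf_def algebra_simps)
 then show "(\<integral>z. ln (norm (fst z - snd z)) * (norm (u (fst z)))\<^sup>2 * (norm (u (snd z)))\<^sup>2 \<partial>lborel2) = V1 u - V2 u"
  using i by (simp add: V1_def V2_def)
qed

lemma V1_nonneg: "V1 u \<ge> 0" unfolding V1_def by (rule integral_nonneg_AE) (simp add: bil_def)

lemma integral_sqf: "(LBINT x. sqf u x) = mass u" by (simp add: mass_def sqf_def)

lemma pot_sqf: "pot (sqf u) = (LBINT x. kf3 x) + ln 2 * mass u + Lp_int 3 u"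
 by (simp add: pot_def sqf_powr integral_sqf)

lemma V2_le: assumes d: "dens (sqf u)" shows "V2 u \<le> mass u * pot (sqf u)"
 using bil_kf(2)[OF densD(1,2,3)[OF d] d] by (simp add: V2_def integral_sqf)

lemma sqf_diff_L1:
 assumes "u \<in> L2" "v \<in> L2"
 shows "L1 (\<lambda>x. \<bar>sqf u x - sqf v x\<bar>)"
  "(LBINT x. \<bar>sqf u x - sqf v x\<bar>) \<le> L2_dist u v * (nrm u + nrm v)"
proof -
 have L: "(\<lambda>x. u x - v x) \<in> L2" by (rule L2_diff[OF assms])
 have i: "L1 (sqf u)" "L1 (sqf v)"
  using assms[THEN L2_integrable] by (auto simp: sqf_def[abs_def])
 then show i1: "L1 (\<lambda>x. \<bar>sqf u x - sqf v x\<bar>)" by simp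
 have "(LBINT x. \<bar>sqf u x - sqf v x\<bar>) \<le> (LBINT x. norm (u x - v x) * norm (u x) + norm (u x - v x) * norm (v x))"
 proof (rule integral_mono[OF i1])
  show "L1 (\<lambda>x. norm (u x - v x) * norm (u x) + norm (u x - v x) * norm (v x))"
   using L2_norm_mult_integrable[OF L assms(1)] L2_norm_mult_integrable[OF L assms(2)] by simp
  fix x
  have "\<bar>sqf u x - sqf v x\<bar> = \<bar>norm (u x) - norm (v x)\<bar> * (norm (u x) + norm (v x))"
   by (simp add: sqf_def power2_eq_square square_diff_square_factored abs_mult mult.commute)
  also have "\<dots> \<le> norm (u x - v x) * (norm (u x) + norm (v x))"
   by (intro mult_right_mono norm_triangle_ineq3) auto
  finally show "\<bar>sqf u x - sqf v x\<bar> \<le> norm (u x - v x) * norm (u x) + norm (u x - v x) * norm (v x)"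
   by (simp add: distrib_left)
 qed
 also have "\<dots> = (LBINT x. norm (u x - v x) * norm (u x)) + (LBINT x. norm (u x - v x) * norm (v x))"
  using L2_norm_mult_integrable[OF L assms(1)] L2_norm_mult_integrable[OF L assms(2)] by simp
 also have "\<dots> \<le> L2_dist u v * (nrm u + nrm v)"
  using L2_norm_mult_le[OF L assms(1)] L2_norm_mult_le[OF L assms(2)] by (simp add: distrib_left)
 finally show "(LBINT x. \<bar>sqf u x - sqf v x\<bar>) \<le> L2_dist u v * (nrm u + nrm v)" .
qed

text \<open>Lipschitz continuity in L^2 on sets bounded in L^2 and L^3. The constant contains no
  logarithmic moment, so strong L^2 convergence carries \<open>V2\<close> to the limit.\<close>

lemma V2_difference:
 assumes u: "u \<in> L2" "dens (sqf u)" and v: "v \<in> L2" "dens (sqf v)"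
 shows "\<bar>V2 u - V2 v\<bar> \<le> L2_dist u v * (nrm u + nrm v) * (pot (sqf u) + pot (sqf v))"
proof -
 define h where "h = (\<lambda>x. \<bar>sqf u x - sqf v x\<bar>)"
 note hL = sqf_diff_L1[OF u(1) v(1)]
 have h: "h \<in> borel_fun" "\<And>x. 0 \<le> h x" "L1 h"
  using hL(1) densD(1)[OF u(2)] densD(1)[OF v(2)] by (auto simp: h_def)
 have "\<bar>V2 u - V2 v\<bar> \<le> (\<integral>z. bil kf h (sqf u) z \<partial>lborel2) + (\<integral>z. bil kf h (sqf v) z \<partial>lborel2)"
  unfolding V2_def
  by (rule bil_difference) (use interaction_split(3)[OF u(2)] interaction_split(3)[OF v(2)] bil_kf(1)[OF h u(2)] bil_kf(1)[OF h v(2)] in \<open>auto simp: h_def kf_uminus\<close>)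
 also have "\<dots> \<le> (LBINT x. h x) * pot (sqf u) + (LBINT x. h x) * pot (sqf v)"
  by (intro add_mono bil_kf(2) h u v)
 also have "\<dots> = (LBINT x. h x) * (pot (sqf u) + pot (sqf v))" by (simp add: distrib_left)
 also have "\<dots> \<le> L2_dist u v * (nrm u + nrm v) * (pot (sqf u) + pot (sqf v))"
  using hL(2) pot_nonneg[OF u(2)] pot_nonneg[OF v(2)] unfolding h_def by (intro mult_right_mono) auto
 finally show ?thesis .
qed

lemma V_shift:
 assumes [measurable]: "u \<in> borel_fun" and [measurable]: "k \<in> borel_fun"
 shows "(\<integral>z. bil k (sqf (\<lambda>x. u (x + y))) (sqf (\<lambda>x. u (x + y))) z \<partial>lborel2) =
  (\<integral>z. bil k (sqf u) (sqf u) z \<partial>lborel2)"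
proof -
 have [measurable]: "sqf u \<in> borel_fun" unfolding sqf_def[abs_def] by measurable
 let ?M = "lborel \<Otimes>\<^sub>M lborel :: ((real^2) \<times> (real^2)) measure"
 have d: "distr lborel borel (\<lambda>z. z + (y, y)) = (lborel :: ((real^2) \<times> (real^2)) measure)"
 proof -
  have "(\<lambda>z. z + (y, y)) = (+) (y, y)" by (rule ext) (rule add.commute)
  then show ?thesis by (simp only: lborel_distr_plus)
 qed
 have m: "bil k (sqf u) (sqf u) \<in> borel_fun"
  using bil_measurable[of k "sqf u" "sqf u"] by (simp add: lborel_prod)
 have "(\<integral>z. bil k (sqf u) (sqf u) z \<partial>?M) = (\<integral>z. bil k (sqf u) (sqf u) z \<partial>distr lborel borel (\<lambda>z. z + (y, y)))"
  by (simp only: d lborel_prod)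
 also have "\<dots> = (LBINT z. bil k (sqf u) (sqf u) (z + (y, y)))"
  by (rule integral_distr) (use m in auto)
 also have "\<dots> = (\<integral>z. bil k (sqf (\<lambda>x. u (x + y))) (sqf (\<lambda>x. u (x + y))) z \<partial>?M)"
  by (simp add: bil_def sqf_def lborel_prod)
 finally show ?thesis by simp
qed

lemma V1_shift: "u \<in> borel_fun \<Longrightarrow> V1 (\<lambda>x. u (x + y)) = V1 u"
 unfolding V1_def by (rule V_shift) auto

lemma V2_shift: "u \<in> borel_fun \<Longrightarrow> V2 (\<lambda>x. u (x + y)) = V2 u"
 unfolding V2_def by (rule V_shift) auto

lemma lw_shift_integrable:
 assumes u: "u \<in> L2" and i: "L1_lw u"
 shows "L1 (\<lambda>x. lw x * (norm (u (x + y)))\<^sup>2)"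
  "(LBINT x. lw x * (norm (u (x + y)))\<^sup>2) \<le> lmom u + lw y * mass u"
proof -
 note [measurable] = L2_measurable[OF u]
 have i1: "L1 (\<lambda>x. lw (x + y) * (norm (u (x + y)))\<^sup>2)" by (rule integrable_shift[OF i])
 have i2: "L1 (\<lambda>x. lw y * (norm (u (x + y)))\<^sup>2)" using integrable_shift[OF L2_integrable[OF u], of y] by simp
 have le: "lw x * (norm (u (x + y)))\<^sup>2 \<le> lw (x + y) * (norm (u (x + y)))\<^sup>2 + lw y * (norm (u (x + y)))\<^sup>2" for x
  using lw_diff[of "x + y" y] by (simp add: mult_right_mono flip: distrib_right)
 show i3: "L1 (\<lambda>x. lw x * (norm (u (x + y)))\<^sup>2)"
  by (rule integrable_dominated[OF Bochner_Integration.integrable_add[OF i1 i2]]) (use le in auto)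
 have "(LBINT x. lw x * (norm (u (x + y)))\<^sup>2) \<le> (LBINT x. lw (x + y) * (norm (u (x + y)))\<^sup>2 + lw y * (norm (u (x + y)))\<^sup>2)"
  by (rule integral_mono[OF i3 Bochner_Integration.integrable_add[OF i1 i2] le])
 also have "\<dots> = (LBINT x. lw (x + y) * (norm (u (x + y)))\<^sup>2) + lw y * mass (\<lambda>x. u (x + y))"
  using i1 i2 integrable_shift[OF L2_integrable[OF u], of y] by (simp add: mass_def)
 also have "(LBINT x. lw (x + y) * (norm (u (x + y)))\<^sup>2) = lmom u"
  using integral_shift[of "\<lambda>x. lw x * (norm (u x))\<^sup>2" y] by simp
 finally show "(LBINT x. lw x * (norm (u (x + y)))\<^sup>2) \<le> lmom u + lw y * mass u"
  by (simp add: mass_shift)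
qed

section \<open>Functions with charge\<close>

lemma powr_add_le:
 assumes "0 \<le> a" "0 \<le> b" "r \<ge> (0::real)" shows "(a + b) powr r \<le> 2 powr r * (a powr r + b powr r)"
proof -
 have "(a + b) powr r \<le> (2 * max a b) powr r" using assms by (intro powr_mono2) auto
 also have "\<dots> = 2 powr r * (max a b) powr r" using assms by (simp add: powr_mult)
 also have "(max a b) powr r \<le> a powr r + b powr r" by (simp add: max_def)
 finally show ?thesis by simp
qed

lemma W12_point_powr:
 assumes u: "u \<in> W12_point" and l: "l > 0" and r: "r \<ge> 2"
 shows "L1 (\<lambda>x. norm (u x) powr r)"
  and "Lp_int r u \<le>
   2 powr r * ((Lp_int r (regular_part l u)) + norm (charge u) powr r * (LBINT x. gr l x powr r))"
proof -
 have R: "regular_part l u \<in> W12" by (rule regular_part_W12[OF u l])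
 note [measurable] = L2_measurable[OF W12_point_L2[OF u]]
 have i1: "L1 (\<lambda>x. norm (regular_part l u x) powr r)"
  using Lp_bound[OF r, of "mass (regular_part l u)" "gmass (regular_part l u)"] R by auto
 have i2: "L1 (\<lambda>x. gr l x powr r)" using gr_powr_integrable[OF l, of r] r by simp
 have le: "norm (u x) powr r \<le> 2 powr r * (norm (regular_part l u x) powr r + norm (charge u) powr r * gr l x powr r)" for x
 proof -
  have "norm (u x) \<le> norm (regular_part l u x) + norm (charge u) * gr l x"
   using norm_triangle_ineq[of "regular_part l u x" "charge u * Green l x"] fun_cong[OF decomposition[of u l], of x]
   by (simp add: norm_mult Green_gr)
  then have "norm (u x) powr r \<le> (norm (regular_part l u x) + norm (charge u) * gr l x) powr r"
   using r by (intro powr_mono2) auto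
  also have "\<dots> \<le> 2 powr r * (norm (regular_part l u x) powr r + (norm (charge u) * gr l x) powr r)"
   using r by (intro powr_add_le) auto
  also have "(norm (charge u) * gr l x) powr r = norm (charge u) powr r * gr l x powr r" by (simp add: powr_mult)
  finally show ?thesis .
 qed
 have i3: "L1 (\<lambda>x. 2 powr r * (norm (regular_part l u x) powr r + norm (charge u) powr r * gr l x powr r))"
  using i1 i2 by simp
 show i: "L1 (\<lambda>x. norm (u x) powr r)"
  by (rule integrable_dominated[OF i3]) (use le in auto)
 have "Lp_int r u \<le> (LBINT x. 2 powr r * (norm (regular_part l u x) powr r + norm (charge u) powr r * gr l x powr r))"
  by (rule integral_mono[OF i i3 le])
 then show "Lp_int r u \<le>
   2 powr r * ((Lp_int r (regular_part l u)) + norm (charge u) powr r * (LBINT x. gr l x powr r))"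
  using i1 i2 by simp
qed

lemma X_space_D:
 assumes "u \<in> X_space"
 shows "u \<in> W12_point" "u \<in> L2" "L1_lw u" "dens (sqf u)"
proof -
 show u: "u \<in> W12_point" "L1_lw u"
  using assms by (auto simp: X_space_def lw_def)
 show "u \<in> L2" by (rule W12_point_L2[OF u(1)])
 then show "dens (sqf u)" using u(2) W12_point_powr(1)[OF u(1), of 1 3] by (intro dens_sqf) auto
qed

lemma X_spaceI:
 assumes "u \<in> W12_point" "L1_lw u" shows "u \<in> X_space"
 using assms by (auto simp: X_space_def lw_def)

lemma energy_eq:
 assumes "u \<in> X_space"
 shows "energy \<alpha> \<beta> p u = 1/2 * H_quad \<alpha> u + 1/4 * (V1 u - V2 u) - \<beta> / p * Lp_int p u"
 unfolding energy_def Lp_norm_pow_def interaction_split(1)[OF X_space_D(4)[OF assms]] ..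

lemma powr_diff_le:
 assumes "0 \<le> a" "0 \<le> b" "p \<ge> (1::real)"
 shows "\<bar>a powr p - b powr p\<bar> \<le> p * \<bar>a - b\<bar> * (a + b) powr (p - 1)"
proof -
 have *: "\<bar>a powr p - b powr p\<bar> \<le> p * (a - b) * (a + b) powr (p - 1)" if ba: "b < a" "0 \<le> b" for a b
 proof (cases "b = 0")
  case True
  have "a powr p = a powr (1 + (p - 1))" by simp
  also have "\<dots> = a * a powr (p - 1)" using ba by (simp only: powr_add) simp
  also have "\<dots> \<le> p * a * a powr (p - 1)" using assms(3) ba by (intro mult_right_mono) auto
  finally show ?thesis using True by simp
 next
  case False
  then have b: "b > 0" using ba by simp
  obtain z where z: "b < z" "z < a" "a powr p - b powr p = (a - b) * (p * z powr (p - 1))"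
   using MVT2[OF ba(1), of "\<lambda>z. z powr p" "\<lambda>z. p * z powr (p - 1)"] b
   by (metis has_real_derivative_powr less_le_trans)
  have "z powr (p - 1) \<le> (a + b) powr (p - 1)" using z b assms(3) by (intro powr_mono2) auto
  then have "(a - b) * (p * z powr (p - 1)) \<le> (a - b) * (p * (a + b) powr (p - 1))"
   using ba assms(3) by (intro mult_left_mono) auto
  moreover have "a powr p \<ge> b powr p" using ba assms(3) by (intro powr_mono2) auto
  ultimately show ?thesis using z(3) by (simp add: ac_simps)
 qed
 consider "a = b" | "b < a" | "a < b" by linarith
 then show ?thesis
 proof cases
  case 2 then show ?thesis using *[of b a] assms by simp
 next
  case 3 then show ?thesis using *[of a b] assms by (simp add: abs_minus_commute add.commute)
 qed simp
qed

section \<open>Coercivity of the energy\<close>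

text \<open>The spectral parameter $\lambda = |q|^2 / c$ of the Gagliardo--Nirenberg inequality
 (any value will do when \<open>q = 0\<close>).\<close>

definition lamc :: "real \<Rightarrow> wfun \<Rightarrow> real" where
 "lamc c u = (if charge u = 0 then 1 else (norm (charge u))\<^sup>2 / c)"

lemma lamc_pos: "c > 0 \<Longrightarrow> lamc c u > 0" by (simp add: lamc_def)

lemma regular_part_nrm:
 assumes u: "u \<in> W12_point" and l: "l > 0"
 shows "nrm (regular_part l u) \<le> nrm u + norm (charge u) * sqrt (1 / (4 * pi * l))"
proof -
 have "nrm (regular_part l u) \<le> nrm u + nrm (\<lambda>x. charge u * Green l x)"
  unfolding regular_part_def by (rule nrm_triangle_diff[OF W12_point_L2[OF u] L2_cmult[OF Green_L2[OF l]]])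
 then show ?thesis by (simp add: nrm_cmult nrm_def[of "Green l"] Green_mass[OF l])
qed

text \<open>For nonzero charge, \<lambda> = |q|^2 / c gives q G_\<lambda> the mass c / (4 pi),
  independently of q.\<close>

lemma regular_part_lamc_mass:
 assumes u: "u \<in> W12_point" and c: "c > 0" "mass u = c"
 shows "mass (regular_part (lamc c u) u) \<le> 4 * c"
proof -
 have "norm (charge u) * sqrt (1 / (4 * pi * lamc c u)) \<le> sqrt c"
 proof (cases "charge u = 0")
  case False
  define q where "q = norm (charge u)"
  have q: "q > 0" using False by (simp add: q_def)
  have "q * sqrt (1 / (4 * pi * lamc c u)) = sqrt (q\<^sup>2 * (1 / (4 * pi * lamc c u)))"
   using q by (simp only: real_sqrt_mult real_sqrt_abs abs_of_pos)
  also have "q\<^sup>2 * (1 / (4 * pi * lamc c u)) = c / (4 * pi)" using q False by (simp add: lamc_def q_def field_simps)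
  also have "sqrt (c / (4 * pi)) \<le> sqrt c"
   using c pi_gt3 by (intro real_sqrt_le_mono) (simp add: divide_le_eq mult_le_cancel_left1)
  finally show ?thesis by (simp add: q_def)
 qed (use c in simp)
 then have "nrm (regular_part (lamc c u) u) \<le> 2 * sqrt c"
  using regular_part_nrm[OF u lamc_pos[OF c(1), of u]] c by (simp add: nrm_def)
 then have "(nrm (regular_part (lamc c u) u))\<^sup>2 \<le> (2 * sqrt c)\<^sup>2" by (intro power_mono) auto
 then show ?thesis using c by (simp add: power_mult_distrib)
qed

text \<open>\<open>Lp_step\<close> at r = 2 puts a coefficient k M^(p-4) in front of the Dirichlet
  energy, which is small for large M because p < 4. By scaling, the singular part contributes a
  multiple of |q|^p / \<lambda> = c |q|^(p-2), and |q|^(p-2) \<le> 1 + |q|^2.\<close>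

lemma GN_eps:
 assumes p: "2 < p" "p < 4" and c: "c > 0" and e: "e > 0"
 shows "\<exists>C\<ge>0. \<forall>u\<in>W12_point. mass u = c \<longrightarrow>
  (Lp_int p u) \<le> e * gmass (regular_part (lamc c u) u) + C * (1 + (norm (charge u))\<^sup>2)"
proof -
 define k where "k = 2 powr p * (3 powr p * p * (4 / pi * (4 * c) / (4 - p)))"
 have k: "k > 0" using p c by (simp add: k_def)
 \<comment> \<open>The solution of k M^(p-4) = e.\<close>
 define M where "M = (k / e) powr (1 / (4 - p))"
 have M: "M > 0" using k e by (simp add: M_def)
 have kM: "k * M powr (p - 4) = e"
 proof -
  have "M powr (p - 4) = (k / e) powr (1 / (4 - p) * (p - 4))" by (simp add: M_def powr_powr)
  also have "1 / (4 - p) * (p - 4) = - 1" using p by (simp add: field_simps)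
  also have "(k / e) powr (- 1) = e / k" using k e by (simp add: powr_minus_divide)
  finally show ?thesis using k by simp
 qed
 define I where "I = (LBINT x. gr 1 x powr p)"
 have I: "I \<ge> 0" by (simp add: I_def integral_nonneg_AE)
 define C1 where "C1 = 2 powr p * (3 powr p * p * ((4 * c) / 9 * (M powr (p - 2) / (p - 2))))"
 define C2 where "C2 = 2 powr p * (c * I)"
 have C12: "C1 \<ge> 0" "C2 \<ge> 0" using p c I by (auto simp: C1_def C2_def)
 have "Lp_int p u \<le> e * gmass (regular_part (lamc c u) u) + (C1 + C2) * (1 + (norm (charge u))\<^sup>2)"
  if u: "u \<in> W12_point" "mass u = c" for u
 proof -
  define \<phi> where "\<phi> = regular_part (lamc c u) u"
  define q where "q = norm (charge u)"
  note l = lamc_pos[OF c, of u]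
  have W: "\<phi> \<in> W12" unfolding \<phi>_def by (rule regular_part_W12[OF u(1) l])
  have m4: "mass \<phi> \<le> 4 * c" unfolding \<phi>_def by (rule regular_part_lamc_mass[OF u(1) c u(2)])
  have i2: "L1 (\<lambda>x. norm (\<phi> x) powr 2)" "(Lp_int 2 \<phi>) \<le> 4 * c"
   using L2_integrable[OF W12_L2[OF W]] m4 by (simp_all only: powr_2_eq mass_def)
  have P: "(Lp_int p \<phi>) \<le> 3 powr p * p * (mass \<phi> / 9 * (M powr (p - 2) / (p - 2)) +
    4 / pi * (4 * c) * gmass \<phi> * (M powr (p - 2 - 2) / (2 + 2 - p)))"
   by (rule Lp_step(2)[OF W order_refl i2]) (use p c M in auto)
  also have "\<dots> \<le> 3 powr p * p * ((4 * c) / 9 * (M powr (p - 2) / (p - 2)) +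
    4 / pi * (4 * c) * gmass \<phi> * (M powr (p - 2 - 2) / (2 + 2 - p)))"
   using m4 p by (intro mult_left_mono add_right_mono mult_right_mono divide_right_mono) auto
  finally have "2 powr p * (Lp_int p \<phi>) \<le> 2 powr p * (3 powr p * p * ((4 * c) / 9 * (M powr (p - 2) / (p - 2)) +
    4 / pi * (4 * c) * gmass \<phi> * (M powr (p - 2 - 2) / (2 + 2 - p))))" by (rule mult_left_mono) simp
  also have "\<dots> = C1 + k * M powr (p - 4) * gmass \<phi>"
   by (simp add: C1_def k_def distrib_left ac_simps)
  finally have 1: "2 powr p * (Lp_int p \<phi>) \<le> C1 + e * gmass \<phi>" unfolding kM .
  have 2: "2 powr p * (q powr p * (LBINT x. gr (lamc c u) x powr p)) \<le> C2 * (1 + q\<^sup>2)"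
  proof (cases "charge u = 0")
   case True then show ?thesis using C12 by (simp add: q_def)
  next
   case False
   then have q: "q > 0" by (simp add: q_def)
   have "(LBINT x. gr (lamc c u) x powr p) = I / lamc c u"
    unfolding I_def by (rule gr_powr_scaling[OF l]) (use p in simp)
   also have "\<dots> = I * c / q\<^sup>2" using False by (simp add: lamc_def q_def)
   finally have "q powr p * (LBINT x. gr (lamc c u) x powr p) = c * I * (q powr p / q\<^sup>2)" by simp
   also have "q powr p / q\<^sup>2 = q powr (p - 2)" using q by (simp add: powr_diff)
   also have "q powr (p - 2) \<le> q powr 0 + q powr 2" using p q by (intro powr_le_add_powr) auto
   also have "q powr 0 + q powr 2 = 1 + q\<^sup>2" using q by simp
   finally show ?thesis using c I by (simp add: C2_def mult.assoc mult_left_mono)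
  qed
  have "Lp_int p u \<le> C1 + e * gmass \<phi> + C2 * (1 + q\<^sup>2)"
   using W12_point_powr(2)[OF u(1) l, of p] p 1 2 by (simp add: \<phi>_def q_def distrib_left)
  also have "C1 \<le> C1 * (1 + q\<^sup>2)" using C12 by (simp add: mult_le_cancel_left1)
  finally show ?thesis by (simp add: \<phi>_def q_def algebra_simps)
 qed
 then show ?thesis using C12 by (intro exI[of _ "C1 + C2"]) auto
qed

lemma gmass_add_sqrt:
 assumes "u \<in> W12" "v \<in> W12"
 shows "gmass (\<lambda>x. u x + v x) \<le> (sqrt (gmass u) + sqrt (gmass v))\<^sup>2"
proof -
 have "Re (grad_ip u v) \<le> sqrt (gmass u) * sqrt (gmass v)"
  using grad_ip_le[OF assms] complex_Re_le_cmod[of "grad_ip u v"] by linarith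
 then show ?thesis
  using gmass_add[OF assms] gmass_nonneg[OF assms(1)] gmass_nonneg[OF assms(2)] by (simp add: power2_sum)
qed

text \<open>The logarithm is replaced by a cruder power: multiplied by \<epsilon>^2, at l =
  \<epsilon>^2 / mass, it is of order \<epsilon> and vanishes in the limit of zero charge.\<close>

lemma gmass_Green_diff_le:
 assumes l: "0 < l" "l \<le> 1/2"
 shows "gmass (\<lambda>x. Green 1 x - Green l x) \<le> 1 / sqrt l"
proof -
 have "ln (1 / l) = 2 * ln (1 / sqrt l)" using l by (simp add: ln_div ln_sqrt)
 also have "ln (1 / sqrt l) \<le> 1 / sqrt l - 1" using l by (intro ln_le_minus_one) simp
 finally have a: "ln (1 / l) \<le> 2 / sqrt l" by simp
 have "green_J 1 l = ln (1 / l) / (1 - l)" using l by (simp add: green_J_def)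
 also have "\<dots> \<le> (2 / sqrt l) / (1/2)" using a l by (intro frac_le) auto
 finally have J: "green_J 1 l \<le> 4 / sqrt l" by simp
 have "(1 + l) * green_J 1 l \<le> (3/2) * (4 / sqrt l)"
  using J l green_J_nonneg[of 1 l] by (intro mult_mono) auto
 then have "(1 + l) * green_J 1 l - 2 \<le> 6 / sqrt l" by simp
 also have "\<dots> \<le> 4 * pi * (1 / sqrt l)"
 proof -
  have "6 * (1 / sqrt l) \<le> 4 * pi * (1 / sqrt l)" using pi_gt3 l by (intro mult_right_mono) auto
  then show ?thesis by simp
 qed
 finally have "((1 + l) * green_J 1 l - 2) / (4 * pi) \<le> 1 / sqrt l" by (simp add: field_simps)
 then show ?thesis using gmass_Green_diff[of 1 l] l by simp
qed

text \<open>The Gagliardo--Nirenberg constant is only given for nonzero charge; charge zero is reached by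
 adding $\varepsilon G_1$ and letting $\varepsilon \to 0$.\<close>

lemma GN_limit:
 assumes K: "GN_constant 4 K" and u: "u \<in> W12" and m: "mass u > 0"
 shows "Lp_int 4 u \<le> K * gmass u * mass u"
proof -
 have K0: "K > 0" using K by (simp add: GN_constant_def)
 define e where "e = (\<lambda>n. inverse (real (Suc n)))"
 have e0: "e n > 0" for n by (simp add: e_def)
 have el: "e ----> 0" unfolding e_def by (rule LIMSEQ_inverse_real_of_nat)
 define U where "U = (\<lambda>n x. u x + complex_of_real (e n) * Green 1 x)"
 have UW: "U n \<in> W12_point" and Uc: "charge (U n) = complex_of_real (e n)" for n
  unfolding U_def by (rule W12_pointI[OF u], simp) (rule charge_eq[OF u], simp)
 have UL: "U n \<in> L2" for n by (rule W12_point_L2[OF UW])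
 define M where "M = (\<lambda>n. mass (U n))"
 have "(\<lambda>n. L2_dist (U n) u) ----> 0"
  using tendsto_mult_left_zero[OF el, of "nrm (Green 1)"] e0 by (simp add: U_def nrm_cmult less_imp_le)
 then have Ml: "M ----> mass u" unfolding M_def by (rule mass_tendsto[OF UL W12_L2[OF u]])
 \<comment> \<open>The parameter that the inequality prescribes for the charge \<open>e n\<close>;
   it tends to 0.\<close>
 define l where "l = (\<lambda>n. (e n)\<^sup>2 / M n)"
 have "l ----> 0\<^sup>2 / mass u" unfolding l_def using m by (intro tendsto_intros el Ml) auto
 then have ll: "l ----> 0" by simp
 define R where "R = (\<lambda>n. K * ((sqrt (gmass u) + sqrt (e n * sqrt (M n)))\<^sup>2 + (e n)\<^sup>2) * M n)"
 have "R ----> K * ((sqrt (gmass u) + sqrt (0 * sqrt (mass u)))\<^sup>2 + 0\<^sup>2) * mass u"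
  unfolding R_def by (intro tendsto_intros el Ml)
 then have Rl: "R ----> K * gmass u * mass u" using gmass_nonneg[OF u] by simp
 have ev: "eventually (\<lambda>n. (Lp_int 4 (U n)) \<le> R n) sequentially"
  using order_tendstoD(1)[OF Ml m] order_tendstoD(2)[OF ll, of "1/2", simplified]
 proof eventually_elim
  case (elim n)
  have l0: "l n > 0" using elim e0[of n] by (simp add: l_def)
  let ?D = "\<lambda>x. Green 1 x - Green (l n) x"
  have DW: "?D \<in> W12" using l0 by (intro Green_diff_W12) auto
  have "U n \<notin> W12" using W12_charge(2)[of "U n"] Uc[of n] e0[of n] by auto
  then have "Lp_norm_pow 4 (U n) \<le> K * (grad_norm (regular_part ((norm (charge (U n)))\<^sup>2 / mass (U n)) (U n)) powr (4 - 2) + norm (charge (U n)) powr (4 - 2)) * mass (U n)"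
   using K UW unfolding GN_constant_def by blast
  also have "(norm (charge (U n)))\<^sup>2 / mass (U n) = l n" using e0[of n] by (simp add: Uc l_def M_def)
  also have "regular_part (l n) (U n) = (\<lambda>x. u x + complex_of_real (e n) * ?D x)"
   unfolding regular_part_def Uc by (simp add: U_def algebra_simps)
  finally have 1: "Lp_norm_pow 4 (U n) \<le> K * (gmass (\<lambda>x. u x + complex_of_real (e n) * ?D x) + (e n)\<^sup>2) * M n"
   using e0[of n] gmass_nonneg[OF W12_add[OF u W12_cmult[OF DW]]] by (simp add: grad_norm_eq Uc M_def)
  have "gmass (\<lambda>x. u x + complex_of_real (e n) * ?D x) \<le> (sqrt (gmass u) + sqrt (gmass (\<lambda>x. complex_of_real (e n) * ?D x)))\<^sup>2"
   by (rule gmass_add_sqrt[OF u W12_cmult[OF DW]])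
  also have "gmass (\<lambda>x. complex_of_real (e n) * ?D x) = (e n)\<^sup>2 * gmass ?D" using gmass_cmult[OF DW, of "complex_of_real (e n)"] by simp
  also have "(sqrt (gmass u) + sqrt ((e n)\<^sup>2 * gmass ?D))\<^sup>2 \<le> (sqrt (gmass u) + sqrt (e n * sqrt (M n)))\<^sup>2"
  proof (intro power_mono add_left_mono real_sqrt_le_mono)
   have "(e n)\<^sup>2 * gmass ?D \<le> (e n)\<^sup>2 * (1 / sqrt (l n))"
    using gmass_Green_diff_le[OF l0] elim by (intro mult_left_mono) auto
   also have "\<dots> = e n * sqrt (M n)"
    using elim e0[of n] by (simp add: l_def real_sqrt_divide power2_eq_square)
   finally show "(e n)\<^sup>2 * gmass ?D \<le> e n * sqrt (M n)" .
  qed (use gmass_nonneg[OF u] gmass_nonneg[OF DW] in auto)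
  finally have "K * (gmass (\<lambda>x. u x + complex_of_real (e n) * ?D x) + (e n)\<^sup>2) * M n \<le> R n"
   unfolding R_def using K0 elim by (intro mult_right_mono mult_left_mono) auto
  with 1 show ?case by (simp add: Lp_norm_pow_def)
 qed
 show ?thesis
 proof (rule field_le_epsilon)
  fix d :: real assume d: "d > 0"
  have "eventually (\<lambda>n. R n < K * gmass u * mass u + d) sequentially" using order_tendstoD(2)[OF Rl] d by simp
  with ev have "eventually (\<lambda>n. (Lp_int 4 (U n)) \<le> K * gmass u * mass u + d) sequentially"
   by eventually_elim linarith
  then obtain N where N: "\<And>n. n \<ge> N \<Longrightarrow> (Lp_int 4 (U n)) \<le> K * gmass u * mass u + d"
   by (auto simp: eventually_sequentially)
  show "Lp_int 4 u \<le> K * gmass u * mass u + d"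
  proof (rule Fatou_real_bound(2))
   show "(Lp_int 4 (U (n + N))) \<le> K * gmass u * mass u + d" for n by (rule N) simp
   show "AE x in lborel. (\<lambda>n. norm (U (n + N) x) powr 4) ----> norm (u x) powr 4"
   proof (rule AE_I2)
    fix x
    have "(\<lambda>n. U (n + N) x) ----> u x + complex_of_real 0 * Green 1 x"
     unfolding U_def by (intro tendsto_intros LIMSEQ_ignore_initial_segment el)
    then have "(\<lambda>n. norm (U (n + N) x)) ----> norm (u x)" by (intro tendsto_norm) simp
    then show "(\<lambda>n. norm (U (n + N) x) powr 4) ----> norm (u x) powr 4"
     using tendsto_power[of "\<lambda>n. norm (U (n + N) x)" "norm (u x)" sequentially 4] by simp
   qed
   show "L1 (\<lambda>x. norm (U (n + N) x) powr 4)" for n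
    by (rule W12_point_powr(1)[OF UW, of 1]) auto
  qed (use L2_measurable[OF UL] L2_measurable[OF W12_L2[OF u]] in auto)
 qed
qed

definition admissible :: "real \<Rightarrow> real \<Rightarrow> real \<Rightarrow> real \<Rightarrow> bool" where
 "admissible \<beta> c p K \<longleftrightarrow> c > 0 \<and> ((\<beta> \<le> 0 \<and> p > 2)
    \<or> (\<beta> > 0 \<and> 2 < p \<and> p < 4)
    \<or> (\<beta> > 0 \<and> p = 4 \<and> GN_constant p K \<and> c < 2 / (\<beta> * K)))"

lemma admissible_p: "admissible \<beta> c p K \<Longrightarrow> p > 2"
 by (auto simp: admissible_def)

text \<open>The coefficient of the Dirichlet energy has to stay strictly below the 1/2 of the
  kinetic term. The margin 2 \<delta> pays for \<open>V2\<close> and still leaves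
  coercivity.\<close>

lemma power_term_bound:
 assumes a: "admissible \<beta> c p K"
 shows "\<exists>\<delta>>0. \<exists>C\<ge>0. \<forall>u\<in>W12_point. mass u = c \<longrightarrow>
  \<beta> / p * Lp_int p u \<le> (1/2 - 2 * \<delta>) * gmass (regular_part (lamc c u) u) + C * (1 + (norm (charge u))\<^sup>2)"
proof -
 have c: "c > 0" using a by (simp add: admissible_def)
 have g0: "gmass (regular_part (lamc c u) u) \<ge> 0" if "u \<in> W12_point" for u
  by (rule gmass_nonneg[OF regular_part_W12[OF that lamc_pos[OF c]]])
 consider "\<beta> \<le> 0" "p > 2" | "\<beta> > 0" "2 < p" "p < 4" | "\<beta> > 0" "p = 4" "GN_constant p K" "c < 2 / (\<beta> * K)"
  using a by (auto simp: admissible_def)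
 then show ?thesis
 proof cases
  case 1
  have "\<beta> / p * Lp_int p u \<le> (1/2 - 2 * (1/8)) * gmass (regular_part (lamc c u) u) + 0 * (1 + (norm (charge u))\<^sup>2)"
   if "u \<in> W12_point" for u
  proof -
   have "\<beta> / p * Lp_int p u \<le> 0"
    using 1 by (intro mult_nonpos_nonneg integral_nonneg_AE divide_nonpos_pos) auto
   also have "0 \<le> (1/2 - 2 * (1/8)) * gmass (regular_part (lamc c u) u) + 0 * (1 + (norm (charge u))\<^sup>2)"
    using g0[OF that] by simp
   finally show ?thesis .
  qed
  then show ?thesis by (intro exI[of _ "1/8"] conjI exI[of _ 0]) auto
 next
  case 2
  have "p / (4 * \<beta>) > 0" using 2 by simp
  from GN_eps[OF 2(2,3) c this] obtain C where C: "C \<ge> 0" "\<And>u. u \<in> W12_point \<Longrightarrow> mass u = c \<Longrightarrow>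
   (Lp_int p u) \<le> p / (4 * \<beta>) * gmass (regular_part (lamc c u) u) + C * (1 + (norm (charge u))\<^sup>2)"
   by blast
  have "\<beta> / p * Lp_int p u \<le> (1/2 - 2 * (1/8)) * gmass (regular_part (lamc c u) u) + (\<beta> / p * C) * (1 + (norm (charge u))\<^sup>2)"
   if "u \<in> W12_point" "mass u = c" for u
  proof -
   have "\<beta> / p * Lp_int p u \<le> \<beta> / p * (p / (4 * \<beta>) * gmass (regular_part (lamc c u) u) + C * (1 + (norm (charge u))\<^sup>2))"
    using C(2)[OF that] 2 by (intro mult_left_mono) auto
   also have "\<dots> = (1/2 - 2 * (1/8)) * gmass (regular_part (lamc c u) u) + (\<beta> / p * C) * (1 + (norm (charge u))\<^sup>2)"
    using 2 by (simp add: distrib_left)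
   finally show ?thesis .
  qed
  then show ?thesis using 2 C(1) by (intro exI[of _ "1/8"] conjI exI[of _ "\<beta> / p * C"]) auto
 next
  case 3
  have K: "K > 0" "GN_constant 4 K" using 3 by (auto simp: GN_constant_def)
  \<comment> \<open>The inequality k < 1/2 is exactly the condition c < 2 / (\<beta> K).\<close>
  define k where "k = \<beta> / 4 * K * c"
  have k: "k > 0" "k < 1/2" using 3 K c by (auto simp: k_def field_simps)
  have "\<beta> / p * Lp_int p u \<le> (1/2 - 2 * ((1/2 - k) / 2)) * gmass (regular_part (lamc c u) u) + k * (1 + (norm (charge u))\<^sup>2)"
   if u: "u \<in> W12_point" "mass u = c" for u
  proof -
   have "Lp_int 4 u \<le> K * (gmass (regular_part (lamc c u) u) + (norm (charge u))\<^sup>2) * c"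
   proof (cases "charge u = 0")
    case True
    have "u \<in> W12" by (rule charge_zero_W12[OF u(1) True])
    from GN_limit[OF K(2) this] W12_charge(3)[OF this] show ?thesis using True u c by simp
   next
    case False
    then have "u \<in> W12_point - W12" using u W12_charge(2) by blast
    then have "Lp_norm_pow 4 u \<le> K * (grad_norm (regular_part ((norm (charge u))\<^sup>2 / mass u) u) powr (4 - 2) + norm (charge u) powr (4 - 2)) * mass u"
     using K(2) unfolding GN_constant_def by blast
    also have "(norm (charge u))\<^sup>2 / mass u = lamc c u" using False u by (simp add: lamc_def)
    finally show ?thesis using g0[OF u(1)] False u by (simp add: grad_norm_eq Lp_norm_pow_def)
   qed
   then have "\<beta> / 4 * Lp_int 4 u \<le> \<beta> / 4 * (K * (gmass (regular_part (lamc c u) u) + (norm (charge u))\<^sup>2) * c)"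
    using 3 by (intro mult_left_mono) auto
   also have "\<dots> = k * gmass (regular_part (lamc c u) u) + k * (norm (charge u))\<^sup>2" by (simp add: k_def algebra_simps)
   finally have "\<beta> / p * Lp_int p u \<le> k * gmass (regular_part (lamc c u) u) + k * (norm (charge u))\<^sup>2"
    using 3 by simp
   moreover have "(1/2 - 2 * ((1/2 - k) / 2)) = k" by argo
   then have "k * gmass (regular_part (lamc c u) u) + k * (norm (charge u))\<^sup>2 \<le>
     (1/2 - 2 * ((1/2 - k) / 2)) * gmass (regular_part (lamc c u) u) + k * (1 + (norm (charge u))\<^sup>2)"
    using k by (simp only: distrib_left mult_1_right)
   ultimately show ?thesis by linarith
  qed
  then show ?thesis using k by (intro exI[of _ "(1/2 - k) / 2"] conjI exI[of _ k]) auto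
 qed
qed

text \<open>For ln s \<ge> 2 pi (A - a) the quadratic bound holds outright. Below that level s is
  bounded, and - s^2 ln s \<le> s controls the logarithm near 0.\<close>

lemma log_growth: "\<exists>C. \<forall>s>0. A * s\<^sup>2 - C \<le> s\<^sup>2 * (a + ln s / (2 * pi))"
proof -
 define L where "L = 2 * pi * (A - a)"
 define C where "C = (exp L)\<^sup>2 * \<bar>A - a\<bar> + exp L"
 have C0: "C \<ge> 0" by (simp add: C_def)
 have "A * s\<^sup>2 - C \<le> s\<^sup>2 * (a + ln s / (2 * pi))" if s: "s > 0" for s
 proof (cases "ln s \<ge> L")
  case True
  then have "A - a \<le> ln s / (2 * pi)" by (simp add: L_def field_simps)
  then have "s\<^sup>2 * A \<le> s\<^sup>2 * (a + ln s / (2 * pi))" by (intro mult_left_mono) auto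
  then show ?thesis using C0 by (simp add: mult.commute)
 next
  case False
  then have sL: "s \<le> exp L" using s by (metis exp_le_cancel_iff exp_ln linorder_linear)
  have "ln (1 / s) \<le> 1 / s - 1" using s by (intro ln_le_minus_one) simp
  then have "- ln s \<le> 1 / s" using s by (simp add: ln_div)
  then have "- ln s / (2 * pi) \<le> 1 / s"
  proof -
   have "- ln s / (2 * pi) \<le> (1 / s) / (2 * pi)" using \<open>- ln s \<le> 1 / s\<close> by (intro divide_right_mono) auto
   also have "\<dots> \<le> (1 / s) / 1" using s pi_gt3 by (intro divide_left_mono) auto
   finally show ?thesis by simp
  qed
  then have "A - a - ln s / (2 * pi) \<le> \<bar>A - a\<bar> + 1 / s" by linarith
  then have "s\<^sup>2 * (A - a - ln s / (2 * pi)) \<le> s\<^sup>2 * (\<bar>A - a\<bar> + 1 / s)" by (intro mult_left_mono) auto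
  also have "\<dots> = s\<^sup>2 * \<bar>A - a\<bar> + s" using s by (simp add: power2_eq_square algebra_simps)
  also have "\<dots> \<le> C" unfolding C_def using sL s by (intro add_mono mult_right_mono power_mono) auto
  finally show ?thesis by (simp add: algebra_simps)
 qed
 then show ?thesis by blast
qed

text \<open>At \<lambda> = |q|^2 / c the term - \<lambda> c equals - |q|^2, whereas
  \<theta>_\<lambda> contains ln |q| / (2 pi); so the form dominates any prescribed multiple of
  |q|^2 up to a constant.\<close>

lemma H_lower:
 assumes c: "c > 0"
 shows "\<exists>C\<ge>0. \<forall>u\<in>W12_point. mass u = c \<longrightarrow>
  gmass (regular_part (lamc c u) u) + A * (norm (charge u))\<^sup>2 - C \<le> H_quad \<alpha> u"
proof -
 define a where "a = \<alpha> - 1 + euler_mascheroni / (2 * pi) - ln (2 * sqrt c) / (2 * pi)"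
 obtain C where C: "\<And>s. s > 0 \<Longrightarrow> A * s\<^sup>2 - C \<le> s\<^sup>2 * (a + ln s / (2 * pi))"
  using log_growth[of A a] by blast
 have "gmass (regular_part (lamc c u) u) + A * (norm (charge u))\<^sup>2 - \<bar>C\<bar> \<le> H_quad \<alpha> u"
  if u: "u \<in> W12_point" "mass u = c" for u
 proof -
  define q where "q = norm (charge u)"
  have l: "lamc c u > 0" by (rule lamc_pos[OF c])
  note H = H_quad_eq[OF u(1) l, of \<alpha>]
  show ?thesis
  proof (cases "charge u = 0")
   case True
   have "regular_part (lamc c u) u = u" using W12_charge(3)[OF charge_zero_W12[OF u(1) True]] .
   then show ?thesis using H True by simp
  next
   case False
   then have q: "q > 0" by (simp add: q_def)
   have lc: "lamc c u * c = q\<^sup>2" using False c by (simp add: lamc_def q_def)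
   have "sqrt (lamc c u) / 2 = q / (2 * sqrt c)" using False c by (simp add: lamc_def q_def real_sqrt_divide)
   then have "theta (lamc c u) = euler_mascheroni / (2 * pi) + (ln q - ln (2 * sqrt c)) / (2 * pi)"
    using q c by (simp add: theta_def ln_div)
   then have th: "\<alpha> + theta (lamc c u) - 1 = a + ln q / (2 * pi)" by (simp add: a_def diff_divide_distrib)
   have "H_quad \<alpha> u = gmass (regular_part (lamc c u) u) + lamc c u * mass (regular_part (lamc c u) u) + q\<^sup>2 * (\<alpha> + theta (lamc c u) - 1)"
    using H lc u by (simp add: q_def algebra_simps)
   moreover have "0 \<le> lamc c u * mass (regular_part (lamc c u) u)" using l by simp
   ultimately show ?thesis using C[OF q] unfolding th q_def by linarith
  qed
 qed
 then show ?thesis by (intro exI[of _ "\<bar>C\<bar>"]) auto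
qed

lemma mass_sphereD:
 assumes "u \<in> mass_sphere c"
 shows "u \<in> X_space" "mass u = c" "u \<in> W12_point" "u \<in> L2" "dens (sqf u)"
  "L1_lw u"
 using assms X_space_D by (auto simp: mass_sphere_def)

text \<open>The bounds on \<open>V2\<close> and on the power term accompany the lower bound so that
  an upper bound on the energy can be turned back into one on \<open>H_quad\<close>.\<close>

lemma coercive:
 assumes a: "admissible \<beta> c p K"
 shows "\<exists>\<delta>>0. \<exists>C\<ge>0. \<forall>u\<in>mass_sphere c.
   \<delta> * gmass (regular_part (lamc c u) u) + V1 u / 4 + (norm (charge u))\<^sup>2 - C \<le> energy \<alpha> \<beta> p u \<and>
   V2 u \<le> C * (1 + (norm (charge u))\<^sup>2) + \<delta> * gmass (regular_part (lamc c u) u) \<and>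
   \<beta> / p * Lp_int p u \<le> gmass (regular_part (lamc c u) u) + C * (1 + (norm (charge u))\<^sup>2)"
proof -
 have c: "c > 0" using a by (simp add: admissible_def)
 obtain \<delta> C1 where P: "\<delta> > 0" "C1 \<ge> 0" "\<And>u. u \<in> W12_point \<Longrightarrow> mass u = c \<Longrightarrow>
  \<beta> / p * Lp_int p u \<le> (1/2 - 2 * \<delta>) * gmass (regular_part (lamc c u) u) + C1 * (1 + (norm (charge u))\<^sup>2)"
  using power_term_bound[OF a] by blast
 have dc: "\<delta> / c > 0" using P c by simp
 obtain C2 where G: "C2 \<ge> 0" "\<And>u. u \<in> W12_point \<Longrightarrow> mass u = c \<Longrightarrow>
  (Lp_int 3 u) \<le> \<delta> / c * gmass (regular_part (lamc c u) u) + C2 * (1 + (norm (charge u))\<^sup>2)"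
  using GN_eps[OF _ _ c dc, of 3] by auto
 define k where "k = (LBINT x. kf3 x) + ln 2 * c"
 have k: "k \<ge> 0" unfolding k_def using c by (intro add_nonneg_nonneg integral_nonneg_AE) auto
 define C3 where "C3 = c * (k + C2)"
 have C3: "C3 \<ge> 0" using c k G by (simp add: C3_def)
 \<comment> \<open>Half of A |q|^2 covers C3/4 from \<open>V2\<close>, C1 from the power term, and
   the surplus |q|^2 in the claim.\<close>
 define A where "A = 2 * (1 + C3 / 4 + C1)"
 obtain C4 where H: "C4 \<ge> 0" "\<And>u. u \<in> W12_point \<Longrightarrow> mass u = c \<Longrightarrow>
   gmass (regular_part (lamc c u) u) + A * (norm (charge u))\<^sup>2 - C4 \<le> H_quad \<alpha> u"
  using H_lower[OF c, of A \<alpha>] by blast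
 define C where "C = C1 + C3 + C4"
 have CC: "C \<ge> 0" "C1 \<le> C" "C3 \<le> C" using P H C3 by (auto simp: C_def)
 have "\<delta> * gmass (regular_part (lamc c u) u) + V1 u / 4 + (norm (charge u))\<^sup>2 - C \<le> energy \<alpha> \<beta> p u \<and>
   V2 u \<le> C * (1 + (norm (charge u))\<^sup>2) + \<delta> * gmass (regular_part (lamc c u) u) \<and>
   \<beta> / p * Lp_int p u \<le> gmass (regular_part (lamc c u) u) + C * (1 + (norm (charge u))\<^sup>2)"
  if u: "u \<in> mass_sphere c" for u
 proof -
  note D = mass_sphereD[OF u]
  define g where "g = gmass (regular_part (lamc c u) u)"
  define s where "s = (norm (charge u))\<^sup>2"
  have g0: "g \<ge> 0" unfolding g_def by (rule gmass_nonneg[OF regular_part_W12[OF D(3) lamc_pos[OF c]]])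
  have s0: "s \<ge> 0" by (simp add: s_def)
  have "V2 u \<le> c * (k + Lp_int 3 u)"
   using V2_le[OF D(5)] unfolding pot_sqf D(2) k_def .
  also have "\<dots> \<le> c * (k + (\<delta> / c * g + C2 * (1 + s)))"
   using G(2)[OF D(3,2)] c by (intro mult_left_mono add_left_mono) (auto simp: g_def s_def)
  also have "\<dots> = c * k + c * C2 * (1 + s) + \<delta> * g" using c by (simp add: distrib_left)
  also have "\<dots> \<le> C3 * (1 + s) + \<delta> * g"
   using mult_nonneg_nonneg[of "c * k" s] c k s0 by (simp add: C3_def algebra_simps)
  finally have v2: "V2 u \<le> C3 * (1 + s) + \<delta> * g" .
  have p: "\<beta> / p * Lp_int p u \<le> (1/2 - 2 * \<delta>) * g + C1 * (1 + s)"
   using P(3)[OF D(3,2)] by (simp add: g_def s_def)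
  have h: "g + A * s - C4 \<le> H_quad \<alpha> u" using H(2)[OF D(3,2)] by (simp add: g_def s_def)
  have dg: "\<delta> * g \<ge> 0" using P g0 by simp
  have E: "energy \<alpha> \<beta> p u = 1/2 * H_quad \<alpha> u + 1/4 * (V1 u - V2 u) - \<beta> / p * Lp_int p u"
   by (rule energy_eq[OF D(1)])
  have As: "A * s = 2 * s + C3 * s / 2 + 2 * (C1 * s)" by (simp add: A_def algebra_simps)
  have "\<delta> * g + V1 u / 4 + s - C \<le> energy \<alpha> \<beta> p u"
  proof -
   have "X + s' + v / 4 \<ge> d + v / 4 + s - (C1 + C3 + C4)"
    if "w \<le> C3 + t + d" "P \<le> g / 2 - 2 * d + (C1 + r)" "g + (2 * s + t / 2 + 2 * r) - C4 \<le> h" "d \<ge> 0"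
     "X = h / 2 - P" "s' = - w / 4" for X s' v d w t P r h
    using that P(2) C3 H(1) by argo
   from this[of "V2 u" "C3 * s" "\<delta> * g" "\<beta> / p * Lp_int p u" "C1 * s" "H_quad \<alpha> u", OF _ _ _ dg refl refl, of "V1 u"]
   show ?thesis using v2 p h unfolding E As C_def by (simp add: algebra_simps diff_divide_distrib)
  qed
  moreover have "V2 u \<le> C * (1 + s) + \<delta> * g"
   using v2 mult_right_mono[OF CC(3), of "1 + s"] s0 by linarith
  moreover have "\<beta> / p * Lp_int p u \<le> g + C * (1 + s)"
  proof -
   have "(1/2 - 2 * \<delta>) * g \<le> 1 * g" using P(1) g0 by (intro mult_right_mono) auto
   then show ?thesis using p mult_right_mono[OF CC(2), of "1 + s"] s0 by linarith
  qed
  ultimately show ?thesis by (simp add: g_def s_def)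
 qed
 then show ?thesis using P(1) CC(1) by blast
qed

text \<open>The bound on \<open>H_quad\<close> comes from solving the energy for it:
  \<open>V1\<close> then has the favourable sign, and \<open>V2\<close> and the power term are
  controlled by \<open>coercive\<close>.\<close>

lemma sublevel_bounds:
 assumes a: "admissible \<beta> c p K"
 shows "\<exists>C\<ge>0. \<forall>u\<in>mass_sphere c. energy \<alpha> \<beta> p u \<le> B \<longrightarrow> norm (charge u) \<le> C \<and> V1 u \<le> C \<and> H_quad \<alpha> u \<le> C"
proof -
 obtain \<delta> C where C: "\<delta> > 0" "C \<ge> 0" "\<And>u. u \<in> mass_sphere c \<Longrightarrow>
   \<delta> * gmass (regular_part (lamc c u) u) + V1 u / 4 + (norm (charge u))\<^sup>2 - C \<le> energy \<alpha> \<beta> p u"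
   "\<And>u. u \<in> mass_sphere c \<Longrightarrow> V2 u \<le> C * (1 + (norm (charge u))\<^sup>2) + \<delta> * gmass (regular_part (lamc c u) u)"
   "\<And>u. u \<in> mass_sphere c \<Longrightarrow> \<beta> / p * Lp_int p u \<le> gmass (regular_part (lamc c u) u) + C * (1 + (norm (charge u))\<^sup>2)"
  using coercive[OF a, of \<alpha>] by blast
 have c: "c > 0" using a by (simp add: admissible_def)
 define T where "T = max 0 (B + C)"
 define D where "D = 1 + 4 * T + 2 * \<bar>B\<bar> + (C * (1 + T) + T) + 2 * (T / \<delta> + C * (1 + T))"
 have T0: "T \<ge> 0" by (simp add: T_def)
 have pos: "0 \<le> C * (1 + T)" "0 \<le> T / \<delta>" using C T0 by auto
 have "norm (charge u) \<le> D \<and> V1 u \<le> D \<and> H_quad \<alpha> u \<le> D" if u: "u \<in> mass_sphere c" "energy \<alpha> \<beta> p u \<le> B" for u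
 proof -
  note M = mass_sphereD[OF u(1)]
  define g where "g = gmass (regular_part (lamc c u) u)"
  define s where "s = (norm (charge u))\<^sup>2"
  have g0: "g \<ge> 0" unfolding g_def by (rule gmass_nonneg[OF regular_part_W12[OF M(3) lamc_pos[OF c]]])
  have s0: "s \<ge> 0" by (simp add: s_def)
  have v0: "V1 u \<ge> 0" by (rule V1_nonneg)
  have dg: "\<delta> * g \<ge> 0" using C g0 by simp
  have main: "\<delta> * g + V1 u / 4 + s \<le> T" using C(3)[OF u(1)] u(2) by (simp add: g_def s_def T_def)
  have s: "s \<le> T" and v: "V1 u \<le> 4 * T" and dgT: "\<delta> * g \<le> T" using main dg v0 s0 by linarith+
  have g: "g \<le> T / \<delta>" using dgT C(1) by (simp add: field_simps)
  have Cs: "C * (1 + s) \<le> C * (1 + T)" using s C by (intro mult_left_mono) auto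
  have "(norm (charge u))\<^sup>2 \<le> T" using s by (simp add: s_def)
  then have "norm (charge u) \<le> 1 + T" using self_le_power[of "norm (charge u)" 2]
   by (cases "norm (charge u) \<le> 1") (use T0 in auto)
  moreover have "1 + T \<le> D" using pos T0 unfolding D_def by argo
  ultimately have 1: "norm (charge u) \<le> D" by linarith
  have "4 * T \<le> D" using pos T0 unfolding D_def by argo
  with v have 2: "V1 u \<le> D" by linarith
  have "H_quad \<alpha> u = 2 * energy \<alpha> \<beta> p u - 1/2 * V1 u + 1/2 * V2 u + 2 * (\<beta> / p * Lp_int p u)"
   using energy_eq[OF M(1), of \<alpha> \<beta> p] by argo
  also have "\<dots> \<le> 2 * B + 1/2 * (C * (1 + T) + T) + 2 * (T / \<delta> + C * (1 + T))"
   using C(4)[OF u(1)] C(5)[OF u(1)] Cs u(2) v0 g dgT unfolding g_def[symmetric] s_def[symmetric] by argo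
  also have "\<dots> \<le> D" using pos T0 unfolding D_def by argo
  finally show ?thesis using 1 2 by simp
 qed
 moreover have "D \<ge> 0" using pos T0 unfolding D_def by argo
 ultimately show ?thesis by blast
qed

lemma energy_bounded_below:
 assumes a: "admissible \<beta> c p K"
 shows "\<exists>C. \<forall>u\<in>mass_sphere c. - C \<le> energy \<alpha> \<beta> p u"
proof -
 obtain \<delta> C where C: "\<delta> > 0" "C \<ge> 0" "\<And>u. u \<in> mass_sphere c \<Longrightarrow>
   \<delta> * gmass (regular_part (lamc c u) u) + V1 u / 4 + (norm (charge u))\<^sup>2 - C \<le> energy \<alpha> \<beta> p u"
  using coercive[OF a, of \<alpha>] by blast
 have c: "c > 0" using a by (simp add: admissible_def)
 have "- C \<le> energy \<alpha> \<beta> p u" if u: "u \<in> mass_sphere c" for u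
 proof -
  have "0 \<le> \<delta> * gmass (regular_part (lamc c u) u)"
   using C(1) gmass_nonneg[OF regular_part_W12[OF mass_sphereD(3)[OF u] lamc_pos[OF c]]] by simp
  then show ?thesis using C(3)[OF u] V1_nonneg[of u] zero_le_power2[of "norm (charge u)"] by linarith
 qed
 then show ?thesis by blast
qed

text \<open>\<open>coercive\<close> speaks of the parameter \<open>lamc\<close>, which varies with u
  and may come close to 0. The value \<open>H_quad\<close> does not depend on the parameter and
  transfers the bounds to any fixed l.\<close>

lemma regular_part_bounds:
 assumes c: "c > 0" and l: "l > 0"
 shows "\<exists>C\<ge>0. \<forall>u\<in>W12_point. mass u = c \<longrightarrow> norm (charge u) \<le> Q \<longrightarrow> H_quad \<alpha> u \<le> Q \<longrightarrow>
   gmass (regular_part l u) \<le> C \<and> mass (regular_part l u) \<le> C"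
proof -
 define C1 where "C1 = \<bar>Q\<bar> + l * c + \<bar>\<alpha> + theta l\<bar> * Q\<^sup>2"
 define C2 where "C2 = (sqrt c + \<bar>Q\<bar> * sqrt (1 / (4 * pi * l)))\<^sup>2"
 have "gmass (regular_part l u) \<le> C1 \<and> mass (regular_part l u) \<le> C2"
  if u: "u \<in> W12_point" "mass u = c" "norm (charge u) \<le> Q" "H_quad \<alpha> u \<le> Q" for u
 proof
  have q: "(norm (charge u))\<^sup>2 \<le> Q\<^sup>2" using u(3) by (intro power_mono) auto
  have "- (\<bar>\<alpha> + theta l\<bar> * Q\<^sup>2) \<le> (\<alpha> + theta l) * (norm (charge u))\<^sup>2"
  proof -
   have "\<bar>(\<alpha> + theta l) * (norm (charge u))\<^sup>2\<bar> \<le> \<bar>\<alpha> + theta l\<bar> * Q\<^sup>2"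
    unfolding abs_mult using q by (intro mult_left_mono) auto
   then show ?thesis by linarith
  qed
  moreover have "0 \<le> l * mass (regular_part l u)" using l by simp
  ultimately show "gmass (regular_part l u) \<le> C1"
   using H_quad_eq[OF u(1) l, of \<alpha>] u(2,4) by (simp add: C1_def right_diff_distrib)
  have "nrm (regular_part l u) \<le> sqrt c + \<bar>Q\<bar> * sqrt (1 / (4 * pi * l))"
  proof -
   have "norm (charge u) * sqrt (1 / (4 * pi * l)) \<le> \<bar>Q\<bar> * sqrt (1 / (4 * pi * l))"
    using u(3) l by (intro mult_right_mono) auto
   then show ?thesis using regular_part_nrm[OF u(1) l] u(2) by (simp add: nrm_def[of u])
  qed
  then have "(nrm (regular_part l u))\<^sup>2 \<le> C2" unfolding C2_def by (intro power_mono) auto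
  then show "mass (regular_part l u) \<le> C2" by simp
 qed
 moreover have "C1 \<ge> 0" "C2 \<ge> 0" using c l by (auto simp: C1_def C2_def)
 ultimately show ?thesis by (intro exI[of _ "C1 + C2"]) (fastforce intro: add_increasing add_increasing2)
qed

lemma powr_bounds:
 assumes c: "c > 0" and r: "r \<ge> 2"
 shows "\<exists>C. \<forall>u\<in>W12_point. mass u = c \<longrightarrow> norm (charge u) \<le> Q \<longrightarrow> H_quad \<alpha> u \<le> Q \<longrightarrow>
   (Lp_int r u) \<le> C"
proof -
 obtain A where A: "\<And>u. u \<in> W12_point \<Longrightarrow> mass u = c \<Longrightarrow> norm (charge u) \<le> Q \<Longrightarrow> H_quad \<alpha> u \<le> Q \<Longrightarrow>
   gmass (regular_part 1 u) \<le> A \<and> mass (regular_part 1 u) \<le> A"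
  using regular_part_bounds[OF c zero_less_one, of Q \<alpha>] by blast
 obtain B where B: "\<And>u. u \<in> W12 \<Longrightarrow> mass u \<le> A \<Longrightarrow> gmass u \<le> A \<Longrightarrow> (Lp_int r u) \<le> B"
  using Lp_bound[OF r, of A A] by blast
 define I where "I = (LBINT x. gr 1 x powr r)"
 have I: "I \<ge> 0" by (simp add: I_def integral_nonneg_AE)
 have "Lp_int r u \<le> 2 powr r * (B + \<bar>Q\<bar> powr r * I)"
  if u: "u \<in> W12_point" "mass u = c" "norm (charge u) \<le> Q" "H_quad \<alpha> u \<le> Q" for u
 proof -
  have "(Lp_int r (regular_part 1 u)) \<le> B"
   by (rule B[OF regular_part_W12[OF u(1)]]) (use A[OF u] in auto)
  moreover have "norm (charge u) powr r \<le> \<bar>Q\<bar> powr r" using u(3) r by (intro powr_mono2) auto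
  ultimately have "2 powr r * ((Lp_int r (regular_part 1 u)) + norm (charge u) powr r * I) \<le> 2 powr r * (B + \<bar>Q\<bar> powr r * I)"
   using I by (intro mult_left_mono add_mono mult_right_mono) auto
  then show ?thesis using W12_point_powr(2)[OF u(1) zero_less_one r] unfolding I_def by linarith
 qed
 then show ?thesis by blast
qed

section \<open>Ground states are charged\<close>

text \<open>The squared L^2 norm of \<open>wt u\<close> is the mass plus the logarithmic moment, so
  L^2 estimates for \<open>wt\<close> are estimates in the weighted space.\<close>

definition wt :: "wfun \<Rightarrow> wfun" where
 "wt u x = complex_of_real (sqrt (1 + lw x)) * u x"

lemma sqf_wt: "sqf (wt u) x = sqf u x + lw x * sqf u x"
 by (simp add: sqf_def wt_def norm_mult power_mult_distrib distrib_right)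

lemma wt_L2:
 assumes u: "u \<in> L2" and i: "L1_lw u"
 shows "wt u \<in> L2" "mass (wt u) = mass u + lmom u"
proof -
 have e: "(norm (wt u x))\<^sup>2 = (norm (u x))\<^sup>2 + lw x * (norm (u x))\<^sup>2" for x
  using sqf_wt[of u x] by (simp add: sqf_def)
 have "wt u = (\<lambda>x. complex_of_real (sqrt (1 + lw x)) * u x)" by (simp add: wt_def fun_eq_iff)
 then have "wt u \<in> borel_fun" using L2_measurable[OF u] by simp
 then show "wt u \<in> L2" by (rule L2I) (use L2_integrable[OF u] i in \<open>simp add: e\<close>)
 show "mass (wt u) = mass u + lmom u"
  using L2_integrable[OF u] i by (simp add: mass_def e)
qed

lemma integrable_lw_dominated:
 assumes u: "u \<in> L2" and v: "L1_lw v"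
  and w: "L1_lw w"
  and le: "\<And>x. norm (u x) \<le> a * norm (v x) + b * norm (w x)"
 shows "L1_lw u"
proof (rule integrable_dominated)
 show "L1 (\<lambda>x. 2 * a\<^sup>2 * (lw x * (norm (v x))\<^sup>2) + 2 * b\<^sup>2 * (lw x * (norm (w x))\<^sup>2))"
  using v w by simp
 have "lw x * (norm (u x))\<^sup>2 \<le> 2 * a\<^sup>2 * (lw x * (norm (v x))\<^sup>2) + 2 * b\<^sup>2 * (lw x * (norm (w x))\<^sup>2)" for x
 proof -
  have "(norm (u x))\<^sup>2 \<le> (a * norm (v x) + b * norm (w x))\<^sup>2" using le[of x] by (intro power_mono) auto
  also have "\<dots> \<le> 2 * (a * norm (v x))\<^sup>2 + 2 * (b * norm (w x))\<^sup>2"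
   using sum_squares_bound[of "a * norm (v x)" "b * norm (w x)"] by (simp add: power2_sum)
  finally have "lw x * (norm (u x))\<^sup>2 \<le> lw x * (2 * (a * norm (v x))\<^sup>2 + 2 * (b * norm (w x))\<^sup>2)"
   by (intro mult_left_mono) auto
  then show ?thesis by (simp add: power_mult_distrib algebra_simps)
 qed
 then show "AE x in lborel. norm (lw x * (norm (u x))\<^sup>2) \<le>
   norm (2 * a\<^sup>2 * (lw x * (norm (v x))\<^sup>2) + 2 * b\<^sup>2 * (lw x * (norm (w x))\<^sup>2))"
  by (intro AE_I2) simp
qed (use L2_measurable[OF u] in simp)

text \<open>As for \<open>V2\<close>, except that lw (x - y) \<le> lw x + lw y puts the weight on
  one factor or the other. The densities of \<open>wt u\<close> and \<open>wt v\<close> differ by (1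
  + lw) h, so their distance controls h with and without weight.\<close>

lemma V1_difference:
 assumes u: "u \<in> L2" "dens (sqf u)" and v: "v \<in> L2" "dens (sqf v)"
 shows "\<bar>V1 u - V1 v\<bar> \<le> L2_dist (wt u) (wt v) * (nrm (wt u) + nrm (wt v)) * (mass (wt u) + mass (wt v))"
proof -
 have i: "L1_lw u" "L1_lw v"
  using densD(4)[OF u(2)] densD(4)[OF v(2)] by (auto simp: sqf_def)
 note wu = wt_L2[OF u(1) i(1)] and wv = wt_L2[OF v(1) i(2)]
 define h where "h x = \<bar>sqf u x - sqf v x\<bar>" for x
 note S = sqf_diff_L1[OF wu(1) wv(1)]
 have [measurable]: "sqf u \<in> borel_fun" "sqf v \<in> borel_fun" using densD(1) u v by auto
 have hm: "h \<in> borel_fun" by (simp add: h_def[abs_def])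
 have eq: "\<bar>sqf (wt u) x - sqf (wt v) x\<bar> = h x + lw x * h x" for x
 proof -
  have "sqf (wt u) x - sqf (wt v) x = (1 + lw x) * (sqf u x - sqf v x)" by (simp add: sqf_wt algebra_simps)
  then have "\<bar>sqf (wt u) x - sqf (wt v) x\<bar> = (1 + lw x) * h x" by (simp only: h_def abs_mult) simp
  then show ?thesis by (simp add: distrib_right)
 qed
 have S1: "L1 (\<lambda>x. h x + lw x * h x)" using S(1) by (simp add: eq)
 have hi: "L1 h" "L1 (\<lambda>x. lw x * h x)"
  by (rule integrable_dominated[OF S1]; use hm in \<open>auto simp: h_def intro!: AE_I2\<close>)+
 define T where "T = L2_dist (wt u) (wt v) * (nrm (wt u) + nrm (wt v))"
 have T: "(LBINT x. h x) + (LBINT x. lw x * h x) \<le> T"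
  using S(2) hi by (simp add: eq T_def)
 have h0: "h x \<ge> 0" for x by (simp add: h_def)
 have p: "integrable lborel2 (bil lw h (sqf f))"
   "(\<integral>z. bil lw h (sqf f) z \<partial>lborel2) \<le> T * mass (wt f)"
  if f: "f \<in> L2" "dens (sqf f)" for f
 proof -
  have fi: "L1_lw f" using densD(4)[OF f(2)] by (simp add: sqf_def)
  note b = bil_lw[OF hm h0 hi densD(1,2,3,4)[OF f(2)]]
  show "integrable lborel2 (bil lw h (sqf f))" by (rule b(1))
  define A where "A = (LBINT x. h x)"
  define B where "B = (LBINT x. lw x * h x)"
  define C where "C = (LBINT x. lw x * sqf f x)"
  have nn: "A \<ge> 0" "B \<ge> 0" "C \<ge> 0" using h0 by (auto simp: A_def B_def C_def intro!: integral_nonneg_AE)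
  have "(\<integral>z. bil lw h (sqf f) z \<partial>lborel2) \<le> B * mass f + A * C"
   using b(2) unfolding integral_sqf A_def B_def C_def .
  also have "\<dots> \<le> (A + B) * (mass f + C)" using nn by (simp add: algebra_simps)
  also have "\<dots> \<le> T * (mass f + C)" using T nn by (intro mult_right_mono) (auto simp: A_def B_def)
  also have "mass f + C = mass (wt f)" using wt_L2(2)[OF f(1) fi] by (simp add: C_def sqf_def)
  finally show "(\<integral>z. bil lw h (sqf f) z \<partial>lborel2) \<le> T * mass (wt f)" .
 qed
 have "\<bar>V1 u - V1 v\<bar> \<le> (\<integral>z. bil lw h (sqf u) z \<partial>lborel2) + (\<integral>z. bil lw h (sqf v) z \<partial>lborel2)"
  unfolding V1_def
  by (rule bil_difference) (use interaction_split(2) u v p in \<open>auto simp: h_def\<close>)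
 also have "\<dots> \<le> T * mass (wt u) + T * mass (wt v)" using p(2)[OF u] p(2)[OF v] by simp
 finally show ?thesis by (simp add: T_def distrib_left)
qed

text \<open>A mean value inequality with the power p - 1, then Cauchy-Schwarz; squaring that power
  produces the exponent 2p - 2.\<close>

lemma Lp_difference:
 assumes u: "u \<in> L2" "\<And>r. r \<ge> 2 \<Longrightarrow> L1 (\<lambda>x. norm (u x) powr r)"
  and v: "v \<in> L2" "\<And>r. r \<ge> 2 \<Longrightarrow> L1 (\<lambda>x. norm (v x) powr r)" and p: "p \<ge> 2"
 shows "\<bar>(Lp_int p u) - (LBINT x. norm (v x) powr p)\<bar> \<le>
  p * L2_dist u v * sqrt (2 powr (2 * p - 2) *
   ((Lp_int (2 * p - 2) u) + Lp_int (2 * p - 2) v))"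
proof -
 define r where "r = 2 * p - 2"
 have r: "r \<ge> 2" using p by (simp add: r_def)
 note L = u(1) v(1)
 have [measurable]: "u \<in> borel_fun" "v \<in> borel_fun" using L L2_measurable by auto
 note iu = u(2) and iv = v(2)
 define F where "F x = (norm (u x) + norm (v x)) powr (p - 1)" for x
 have F2: "(F x)\<^sup>2 = (norm (u x) + norm (v x)) powr r" for x
  by (simp add: F_def r_def power2_eq_square powr_add[symmetric])
 have Fle: "(F x)\<^sup>2 \<le> 2 powr r * (norm (u x) powr r + norm (v x) powr r)" for x
  unfolding F2 by (rule powr_add_le) (use r in auto)
 have iR: "L1 (\<lambda>x. 2 powr r * (norm (u x) powr r + norm (v x) powr r))"
  using iu[OF r] iv[OF r] by simp
 have [measurable]: "F \<in> borel_fun" by (simp add: F_def[abs_def])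
 have iF: "L1 (\<lambda>x. (F x)\<^sup>2)"
  by (rule integrable_dominated[OF iR]) (use Fle in \<open>auto intro!: AE_I2 order_trans[OF Fle]\<close>)
 have id: "L1 (\<lambda>x. (norm (u x - v x))\<^sup>2)" by (rule L2_integrable[OF L2_diff[OF L]])
 have im: "L1 (\<lambda>x. norm (u x - v x) * F x)"
  by (rule integrable_mult_squares[OF _ _ id iF]) auto
 have "Lp_int p u - (LBINT x. norm (v x) powr p) =
   (LBINT x. norm (u x) powr p - norm (v x) powr p)" using iu[OF p] iv[OF p] by simp
 also have "\<bar>\<dots>\<bar> \<le> (LBINT x. \<bar>norm (u x) powr p - norm (v x) powr p\<bar>)" by (rule integral_abs_bound)
 also have "\<dots> \<le> (LBINT x. p * (norm (u x - v x) * F x))"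
 proof (rule integral_mono)
  fix x
  have "\<bar>norm (u x) powr p - norm (v x) powr p\<bar> \<le> p * \<bar>norm (u x) - norm (v x)\<bar> * F x"
   unfolding F_def using p by (intro powr_diff_le) auto
  also have "\<dots> \<le> p * norm (u x - v x) * F x"
   using p norm_triangle_ineq3[of "u x" "v x"] by (intro mult_right_mono mult_left_mono) (auto simp: F_def)
  finally show "\<bar>norm (u x) powr p - norm (v x) powr p\<bar> \<le> p * (norm (u x - v x) * F x)" by (simp add: mult.assoc)
 qed (use iu[OF p] iv[OF p] im in auto)
 also have "\<dots> = p * (LBINT x. norm (u x - v x) * F x)" by simp
 also have "(LBINT x. norm (u x - v x) * F x) \<le> sqrt (LBINT x. (norm (u x - v x))\<^sup>2) * sqrt (LBINT x. (F x)\<^sup>2)"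
  by (rule integral_Cauchy_Schwarz[OF _ _ id iF]) auto
 also have "(LBINT x. (F x)\<^sup>2) \<le> 2 powr r * (Lp_int r u + (LBINT x. norm (v x) powr r))"
  using integral_mono[OF iF iR Fle] iu[OF r] iv[OF r] by simp
 finally have "\<bar>(Lp_int p u) - (LBINT x. norm (v x) powr p)\<bar> \<le>
  p * (sqrt (LBINT x. (norm (u x - v x))\<^sup>2) * sqrt (2 powr r * (Lp_int r u + (LBINT x. norm (v x) powr r))))"
  using p by (simp add: mult_left_mono)
 then show ?thesis by (simp add: nrm_def mass_def r_def mult.assoc)
qed

lemma ground_state_le:
 assumes "is_ground_state \<alpha> \<beta> p c u" "v \<in> mass_sphere c"
 shows "energy \<alpha> \<beta> p u \<le> energy \<alpha> \<beta> p v"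
proof -
 have "ground_level \<alpha> \<beta> p c \<le> ereal (energy \<alpha> \<beta> p v)" unfolding ground_level_def by (rule INF_lower[OF assms(2)])
 then have "ereal (energy \<alpha> \<beta> p u) \<le> ereal (energy \<alpha> \<beta> p v)" using assms(1) unfolding is_ground_state_def by argo
 then show ?thesis by simp
qed

lemma H_quad_W12:
 assumes "u \<in> W12" shows "H_quad \<alpha> u = gmass u"
 using H_quad_eq[OF W12_charge(1)[OF assms] zero_less_one] W12_charge[OF assms] by simp

lemma mass_sphere_shift:
 assumes u: "u \<in> mass_sphere c" "u \<in> W12"
 shows "(\<lambda>x. u (x + y)) \<in> mass_sphere c" "energy \<alpha> \<beta> p (\<lambda>x. u (x + y)) = energy \<alpha> \<beta> p u"
proof -
 note D = mass_sphereD[OF u(1)] and W = W12_shift[OF u(2), of y]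
 have m: "u \<in> borel_fun" by (rule L2_measurable[OF D(4)])
 have X: "(\<lambda>x. u (x + y)) \<in> X_space"
  by (rule X_spaceI[OF W12_charge(1)[OF W(1)] lw_shift_integrable(1)[OF D(4,6)]])
 then show "(\<lambda>x. u (x + y)) \<in> mass_sphere c" using D(2) mass_shift[OF m] by (simp add: mass_sphere_def)
 have "(Lp_int p (\<lambda>x. u (x + y))) = Lp_int p u"
  by (rule integral_shift) (use m in simp)
 then show "energy \<alpha> \<beta> p (\<lambda>x. u (x + y)) = energy \<alpha> \<beta> p u"
  using W u(2) by (simp add: energy_eq[OF X] energy_eq[OF D(1)] H_quad_W12 V1_shift[OF m] V2_shift[OF m])
qed

text \<open>G_l(x) = G_1(sqrt l x), and for l \<ge> 1 this dilation only increases the logarithmic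
  weight; the factor 1/l is the Jacobian.\<close>

lemma wt_Green_mass:
 assumes l: "l \<ge> 1"
 shows "mass (wt (Green l)) \<le> mass (wt (Green 1)) / l"
proof -
 have l0: "l > 0" using l by simp
 have i: "L1_lw (Green k)" if "k > 0" for k
  using gr_sq_moment(2)[OF that] by (simp add: Green_gr)
 have W: "wt (Green k) \<in> L2" if "k > 0" for k by (rule wt_L2(1)[OF Green_L2[OF that] i[OF that]])
 have [measurable]: "wt (Green 1) \<in> borel_fun" by (rule L2_measurable[OF W]) simp
 have "ennreal l * ennreal (mass (wt (Green l))) = ennreal l * (NNL x. ennreal ((norm (wt (Green l) x))\<^sup>2))"
  by (simp add: mass_nn[OF W[OF l0]])
 also have "\<dots> \<le> ennreal l * (NNL x. ennreal ((norm (wt (Green 1) (sqrt l *\<^sub>R x)))\<^sup>2))"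
 proof (intro mult_left_mono nn_integral_mono ennreal_leI power_mono)
  fix x :: "real^2"
  have "norm x \<le> sqrt l * norm x" using l by (simp add: mult_le_cancel_right1)
  then have "lw x \<le> lw (sqrt l *\<^sub>R x)" using l unfolding lw_def by (intro ln_mono) (auto intro: add_pos_nonneg)
  then show "norm (wt (Green l) x) \<le> norm (wt (Green 1) (sqrt l *\<^sub>R x))"
   using gr_dilation[OF l0, of x] by (auto simp: wt_def Green_gr norm_mult intro!: mult_right_mono)
 qed auto
 also have "\<dots> = ennreal ((sqrt l)\<^sup>2) * (NNL x. ennreal ((norm (wt (Green 1) (sqrt l *\<^sub>R x)))\<^sup>2))"
  using l0 by simp
 also have "\<dots> = (NNL x. ennreal ((norm (wt (Green 1) x))\<^sup>2))"
  by (rule nn_integral_dilation[symmetric]) (use l0 in auto)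
 also have "\<dots> = ennreal (mass (wt (Green 1)))" by (rule mass_nn[OF W]) simp
 finally have "l * mass (wt (Green l)) \<le> mass (wt (Green 1))" using l0 by (simp add: ennreal_mult[symmetric])
 then show ?thesis using l0 by (simp add: pos_le_divide_eq mult.commute)
qed

text \<open>The perturbation has weighted norm at most e g / sqrt l, where g is that of G_1, and the
  three terms are Lipschitz along such perturbations. The constant must be uniform in l, e and z,
  because e tends to 0 before l tends to infinity.\<close>

lemma perturbation_bound:
 assumes U: "U \<in> W12" "U \<in> mass_sphere c" and p: "p \<ge> 2"
 shows "\<exists>C. \<forall>l\<ge>1. \<forall>e. 0 < e \<and> e \<le> 1 \<longrightarrow> (\<forall>z. norm z = 1 \<longrightarrow>
  \<bar>V1 (\<lambda>x. U x + e * z * Green l x) - V1 U\<bar> \<le> e * C / sqrt l \<and>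
  \<bar>V2 (\<lambda>x. U x + e * z * Green l x) - V2 U\<bar> \<le> e * C / sqrt l \<and>
  \<bar>(Lp_int p (\<lambda>x. U x + e * z * Green l x)) - Lp_int p U\<bar> \<le> e * C / sqrt l)"
proof -
 note D = mass_sphereD[OF U(2)]
 define g where "g = nrm (wt (Green 1))"
 define A where "A = nrm (wt U) + g"
 define I where "I r = 2 powr r * (Lp_int r U + (LBINT x. gr 1 x powr r))" for r
 define Q where "Q = (LBINT x. kf3 x) + ln 2 * A\<^sup>2 + I 3 + pot (sqf U)"
 define C1 where "C1 = g * (A + nrm (wt U)) * (A\<^sup>2 + mass (wt U))"
 define C2 where "C2 = g * (A + nrm (wt U)) * Q"
 define C3 where "C3 = p * g * sqrt (2 powr (2 * p - 2) * (I (2 * p - 2) + Lp_int (2 * p - 2) U))"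
 have g0: "g \<ge> 0" and A0: "A \<ge> 0" by (auto simp: g_def A_def)
 have I0: "I r \<ge> 0" for r by (simp add: I_def integral_nonneg_AE)
 have Q0: "Q \<ge> 0" unfolding Q_def using I0 pot_nonneg[OF D(5)] by (intro add_nonneg_nonneg integral_nonneg_AE) auto
 have C0: "C1 \<ge> 0" "C2 \<ge> 0" "C3 \<ge> 0"
  using g0 A0 Q0 I0 p by (auto simp: C1_def C2_def C3_def integral_nonneg_AE)
 have "\<bar>V1 w - V1 U\<bar> \<le> e * C1 / sqrt l \<and> \<bar>V2 w - V2 U\<bar> \<le> e * C2 / sqrt l \<and>
   \<bar>(Lp_int p w) - (LBINT x. norm (U x) powr p)\<bar> \<le> e * C3 / sqrt l"
  if l: "l \<ge> 1" and e: "0 < e" "e \<le> 1" and z: "norm z = 1" and w: "w = (\<lambda>x. U x + complex_of_real e * z * Green l x)"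
  for l e z w
 proof -
  have l0: "l > 0" using l by simp
  have ez: "norm (complex_of_real e * z) = e" using e z by (simp add: norm_mult)
  have W: "w \<in> W12_point" unfolding w by (rule W12_pointI[OF U(1) l0])
  note WL = W12_point_L2[OF W]
  have Gi: "L1_lw (Green l)" using gr_sq_moment(2)[OF l0] by (simp add: Green_gr)
  have wi: "L1_lw w"
   by (rule integrable_lw_dominated[OF WL D(6) Gi, of 1 1])
     (use norm_triangle_ineq e in \<open>auto simp: w norm_mult z intro!: order_trans[OF norm_triangle_ineq] mult_left_le_one_le\<close>)
  have dw: "dens (sqf w)" by (rule X_space_D(4)[OF X_spaceI[OF W wi]])
  have "nrm (wt (Green l)) \<le> sqrt (mass (wt (Green 1)) / l)"
   unfolding nrm_def by (rule real_sqrt_le_mono[OF wt_Green_mass[OF l]])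
  then have gl: "nrm (wt (Green l)) \<le> g / sqrt l" by (simp add: g_def nrm_def real_sqrt_divide)
  have sl: "sqrt l \<ge> 1" using l by simp
  have "mass (Green l) \<le> mass (wt (Green l))"
   using wt_L2(2)[OF Green_L2[OF l0] Gi] by (simp add: integral_nonneg_AE)
  then have "nrm (Green l) \<le> nrm (wt (Green l))" by (simp add: nrm_def)
  then have Gg: "nrm (Green l) \<le> g / sqrt l" using gl by simp
  have d1: "L2_dist w U \<le> e * (g / sqrt l)"
   using mult_left_mono[OF Gg, of e] e by (simp add: w nrm_cmult ez)
  have "(\<lambda>x. wt w x - wt U x) = (\<lambda>x. (complex_of_real e * z) * wt (Green l) x)"
   by (simp add: w wt_def algebra_simps)
  then have d2: "L2_dist (wt w) (wt U) \<le> e * (g / sqrt l)"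
   using mult_left_mono[OF gl, of e] e by (simp add: nrm_cmult ez)
  note wL = wt_L2[OF WL wi] and UL = wt_L2[OF D(4,6)]
  have "e * (g / sqrt l) \<le> 1 * (g / 1)" using e g0 sl by (intro mult_mono divide_left_mono) auto
  then have wA: "nrm (wt w) \<le> A"
   using nrm_abs_diff[OF wL(1) UL(1)] d2 by (simp add: A_def)
  have wA2: "mass (wt w) \<le> A\<^sup>2" using power_mono[OF wA, of 2] by simp
  have "mass w \<le> mass (wt w)" using wL(2) by (simp add: integral_nonneg_AE)
  then have mA2: "mass w \<le> A\<^sup>2" using wA2 by simp
  have mA: "nrm w \<le> A" using real_sqrt_le_mono[OF mA2] A0 by (simp add: nrm_def)
  have "mass U \<le> mass (wt U)" using UL(2) by (simp add: integral_nonneg_AE)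
  then have UU: "nrm U \<le> nrm (wt U)" by (simp add: nrm_def)
  have Ir: "Lp_int r w \<le> I r" if r: "r \<ge> 2" for r
  proof -
   have cw: "charge w = complex_of_real e * z" unfolding w by (rule charge_eq[OF U(1) l0])
   have rw: "regular_part l w = U" unfolding w by (rule regular_part_eq[OF U(1) l0])
   have er: "e powr r \<le> 1" using powr_mono2[of r e 1] e r by simp
   have gi: "0 \<le> (LBINT x. gr 1 x powr r)" by (simp add: integral_nonneg_AE)
   have "e powr r * ((LBINT x. gr 1 x powr r) / l) \<le> 1 * ((LBINT x. gr 1 x powr r) / 1)"
    using er gi l by (intro mult_mono divide_left_mono) auto
   then have "2 powr r * (Lp_int r U + e powr r * ((LBINT x. gr 1 x powr r) / l)) \<le> I r"
    unfolding I_def by (intro mult_left_mono add_left_mono) auto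
   moreover have "r \<ge> 1" using r by simp
   ultimately show ?thesis using W12_point_powr(2)[OF W l0 r] unfolding cw rw ez gr_powr_scaling[OF l0 \<open>r \<ge> 1\<close>] by linarith
  qed
  have 1: "\<bar>V1 w - V1 U\<bar> \<le> e * C1 / sqrt l"
  proof -
   have "\<bar>V1 w - V1 U\<bar> \<le> L2_dist (wt w) (wt U) * (nrm (wt w) + nrm (wt U)) * (mass (wt w) + mass (wt U))"
    by (rule V1_difference[OF WL dw D(4,5)])
   also have "\<dots> \<le> e * (g / sqrt l) * (A + nrm (wt U)) * (A\<^sup>2 + mass (wt U))"
    using d2 wA wA2 e g0 l0 A0 by (intro mult_mono add_right_mono) auto
   finally show ?thesis by (simp add: C1_def mult.assoc)
  qed
  have 2: "\<bar>V2 w - V2 U\<bar> \<le> e * C2 / sqrt l"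
  proof -
   have "pot (sqf w) + pot (sqf U) \<le> Q"
    unfolding pot_sqf[of w] Q_def using Ir[of 3] mA2 by (intro add_right_mono add_mono) auto
   then have "L2_dist w U * (nrm w + nrm U) * (pot (sqf w) + pot (sqf U)) \<le> e * (g / sqrt l) * (A + nrm (wt U)) * Q"
    using d1 mA UU e g0 l0 A0 pot_nonneg[OF dw] pot_nonneg[OF D(5)] by (intro mult_mono add_mono) auto
   then show ?thesis using V2_difference[OF WL dw D(4,5)] by (simp add: C2_def mult.assoc)
  qed
  have 3: "\<bar>(Lp_int p w) - (LBINT x. norm (U x) powr p)\<bar> \<le> e * C3 / sqrt l"
  proof -
   have "p * L2_dist w U * sqrt (2 powr (2 * p - 2) *
    ((Lp_int (2 * p - 2) w) + Lp_int (2 * p - 2) U))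
    \<le> p * (e * (g / sqrt l)) * sqrt (2 powr (2 * p - 2) * (I (2 * p - 2) + Lp_int (2 * p - 2) U))"
    using d1 Ir[of "2 * p - 2"] p e g0 l0
    by (intro mult_mono mult_left_mono real_sqrt_le_mono add_right_mono) (auto intro!: mult_nonneg_nonneg add_nonneg_nonneg integral_nonneg_AE)
   then show ?thesis using Lp_difference[OF WL W12_point_powr(1)[OF W zero_less_one] D(4) W12_point_powr(1)[OF D(3) zero_less_one] p] by (simp add: C3_def mult_ac)
  qed
  show ?thesis using 1 2 3 by blast
 qed note * = this
 have le: "e * X / sqrt l \<le> e * (C1 + C2 + C3) / sqrt l" if "X \<le> C1 + C2 + C3" "0 < e" "l \<ge> 1" for X e l
  using that by (intro divide_right_mono mult_left_mono) auto
 show ?thesis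
 proof (intro exI[of _ "C1 + C2 + C3"] allI impI conjI)
  fix l e :: real and z :: complex assume h: "1 \<le> l" "0 < e \<and> e \<le> 1" "norm z = 1"
  note b = *[OF h(1) _ _ h(3) refl, of e]
  show "\<bar>V1 (\<lambda>x. U x + e * z * Green l x) - V1 U\<bar> \<le> e * (C1 + C2 + C3) / sqrt l"
   using b le[of C1 e l] C0 h by force
  show "\<bar>V2 (\<lambda>x. U x + e * z * Green l x) - V2 U\<bar> \<le> e * (C1 + C2 + C3) / sqrt l"
   using b le[of C2 e l] C0 h by force
  show "\<bar>(Lp_int p (\<lambda>x. U x + e * z * Green l x)) - Lp_int p U\<bar> \<le> e * (C1 + C2 + C3) / sqrt l"
   using b le[of C3 e l] C0 h by force
 qed
qed

lemma V_scale:
 "V1 (\<lambda>x. complex_of_real s * u x) = s ^ 4 * V1 u" "V2 (\<lambda>x. complex_of_real s * u x) = s ^ 4 * V2 u"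
proof -
 have "bil k (sqf (\<lambda>x. complex_of_real s * u x)) (sqf (\<lambda>x. complex_of_real s * u x)) = (\<lambda>z. s ^ 4 * bil k (sqf u) (sqf u) z)" for k
  by (auto simp: bil_def sqf_def norm_mult power_mult_distrib fun_eq_iff power2_eq_square power4_eq_xxxx)
 then show "V1 (\<lambda>x. complex_of_real s * u x) = s ^ 4 * V1 u" "V2 (\<lambda>x. complex_of_real s * u x) = s ^ 4 * V2 u"
  by (simp_all add: V1_def V2_def)
qed

text \<open>Let a = |<U, G_l>|. For U + e z G_l rescaled to mass c, the form changes by - 2 l a e to
  first order, up to the nonpositive change of the Dirichlet energy. The charge term is O(e^2); the
  lower order terms cost O(e / sqrt l) and, through the rescaling, a multiple of a e. Dividing by e
  and letting e tend to 0 bounds l a by a multiple of a plus O(l^(-1/2)), and a itself is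
  O(l^(-1/2)).\<close>

lemma charge_free_minimizer_estimate:
 assumes U: "U \<in> W12" "U \<in> mass_sphere c" and c: "c > 0" and p: "p > 2"
  and min: "\<And>v. v \<in> mass_sphere c \<Longrightarrow> energy \<alpha> \<beta> p U \<le> energy \<alpha> \<beta> p v"
 shows "\<exists>C. \<forall>l\<ge>1. l * norm (L2_ip U (Green l)) \<le> C / sqrt l"
proof -
 note D = mass_sphereD[OF U(2)]
 have p2: "p \<ge> 2" using p by simp
 define P where "P u = Lp_int p u" for u :: wfun
 define V where "V = \<bar>V1 U - V2 U\<bar>"
 define r where "r = p / 2"
 define k where "k = r * 2 powr (r - 1)"
 define B where "B = \<bar>\<beta>\<bar> / p"
 have PU0: "P U \<ge> 0" by (simp add: P_def integral_nonneg_AE)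
 have nn: "V \<ge> 0" "k \<ge> 0" "B \<ge> 0" using p by (auto simp: V_def k_def B_def r_def)
 obtain C where C: "\<And>l e z. l \<ge> 1 \<Longrightarrow> 0 < e \<Longrightarrow> e \<le> 1 \<Longrightarrow> norm z = 1 \<Longrightarrow>
  \<bar>V1 (\<lambda>x. U x + complex_of_real e * z * Green l x) - V1 U\<bar> \<le> e * C / sqrt l \<and>
  \<bar>V2 (\<lambda>x. U x + complex_of_real e * z * Green l x) - V2 U\<bar> \<le> e * C / sqrt l \<and>
  \<bar>P (\<lambda>x. U x + complex_of_real e * z * Green l x) - P U\<bar> \<le> e * C / sqrt l"
  unfolding P_def using perturbation_bound[OF U p2] by blast
 define K where "K = V / 2 + B * k * P U"
 have "l * norm (L2_ip U (Green l)) \<le> (sqrt c * (2 * K / c) + C / 2 + B * C) / sqrt l" if l: "l \<ge> 1" for l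
 proof -
  have l0: "l > 0" using l by simp
  define a where "a = norm (L2_ip U (Green l))"
  define g where "g = mass (Green l)"
  define d where "d = C / sqrt l"
  have g0: "g \<ge> 0" and a0: "a \<ge> 0" by (auto simp: g_def a_def)
  \<comment> \<open>The phase z makes the first-order change of the mass real and
    nonnegative.\<close>
  obtain z where z: "norm z = 1" "z * L2_ip U (Green l) = complex_of_real a"
  proof (cases "L2_ip U (Green l) = 0")
   case True then show ?thesis using that[of 1] by (simp add: a_def)
  next
   case False
   show ?thesis
    by (rule that[of "cnj (sgn (L2_ip U (Green l)))"])
      (use False in \<open>auto simp: a_def sgn_eq norm_divide complex_norm_square[symmetric] mult.commute power2_eq_square\<close>)
  qed
  \<comment> \<open>\<open>M e\<close> is the mass of the perturbed function; \<open>f e\<close> is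
    (1 - t) / e for the rescaling factor t = c / M e, and it tends to 2 a / c.\<close>
  define M where "M e = c + 2 * e * a + e\<^sup>2 * g" for e
  define f where "f e = (2 * a + e * g) / M e" for e
  have main: "l * c / 2 * f e \<le> \<bar>\<alpha> + theta l\<bar> * e / 2 + d / 2 + K * f e + B * d" if e: "0 < e" "e \<le> 1" for e
  proof -
   define w where "w = (\<lambda>x. U x + complex_of_real e * z * Green l x)"
   define t where "t = c / M e"
   have ez: "norm (complex_of_real e * z) = e" using e z by (simp add: norm_mult)
   have Mc: "M e \<ge> c" using e a0 g0 by (simp add: M_def)
   have M0: "M e > 0" using Mc c by simp
   have t: "0 < t" "t \<le> 1" using Mc M0 c by (auto simp: t_def)
   have tf: "1 - t = e * f e" using M0 by (simp add: t_def f_def M_def field_simps power2_eq_square)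
   define s where "s = sqrt t"
   have s: "s > 0" "s\<^sup>2 = t" using t by (auto simp: s_def)
   define v where "v = (\<lambda>x. complex_of_real s * w x)"
   have W: "w \<in> W12_point" unfolding w_def by (rule W12_pointI[OF U(1) l0])
   have mw: "mass w = M e"
   proof -
    have "L2_ip U (\<lambda>x. complex_of_real e * z * Green l x) = complex_of_real (e * a)"
     by (simp add: L2_ip_cmult_right z mult.assoc)
    then have "mass w = mass U + 2 * (e * a) + mass (\<lambda>x. complex_of_real e * z * Green l x)"
     unfolding w_def by (subst mass_add[OF D(4) L2_cmult[OF Green_L2[OF l0]]]) simp
    then show ?thesis using D(2) ez by (simp add: M_def g_def mass_cmult)
   qed
   have vdef: "v = (\<lambda>x. (complex_of_real s * U x) + (complex_of_real s * complex_of_real e * z) * Green l x)"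
    by (simp add: v_def w_def algebra_simps)
   note sU = W12_cmult[OF U(1), of "complex_of_real s"]
   have vW: "v \<in> W12_point" unfolding vdef by (rule W12_pointI[OF sU l0])
   have vc: "charge v = complex_of_real s * complex_of_real e * z" unfolding vdef by (rule charge_eq[OF sU l0])
   have vr: "regular_part l v = (\<lambda>x. complex_of_real s * U x)" unfolding vdef by (rule regular_part_eq[OF sU l0])
   have mv: "mass v = c" using s M0 by (simp add: v_def mass_cmult mw t_def)
   have Gi: "L1_lw (Green l)" using gr_sq_moment(2)[OF l0] by (simp add: Green_gr)
   have "norm (v x) \<le> s * norm (U x) + s * e * norm (Green l x)" for x
    unfolding vdef using s e z by (intro order_trans[OF norm_triangle_ineq]) (simp add: norm_mult)
   then have vX: "v \<in> X_space"
    by (intro X_spaceI[OF vW] integrable_lw_dominated[OF W12_point_L2[OF vW] D(6) Gi])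
   then have vS: "v \<in> mass_sphere c" using mv by (simp add: mass_sphere_def)
   have s4: "s ^ 4 = t\<^sup>2" using s(2) by (simp add: power4_eq_xxxx power2_eq_square mult.assoc)
   have Vv: "V1 v - V2 v = t\<^sup>2 * (V1 w - V2 w)" by (simp add: v_def V_scale s4 right_diff_distrib)
   have "norm (v x) powr p = t powr r * norm (w x) powr p" for x
    using s t by (simp add: v_def norm_mult powr_mult s_def r_def powr_half_sqrt[symmetric] powr_powr)
   then have Pv: "P v = t powr r * P w" by (simp add: P_def)
   \<comment> \<open>At the parameter l the regular part of the rescaled function is s U, of mass t
     c, whereas the whole function has mass c. This deficit is the source of the gain l (t c -
     c).\<close>
   have Hv: "H_quad \<alpha> v = t * gmass U + l * (t * c - c) + (\<alpha> + theta l) * (t * e\<^sup>2)"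
    using H_quad_eq[OF vW l0, of \<alpha>] s e z D(2)
    by (simp add: vr vc mv gmass_cmult[OF U(1)] mass_cmult norm_mult power_mult_distrib)
   have EU: "energy \<alpha> \<beta> p U = 1/2 * gmass U + 1/4 * (V1 U - V2 U) - \<beta> / p * P U"
    by (simp add: energy_eq[OF D(1)] H_quad_W12[OF U(1)] P_def)
   have Ev: "energy \<alpha> \<beta> p v = 1/2 * (t * gmass U + l * (t * c - c) + (\<alpha> + theta l) * (t * e\<^sup>2))
     + 1/4 * (t\<^sup>2 * (V1 w - V2 w)) - \<beta> / p * (t powr r * P w)"
    by (simp add: energy_eq[OF vX] Hv Vv Pv[symmetric]) (simp add: P_def)
   have le: "energy \<alpha> \<beta> p U \<le> energy \<alpha> \<beta> p v" by (rule min[OF vS])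
   have 1: "t * gmass U \<le> gmass U" using t gmass_nonneg[OF U(1)] by (simp add: mult_left_le_one_le)
   have 2: "(\<alpha> + theta l) * (t * e\<^sup>2) \<le> \<bar>\<alpha> + theta l\<bar> * e\<^sup>2"
   proof -
    have "(\<alpha> + theta l) * (t * e\<^sup>2) \<le> \<bar>\<alpha> + theta l\<bar> * (t * e\<^sup>2)" using t by (intro mult_right_mono) auto
    also have "\<dots> \<le> \<bar>\<alpha> + theta l\<bar> * (1 * e\<^sup>2)" using t by (intro mult_left_mono mult_right_mono) auto
    finally show ?thesis by simp
   qed
   note Cw = C[OF l e z(1), folded w_def]
   have 3: "t\<^sup>2 * (V1 w - V2 w) - (V1 U - V2 U) \<le> 2 * (e * d) + 2 * (1 - t) * V"
   proof -
    have t2: "t\<^sup>2 \<le> 1" "1 - t\<^sup>2 \<le> 2 * (1 - t)" using t power_le_one[of t 2] zero_le_power2[of "1 - t"]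
     by (auto simp: power2_diff)
    have "\<bar>(V1 w - V2 w) - (V1 U - V2 U)\<bar> \<le> 2 * (e * d)" using Cw unfolding d_def times_divide_eq_right by linarith
    then have "t\<^sup>2 * \<bar>(V1 w - V2 w) - (V1 U - V2 U)\<bar> \<le> 1 * (2 * (e * d))" using t2 by (intro mult_mono) auto
    moreover have "t\<^sup>2 * ((V1 w - V2 w) - (V1 U - V2 U)) \<le> t\<^sup>2 * \<bar>(V1 w - V2 w) - (V1 U - V2 U)\<bar>"
     by (intro mult_left_mono) auto
    moreover have "(1 - t\<^sup>2) * (- (V1 U - V2 U)) \<le> (1 - t\<^sup>2) * V" using t2 by (intro mult_left_mono) (auto simp: V_def)
    moreover have "(1 - t\<^sup>2) * V \<le> (2 * (1 - t)) * V" using t2 nn by (intro mult_right_mono) auto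
    ultimately show ?thesis by (simp add: algebra_simps)
   qed
   have 4: "- (\<beta> / p * (t powr r * P w - P U)) \<le> B * (e * d + k * (1 - t) * P U)"
   proof -
    have r1: "r \<ge> 1" using p by (simp add: r_def)
    have tr: "t powr r \<le> 1" using powr_mono2[of r t 1] t r1 by simp
    have "\<bar>1 powr r - t powr r\<bar> \<le> r * \<bar>1 - t\<bar> * (1 + t) powr (r - 1)" by (rule powr_diff_le) (use t r1 in auto)
    also have "(1 + t) powr (r - 1) \<le> 2 powr (r - 1)" using t r1 by (intro powr_mono2) auto
    finally have "\<bar>1 powr r - t powr r\<bar> \<le> r * \<bar>1 - t\<bar> * 2 powr (r - 1)" using r1 by (simp add: mult_left_mono)
    then have tk: "1 - t powr r \<le> k * (1 - t)" using t tr by (simp add: k_def mult_ac)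
    have "\<bar>t powr r * P w - P U\<bar> = \<bar>t powr r * (P w - P U) - (1 - t powr r) * P U\<bar>" by (simp add: algebra_simps)
    also have "\<dots> \<le> \<bar>t powr r * (P w - P U)\<bar> + \<bar>(1 - t powr r) * P U\<bar>" by (rule abs_triangle_ineq4)
    also have "\<dots> = t powr r * \<bar>P w - P U\<bar> + (1 - t powr r) * P U" using tr PU0 by (simp add: abs_mult)
    also have "\<dots> \<le> 1 * (e * d) + k * (1 - t) * P U"
     using tr tk Cw PU0 by (intro add_mono mult_mono mult_right_mono) (auto simp: d_def)
    finally have "\<bar>t powr r * P w - P U\<bar> \<le> e * d + k * (1 - t) * P U" by simp
    then have "B * \<bar>t powr r * P w - P U\<bar> \<le> B * (e * d + k * (1 - t) * P U)" using nn by (intro mult_left_mono) auto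
    moreover have "- (\<beta> / p * (t powr r * P w - P U)) \<le> \<bar>\<beta> / p * (t powr r * P w - P U)\<bar>" by (rule abs_ge_minus_self)
    moreover have "\<bar>\<beta> / p * (t powr r * P w - P U)\<bar> = B * \<bar>t powr r * P w - P U\<bar>" using p by (simp add: B_def abs_mult)
    ultimately show ?thesis by linarith
   qed
   have lc: "l * (t * c - c) = - (l * c * (e * f e))" unfolding tf[symmetric] by (simp add: algebra_simps)
   have "l * c * (e * f e) / 2 \<le> \<bar>\<alpha> + theta l\<bar> * e\<^sup>2 / 2 + (2 * (e * d) + 2 * (e * f e) * V) / 4 + B * (e * d + k * (e * f e) * P U)"
   proof -
    have "X / 2 \<le> A / 2 + Y / 4 + Z"
     if "1/2 * m + 1/4 * v - b \<le> 1/2 * (m' + (- X) + A') + 1/4 * v' - b'" "m' \<le> m" "A' \<le> A" "v' - v \<le> Y" "- (b' - b) \<le> Z"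
     for X A Y Z m v b m' A' v' b' :: real
     using that by argo
    from this[OF le[unfolded EU Ev lc] 1 2 3[unfolded tf] 4[unfolded tf right_diff_distrib[of "\<beta> / p"]]] show ?thesis .
   qed
   also have "\<dots> = e * (\<bar>\<alpha> + theta l\<bar> * e / 2 + d / 2 + K * f e + B * d)"
    by (simp add: K_def power2_eq_square algebra_simps)
   also have "l * c * (e * f e) / 2 = e * (l * c / 2 * f e)" by simp
   finally show ?thesis using e by (simp only: mult_le_cancel_left_pos)
  qed
  have lf: "(f \<longlongrightarrow> 2 * a / c) (at_right 0)"
  proof -
   have "(f \<longlongrightarrow> (2 * a + 0 * g) / (c + 2 * 0 * a + 0\<^sup>2 * g)) (at_right 0)"
    unfolding f_def M_def using c by (intro tendsto_intros) auto
   then show ?thesis by simp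
  qed
  have "l * c / 2 * (2 * a / c) \<le> \<bar>\<alpha> + theta l\<bar> * 0 / 2 + d / 2 + K * (2 * a / c) + B * d"
  proof (rule tendsto_le)
   show "((\<lambda>e. l * c / 2 * f e) \<longlongrightarrow> l * c / 2 * (2 * a / c)) (at_right 0)" by (intro tendsto_intros lf)
   show "((\<lambda>e. \<bar>\<alpha> + theta l\<bar> * e / 2 + d / 2 + K * f e + B * d) \<longlongrightarrow> \<bar>\<alpha> + theta l\<bar> * 0 / 2 + d / 2 + K * (2 * a / c) + B * d) (at_right 0)"
    by (intro tendsto_intros lf) auto
   show "eventually (\<lambda>e. l * c / 2 * f e \<le> \<bar>\<alpha> + theta l\<bar> * e / 2 + d / 2 + K * f e + B * d) (at_right 0)"
    using eventually_at_right_real[OF zero_less_one] by eventually_elim (use main in auto)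
  qed simp
  then have fin: "l * a \<le> a * (2 * K / c) + d / 2 + B * d" using c by (simp add: mult_ac)
  \<comment> \<open>The remaining multiple of a is absorbed by the plain Cauchy-Schwarz bound a =
    O(l^(-1/2)).\<close>
  have "a \<le> nrm U * nrm (Green l)" unfolding a_def by (rule L2_ip_le[OF D(4) Green_L2[OF l0]])
  also have "nrm (Green l) \<le> 1 / sqrt l"
  proof -
   have "1 / (4 * pi * l) \<le> 1 / (1 * l)" using l pi_gt3 by (intro divide_left_mono mult_right_mono) auto
   then show ?thesis using real_sqrt_le_mono[of "1 / (4 * pi * l)" "1 / l"] by (simp add: nrm_def Green_mass[OF l0] real_sqrt_divide)
  qed
  finally have "a \<le> nrm U * (1 / sqrt l)" by (simp add: mult_left_mono)
  then have "a \<le> sqrt c / sqrt l" using D(2) by (simp add: nrm_def)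
  moreover have "2 * K / c \<ge> 0" using nn PU0 c by (simp add: K_def)
  ultimately have "a * (2 * K / c) \<le> sqrt c / sqrt l * (2 * K / c)" by (rule mult_right_mono)
  then have "l * a \<le> sqrt c / sqrt l * (2 * K / c) + d / 2 + B * d" using fin by linarith
  also have "\<dots> = (sqrt c * (2 * K / c) + C / 2 + B * C) / sqrt l" by (simp add: d_def add_divide_distrib mult_ac)
  finally show ?thesis by (simp add: a_def)
 qed
 then show ?thesis by blast
qed

text \<open>Links the approximate identity at the point y to the pairing that is estimated for the
  minimizer translated by y.\<close>

lemma conv_Green:
 assumes u: "u \<in> L2"
 shows "norm (conv (\<lambda>x. l * gr l x) u y) = \<bar>l\<bar> * norm (L2_ip (\<lambda>x. u (x + y)) (Green l))"
proof -
 have "conv (\<lambda>x. l * gr l x) u y = (LBINT x. complex_of_real l * cnj (cnj (u (x + y)) * Green l x))"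
  unfolding conv_def by (intro Bochner_Integration.integral_cong) (auto simp: Green_gr scaleR_conv_of_real mult_ac add.commute)
 also have "\<dots> = complex_of_real l * cnj (L2_ip (\<lambda>x. u (x + y)) (Green l))"
  by (simp add: L2_ip_def del: complex_cnj_mult)
 finally show ?thesis by (simp add: norm_mult)
qed

theorem ground_state_charge:
 assumes g: "is_ground_state \<alpha> \<beta> p c u" and c: "c > 0" and p: "p > 2"
 shows "charge u \<noteq> 0"
proof
 assume q: "charge u = 0"
 have S: "u \<in> mass_sphere c" using g by (simp add: is_ground_state_def)
 note D = mass_sphereD[OF S]
 have W: "u \<in> W12" by (rule charge_zero_W12[OF D(3) q])
 define T where "T n = conv (\<lambda>x. real (Suc n) * gr (real (Suc n)) x) u" for n
 have T0: "(\<lambda>n. T n y) ----> 0" for y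
 proof -
  let ?U = "\<lambda>x. u (x + y)"
  \<comment> \<open>The constant may depend on y, so \<open>T n\<close> tends to 0 only pointwise;
    this is compared with the L^2 limit u along an almost everywhere convergent subsequence.\<close>
  have "\<exists>C. \<forall>l\<ge>1. l * norm (L2_ip ?U (Green l)) \<le> C / sqrt l"
   by (rule charge_free_minimizer_estimate[OF W12_shift(1)[OF W] mass_sphere_shift(1)[OF S W] c p])
     (simp only: mass_sphere_shift(2)[OF S W], rule ground_state_le[OF g])
  then obtain C where C: "\<And>l. l \<ge> 1 \<Longrightarrow> l * norm (L2_ip ?U (Green l)) \<le> C / sqrt l" by blast
  have "(\<lambda>n. C / sqrt (real (Suc n))) ----> 0" by real_asymp
  then show ?thesis
   by (rule Lim_null_comparison[rotated]) (use C in \<open>auto simp: T_def conv_Green[OF D(4)] simp del: of_nat_Suc intro!: always_eventually\<close>)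
 qed
 have pd: "prob_density (\<lambda>x. real (Suc n) * gr (real (Suc n)) x)" for n by (rule gr_prob_density) simp
 have TL: "T n \<in> L2" for n unfolding T_def by (rule conv_contraction(1)[OF pd D(4)])
 have est: "mass (\<lambda>x. T n x - u x) \<le> 16 / real (Suc n) * gmass u" for n
  unfolding T_def by (rule conv_estimate[OF pd W _ gr_prob_density(2)]) auto
 have "(\<lambda>n. 16 / real (Suc n)) ----> 0" by real_asymp
 then have lim: "(\<lambda>n. 16 / real (Suc n) * gmass u) ----> 0" by (rule tendsto_mult_left_zero)
 have "(\<lambda>n. mass (\<lambda>x. T n x - u x)) ----> 0"
 proof (rule tendsto_sandwich[OF _ _ tendsto_const lim])
  show "\<forall>\<^sub>F n in sequentially. 0 \<le> mass (\<lambda>x. T n x - u x)" by (rule always_eventually, rule allI, rule mass_nonneg)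
  show "\<forall>\<^sub>F n in sequentially. mass (\<lambda>x. T n x - u x) \<le> 16 / real (Suc n) * gmass u"
   by (rule always_eventually, rule allI, rule est)
 qed
 then have "(\<lambda>n. L2_dist (T n) u) ----> 0" by (simp add: mass_tendsto_zero_iff)
 then obtain r :: "nat \<Rightarrow> nat" where r: "strict_mono r" "AE x in lborel. (\<lambda>n. T (r n) x) ----> u x"
  using L2_tendsto_AE_subseq[where u = T, OF TL D(4)] by blast
 have "AE x in lborel. u x = 0"
  using r(2)
 proof eventually_elim
  case (elim x)
  have "(\<lambda>n. T (r n) x) ----> 0" using LIMSEQ_subseq_LIMSEQ[OF T0[of x] r(1)] by (simp add: o_def)
  then show ?case using elim LIMSEQ_unique by blast
 qed
 then have "mass u = mass (\<lambda>x. 0)" using L2_measurable[OF D(4)] by (intro mass_cong_AE) auto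
 then show False using D(2) c by simp
qed

section \<open>Limits of the lower order terms\<close>

lemma AE_pair_both:
 assumes "AE x in lborel. P (x::real^2)"
 shows "AE z in lborel \<Otimes>\<^sub>M lborel. P (fst z) \<and> P (snd z)"
proof -
 obtain N where N: "{x \<in> space lborel. \<not> P x} \<subseteq> N" "N \<in> sets lborel" "emeasure lborel N = 0" using assms by (rule AE_E)
 have [measurable]: "N \<in> sets borel" using N by simp
 have a: "AE x in lborel. x \<notin> N" using N by (intro AE_not_in) (auto simp: null_sets_def)
 have "AE z in lborel \<Otimes>\<^sub>M lborel. fst z \<notin> N \<and> snd z \<notin> N"
 proof (rule lborel_pair.AE_pair_measure)
  show "AE x in lborel. AE y in lborel. fst (x, y) \<notin> N \<and> snd (x, y) \<notin> N"
   using a by eventually_elim (use a in simp)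
 qed measurable
 then show ?thesis by eventually_elim (use N in auto)
qed

lemma product_integral:
 fixes f g :: "real^2 \<Rightarrow> real"
 assumes f: "L1 f" and g: "L1 g"
 shows "integrable lborel2 (\<lambda>z. f (fst z) * g (snd z))"
  "(\<integral>z. f (fst z) * g (snd z) \<partial>lborel2) = (LBINT x. f x) * (LBINT x. g x)"
proof -
 have [measurable]: "f \<in> borel_fun" "g \<in> borel_fun" using f g by auto
 show i: "integrable lborel2 (\<lambda>z. f (fst z) * g (snd z))"
  by (rule lborel_pair.Fubini_integrable) (use f g in \<open>auto simp: abs_mult\<close>)
 show "(\<integral>z. f (fst z) * g (snd z) \<partial>lborel2) = (LBINT x. f x) * (LBINT x. g x)"
  using lborel_pair.integral_fst'[OF i] by simp
qed

text \<open>\<open>V2\<close> and the power term converge by their Lipschitz bounds in L^2. The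
  logarithmic moments are merely bounded, so \<open>V1\<close> is only lower semicontinuous, by
  Fatou's lemma on the product space.\<close>

lemma lower_order_limits:
 fixes w :: "nat \<Rightarrow> wfun"
 assumes w: "\<And>n. w n \<in> L2" and v: "v \<in> L2" and lim: "(\<lambda>n. L2_dist (w n) v) ----> 0"
  and lwi: "\<And>n. L1_lw (w n)" and C: "\<And>n. lmom (w n) \<le> C"
  and pw: "\<And>n r. r \<ge> 2 \<Longrightarrow> L1 (\<lambda>x. norm (w n x) powr r)"
  and pB: "\<And>r. r \<ge> 2 \<Longrightarrow> \<exists>B. \<forall>n. (Lp_int r (w n)) \<le> B"
  and V: "(\<lambda>n. V1 (w n)) ----> b" and p: "p \<ge> 2"
 shows "L1_lw v" "dens (sqf v)" "V1 v \<le> b"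
  "(\<lambda>n. V2 (w n)) ----> V2 v"
  "(\<lambda>n. \<integral>x. norm (w n x) powr p \<partial>lborel) ----> (Lp_int p v)"
proof -
 have [measurable]: "w n \<in> borel_fun" "v \<in> borel_fun" for n
  using L2_measurable w v by auto
 obtain r :: "nat \<Rightarrow> nat" where r: "strict_mono r" "AE x in lborel. (\<lambda>n. w (r n) x) ----> v x"
  using L2_tendsto_AE_subseq[OF w v lim] by blast
 show lv: "L1_lw v"
 proof (rule Fatou_real_bound(1))
  show "AE x in lborel. (\<lambda>n. lw x * (norm (w (r n) x))\<^sup>2) ----> lw x * (norm (v x))\<^sup>2"
   using r(2) by eventually_elim (intro tendsto_intros)
  show "lmom (w (r n)) \<le> C" for n by (rule C)
 qed (use lwi in auto)
 have pv: "L1 (\<lambda>x. norm (v x) powr q)" if q: "q \<ge> 2" for q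
 proof -
  obtain B where B: "\<And>n. (Lp_int q (w n)) \<le> B" using pB[OF q] by blast
  show ?thesis
  proof (rule Fatou_real_bound(1))
   show "AE x in lborel. (\<lambda>n. norm (w (r n) x) powr q) ----> norm (v x) powr q"
    using r(2) by eventually_elim (use q in \<open>intro tendsto_powr' tendsto_norm tendsto_const, auto\<close>)
   show "(Lp_int q (w (r n))) \<le> B" for n by (rule B)
  qed (use pw[OF q] in auto)
 qed
 have dw: "dens (sqf (w n))" for n by (rule dens_sqf[OF w lwi pw]) simp
 show dv: "dens (sqf v)" by (rule dens_sqf[OF v lv pv]) simp
 have [measurable]: "sqf (w n) \<in> borel_fun" "sqf v \<in> borel_fun" for n
  using densD(1) dw dv by auto
 show "V1 v \<le> b"
  unfolding V1_def
 proof (rule Fatou_real(2))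
  show "AE z in lborel \<Otimes>\<^sub>M lborel. (\<lambda>n. bil lw (sqf (w (r n))) (sqf (w (r n))) z) ----> bil lw (sqf v) (sqf v) z"
   using AE_pair_both[OF r(2)] by eventually_elim (auto simp: bil_def sqf_def intro!: tendsto_intros)
  show "integrable lborel2 (bil lw (sqf (w (r n))) (sqf (w (r n))))" for n
   by (rule interaction_split(2)[OF dw])
  show "(\<lambda>n. \<integral>z. bil lw (sqf (w (r n))) (sqf (w (r n))) z \<partial>lborel2) ----> b"
   using LIMSEQ_subseq_LIMSEQ[OF V r(1)] by (simp add: V1_def o_def)
 qed (auto simp: bil_def)
 note nl = nrm_tendsto[OF w v lim] and ml = mass_tendsto[OF w v lim]
 show "(\<lambda>n. V2 (w n)) ----> V2 v"
 proof -
  obtain B where B: "\<And>n. (Lp_int 3 (w n)) \<le> B" using pB[of 3] by auto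
  define D where "D n = L2_dist (w n) v * (nrm (w n) + nrm v) *
    ((LBINT x. kf3 x) + ln 2 * mass (w n) + B + pot (sqf v))" for n
  have "D ----> 0 * (nrm v + nrm v) * ((LBINT x. kf3 x) + ln 2 * mass v + B + pot (sqf v))"
   unfolding D_def by (intro tendsto_intros lim nl ml)
  then have D0: "D ----> 0" by simp
  have "\<bar>V2 (w n) - V2 v\<bar> \<le> D n" for n
  proof -
   have "L2_dist (w n) v * (nrm (w n) + nrm v) * (pot (sqf (w n)) + pot (sqf v)) \<le> D n"
    unfolding D_def pot_sqf[of "w n"] using B[of n] by (intro mult_left_mono add_right_mono add_left_mono) auto
   then show ?thesis using V2_difference[OF w dw v dv, of n] by linarith
  qed
  then have "(\<lambda>n. V2 (w n) - V2 v) ----> 0" by (intro Lim_null_comparison[OF _ D0]) (simp add: always_eventually)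
  then show ?thesis by (simp add: LIM_zero_iff)
 qed
 show "(\<lambda>n. \<integral>x. norm (w n x) powr p \<partial>lborel) ----> (Lp_int p v)"
 proof -
  obtain B where B: "\<And>n. (Lp_int (2 * p - 2) (w n)) \<le> B" using pB[of "2 * p - 2"] p by auto
  define k where "k = sqrt (2 powr (2 * p - 2) * (B + Lp_int (2 * p - 2) v))"
  have "(\<lambda>n. p * L2_dist (w n) v * k) ----> p * 0 * k" by (intro tendsto_intros lim)
  then have D0: "(\<lambda>n. p * L2_dist (w n) v * k) ----> 0" by simp
  have "\<bar>(Lp_int p (w n)) - Lp_int p v\<bar> \<le> p * L2_dist (w n) v * k" for n
  proof -
   have "p * L2_dist (w n) v * sqrt (2 powr (2 * p - 2) *
    ((Lp_int (2 * p - 2) (w n)) + Lp_int (2 * p - 2) v)) \<le> p * L2_dist (w n) v * k"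
    unfolding k_def using B[of n] p by (intro mult_left_mono real_sqrt_le_mono add_right_mono) auto
   then show ?thesis using Lp_difference[OF w pw v pv p, of n] by linarith
  qed
  then have "(\<lambda>n. (Lp_int p (w n)) - Lp_int p v) ----> 0"
   by (intro Lim_null_comparison[OF _ D0]) (simp add: always_eventually)
  then show ?thesis by (simp add: LIM_zero_iff)
 qed
qed

lemma sqf_restr: "sqf (restr R u) x = indicator (cball 0 R) x * sqf u x"
 by (auto simp: sqf_def restr_def indicator_def)

text \<open>Convergence of the logarithmic energy upgrades to convergence in the weighted space, since
 $\log(1+|x|) \le \log(1+|x-y|) + \log(1+|y|)$ and a fixed fraction of the mass sits at bounded \<open>y\<close>.\<close>

lemma weighted_convergence:
 fixes w :: "nat \<Rightarrow> wfun"
 assumes w: "\<And>n. w n \<in> L2" "\<And>n. dens (sqf (w n))" and v: "v \<in> L2" "dens (sqf v)" "mass v > 0"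
  and lim: "(\<lambda>n. L2_dist (w n) v) ----> 0" and ae: "AE x in lborel. (\<lambda>n. w n x) ----> v x"
  and V: "(\<lambda>n. V1 (w n)) ----> V1 v" and T: "(\<lambda>n. lmom (\<lambda>x. w n x - v x)) ----> \<tau>"
 shows "\<tau> = 0"
proof -
 have [measurable]: "w n \<in> borel_fun" "v \<in> borel_fun" for n
  using L2_measurable w v by auto
 have [measurable]: "sqf (w n) \<in> borel_fun" "sqf v \<in> borel_fun" for n
  using densD(1) w v by auto
 have "eventually (\<lambda>k. 0 < mass (restr (real k) v)) sequentially"
  by (rule order_tendstoD(1)[OF mass_restr_tendsto[OF v(1)] v(3)])
 then obtain k where k: "0 < mass (restr (real k) v)" by (auto simp: eventually_sequentially)
 define R where "R = real k"
 \<comment> \<open>The density cut to a ball carrying a positive part of the mass of v. The weight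
   is bounded there, so the mass and the logarithmic moment of the cut density converge.\<close>
 define s where "s u = sqf (restr R u)" for u
 have s: "s u x = indicator (cball 0 R) x * sqf u x" for u x by (simp add: s_def sqf_restr)
 have s0: "0 \<le> s u x" "s u x \<le> sqf u x" for u x by (auto simp: s indicator_def)
 have rL: "restr R (w n) \<in> L2" "restr R v \<in> L2" for n using restr_L2 w v by auto
 have rl: "(\<lambda>n. L2_dist (restr R (w n)) (restr R v)) ----> 0"
  using restr_mass_le_full[OF w(1) v(1) lim, of R] by (simp add: restr_diff mass_tendsto_zero_iff)
 have si: "L1 (s u)" if "dens (sqf u)" for u
 proof (rule integrable_dominated[OF densD(3)[OF that]])
  show "AE x in lborel. norm (s u x) \<le> norm (sqf u x)" using s0 by (auto simp: abs_of_nonneg)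
 qed (use densD(1)[OF that] in \<open>simp add: s[abs_def]\<close>)
 have lws: "lw x * s u x \<le> ln (1 + R) * s u x" for u x
 proof (cases "x \<in> cball 0 R")
  case True
  then have "lw x \<le> ln (1 + R)" unfolding lw_def by (intro ln_mono) (auto intro: add_pos_nonneg)
  then show ?thesis using s0(1) by (rule mult_right_mono)
 qed (simp add: s)
 have lsi: "L1 (\<lambda>x. lw x * s u x)" if d: "dens (sqf u)" for u
 proof (rule integrable_dominated)
  show "L1 (\<lambda>x. ln (1 + R) * s u x)" using si[OF d] by simp
  show "AE x in lborel. norm (lw x * s u x) \<le> norm (ln (1 + R) * s u x)"
   using lws[of _ u] s0[of u] by (intro AE_I2) (simp add: R_def abs_mult)
 qed (use densD(1)[OF d] in \<open>simp add: s[abs_def]\<close>)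
 define \<rho> where "\<rho> u = mass (restr R u)" for u
 define A where "A u = (LBINT x. lw x * s u x)" for u
 have si_eq: "(LBINT x. s u x) = \<rho> u" for u by (simp add: s_def \<rho>_def integral_sqf)
 have \<rho>l: "(\<lambda>n. \<rho> (w n)) ----> \<rho> v" unfolding \<rho>_def by (rule mass_tendsto[OF rL rl])
 have Al: "(\<lambda>n. A (w n)) ----> A v"
 proof -
  define D where "D n = ln (1 + R) * (L2_dist (restr R (w n)) (restr R v) * (nrm (restr R (w n)) + nrm (restr R v)))" for n
  have "D ----> ln (1 + R) * (0 * (nrm (restr R v) + nrm (restr R v)))"
   unfolding D_def by (intro tendsto_intros rl nrm_tendsto[OF rL rl])
  then have D0: "D ----> 0" by simp
  have "\<bar>A (w n) - A v\<bar> \<le> D n" for n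
  proof -
   note S = sqf_diff_L1[OF rL(1)[of n] rL(2), folded s_def]
   have "A (w n) - A v = (LBINT x. lw x * (s (w n) x - s v x))"
    using lsi[OF w(2)] lsi[OF v(2)] by (simp add: A_def right_diff_distrib)
   also have "\<bar>\<dots>\<bar> \<le> (LBINT x. \<bar>lw x * (s (w n) x - s v x)\<bar>)" by (rule integral_abs_bound)
   also have "\<dots> \<le> (LBINT x. ln (1 + R) * \<bar>s (w n) x - s v x\<bar>)"
   proof (rule integral_mono)
    show "L1 (\<lambda>x. \<bar>lw x * (s (w n) x - s v x)\<bar>)"
     using lsi[OF w(2)[of n]] lsi[OF v(2)] by (simp add: right_diff_distrib)
    show "\<bar>lw x * (s (w n) x - s v x)\<bar> \<le> ln (1 + R) * \<bar>s (w n) x - s v x\<bar>" for x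
    proof (cases "x \<in> cball 0 R")
     case True
     then have "lw x \<le> ln (1 + R)" unfolding lw_def by (intro ln_mono) (auto intro: add_pos_nonneg)
     then show ?thesis by (simp add: abs_mult mult_right_mono)
    qed (simp add: s)
   qed (use S(1) in simp)
   also have "\<dots> \<le> D n" using S(2) by (simp add: D_def R_def mult_left_mono)
   finally show ?thesis .
  qed
  then have "(\<lambda>n. A (w n) - A v) ----> 0" by (intro Lim_null_comparison[OF _ D0]) (simp add: always_eventually)
  then show ?thesis by (simp add: LIM_zero_iff)
 qed
 define L where "L = lmom v"
 \<comment> \<open>\<open>E\<close> majorises \<open>h\<close>, by |w - v|^2 \<le> 2 |w|^2 + 2 |v|^2
   and the subadditivity of \<open>lw\<close>, and its integrals converge to that at v. Fatou's
   lemma for E - h then leaves at most 0 for the limit of the integrals of \<open>h\<close>, which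
   are weighted distance times mass in the ball.\<close>
 define E where "E u z = 2 * bil lw (sqf u) (sqf u) z + 2 * (sqf u (fst z) * (lw (snd z) * s u (snd z)))
   + 2 * ((lw (fst z) * sqf v (fst z)) * s u (snd z))" for u z
 define h where "h n z = (lw (fst z) * (norm (w n (fst z) - v (fst z)))\<^sup>2) * s (w n) (snd z)" for n z
 have Ei: "integrable lborel2 (E u)"
   "(\<integral>z. E u z \<partial>lborel2) = 2 * V1 u + 2 * (mass u * A u) + 2 * (L * \<rho> u)" if d: "dens (sqf u)" for u
 proof -
  note i1 = interaction_split(2)[OF d] and i2 = product_integral[OF densD(3)[OF d] lsi[OF d]]
   and i3 = product_integral[OF densD(4)[OF v(2)] si[OF d]]
  show "integrable lborel2 (E u)" unfolding E_def[abs_def] using i1 i2(1) i3(1) by simp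
  show "(\<integral>z. E u z \<partial>lborel2) = 2 * V1 u + 2 * (mass u * A u) + 2 * (L * \<rho> u)"
   unfolding E_def using i1 i2 i3 by (simp add: V1_def integral_sqf A_def L_def si_eq sqf_def[of v])
 qed
 have Dl: "L1 (\<lambda>x. lw x * (norm (w n x - v x))\<^sup>2)" for n
  by (rule integrable_lw_dominated[OF L2_diff[OF w(1) v(1)], where v = "w n" and w = v and a = 1 and b = 1])
    (use densD(4)[OF w(2)] densD(4)[OF v(2)] norm_triangle_ineq4 in \<open>auto simp: sqf_def\<close>)
 have hi: "integrable lborel2 (h n)"
   "(\<integral>z. h n z \<partial>lborel2) = lmom (\<lambda>x. w n x - v x) * \<rho> (w n)" for n
  using product_integral[OF Dl si[OF w(2)]] by (simp_all add: h_def[abs_def] si_eq)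
 have hE: "h n z \<le> E (w n) z" for n z
 proof -
  obtain x y where z: "z = (x, y)" by fastforce
  let ?W = "sqf (w n) x" and ?s = "s (w n) y"
  have "(norm (w n x - v x))\<^sup>2 \<le> 2 * ?W + 2 * sqf v x"
   using sq_norm_add_le[of "w n x" "- v x"] by (simp add: sqf_def)
  then have "h n z \<le> lw x * (2 * ?W + 2 * sqf v x) * ?s"
   unfolding h_def z using s0 by (auto intro!: mult_right_mono mult_left_mono)
  moreover have "lw x * ?W * ?s \<le> (lw (x - y) + lw y) * ?W * ?s"
   using lw_add[of "x - y" y] s0 by (intro mult_right_mono) auto
  moreover have "lw (x - y) * ?W * ?s \<le> lw (x - y) * ?W * sqf (w n) y"
   using s0 by (intro mult_left_mono) auto
  ultimately show ?thesis by (simp add: E_def z bil_def algebra_simps)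
 qed
 have "(\<integral>z. E v z \<partial>lborel2) \<le> (\<integral>z. E v z \<partial>lborel2) - \<tau> * \<rho> v"
 proof (rule Fatou_real(2))
  show "AE z in lborel \<Otimes>\<^sub>M lborel. (\<lambda>n. E (w n) z - h n z) ----> E v z"
   using AE_pair_both[OF ae]
  proof eventually_elim
   case (elim z)
   then have a: "(\<lambda>n. sqf (w n) (fst z)) ----> sqf v (fst z)" "(\<lambda>n. sqf (w n) (snd z)) ----> sqf v (snd z)"
    "(\<lambda>n. (norm (w n (fst z) - v (fst z)))\<^sup>2) ----> (norm (v (fst z) - v (fst z)))\<^sup>2"
    unfolding sqf_def by (fast intro: tendsto_power tendsto_norm tendsto_diff tendsto_const)+
   then have "(\<lambda>n. E (w n) z - h n z) ----> E v z - (lw (fst z) * (norm (v (fst z) - v (fst z)))\<^sup>2) * s v (snd z)"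
    unfolding E_def h_def bil_def s by (intro a tendsto_diff tendsto_add tendsto_mult tendsto_const)
   then show ?case by simp
  qed
  show "integrable lborel2 (\<lambda>z. E (w n) z - h n z)" for n using Ei(1)[OF w(2)] hi(1) by simp
  have "(\<lambda>n. 2 * V1 (w n) + 2 * (mass (w n) * A (w n)) + 2 * (L * \<rho> (w n)) - lmom (\<lambda>x. w n x - v x) * \<rho> (w n))
    ----> 2 * V1 v + 2 * (mass v * A v) + 2 * (L * \<rho> v) - \<tau> * \<rho> v"
   by (intro tendsto_intros V Al \<rho>l T mass_tendsto[OF w(1) v(1) lim])
  then show "(\<lambda>n. \<integral>z. E (w n) z - h n z \<partial>lborel2) ----> (\<integral>z. E v z \<partial>lborel2) - \<tau> * \<rho> v"
   using Ei[OF w(2)] Ei[OF v(2)] hi by simp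
  show "(\<lambda>z. E (w n) z - h n z) \<in> borel_measurable lborel2" for n using Ei(1)[OF w(2)] hi(1) by auto
  show "E v \<in> borel_measurable lborel2" using Ei(1)[OF v(2)] by auto
  show "0 \<le> E (w n) z - h n z" for n z using hE by simp
  show "0 \<le> E v z" for z using s0 by (simp add: E_def bil_def)
 qed
 then have "\<tau> * \<rho> v \<le> 0" by simp
 then have "\<tau> \<le> 0" using k by (simp add: \<rho>_def R_def mult_le_0_iff)
 moreover have "0 \<le> \<tau>" by (rule LIMSEQ_le_const[OF T]) (auto intro!: integral_nonneg_AE)
 ultimately show ?thesis by simp
qed

text \<open>V1 u / c is the average, with respect to |u|^2 / c, of the logarithmic moments about the
  points of the plane; so some centre does not exceed it by more than 1.\<close>

lemma exists_center:
 assumes u: "u \<in> mass_sphere c" and c: "c > 0"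
 shows "\<exists>y. lmom (\<lambda>x. u (x + y)) \<le> V1 u / c + 1"
proof (rule ccontr)
 assume "\<not> ?thesis"
 then have n: "V1 u / c + 1 \<le> lmom (\<lambda>x. u (x + y))" for y by (auto simp: not_le less_imp_le)
 note D = mass_sphereD[OF u]
 have [measurable]: "u \<in> borel_fun" by (rule L2_measurable[OF D(4)])
 note i = interaction_split(2)[OF D(5)]
 have G: "(LBINT y. bil lw (sqf u) (sqf u) (x, y)) = sqf u x * lmom (\<lambda>y. u (y + x))" for x
 proof -
  have "lmom (\<lambda>y. u (y + x)) = (LBINT y. lw (y - x) * (norm (u y))\<^sup>2)"
   using integral_shift[of "\<lambda>y. lw (y - x) * (norm (u y))\<^sup>2" x] by simp
  also have "\<dots> = (LBINT y. lw (x - y) * sqf u y)" by (simp add: sqf_def lw_def norm_minus_commute)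
  finally have "lmom (\<lambda>y. u (y + x)) = (LBINT y. lw (x - y) * sqf u y)" .
  moreover have "bil lw (sqf u) (sqf u) (x, y) = sqf u x * (lw (x - y) * sqf u y)" for y by (simp add: bil_def)
  ultimately show ?thesis by simp
 qed
 have "mass u * (V1 u / c + 1) = (LBINT x. sqf u x * (V1 u / c + 1))" by (simp add: integral_sqf)
 also have "\<dots> \<le> (LBINT x. sqf u x * lmom (\<lambda>y. u (y + x)))"
  using lborel_pair.integrable_fst'[OF i] densD(3)[OF D(5)] n
  by (intro integral_mono) (auto simp: G intro!: mult_left_mono)
 also have "\<dots> = V1 u" using lborel_pair.integral_fst'[OF i] by (simp add: G V1_def)
 finally show False using D(2) c by (simp add: distrib_left)
qed

section \<open>Minimizing sequences\<close>

text \<open>This is the parameter at which the explicit charge term of the form disappears.\<close>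

lemma theta_omega: "omega \<alpha> > 0" "\<alpha> + theta (omega \<alpha>) = 0"
proof -
 show o: "omega \<alpha> > 0" by (simp add: omega_def)
 have "ln (sqrt (omega \<alpha>) / 2) = ln (omega \<alpha>) / 2 - ln 2" using o by (simp add: ln_div ln_sqrt)
 also have "ln (omega \<alpha>) = ln 4 + (- 4 * pi * \<alpha> - 2 * euler_mascheroni)" by (simp add: omega_def ln_mult)
 also have "ln (4::real) = 2 * ln 2" using ln_realpow[of 2 2] by simp
 finally show "\<alpha> + theta (omega \<alpha>) = 0" by (simp add: theta_def field_simps)
qed

text \<open>Charge and regular part are linear in the function, so the squared norm of the
  difference, expanded at \<lambda> = 1, is a combination of the quantities assumed to
  converge.\<close>

lemma X_norm_tendsto:
 fixes u :: "nat \<Rightarrow> wfun"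
 assumes u: "\<And>n. u n \<in> X_space" and v: "v \<in> X_space" and m: "(\<lambda>n. L2_dist (u n) v) ----> 0"
  and q: "(\<lambda>n. charge (u n)) ----> charge v"
  and g: "(\<lambda>n. gmass (\<lambda>x. regular_part 1 (u n) x - regular_part 1 v x)) ----> 0"
  and \<phi>: "(\<lambda>n. L2_dist (regular_part 1 (u n)) (regular_part 1 v)) ----> 0"
  and l: "(\<lambda>n. lmom (\<lambda>x. u n x - v x)) ----> 0"
 shows "(\<lambda>n. X_norm \<alpha> (\<lambda>x. u n x - v x)) ----> 0"
proof -
 note U = X_space_D[OF u] and W = X_space_D[OF v]
 let ?d = "\<lambda>n x. u n x - v x"
 have d: "?d n \<in> W12_point" "charge (?d n) = charge (u n) - charge v"
  "regular_part 1 (?d n) = (\<lambda>x. regular_part 1 (u n) x - regular_part 1 v x)" for n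
  using W12_point_add(1,2)[OF U(1)[of n] W(1), of "-1"] W12_point_add(3)[OF U(1)[of n] W(1) zero_less_one, of "-1"] by auto
 have "Re (X_ip \<alpha> (?d n) (?d n)) = gmass (regular_part 1 (?d n)) + 1 * (mass (regular_part 1 (?d n)) - mass (?d n))
   + (\<alpha> + theta 1) * (norm (charge (?d n)))\<^sup>2 + (1 + omega \<alpha>) * mass (?d n) + lmom (?d n)" for n
 proof -
  have "(LBINT x. complex_of_real (ln (1 + norm x)) * cnj (?d n x) * ?d n x) = (LBINT x. complex_of_real (lw x * (norm (?d n x))\<^sup>2))"
  proof -
   have "cnj z * z = complex_of_real ((norm z)\<^sup>2)" for z
    using complex_norm_square[of z] by (simp add: mult.commute)
   then show ?thesis by (simp only: lw_def mult.assoc of_real_mult)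
  qed
  also have "\<dots> = complex_of_real (lmom (?d n))" by (rule integral_complex_of_real)
  finally show ?thesis unfolding X_ip_def W12_point_ip_def H_form_self[OF d(1)] H_quad_eq[OF d(1) zero_less_one] L2_ip_self[OF W12_point_L2[OF d(1)]]
   by simp
 qed note e = this
 have "(\<lambda>n. Re (X_ip \<alpha> (?d n) (?d n))) ----> 0 + 1 * (0 - 0) + (\<alpha> + theta 1) * (norm (charge v - charge v))\<^sup>2 + (1 + omega \<alpha>) * 0 + 0"
  unfolding e d using m \<phi> by (intro tendsto_intros g l q) (simp_all add: mass_tendsto_zero_iff)
 then have "(\<lambda>n. sqrt (Re (X_ip \<alpha> (?d n) (?d n)))) ----> sqrt 0" by (intro tendsto_real_sqrt) simp
 then show ?thesis by (simp add: X_norm_def)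
qed

text \<open>Of the infimum m only the lower bound property is recorded, so the assumptions pass to
  subsequences and the locale can be reinterpreted for them.\<close>

locale min_seq =
 fixes \<alpha> \<beta> c p K m :: real and u :: "nat \<Rightarrow> wfun"
 assumes adm: "admissible \<beta> c p K"
  and us: "u n \<in> mass_sphere c"
  and ul: "(\<lambda>n. energy \<alpha> \<beta> p (u n)) ----> m"
  and lb: "v \<in> mass_sphere c \<Longrightarrow> m \<le> energy \<alpha> \<beta> p v"

begin

lemma c0: "c > 0" and p2: "p > 2" "p \<ge> 2"
 using adm admissible_p[OF adm] by (auto simp: admissible_def)

lemma subseq: "strict_mono r \<Longrightarrow> min_seq \<alpha> \<beta> c p K m (\<lambda>n. u (r n))"
 using adm us lb LIMSEQ_subseq_LIMSEQ[OF ul] by unfold_locales (auto simp: o_def)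

lemmas uD = mass_sphereD[OF us]

lemma bounds: "\<exists>Q\<ge>0. \<forall>n. norm (charge (u n)) \<le> Q \<and> V1 (u n) \<le> Q \<and> H_quad \<alpha> (u n) \<le> Q"
proof -
 obtain B where "\<And>n. norm (energy \<alpha> \<beta> p (u n)) \<le> B" using convergent_imp_Bseq[OF convergentI[OF ul]] by (auto simp: Bseq_def)
 then have B: "energy \<alpha> \<beta> p (u n) \<le> B" for n using abs_le_D1 by (metis real_norm_def)
 show ?thesis using sublevel_bounds[OF adm, of \<alpha> B] B us by blast
qed

lemma regular_bounds:
 assumes "l > 0" shows "\<exists>C\<ge>0. \<forall>n. gmass (regular_part l (u n)) \<le> C \<and> mass (regular_part l (u n)) \<le> C"
proof -
 obtain Q where "\<forall>n. norm (charge (u n)) \<le> Q \<and> V1 (u n) \<le> Q \<and> H_quad \<alpha> (u n) \<le> Q" using bounds by blast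
 then show ?thesis using regular_part_bounds[OF c0 assms, of Q \<alpha>] uD by blast
qed

lemma Lp_bounds:
 assumes "r \<ge> 2" shows "\<exists>B. \<forall>n. (Lp_int r (u n)) \<le> B"
proof -
 obtain Q where "\<forall>n. norm (charge (u n)) \<le> Q \<and> V1 (u n) \<le> Q \<and> H_quad \<alpha> (u n) \<le> Q" using bounds by blast
 then show ?thesis using powr_bounds[OF c0 assms, of Q \<alpha>] uD by blast
qed

text \<open>A large parameter l makes the singular part small in L^2, uniformly in n because the
  charges are bounded. The translated regular parts are then approximants of bounded Dirichlet
  energy.\<close>

lemma compactness:
 assumes C: "\<And>n. lmom (\<lambda>x. u n (x + y n)) \<le> C"
 shows "\<exists>r v. strict_mono (r :: nat \<Rightarrow> nat) \<and> v \<in> L2 \<and> (\<lambda>n. nrm (\<lambda>x. u (r n) (x + y (r n)) - v x)) ----> 0"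
proof (rule L2_compactness[where w = "\<lambda>n x. u n (x + y n)"])
 obtain Q where Q: "Q \<ge> 0" "\<And>n. norm (charge (u n)) \<le> Q" using bounds by blast
 show "(\<lambda>x. u n (x + y n)) \<in> L2" for n by (rule L2_shift[OF uD(4)])
 show "nrm (\<lambda>x. u n (x + y n)) \<le> sqrt c" for n
  using nrm_shift[OF L2_measurable[OF uD(4)]] uD(2) by (simp add: nrm_def)
 show "L1 (\<lambda>x. lw x * (norm (u n (x + y n)))\<^sup>2)" for n by (rule lw_shift_integrable(1)[OF uD(4,6)])
 show "lmom (\<lambda>x. u n (x + y n)) \<le> C" for n by (rule C)
 fix e :: real assume e: "e > 0"
 \<comment> \<open>This gives sqrt l \<ge> Q / e, while the norm of G_l is at most 1 / sqrt l; the
   summand 1 keeps l positive when Q = 0.\<close>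
 define l where "l = (Q / e)\<^sup>2 + 1"
 have l: "l > 0" by (simp add: l_def add_nonneg_pos)
 obtain G where G: "\<And>n. gmass (regular_part l (u n)) \<le> G" using regular_bounds[OF l] by blast
 have "Q * nrm (Green l) \<le> e"
 proof -
  have "1 * l \<le> 4 * pi * l" using l pi_gt3 by (intro mult_right_mono) auto
  then have "1 / (4 * pi * l) \<le> 1 / l" using l by (intro divide_left_mono) auto
  then have "nrm (Green l) \<le> 1 / sqrt l"
   using real_sqrt_le_mono[of "1 / (4 * pi * l)" "1 / l"] by (simp add: nrm_def Green_mass[OF l] real_sqrt_divide)
  then have "Q * nrm (Green l) \<le> Q * (1 / sqrt l)" using Q by (intro mult_left_mono) auto
  also have "Q / e \<le> sqrt l" using Q e by (intro real_le_rsqrt) (simp add: l_def)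
  then have "Q * (1 / sqrt l) \<le> e" using l e by (simp add: field_simps)
  finally show ?thesis .
 qed note Qe = this
 show "\<exists>G. \<forall>n. \<exists>a\<in>W12. gmass a \<le> G \<and> nrm (\<lambda>x. u n (x + y n) - a x) \<le> e"
 proof (intro exI[of _ G] allI)
  fix n
  note W = regular_part_W12[OF uD(3) l, of n]
  have "nrm (\<lambda>x. u n (x + y n) - regular_part l (u n) (x + y n)) = nrm (\<lambda>x. charge (u n) * Green l (x + y n))"
   by (simp add: regular_part_def)
  also have "\<dots> = norm (charge (u n)) * nrm (Green l)" by (simp add: nrm_cmult nrm_shift)
  also have "\<dots> \<le> Q * nrm (Green l)" using Q by (intro mult_right_mono) auto
  finally have "nrm (\<lambda>x. u n (x + y n) - regular_part l (u n) (x + y n)) \<le> e" using Qe by linarith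
  then show "\<exists>a\<in>W12. gmass a \<le> G \<and> nrm (\<lambda>x. u n (x + y n) - a x) \<le> e"
   using W12_shift[OF W, of "y n"] G[of n] by (intro bexI[of _ "\<lambda>x. regular_part l (u n) (x + y n)"]) auto
 qed
qed

text \<open>Mass, \<open>V1\<close>, \<open>V2\<close> and L^p norms ignore translations, so limits
  found for the translates hold for the sequence itself.\<close>

lemma shifted_limits:
 assumes v: "v \<in> L2" and lim: "(\<lambda>n. nrm (\<lambda>x. u n (x + y n) - v x)) ----> 0"
  and C: "\<And>n. lmom (\<lambda>x. u n (x + y n)) \<le> C" and b: "(\<lambda>n. V1 (u n)) ----> b"
 shows "mass v = c" "L1_lw v" "dens (sqf v)" "V1 v \<le> b"
  "(\<lambda>n. V2 (u n)) ----> V2 v"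
  "(\<lambda>n. \<integral>x. norm (u n x) powr p \<partial>lborel) ----> (Lp_int p v)"
proof -
 have m: "u n \<in> borel_fun" for n by (rule L2_measurable[OF uD(4)])
 have P: "(Lp_int r (\<lambda>x. u n (x + y n))) = Lp_int r (u n)" for n r
  by (rule integral_shift) (use m in simp)
 note i = W12_point_powr(1)[OF uD(3) zero_less_one]
 have L: "(\<lambda>x. u n (x + y n)) \<in> L2" for n by (rule L2_shift[OF uD(4)])
 have "(\<lambda>n. mass (\<lambda>x. u n (x + y n))) ----> mass v" by (rule mass_tendsto[OF L v lim])
 then show "mass v = c" by (simp add: mass_shift[OF m] uD(2) LIMSEQ_const_iff)
 have V: "(\<lambda>n. V1 (\<lambda>x. u n (x + y n))) ----> b" using b by (simp add: V1_shift[OF m])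
 note R = lower_order_limits[where w = "\<lambda>n x. u n (x + y n)", OF L v lim lw_shift_integrable(1)[OF uD(4,6)] C integrable_shift[OF i] _ V p2(2), unfolded P V2_shift[OF m], OF _ Lp_bounds]
 show "L1_lw v" "dens (sqf v)" "V1 v \<le> b"
  "(\<lambda>n. V2 (u n)) ----> V2 v"
  "(\<lambda>n. \<integral>x. norm (u n x) powr p \<partial>lborel) ----> (Lp_int p v)"
  by (rule R; assumption)+
qed

text \<open>In the translated frame the singular part leaves every ball, so the regular parts have
  the same local limit v, which lies in \<open>W12\<close> by lower semicontinuity. At \<lambda> =
  \<omega>_\<alpha> the explicit charge term is absent and the limiting mass of the regular parts is
  at least c, so the energy of v is at most m.\<close>

lemma no_escape:
 assumes C: "\<And>n. lmom (\<lambda>x. u n (x + y n)) \<le> C" and y: "filterlim (\<lambda>n. norm (y n)) at_top sequentially"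
  and v: "v \<in> L2" and lim: "(\<lambda>n. nrm (\<lambda>x. u n (x + y n) - v x)) ----> 0"
  and b: "(\<lambda>n. V1 (u n)) ----> b"
  and a: "(\<lambda>n. gmass (regular_part (omega \<alpha>) (u n))) ----> a"
  and \<mu>: "(\<lambda>n. mass (regular_part (omega \<alpha>) (u n))) ----> \<mu>"
 shows False
proof -
 define l where "l = omega \<alpha>"
 have l: "l > 0" "\<alpha> + theta l = 0" using theta_omega by (auto simp: l_def)
 obtain Q where Q: "Q \<ge> 0" "\<And>n. norm (charge (u n)) \<le> Q" using bounds by blast
 note S = shifted_limits[OF v lim C b]
 define \<psi> where "\<psi> n x = regular_part l (u n) (x + y n)" for n x
 note \<psi>' = \<psi>_def[abs_def]
 note W = regular_part_W12[OF uD(3) l(1)]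
 have \<psi>W: "\<psi> n \<in> W12" "gmass (\<psi> n) = gmass (regular_part l (u n))" "mass (\<psi> n) = mass (regular_part l (u n))" for n
  using W12_shift[OF W[of n]] mass_shift[OF L2_measurable[OF W12_L2[OF W[of n]]]] by (auto simp: \<psi>')
 have uL: "(\<lambda>x. u n (x + y n)) \<in> L2" for n by (rule L2_shift[OF uD(4)])
 have GL: "(\<lambda>x. Green l (x + y n)) \<in> L2" for n by (rule L2_shift[OF Green_L2[OF l(1)]])
 have Gl: "(\<lambda>n. nrm (restr R (\<lambda>x. Green l (x + y n)))) ----> 0" for R
 proof -
  define M where "M = (LBINT x. (norm x)\<^sup>2 * (gr l x)\<^sup>2)"
  note i = integrable_shift[OF gr_sq_moment(1)[OF l(1)]]
  \<comment> \<open>Chebyshev's inequality with the second moment: on the ball of radius R the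
    argument has norm at least |y n| - R.\<close>
  have ev: "eventually (\<lambda>n. mass (restr R (\<lambda>x. Green l (x + y n))) \<le> M / (norm (y n) - R)\<^sup>2) sequentially"
   using filterlim_at_top_dense[THEN iffD1, OF y, rule_format, of R]
  proof eventually_elim
   case (elim n)
   define d where "d = norm (y n) - R"
   have d: "d > 0" using elim by (simp add: d_def)
   have "d\<^sup>2 * mass (restr R (\<lambda>x. Green l (x + y n))) = (LBINT x. d\<^sup>2 * (norm (restr R (\<lambda>x. Green l (x + y n)) x))\<^sup>2)"
    by (simp add: mass_def)
   also have "\<dots> \<le> (LBINT x. (norm (x + y n))\<^sup>2 * (gr l (x + y n))\<^sup>2)"
   proof (rule integral_mono)
    show "d\<^sup>2 * (norm (restr R (\<lambda>x. Green l (x + y n)) x))\<^sup>2 \<le> (norm (x + y n))\<^sup>2 * (gr l (x + y n))\<^sup>2" for x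
    proof (cases "norm x \<le> R")
     case True
     then have "d \<le> norm (x + y n)" using norm_triangle_ineq[of "x + y n" "- x"] by (simp add: d_def)
     then show ?thesis using d True by (auto simp: restr_def Green_gr intro!: mult_right_mono power_mono)
    qed (simp add: restr_def)
   qed (use i L2_integrable[OF restr_L2[OF GL]] in auto)
   also have "\<dots> = M" unfolding M_def by (rule integral_shift) measurable
   finally show ?case using d by (simp add: d_def[symmetric] pos_le_divide_eq mult.commute)
  qed
  have "filterlim (\<lambda>n. - R + norm (y n)) at_top sequentially" by (rule filterlim_tendsto_add_at_top[OF tendsto_const y])
  then have f: "filterlim (\<lambda>n. norm (y n) - R) at_top sequentially" by simp
  then have "filterlim (\<lambda>n. (norm (y n) - R)\<^sup>2) at_top sequentially" by (intro filterlim_pow_at_top) auto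
  then have "(\<lambda>n. M / (norm (y n) - R)\<^sup>2) ----> 0" by (intro tendsto_divide_0[OF tendsto_const] filterlim_at_top_imp_at_infinity)
  then have "(\<lambda>n. mass (restr R (\<lambda>x. Green l (x + y n)))) ----> 0"
   by (intro tendsto_sandwich[OF _ ev tendsto_const]) (simp_all add: always_eventually)
  then show ?thesis by (simp add: mass_tendsto_zero_iff)
 qed
 have loc: "(\<lambda>n. nrm (restr R (\<lambda>x. \<psi> n x - v x))) ----> 0" for R
 proof (rule tendsto_sandwich[OF _ _ tendsto_const])
  have "(\<lambda>n. nrm (restr R (\<lambda>x. u n (x + y n) - v x)) + Q * nrm (restr R (\<lambda>x. Green l (x + y n)))) ----> 0 + Q * 0"
   using restr_mass_le_full[OF uL v lim, of R] by (intro tendsto_intros Gl) (simp add: mass_tendsto_zero_iff)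
  then show "(\<lambda>n. nrm (restr R (\<lambda>x. u n (x + y n) - v x)) + Q * nrm (restr R (\<lambda>x. Green l (x + y n)))) ----> 0" by simp
  have "nrm (restr R (\<lambda>x. \<psi> n x - v x)) \<le> nrm (restr R (\<lambda>x. u n (x + y n) - v x)) + Q * nrm (restr R (\<lambda>x. Green l (x + y n)))" for n
  proof -
   have "restr R (\<lambda>x. \<psi> n x - v x) = (\<lambda>x. restr R (\<lambda>x. u n (x + y n) - v x) x - charge (u n) * restr R (\<lambda>x. Green l (x + y n)) x)"
    by (auto simp: restr_def \<psi>_def regular_part_def fun_eq_iff indicator_def)
   then have "nrm (restr R (\<lambda>x. \<psi> n x - v x)) \<le> nrm (restr R (\<lambda>x. u n (x + y n) - v x)) + nrm (\<lambda>x. charge (u n) * restr R (\<lambda>x. Green l (x + y n)) x)"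
    using nrm_triangle_diff[OF restr_L2[OF L2_diff[OF uL v]] L2_cmult[OF restr_L2[OF GL]]] by simp
   also have "nrm (\<lambda>x. charge (u n) * restr R (\<lambda>x. Green l (x + y n)) x) \<le> Q * nrm (restr R (\<lambda>x. Green l (x + y n)))"
    unfolding nrm_cmult using Q by (intro mult_right_mono) auto
   finally show ?thesis by simp
  qed
  then show "\<forall>\<^sub>F n in sequentially. nrm (restr R (\<lambda>x. \<psi> n x - v x)) \<le> nrm (restr R (\<lambda>x. u n (x + y n) - v x)) + Q * nrm (restr R (\<lambda>x. Green l (x + y n)))"
   by (intro always_eventually allI)
 qed (simp add: always_eventually)
 have locm: "(\<lambda>n. mass (restr R (\<lambda>x. \<psi> n x - v x))) ----> 0" for R using loc[of R] by (simp only: mass_tendsto_zero_iff)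
 have ga: "(\<lambda>n. gmass (\<psi> n)) ----> a" using a by (simp add: \<psi>W l_def)
 have vW: "v \<in> W12" and gv: "gmass v \<le> a"
  using grad_lsc[where \<phi>n = \<psi>, OF \<psi>W(1) v locm ga] by auto
 \<comment> \<open>The regular parts converge only locally and may keep additional mass far away, so
   the comparison is made on balls and R is sent to infinity afterwards.\<close>
 have "mass (restr R v) \<le> \<mu>" for R
 proof (rule LIMSEQ_le)
  show "(\<lambda>n. mass (restr R (\<psi> n))) ----> mass (restr R v)"
   using loc[of R] by (intro mass_tendsto restr_L2 W12_L2 \<psi>W(1) v) (simp add: restr_diff)
  show "\<exists>N. \<forall>n\<ge>N. mass (restr R (\<psi> n)) \<le> mass (regular_part l (u n))"
   using mass_restr_le[OF W12_L2[OF \<psi>W(1)]] by (simp add: \<psi>W(3)[symmetric])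
 qed (use \<mu> in \<open>simp add: l_def\<close>)
 then have \<mu>c: "c \<le> \<mu>" using LIMSEQ_le_const2[OF mass_restr_tendsto[OF v]] S(1) by auto
 have vX: "v \<in> X_space" by (rule X_spaceI[OF W12_charge(1)[OF vW] S(2)])
 then have vS: "v \<in> mass_sphere c" using S(1) by (simp add: mass_sphere_def)
 have "(\<lambda>n. 1/2 * (gmass (regular_part l (u n)) + l * (mass (regular_part l (u n)) - c) + 0 * (norm (charge (u n)))\<^sup>2)
   + 1/4 * (V1 (u n) - V2 (u n)) - \<beta> / p * Lp_int p (u n))
  ----> 1/2 * (a + l * (\<mu> - c) + 0) + 1/4 * (b - V2 v) - \<beta> / p * Lp_int p v"
  using a \<mu> by (intro tendsto_intros b S(5,6)) (simp_all add: l_def)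
 then have "(\<lambda>n. energy \<alpha> \<beta> p (u n)) ----> 1/2 * (a + l * (\<mu> - c)) + 1/4 * (b - V2 v) - \<beta> / p * Lp_int p v"
  by (simp add: energy_eq[OF uD(1)] H_quad_eq[OF uD(3) l(1)] uD(2) l(2))
 then have "m = 1/2 * (a + l * (\<mu> - c)) + 1/4 * (b - V2 v) - \<beta> / p * Lp_int p v"
  by (rule LIMSEQ_unique[OF ul])
 moreover have "0 \<le> l * (\<mu> - c)" using l \<mu>c by simp
 ultimately have "energy \<alpha> \<beta> p v \<le> m"
  using gv S(4) unfolding energy_eq[OF vX] H_quad_W12[OF vW] by argo
 then have "\<And>w. w \<in> mass_sphere c \<Longrightarrow> energy \<alpha> \<beta> p v \<le> energy \<alpha> \<beta> p w" using lb by force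
 then have "ground_level \<alpha> \<beta> p c = ereal (energy \<alpha> \<beta> p v)"
  unfolding ground_level_def by (intro antisym INF_lower INF_greatest vS) auto
 then have "is_ground_state \<alpha> \<beta> p c v" using vS by (simp add: is_ground_state_def)
 then show False using ground_state_charge[OF _ c0 p2(1)] W12_charge(2)[OF vW] by blast
qed

text \<open>With bounded moments about the origin no translation is involved, so a limit of the
  charges becomes the charge of the limit function.\<close>

lemma tight_case:
 assumes C: "\<And>n. lmom (u n) \<le> C"
 shows "\<exists>r v. strict_mono (r :: nat \<Rightarrow> nat) \<and> v \<in> mass_sphere c \<and> energy \<alpha> \<beta> p v = m \<and>
  (\<lambda>n. X_norm \<alpha> (\<lambda>x. u (r n) x - v x)) ----> 0"
proof -
 obtain Q where Q: "Q \<ge> 0" "\<And>n. norm (charge (u n)) \<le> Q" "\<And>n. V1 (u n) \<le> Q" using bounds by blast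
 obtain G where G: "G \<ge> 0" "\<And>n. gmass (regular_part 1 (u n)) \<le> G" using regular_bounds[OF zero_less_one] by blast
 obtain r1 v where r1: "strict_mono (r1 :: nat \<Rightarrow> nat)" and v: "v \<in> L2"
  and lim1: "(\<lambda>n. L2_dist (u (r1 n)) v) ----> 0"
  using compactness[where y = "\<lambda>_. 0" and C = C] C by auto
 obtain r2 where r2: "strict_mono (r2 :: nat \<Rightarrow> nat)" "AE x in lborel. (\<lambda>n. u (r1 (r2 n)) x) ----> v x"
  using L2_tendsto_AE_subseq[of "\<lambda>n. u (r1 n)", OF uD(4) v lim1] by blast
 define X where "X n = (charge (u (r1 (r2 n))), V1 (u (r1 (r2 n))), gmass (regular_part 1 (u (r1 (r2 n)))))" for n
 have "bounded (range X)"
 proof (rule boundedI)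
  fix z assume "z \<in> range X"
  then obtain n where n: "z = X n" by auto
  let ?u = "u (r1 (r2 n))"
  have "norm (X n) \<le> norm (charge ?u) + (norm (V1 ?u) + norm (gmass (regular_part 1 ?u)))"
   unfolding X_def by (intro order_trans[OF norm_Pair_le] add_left_mono norm_Pair_le)
  also have "\<dots> \<le> Q + (Q + G)"
   using Q(2,3) G(2) V1_nonneg gmass_nonneg[OF regular_part_W12[OF uD(3)]] by (intro add_mono) auto
  finally show "norm z \<le> Q + (Q + G)" by (simp add: n)
 qed
 then obtain X0 r3 where r3: "strict_mono (r3 :: nat \<Rightarrow> nat)" "(X \<circ> r3) ----> X0"
  using bounded_imp_convergent_subsequence by blast
 obtain q b a where X0: "X0 = (q, b, a)" by (cases X0)
 define U where "U n = u (r1 (r2 (r3 n)))" for n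
 have sU: "strict_mono (\<lambda>n. r1 (r2 (r3 n)))" using strict_mono_o[OF strict_mono_o[OF r1 r2(1)] r3(1)] by (simp add: o_def)
 interpret U: min_seq \<alpha> \<beta> c p K m U unfolding U_def by (rule subseq[OF sU])
 have ql: "(\<lambda>n. charge (U n)) ----> q" and bl: "(\<lambda>n. V1 (U n)) ----> b" and al: "(\<lambda>n. gmass (regular_part 1 (U n))) ----> a"
  using tendsto_fst[OF r3(2)] tendsto_fst[OF tendsto_snd[OF r3(2)]] tendsto_snd[OF tendsto_snd[OF r3(2)]]
  by (simp_all add: X_def X0 U_def o_def)
 have r23: "strict_mono (\<lambda>n. r2 (r3 n))" using strict_mono_o[OF r2(1) r3(1)] by (simp add: o_def)
 have lim: "(\<lambda>n. L2_dist (U n) v) ----> 0" using LIMSEQ_subseq_LIMSEQ[OF lim1 r23] by (simp add: U_def o_def)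
 have ae: "AE x in lborel. (\<lambda>n. U n x) ----> v x"
  using r2(2)
 proof eventually_elim
  case (elim x) then show ?case using LIMSEQ_subseq_LIMSEQ[OF elim r3(1)] by (simp add: U_def o_def)
 qed
 note S = U.shifted_limits[OF v, of "\<lambda>_. 0", unfolded add_0_right, OF lim _ bl, of C]
 have CU: "lmom (U n) \<le> C" for n by (simp add: U_def C)
 note S = S[OF CU]
 define \<phi> where "\<phi> = (\<lambda>x. v x - q * Green 1 x)"
 define \<phi>n where "\<phi>n n = regular_part 1 (U n)" for n
 note G1 = Green_L2[OF zero_less_one]
 have \<phi>nW: "\<phi>n n \<in> W12" for n unfolding \<phi>n_def by (rule regular_part_W12[OF U.uD(3)]) simp
 have \<phi>L: "\<phi> \<in> L2" unfolding \<phi>_def by (intro L2_diff L2_cmult v G1)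
 have \<phi>l: "(\<lambda>n. L2_dist (\<phi>n n) \<phi>) ----> 0"
 proof (rule tendsto_sandwich[OF _ _ tendsto_const])
  have "(\<lambda>n. L2_dist (U n) v + norm (charge (U n) - q) * nrm (Green 1)) ----> 0 + norm (q - q) * nrm (Green 1)"
   by (intro tendsto_intros lim ql)
  then show "(\<lambda>n. L2_dist (U n) v + norm (charge (U n) - q) * nrm (Green 1)) ----> 0" by simp
  have "L2_dist (\<phi>n n) \<phi> \<le> L2_dist (U n) v + norm (charge (U n) - q) * nrm (Green 1)" for n
  proof -
   have "(\<lambda>x. \<phi>n n x - \<phi> x) = (\<lambda>x. (U n x - v x) - (charge (U n) - q) * Green 1 x)"
    by (simp add: \<phi>n_def \<phi>_def regular_part_def algebra_simps)
   then show ?thesis using nrm_triangle_diff[OF L2_diff[OF U.uD(4) v] L2_cmult[OF G1]] by (simp add: nrm_cmult)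
  qed
  then show "\<forall>\<^sub>F n in sequentially. L2_dist (\<phi>n n) \<phi> \<le> L2_dist (U n) v + norm (charge (U n) - q) * nrm (Green 1)"
   by (intro always_eventually allI)
 qed (simp add: always_eventually)
 have al': "(\<lambda>n. gmass (\<phi>n n)) ----> a" using al by (simp add: \<phi>n_def)
 have \<phi>W: "\<phi> \<in> W12" and ga: "gmass \<phi> \<le> a"
  using grad_lsc[where \<phi>n = \<phi>n, OF \<phi>nW \<phi>L restr_mass_le_full[OF W12_L2[OF \<phi>nW] \<phi>L \<phi>l] al'] by auto
 have veq: "v = (\<lambda>x. \<phi> x + q * Green 1 x)" by (simp add: \<phi>_def)
 have vW: "v \<in> W12_point" by (subst veq, rule W12_pointI[OF \<phi>W zero_less_one])
 have vc: "charge v = q" by (subst veq, rule charge_eq[OF \<phi>W zero_less_one])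
 have vr: "regular_part 1 v = \<phi>" by (subst veq, rule regular_part_eq[OF \<phi>W zero_less_one])
 have vX: "v \<in> X_space" by (rule X_spaceI[OF vW S(2)])
 then have vS: "v \<in> mass_sphere c" using S(1) by (simp add: mass_sphere_def)
 let ?P = "\<beta> / p * Lp_int p v"
 have "(\<lambda>n. 1/2 * (gmass (\<phi>n n) + 1 * (mass (\<phi>n n) - c) + (\<alpha> + theta 1) * (norm (charge (U n)))\<^sup>2)
   + 1/4 * (V1 (U n) - V2 (U n)) - \<beta> / p * Lp_int p (U n))
  ----> 1/2 * (a + 1 * (mass \<phi> - c) + (\<alpha> + theta 1) * (norm q)\<^sup>2) + 1/4 * (b - V2 v) - ?P"
  by (intro tendsto_intros al' mass_tendsto[OF W12_L2[OF \<phi>nW] \<phi>L \<phi>l] ql bl S(5,6))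
 then have "(\<lambda>n. energy \<alpha> \<beta> p (U n)) ----> 1/2 * (a + 1 * (mass \<phi> - c) + (\<alpha> + theta 1) * (norm q)\<^sup>2) + 1/4 * (b - V2 v) - ?P"
  by (simp only: energy_eq[OF U.uD(1)] H_quad_eq[OF U.uD(3) zero_less_one] U.uD(2) \<phi>n_def)
 then have mE: "m = 1/2 * (a + 1 * (mass \<phi> - c) + (\<alpha> + theta 1) * (norm q)\<^sup>2) + 1/4 * (b - V2 v) - ?P"
  by (rule LIMSEQ_unique[OF U.ul])
 have vE: "energy \<alpha> \<beta> p v = 1/2 * (gmass \<phi> + 1 * (mass \<phi> - c) + (\<alpha> + theta 1) * (norm q)\<^sup>2) + 1/4 * (V1 v - V2 v) - ?P"
  by (simp only: energy_eq[OF vX] H_quad_eq[OF vW zero_less_one] S(1) vr vc)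
 \<comment> \<open>The energy of v is at least m by minimality and at most m by semicontinuity, so
   both semicontinuous terms converge to their values at v.\<close>
 have eqs: "gmass \<phi> = a" "V1 v = b" "energy \<alpha> \<beta> p v = m"
 proof -
  have "X = a \<and> Y = b \<and> E = m" if "m = 1/2 * (a + k + k') + 1/4 * (b - V) - P" "E = 1/2 * (X + k + k') + 1/4 * (Y - V) - P"
   "m \<le> E" "X \<le> a" "Y \<le> b" for X Y E k k' V P :: real using that by argo
  from this[OF mE vE lb[OF vS] ga S(4)] show "gmass \<phi> = a" "V1 v = b" "energy \<alpha> \<beta> p v = m" by auto
 qed
 \<comment> \<open>Both quantities are bounded; a further subsequence makes them converge, and their
   limits are determined afterwards.\<close>
 define Z where "Z n = (gmass (\<lambda>x. \<phi>n n x + \<phi> x), lmom (\<lambda>x. U n x - v x))" for n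
 have Ui: "L1 (\<lambda>x. lw x * (norm (U n x - v x))\<^sup>2)" for n
  by (rule integrable_lw_dominated[OF L2_diff[OF U.uD(4) v] U.uD(6)[of n] S(2), where a = 1 and b = 1]) (use norm_triangle_ineq4 in auto)
 have "bounded (range Z)"
 proof (rule boundedI)
  fix z assume "z \<in> range Z"
  then obtain n where n: "z = Z n" by auto
  have "norm (Z n) \<le> norm (gmass (\<lambda>x. \<phi>n n x + \<phi> x)) + norm (lmom (\<lambda>x. U n x - v x))"
   unfolding Z_def by (rule norm_Pair_le)
  also have "norm (gmass (\<lambda>x. \<phi>n n x + \<phi> x)) \<le> 2 * G + 2 * gmass \<phi>"
   using gmass_add_le[OF \<phi>nW[of n] \<phi>W] G(2) gmass_nonneg[OF W12_add[OF \<phi>nW[of n] \<phi>W]]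
   by (auto simp: \<phi>n_def U_def intro: order_trans)
  also have "norm (lmom (\<lambda>x. U n x - v x)) \<le> 2 * C + 2 * lmom v"
  proof -
   have "lmom (\<lambda>x. U n x - v x) \<le> (LBINT x. 2 * (lw x * (norm (U n x))\<^sup>2) + 2 * (lw x * (norm (v x))\<^sup>2))"
   proof (rule integral_mono[OF Ui])
    show "L1 (\<lambda>x. 2 * (lw x * (norm (U n x))\<^sup>2) + 2 * (lw x * (norm (v x))\<^sup>2))" using U.uD(6) S(2) by simp
    show "lw x * (norm (U n x - v x))\<^sup>2 \<le> 2 * (lw x * (norm (U n x))\<^sup>2) + 2 * (lw x * (norm (v x))\<^sup>2)" for x
     using mult_left_mono[OF sq_norm_add_le[of "U n x" "- v x"], of "lw x"] by (simp add: algebra_simps)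
   qed
   also have "\<dots> = 2 * lmom (U n) + 2 * lmom v" using U.uD(6) S(2) by simp
   finally show ?thesis using CU[of n] by (simp add: integral_nonneg_AE)
  qed
  finally show "norm z \<le> 2 * G + 2 * gmass \<phi> + (2 * C + 2 * lmom v)" by (simp add: n)
 qed
 then obtain Z0 r4 where r4: "strict_mono (r4 :: nat \<Rightarrow> nat)" "(Z \<circ> r4) ----> Z0"
  using bounded_imp_convergent_subsequence by blast
 have a': "(\<lambda>n. gmass (\<lambda>x. \<phi>n (r4 n) x + \<phi> x)) ----> fst Z0" and t: "(\<lambda>n. lmom (\<lambda>x. U (r4 n) x - v x)) ----> snd Z0"
  using tendsto_fst[OF r4(2)] tendsto_snd[OF r4(2)] by (simp_all add: Z_def o_def)
 note sub = LIMSEQ_subseq_LIMSEQ[OF _ r4(1), unfolded o_def]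
 have "snd Z0 = 0"
 proof (rule weighted_convergence[where w = "\<lambda>n. U (r4 n)", OF U.uD(4,5) v S(3) _ sub[OF lim] _ _ t])
  show "mass v > 0" using S(1) c0 by simp
  show "AE x in lborel. (\<lambda>n. U (r4 n) x) ----> v x" using ae by eventually_elim (rule sub)
  show "(\<lambda>n. V1 (U (r4 n))) ----> V1 v" using sub[OF bl] by (simp add: eqs)
 qed
 then have t0: "(\<lambda>n. lmom (\<lambda>x. U (r4 n) x - v x)) ----> 0" using t by simp
 \<comment> \<open>By semicontinuity the sums have limit energy at least
   \<open>4 * gmass \<phi>\<close>. As the energies themselves converge, the parallelogram law
   leaves nothing for the differences.\<close>
 have g0: "(\<lambda>n. gmass (\<lambda>x. \<phi>n (r4 n) x - \<phi> x)) ----> 0"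
 proof -
  have "4 * gmass \<phi> \<le> fst Z0"
  proof -
   have "gmass (\<lambda>x. \<phi> x + \<phi> x) \<le> fst Z0"
   proof (rule grad_lsc(2)[where \<phi>n = "\<lambda>n x. \<phi>n (r4 n) x + \<phi> x", OF W12_add[OF \<phi>nW \<phi>W] L2_add[OF \<phi>L \<phi>L] _ a'])
    show "(\<lambda>n. mass (restr R (\<lambda>x. \<phi>n (r4 n) x + \<phi> x - (\<phi> x + \<phi> x)))) ----> 0" for R
     using sub[OF restr_mass_le_full[OF W12_L2[OF \<phi>nW] \<phi>L \<phi>l, of R]] by simp
   qed
   also have "(\<lambda>x. \<phi> x + \<phi> x) = (\<lambda>x. 2 * \<phi> x)" by simp
   finally show ?thesis using gmass_cmult[OF \<phi>W, of 2] by simp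
  qed
  moreover have l: "(\<lambda>n. gmass (\<lambda>x. \<phi>n (r4 n) x - \<phi> x)) ----> 2 * a + 2 * gmass \<phi> - fst Z0"
   unfolding gmass_parallelogram[OF \<phi>nW \<phi>W] by (intro tendsto_intros sub[OF al'] a')
  moreover have "0 \<le> 2 * a + 2 * gmass \<phi> - fst Z0"
   by (rule LIMSEQ_le_const[OF l]) (use gmass_nonneg[OF W12_diff[OF \<phi>nW \<phi>W]] in auto)
  ultimately have "2 * a + 2 * gmass \<phi> - fst Z0 = 0" using eqs by linarith
  then show ?thesis using l by simp
 qed
 have "(\<lambda>n. X_norm \<alpha> (\<lambda>x. U (r4 n) x - v x)) ----> 0"
  by (rule X_norm_tendsto[where u = "\<lambda>n. U (r4 n)", OF U.uD(1) vX sub[OF lim] _ _ _ t0])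
    (use sub[OF ql] g0 sub[OF \<phi>l] in \<open>simp_all add: vc vr \<phi>n_def\<close>)
 moreover have "strict_mono (\<lambda>n. r1 (r2 (r3 (r4 n))))" using strict_mono_o[OF sU r4(1)] by (simp add: o_def)
 ultimately show ?thesis using vS eqs(3) unfolding U_def by (intro exI[of _ "\<lambda>n. r1 (r2 (r3 (r4 n)))"] exI[of _ v]) auto
qed

lemma minimizing_subsequence:
 "\<exists>r v. strict_mono (r :: nat \<Rightarrow> nat) \<and> v \<in> mass_sphere c \<and> energy \<alpha> \<beta> p v = m \<and>
  (\<lambda>n. X_norm \<alpha> (\<lambda>x. u (r n) x - v x)) ----> 0"
proof -
 obtain Q where Q: "Q \<ge> 0" "\<And>n. V1 (u n) \<le> Q" using bounds by blast
 define C where "C = Q / c + 1"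
 have "\<exists>y. lmom (\<lambda>x. u n (x + y)) \<le> C" for n
 proof -
  have "V1 (u n) / c \<le> Q / c" using Q c0 by (intro divide_right_mono) auto
  then show ?thesis using exists_center[OF us[of n] c0] unfolding C_def by (meson add_right_mono order_trans)
 qed
 then have "\<forall>n. \<exists>y. lmom (\<lambda>x. u n (x + y)) \<le> C" by blast
 from choice[OF this] obtain y where y: "\<And>n. lmom (\<lambda>x. u n (x + y n)) \<le> C" by blast
 show ?thesis
 proof (cases "filterlim (\<lambda>n. norm (y n)) at_top sequentially")
  case True
  obtain G where G: "G \<ge> 0" "\<And>n. gmass (regular_part (omega \<alpha>) (u n)) \<le> G" "\<And>n. mass (regular_part (omega \<alpha>) (u n)) \<le> G"
   using regular_bounds[OF theta_omega(1)] by blast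
  obtain r1 v where r1: "strict_mono (r1 :: nat \<Rightarrow> nat)" and v: "v \<in> L2"
   and lim1: "(\<lambda>n. nrm (\<lambda>x. u (r1 n) (x + y (r1 n)) - v x)) ----> 0"
   using compactness[where y = y, OF y] by auto
  define X where "X n = (V1 (u (r1 n)), gmass (regular_part (omega \<alpha>) (u (r1 n))), mass (regular_part (omega \<alpha>) (u (r1 n))))" for n
  have "bounded (range X)"
  proof (rule boundedI)
   fix z assume "z \<in> range X"
   then obtain n where n: "z = X n" by auto
   let ?u = "u (r1 n)"
   have "norm (X n) \<le> norm (V1 ?u) + (norm (gmass (regular_part (omega \<alpha>) ?u)) + norm (mass (regular_part (omega \<alpha>) ?u)))"
    unfolding X_def by (intro order_trans[OF norm_Pair_le] add_left_mono norm_Pair_le)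
   also have "\<dots> \<le> Q + (G + G)"
    using Q(2) G(2,3) V1_nonneg gmass_nonneg[OF regular_part_W12[OF uD(3) theta_omega(1)]] by (intro add_mono) auto
   finally show "norm z \<le> Q + (G + G)" by (simp add: n)
  qed
  then obtain X0 r2 where r2: "strict_mono (r2 :: nat \<Rightarrow> nat)" "(X \<circ> r2) ----> X0"
   using bounded_imp_convergent_subsequence by blast
  have sr: "strict_mono (\<lambda>n. r1 (r2 n))" using strict_mono_o[OF r1 r2(1)] by (simp add: o_def)
  interpret U: min_seq \<alpha> \<beta> c p K m "\<lambda>n. u (r1 (r2 n))" by (rule subseq[OF sr])
  have False
  proof (rule U.no_escape[where y = "\<lambda>n. y (r1 (r2 n))" and v = v])
   show "lmom (\<lambda>x. u (r1 (r2 n)) (x + y (r1 (r2 n)))) \<le> C" for n by (rule y)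
   show "filterlim (\<lambda>n. norm (y (r1 (r2 n)))) at_top sequentially"
    by (rule filterlim_compose[OF True filterlim_subseq[OF sr]])
   show "(\<lambda>n. nrm (\<lambda>x. u (r1 (r2 n)) (x + y (r1 (r2 n))) - v x)) ----> 0"
    using LIMSEQ_subseq_LIMSEQ[OF lim1 r2(1)] by (simp add: o_def)
   show "(\<lambda>n. V1 (u (r1 (r2 n)))) ----> fst X0"
    "(\<lambda>n. gmass (regular_part (omega \<alpha>) (u (r1 (r2 n))))) ----> fst (snd X0)"
    "(\<lambda>n. mass (regular_part (omega \<alpha>) (u (r1 (r2 n))))) ----> snd (snd X0)"
    using tendsto_fst[OF r2(2)] tendsto_fst[OF tendsto_snd[OF r2(2)]] tendsto_snd[OF tendsto_snd[OF r2(2)]]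
    by (simp_all add: X_def o_def)
  qed (rule v)
  then show ?thesis ..
 next
  case False
  \<comment> \<open>Some ball contains infinitely many centres; moving back to the origin costs at
    most ln (1 + R) c in the logarithmic moment.\<close>
  then obtain R where R: "\<not> eventually (\<lambda>n. R \<le> norm (y n)) sequentially" by (auto simp: filterlim_at_top)
  have "infinite {n. norm (y n) < R}"
  proof
   assume "finite {n. norm (y n) < R}"
   then obtain N where "\<forall>n\<in>{n. norm (y n) < R}. n < N" using finite_nat_set_iff_bounded by blast
   then have "\<forall>n\<ge>N. R \<le> norm (y n)" by (auto simp: not_less[symmetric])
   then show False using R by (auto simp: eventually_sequentially)
  qed
  then obtain s where s: "strict_mono (s :: nat \<Rightarrow> nat)" "\<And>n. norm (y (s n)) < R" using infinite_enumerate by blast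
  interpret U: min_seq \<alpha> \<beta> c p K m "\<lambda>n. u (s n)" by (rule subseq[OF s(1)])
  have "lmom (u (s n)) \<le> C + ln (1 + R) * c" for n
  proof -
   let ?w = "\<lambda>x. u (s n) (x + y (s n))"
   have "lmom (\<lambda>x. ?w (x + - y (s n))) \<le> lmom ?w + lw (- y (s n)) * mass ?w"
    by (rule lw_shift_integrable(2)[OF L2_shift[OF uD(4)] lw_shift_integrable(1)[OF uD(4,6)]])
   also have "mass ?w = c" using mass_shift[OF L2_measurable[OF uD(4)]] uD(2) by simp
   also have "lw (- y (s n)) \<le> ln (1 + R)" unfolding lw_def using s(2)[of n] by (intro ln_mono) (auto intro: add_pos_nonneg)
   finally show ?thesis using y[of "s n"] c0 by (simp add: mult_right_mono)
  qed
  then obtain r v where rv: "strict_mono (r :: nat \<Rightarrow> nat)" "v \<in> mass_sphere c" "energy \<alpha> \<beta> p v = m"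
   "(\<lambda>n. X_norm \<alpha> (\<lambda>x. u (s (r n)) x - v x)) ----> 0" using U.tight_case by blast
  have "strict_mono (\<lambda>n. s (r n))" using strict_mono_o[OF s(1) rv(1)] by (simp add: o_def)
  then show ?thesis using rv by blast
 qed
qed

end

theorem theorem1p5:
 fixes \<alpha> \<beta> c p K_GN :: real
 assumes "c > 0"
  and "(\<beta> \<le> 0 \<and> p > 2)
    \<or> (\<beta> > 0 \<and> 2 < p \<and> p < 4)
    \<or> (\<beta> > 0 \<and> p = 4 \<and> GN_constant p K_GN \<and> c < 2 / (\<beta> * K_GN))"
 shows "(\<forall>u. minimizing_sequence \<alpha> \<beta> p c u \<longrightarrow>
      (\<exists>r v. strict_mono (r :: nat \<Rightarrow> nat) \<and> is_ground_state \<alpha> \<beta> p c v \<and>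
          (\<lambda>n. X_norm \<alpha> (\<lambda>x. u (r n) x - v x)) \<longlonglongrightarrow> 0))
    \<and> (\<forall>u. is_ground_state \<alpha> \<beta> p c u \<longrightarrow> charge u \<noteq> 0)"
proof (intro conjI allI impI)
 have adm: "admissible \<beta> c p K_GN" using assms by (simp add: admissible_def)
 show "charge u \<noteq> 0" if "is_ground_state \<alpha> \<beta> p c u" for u
  by (rule ground_state_charge[OF that assms(1) admissible_p[OF adm]])
 fix u assume "minimizing_sequence \<alpha> \<beta> p c u"
 then have u: "\<And>n. u n \<in> mass_sphere c" "(\<lambda>n. ereal (energy \<alpha> \<beta> p (u n))) ----> ground_level \<alpha> \<beta> p c"
  by (auto simp: minimizing_sequence_def)
 have le: "ground_level \<alpha> \<beta> p c \<le> ereal (energy \<alpha> \<beta> p v)" if "v \<in> mass_sphere c" for v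
  unfolding ground_level_def by (rule INF_lower[OF that])
 obtain C where "\<And>v. v \<in> mass_sphere c \<Longrightarrow> - C \<le> energy \<alpha> \<beta> p v" using energy_bounded_below[OF adm, of \<alpha>] by blast
 then have "ereal (- C) \<le> ground_level \<alpha> \<beta> p c" unfolding ground_level_def by (intro INF_greatest) simp
 \<comment> \<open>Coercivity excludes the value minus infinity; the sphere contains
   \<open>u 0\<close>, which excludes plus infinity.\<close>
 then obtain m where m: "ground_level \<alpha> \<beta> p c = ereal m" using le[OF u(1)[of 0]] by (cases "ground_level \<alpha> \<beta> p c") auto
 interpret min_seq \<alpha> \<beta> c p K_GN m u
  by unfold_locales (use adm u le m in auto)
 show "\<exists>r v. strict_mono (r :: nat \<Rightarrow> nat) \<and> is_ground_state \<alpha> \<beta> p c v \<and> (\<lambda>n. X_norm \<alpha> (\<lambda>x. u (r n) x - v x)) ----> 0"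
  using minimizing_subsequence by (auto simp: is_ground_state_def m)
qed

end
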